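(* Let $\phi: U(\mathfrak{gl}_d(\mathbf z,\boldsymbol\gamma))\to\mathcal D$ and $\varphi: U(\mathfrak{gl}_{p+m|q+n}(\mathbf w,\boldsymbol\xi))\to\mathcal D$ be the superalgebra homomorphisms, and let $\mathcal A_d^{\mathbf w,\boldsymbol\xi}(\mathbf z,\boldsymbol\gamma)\subseteq U(\mathfrak{gl}_d(\mathbf z,\boldsymbol\gamma))$ and $\mathcal A_{p+m|q+n}^{\mathbf z,\boldsymbol\gamma}(\mathbf w,\boldsymbol\xi)\subseteq U(\mathfrak{gl}_{p+m|q+n}(\mathbf w,\boldsymbol\xi))$ be the Gaudin algebras, all as defined in the context. Then, as subalgebras of the Weyl superalgebra $\mathcal D$, $$\phi\big(\mathcal A_d^{\mathbf w,\boldsymbol\xi}(\mathbf z,\boldsymbol\gamma)\big)=\varphi\big(\mathcal A_{p+m|q+n}^{\mathbf z,\boldsymbol\gamma}(\mathbf w,\boldsymbol\xi)\big).$$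
   Context: Everything is over $\mathbb C$. Fix $d\ge 1$ and integers $p,q,m,n\ge 0$, not all zero. **Lie superalgebra.** $\mathbb I=\{1,\dots,p+q+m+n\}$; $|i|=\bar 0\in\mathbb Z_2$ if $i\in\{1,\dots,p\}\cup\{p+q+1,\dots,p+q+m\}$ and $|i|=\bar 1$ otherwise. $\mathfrak{gl}_{p+m|q+n}$ has homogeneous basis $E^i_j$ ($i,j\in\mathbb I$) of parity $|i|+|j|$ with $[E^i_j,E^k_l]=\delta_{jk}E^i_l-(-1)^{(|i|+|j|)(|k|+|l|)}\delta_{il}E^k_j$. $\mathfrak{gl}_d$ is the usual Lie algebra with basis $e_{ab}$, $1\le a,b\le d$. **Parameters.** Integers $1\le d'\le d$, $0\le p'\le p$, $0\le q'\le q$, $0\le m'\le m$, $0\le n'\le n$; $\ell=p'+q'+m'+n'$; $\mathbf w\in\mathbb C^{d'}$, $\mathbf z\in\mathbb C^{\ell}$ arbitrary. $\boldsymbol\xi=(\xi_1,\dots,\xi_{d'})$ and $\boldsymbol\gamma=(\gamma_1,\dots,\gamma_\ell)$ consist of positive integers with $\sum\xi_a=d$ and $\sum_{i=1}^{p'}\gamma_i=p$, $\sum_{i=1}^{q'}\gamma_{p'+i}=q$, $\sum_{i=1}^{m'}\gamma_{p'+q'+i}=m$, $\sum_{i=1}^{n'}\gamma_{p'+q'+m'+i}=n$. Put $d_1=0$, $d_{a+1}=\xi_1+\dots+\xi_a$; $l_1=0$, $l_{i+1}=\gamma_1+\dots+\gamma_i$. **Takiff superalgebras.** For a Lie superalgebra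 $\mathfrak g$, $a\in\mathbb C$, $\gamma\ge1$, put $t_a=t-a$ and $\mathfrak g(a,\gamma)=\mathfrak g[t_a]/t_a^\gamma\mathfrak g[t_a]$, where $[A\otimes t_a^r,B\otimes t_a^s]=[A,B]\otimes t_a^{r+s}$; the class of $A\otimes t_a^k$ is written $A\otimes\bar t_a^{\,k}$. Put $\mathfrak{gl}_d(\mathbf z,\boldsymbol\gamma)=\bigoplus_{i=1}^\ell\mathfrak{gl}_d(z_i,\gamma_i)$ and $\mathfrak{gl}_{p+m|q+n}(\mathbf w,\boldsymbol\xi)=\bigoplus_{a=1}^{d'}\mathfrak{gl}_{p+m|q+n}(w_a,\xi_a)$ (external direct sums). **Weyl superalgebra and homomorphisms.** $\mathcal F$ is the polynomial superalgebra (free supercommutative) in $x^a_i$ ($1\le i\le m+n$) and $y^a_r$ ($1\le r\le p+q$), $1\le a\le d$, where $x^a_i$ is even iff $i\le m$ and $y^a_r$ is even iff $r\le p$. $\mathcal D\subseteq\mathrm{End}(\mathcal F)$ is generated by multiplications by these variables and by the (left super-)derivatives $\partial_{x^a_i},\partial_{y^a_r}$. The map $\phi$ is induced by the Lie superalgebra homomorphism with $$e_{ab}\otimes\bar t_{z_i}^{\,k}\mapsto-\sum_{r=l_i+1}^{l_{i+1}-k}y^b_r\partial_{y^a_{r+k}}\ (1\le i\le p'+q',\ 0\le k<\gamma_i),$$ $$e_{ab}\otimes\bar t_{z_j}^{\,k}\mapsto\sum_{r=l_j+1-p-q}^{l_{j+1}-k-p-q}(-1)^{|p+q+r|}\partial_{x^b_r}x^a_{r+k}\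 (p'+q'<j\le\ell,\ 0\le k<\gamma_j).$$ The map $\varphi$ is induced by the Lie superalgebra homomorphism given, with all sums over $\alpha$ from $d_a+1$ to $d_{a+1}-k$, for $1\le a\le d'$, $0\le k<\xi_a$, $1\le r,s\le p+q$, $1\le i,j\le m+n$, by $E^r_s\otimes\bar t_{w_a}^{\,k}\mapsto\sum(-1)^{|s|+1}\partial_{y^{\alpha+k}_r}y^\alpha_s$; $E^r_{p+q+j}\otimes\bar t_{w_a}^{\,k}\mapsto\sum\partial_{y^{\alpha+k}_r}\partial_{x^\alpha_j}$; $E^{p+q+i}_s\otimes\bar t_{w_a}^{\,k}\mapsto\sum(-1)^{|s|+1}x^{\alpha+k}_iy^\alpha_s$; $E^{p+q+i}_{p+q+j}\otimes\bar t_{w_a}^{\,k}\mapsto\sum x^{\alpha+k}_i\partial_{x^\alpha_j}$. **Pseudo-differential operators and determinants.** For a superalgebra $\mathcal A$, $\mathcal A(\!(z^{-1},\partial_z^{-1})\!)$ is the superalgebra of series $\sum_{j\le s}\sum_{i\le r}a_{ij}z^i\partial_z^j$ ($r,s\in\mathbb Z$, $a_{ij}\in\mathcal A$) with $z$, $\partial_z$ even and commuting with $\mathcal A$, and $\partial_z^i f=\sum_{k\ge0}\binom ik f^{(k)}\partial_z^{i-k}$ for $i\in\mathbb Z$ and $f\in\mathcal A(\!(z^{-1})\!)$, $f^{(k)}$ being the $k$-th $z$-derivative. All fractions $(z-c)^{-k}$ are expanded in powers of $z^{-1}$. $\mathrm{cdet}(A)=\sum_{\sigma\in\mathfrak S_k}(-1)^{l(\sigma)}a_{\sigma(1),1}\cdots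 a_{\sigma(k),k}$. For an $N\times N$ matrix $A$ and a sequence $\mathbf s=(s_1,\dots,s_N)$ of 0's and 1's, $\mathrm{Ber}^{\mathbf s}(A)=d_1(A)^{(-1)^{s_1}}\cdots d_N(A)^{(-1)^{s_N}}$, where $d_i(A)$ is the inverse of the $(i,i)$ entry of the inverse of the upper-left $i\times i$ submatrix of $A$. **Gaudin algebras.** $\mathrm J_k(\lambda)$ is the $k\times k$ Jordan block with $\lambda$ on the diagonal and $1$ on the superdiagonal; $\mathrm J_{\boldsymbol\xi}(\mathbf w)=\bigoplus_a\mathrm J_{\xi_a}(w_a)$, $\mathrm J_{\boldsymbol\gamma}(\mathbf z)=\bigoplus_i\mathrm J_{\gamma_i}(z_i)$. (1) $\mathcal A_d^{\mathbf w,\boldsymbol\xi}(\mathbf z,\boldsymbol\gamma)$ is the subalgebra of $U(\mathfrak{gl}_d(\mathbf z,\boldsymbol\gamma))$ generated by all coefficients (of powers of $z^{-1}$) of the series $a_1(z),\dots,a_d(z)$ in $$\mathrm{cdet}\Big[\delta_{ab}\partial_z-\mathrm J_{\boldsymbol\xi}(\mathbf w)_{a,b}-\sum_{i=1}^\ell\sum_{k=0}^{\gamma_i-1}\frac{e_{ab}\otimes\bar t_{z_i}^{\,k}}{(z-z_i)^{k+1}}\Big]_{a,b=1}^d=\partial_z^d+\sum_{i=1}^da_i(z)\partial_z^{i-1}.$$ (2) With $\mathbf s=(0^p,1^q,0^m,1^n)$, $\mathcal A_{p+m|q+n}^{\mathbf z,\boldsymbol\gamma}(\mathbf w,\boldsymbol\xi)$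 is the subalgebra of $U(\mathfrak{gl}_{p+m|q+n}(\mathbf w,\boldsymbol\xi))$ generated by all coefficients of the series $b_i(z)$, $i\le p+m-q-n$, in $$\mathrm{Ber}^{\mathbf s}\Big[\delta_{ij}\partial_z-\mathrm J_{\boldsymbol\gamma}(\mathbf z)_{i,j}-(-1)^{|i|}\sum_{a=1}^{d'}\sum_{k=0}^{\xi_a-1}\frac{E^i_j\otimes\bar t_{w_a}^{\,k}}{(z-w_a)^{k+1}}\Big]_{i,j\in\mathbb I}=\sum_{i\le p+m-q-n}b_i(z)\partial_z^i.$$ *)

theory Defs
  imports Complex_Main
    "HOL-Algebra.QuotRing"
    "HOL-Algebra.Module"
    "HOL-Library.Poly_Mapping"
    "HOL-Library.Z2"
    "HOL-Library.FuncSet"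
    "HOL-Combinatorics.Permutations"
begin

section \<open>Superalgebras\<close>

text \<open>
  Parities are elements of the two-element field \<^typ>\<open>bit\<close>.  A unital associative complex
  superalgebra is a ring record together with scalar multiplication and the two homogeneous
  components \<open>part A 0\<close> (even) and \<open>part A 1\<close> (odd).
\<close>

definition psign :: "bit \<Rightarrow> complex" where
  "psign e = (if e = 0 then 1 else - 1)"

record 'a superalg = "(complex, 'a) module" +
  part :: "bit \<Rightarrow> 'a set"

definition superalg_hom ::
  "('a, 'x) superalg_scheme \<Rightarrow> ('b, 'y) superalg_scheme \<Rightarrow> ('a \<Rightarrow> 'b) set" where
  "superalg_hom A B = {h \<in> ring_hom A B.
     (\<forall>c. \<forall>x\<in>carrier A. h (c \<odot>\<^bsub>A\<^esub> x) = c \<odot>\<^bsub>B\<^esub> h x) \<and>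
     (\<forall>e. h ` part A e \<subseteq> part B e)}"

inductive_set gen_alg :: "('a, 'x) superalg_scheme \<Rightarrow> 'a set \<Rightarrow> 'a set"
  for A :: "('a, 'x) superalg_scheme" and S :: "'a set" where
  one: "\<one>\<^bsub>A\<^esub> \<in> gen_alg A S"
| incl: "x \<in> S \<Longrightarrow> x \<in> gen_alg A S"
| add: "x \<in> gen_alg A S \<Longrightarrow> y \<in> gen_alg A S \<Longrightarrow> x \<oplus>\<^bsub>A\<^esub> y \<in> gen_alg A S"
| mult: "x \<in> gen_alg A S \<Longrightarrow> y \<in> gen_alg A S \<Longrightarrow> x \<otimes>\<^bsub>A\<^esub> y \<in> gen_alg A S"
| smult: "x \<in> gen_alg A S \<Longrightarrow> c \<odot>\<^bsub>A\<^esub> x \<in> gen_alg A S"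


section \<open>Algebras given by generators and relations\<close>

text \<open>
  Words under concatenation, written additively, so that the convolution product of
  \<^typ>\<open>'b \<Rightarrow>\<^sub>0 complex\<close> makes finitely supported functions on words the free associative algebra.
\<close>

datatype 'b word = Word (letters: "'b list")

instantiation word :: (type) monoid_add
begin

definition zero_word :: "'a word" where
  "zero_word = Word []"

definition plus_word :: "'a word \<Rightarrow> 'a word \<Rightarrow> 'a word" where
  "plus_word u v = Word (letters u @ letters v)"

instance
  by standard (simp_all add: zero_word_def plus_word_def)

end

type_synonym 'b free = "'b word \<Rightarrow>\<^sub>0 complex"

definition letter :: "'b \<Rightarrow> 'b free" where
  "letter b = Poly_Mapping.single (Word [b]) 1"

definition scalar :: "complex \<Rightarrow> 'b free" where
  "scalar c = Poly_Mapping.single 0 c"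

definition free_superalg :: "'b set \<Rightarrow> ('b \<Rightarrow> bit) \<Rightarrow> 'b free superalg" where
  "free_superalg B par =
    \<lparr>carrier = {f. \<forall>u\<in>Poly_Mapping.keys f. set (letters u) \<subseteq> B},
     monoid.mult = (*), one = 1, zero = 0, add = (+),
     smult = (\<lambda>c f. scalar c * f),
     part = (\<lambda>e. {f. \<forall>u\<in>Poly_Mapping.keys f.
                     set (letters u) \<subseteq> B \<and> sum_list (map par (letters u)) = e})\<rparr>"

definition rel_ideal :: "'b set \<Rightarrow> ('b \<Rightarrow> bit) \<Rightarrow> 'b free set \<Rightarrow> 'b free set" where
  "rel_ideal B par R = genideal (free_superalg B par) R"

text \<open>
  The quotient of the free superalgebra on \<open>B\<close> by the two-sided ideal generated by the
  (homogeneous) relations \<open>R\<close>; its elements are cosets.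
\<close>

definition presented :: "'b set \<Rightarrow> ('b \<Rightarrow> bit) \<Rightarrow> 'b free set \<Rightarrow> 'b free set superalg" where
  "presented B par R =
    (let F = free_superalg B par; I = rel_ideal B par R; Q = F Quot I in
     \<lparr>carrier = carrier Q, monoid.mult = monoid.mult Q, one = one Q, zero = zero Q, add = add Q,
      smult = (\<lambda>c X. (I +>\<^bsub>F\<^esub> scalar c) \<otimes>\<^bsub>Q\<^esub> X),
      part = (\<lambda>e. (\<lambda>f. I +>\<^bsub>F\<^esub> f) ` part F e)\<rparr>)"

definition presented_gen ::
  "'b set \<Rightarrow> ('b \<Rightarrow> bit) \<Rightarrow> 'b free set \<Rightarrow> 'b \<Rightarrow> 'b free set" where
  "presented_gen B par R b = rel_ideal B par R +>\<^bsub>free_superalg B par\<^esub> letter b"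


section \<open>Lie superalgebras and enveloping superalgebras\<close>

text \<open>
  A complex Lie superalgebra is given by a homogeneous basis, the parities of the basis elements,
  and the brackets of basis elements as finite linear combinations of basis elements.
\<close>

record 'b lie_superalg =
  basis :: "'b set"
  bpar :: "'b \<Rightarrow> bit"
  bracket :: "'b \<Rightarrow> 'b \<Rightarrow> ('b \<Rightarrow>\<^sub>0 complex)"

text \<open>Linear extension of a map between bases.\<close>

definition push :: "('b \<Rightarrow> 'c) \<Rightarrow> ('b \<Rightarrow>\<^sub>0 complex) \<Rightarrow> ('c \<Rightarrow>\<^sub>0 complex)" where
  "push f v = (\<Sum>b\<in>Poly_Mapping.keys v. Poly_Mapping.single (f b) (Poly_Mapping.lookup v b))"

definition env_rels :: "'b lie_superalg \<Rightarrow> 'b free set" where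
  "env_rels g = {letter b * letter c
       - scalar (psign (bpar g b * bpar g c)) * (letter c * letter b)
       - push (\<lambda>x. Word [x]) (bracket g b c) | b c. b \<in> basis g \<and> c \<in> basis g}"

definition univ_env :: "'b lie_superalg \<Rightarrow> 'b free set superalg" where
  "univ_env g = presented (basis g) (bpar g) (env_rels g)"

definition env_gen :: "'b lie_superalg \<Rightarrow> 'b \<Rightarrow> 'b free set" where
  "env_gen g = presented_gen (basis g) (bpar g) (env_rels g)"

text \<open>
  The superalgebra homomorphism from the enveloping superalgebra induced by the Lie superalgebra
  homomorphism with values \<open>\<theta>\<close> on the basis.
\<close>

definition induced_hom ::
  "'b lie_superalg \<Rightarrow> 'a superalg \<Rightarrow> ('b \<Rightarrow> 'a) \<Rightarrow> ('b free set \<Rightarrow> 'a)" where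
  "induced_hom g A \<theta> = (THE h. h \<in> superalg_hom (univ_env g) A \<and>
      h \<in> extensional (carrier (univ_env g)) \<and>
      (\<forall>b\<in>basis g. h (env_gen g b) = \<theta> b))"

definition gl_super :: "nat set \<Rightarrow> (nat \<Rightarrow> bit) \<Rightarrow> (nat \<times> nat) lie_superalg" where
  "gl_super J par =
    \<lparr>basis = J \<times> J,
     bpar = (\<lambda>(i, j). par i + par j),
     bracket = (\<lambda>(i, j) (k, l).
        (if j = k then Poly_Mapping.single (i, l) 1 else 0)
      - (if i = l then Poly_Mapping.single (k, j)
                         (psign ((par i + par j) * (par k + par l))) else 0))\<rparr>"

text \<open>
  The truncated current algebra \<open>g[t]/t^\<gamma> g[t]\<close>; the pair \<open>(b, k)\<close> is the class of \<open>b \<otimes> t^k\<close>.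
  The point \<open>a\<close> in the variable \<open>t - a\<close> is only a name: it does not enter the bracket.
\<close>

definition takiff :: "nat \<Rightarrow> 'b lie_superalg \<Rightarrow> ('b \<times> nat) lie_superalg" where
  "takiff \<gamma> g =
    \<lparr>basis = basis g \<times> {..<\<gamma>},
     bpar = (\<lambda>(b, k). bpar g b),
     bracket = (\<lambda>(b, r) (c, s).
        if r + s < \<gamma> then push (\<lambda>x. (x, r + s)) (bracket g b c) else 0)\<rparr>"

definition lie_dsum :: "nat set \<Rightarrow> (nat \<Rightarrow> 'b lie_superalg) \<Rightarrow> (nat \<times> 'b) lie_superalg" where
  "lie_dsum J g =
    \<lparr>basis = (SIGMA i:J. basis (g i)),
     bpar = (\<lambda>(i, b). bpar (g i) b),
     bracket = (\<lambda>(i, b) (j, c). if i = j then push (Pair i) (bracket (g i) b c) else 0)\<rparr>"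

text \<open>
  \<open>tak i a b k\<close> is the basis vector \<open>E^a_b \<otimes> t^k\<close> (or \<open>e_ab \<otimes> t^k\<close>) of the \<open>i\<close>-th summand in a
  direct sum of truncated current algebras.
\<close>

type_synonym tak = "nat \<times> ((nat \<times> nat) \<times> nat)"

abbreviation tak :: "nat \<Rightarrow> nat \<Rightarrow> nat \<Rightarrow> nat \<Rightarrow> tak" where
  "tak i a b k \<equiv> (i, ((a, b), k))"

definition idx_par :: "nat \<Rightarrow> nat \<Rightarrow> nat \<Rightarrow> nat \<Rightarrow> bit" where
  "idx_par p q m i = (if i \<in> {1..p} \<union> {p + q + 1..p + q + m} then 0 else 1)"

definition gl_takiff :: "nat \<Rightarrow> nat \<Rightarrow> (nat \<Rightarrow> nat) \<Rightarrow> tak lie_superalg" where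
  "gl_takiff d l \<gamma> = lie_dsum {1..l} (\<lambda>i. takiff (\<gamma> i) (gl_super {1..d} (\<lambda>_. 0)))"

definition gls_takiff ::
  "nat \<Rightarrow> nat \<Rightarrow> nat \<Rightarrow> nat \<Rightarrow> nat \<Rightarrow> (nat \<Rightarrow> nat) \<Rightarrow> tak lie_superalg" where
  "gls_takiff p q m n d' \<xi> =
     lie_dsum {1..d'} (\<lambda>a. takiff (\<xi> a) (gl_super {1..p + q + m + n} (idx_par p q m)))"


section \<open>The Weyl superalgebra\<close>

text \<open>\<open>Xv a i\<close> and \<open>Yv a r\<close> are the variables with upper index \<open>a\<close> and lower index \<open>i\<close>, \<open>r\<close>.\<close>

datatype var = Xv nat nat | Yv nat nat

definition vars :: "nat \<Rightarrow> nat \<Rightarrow> nat \<Rightarrow> nat \<Rightarrow> nat \<Rightarrow> var set" where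
  "vars p q m n d = {Xv a i | a i. a \<in> {1..d} \<and> i \<in> {1..m + n}} \<union>
                    {Yv a r | a r. a \<in> {1..d} \<and> r \<in> {1..p + q}}"

definition var_par :: "nat \<Rightarrow> nat \<Rightarrow> var \<Rightarrow> bit" where
  "var_par p m v = (case v of Xv a i \<Rightarrow> (if i \<le> m then 0 else 1)
                            | Yv a r \<Rightarrow> (if r \<le> p then 0 else 1))"

text \<open>The free supercommutative superalgebra; the relations give \<open>2 v\<^sup>2 = 0\<close> for odd \<open>v\<close>.\<close>

definition comm_rels :: "'v set \<Rightarrow> ('v \<Rightarrow> bit) \<Rightarrow> 'v free set" where
  "comm_rels V par = {letter u * letter v - scalar (psign (par u * par v)) * (letter v * letter u)
                      | u v. u \<in> V \<and> v \<in> V}"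

definition superpoly :: "'v set \<Rightarrow> ('v \<Rightarrow> bit) \<Rightarrow> 'v free set superalg" where
  "superpoly V par = presented V par (comm_rels V par)"

definition superpoly_var :: "'v set \<Rightarrow> ('v \<Rightarrow> bit) \<Rightarrow> 'v \<Rightarrow> 'v free set" where
  "superpoly_var V par = presented_gen V par (comm_rels V par)"

text \<open>
  The superalgebra of linear endomorphisms; as in \<^const>\<open>extensional\<close>, maps are
  undefined outside the carrier.
\<close>

definition end_superalg :: "'a superalg \<Rightarrow> ('a \<Rightarrow> 'a) superalg" where
  "end_superalg F =
    (let E = {T \<in> carrier F \<rightarrow>\<^sub>E carrier F.
               (\<forall>f\<in>carrier F. \<forall>g\<in>carrier F. T (f \<oplus>\<^bsub>F\<^esub> g) = T f \<oplus>\<^bsub>F\<^esub> T g) \<and>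
               (\<forall>c. \<forall>f\<in>carrier F. T (c \<odot>\<^bsub>F\<^esub> f) = c \<odot>\<^bsub>F\<^esub> T f)} in
     \<lparr>carrier = E,
      monoid.mult = (\<lambda>S T. compose (carrier F) S T),
      one = (\<lambda>f\<in>carrier F. f),
      zero = (\<lambda>f\<in>carrier F. \<zero>\<^bsub>F\<^esub>),
      add = (\<lambda>S T. \<lambda>f\<in>carrier F. S f \<oplus>\<^bsub>F\<^esub> T f),
      smult = (\<lambda>c T. \<lambda>f\<in>carrier F. c \<odot>\<^bsub>F\<^esub> T f),
      part = (\<lambda>e. {T \<in> E. \<forall>e'. T ` part F e' \<subseteq> part F (e + e')})\<rparr>)"

definition mul_op :: "'v set \<Rightarrow> ('v \<Rightarrow> bit) \<Rightarrow> 'v \<Rightarrow> ('v free set \<Rightarrow> 'v free set)" where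
  "mul_op V par v = (\<lambda>f\<in>carrier (superpoly V par).
     superpoly_var V par v \<otimes>\<^bsub>superpoly V par\<^esub> f)"

text \<open>The left superderivation of parity \<open>par v\<close> that is dual to the variable \<open>v\<close>.\<close>

definition der_op :: "'v set \<Rightarrow> ('v \<Rightarrow> bit) \<Rightarrow> 'v \<Rightarrow> ('v free set \<Rightarrow> 'v free set)" where
  "der_op V par v =
    (let F = superpoly V par in
     THE D. D \<in> carrier (end_superalg F) \<and>
       (\<forall>u\<in>V. D (superpoly_var V par u) = (if u = v then \<one>\<^bsub>F\<^esub> else \<zero>\<^bsub>F\<^esub>)) \<and>
       (\<forall>e. \<forall>f\<in>part F e. \<forall>g\<in>carrier F.
          D (f \<otimes>\<^bsub>F\<^esub> g) = (D f \<otimes>\<^bsub>F\<^esub> g) \<oplus>\<^bsub>F\<^esub> (psign (par v * e) \<odot>\<^bsub>F\<^esub> (f \<otimes>\<^bsub>F\<^esub> D g))))"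

definition weyl_superalg ::
  "'v set \<Rightarrow> ('v \<Rightarrow> bit) \<Rightarrow> ('v free set \<Rightarrow> 'v free set) superalg" where
  "weyl_superalg V par =
    (let E = end_superalg (superpoly V par);
         C = gen_alg E (mul_op V par ` V \<union> der_op V par ` V) in
     E\<lparr>carrier := C, part := (\<lambda>e. part E e \<inter> C)\<rparr>)"

type_synonym weyl_op = "var free set \<Rightarrow> var free set"

definition weylD :: "nat \<Rightarrow> nat \<Rightarrow> nat \<Rightarrow> nat \<Rightarrow> nat \<Rightarrow> weyl_op superalg" where
  "weylD p q m n d = weyl_superalg (vars p q m n d) (var_par p m)"


section \<open>The two homomorphisms\<close>

text \<open>
  \<open>psum \<gamma> i = \<gamma> 1 + \<dots> + \<gamma> (i - 1)\<close>, so that the \<open>i\<close>-th block of indices is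
  \<open>{psum \<gamma> i + 1..psum \<gamma> (i + 1)}\<close>.
\<close>

definition psum :: "(nat \<Rightarrow> nat) \<Rightarrow> nat \<Rightarrow> nat" where
  "psum \<gamma> i = (\<Sum>j\<in>{1..<i}. \<gamma> j)"

text \<open>\<open>pq'\<close> stands for \<open>p' + q'\<close>, the number of blocks of \<open>\<gamma>\<close> inside \<open>{1..p + q}\<close>.\<close>

definition phi_gen ::
  "nat \<Rightarrow> nat \<Rightarrow> nat \<Rightarrow> nat \<Rightarrow> nat \<Rightarrow> nat \<Rightarrow> (nat \<Rightarrow> nat) \<Rightarrow> tak \<Rightarrow> weyl_op" where
  "phi_gen p q m n d pq' \<gamma> = (\<lambda>(i, ((a, b), k)).
    let D = weylD p q m n d;
        mo = mul_op (vars p q m n d) (var_par p m);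
        de = der_op (vars p q m n d) (var_par p m) in
    if i \<le> pq' then
      \<ominus>\<^bsub>D\<^esub> (\<Oplus>\<^bsub>D\<^esub>r\<in>{psum \<gamma> i + 1..psum \<gamma> (i + 1) - k}.
             mo (Yv b r) \<otimes>\<^bsub>D\<^esub> de (Yv a (r + k)))
    else
      (\<Oplus>\<^bsub>D\<^esub>r\<in>{psum \<gamma> i + 1 - p - q..psum \<gamma> (i + 1) - k - p - q}.
         psign (idx_par p q m (p + q + r)) \<odot>\<^bsub>D\<^esub> (de (Xv b r) \<otimes>\<^bsub>D\<^esub> mo (Xv a (r + k)))))"

definition phi ::
  "nat \<Rightarrow> nat \<Rightarrow> nat \<Rightarrow> nat \<Rightarrow> nat \<Rightarrow> nat \<Rightarrow> nat \<Rightarrow> (nat \<Rightarrow> nat) \<Rightarrow> (tak free set \<Rightarrow> weyl_op)" where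
  "phi p q m n d pq' l \<gamma> =
     induced_hom (gl_takiff d l \<gamma>) (weylD p q m n d) (phi_gen p q m n d pq' \<gamma>)"

definition varphi_gen ::
  "nat \<Rightarrow> nat \<Rightarrow> nat \<Rightarrow> nat \<Rightarrow> nat \<Rightarrow> (nat \<Rightarrow> nat) \<Rightarrow> tak \<Rightarrow> weyl_op" where
  "varphi_gen p q m n d \<xi> = (\<lambda>(a, ((i, j), k)).
    let D = weylD p q m n d;
        mo = mul_op (vars p q m n d) (var_par p m);
        de = der_op (vars p q m n d) (var_par p m) in
    (\<Oplus>\<^bsub>D\<^esub>\<alpha>\<in>{psum \<xi> a + 1..psum \<xi> (a + 1) - k}.
      if i \<le> p + q then
        (if j \<le> p + q
         then psign (idx_par p q m j + 1) \<odot>\<^bsub>D\<^esub> (de (Yv (\<alpha> + k) i) \<otimes>\<^bsub>D\<^esub> mo (Yv \<alpha> j))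
         else de (Yv (\<alpha> + k) i) \<otimes>\<^bsub>D\<^esub> de (Xv \<alpha> (j - p - q)))
      else
        (if j \<le> p + q
         then psign (idx_par p q m j + 1) \<odot>\<^bsub>D\<^esub>
                (mo (Xv (\<alpha> + k) (i - p - q)) \<otimes>\<^bsub>D\<^esub> mo (Yv \<alpha> j))
         else mo (Xv (\<alpha> + k) (i - p - q)) \<otimes>\<^bsub>D\<^esub> de (Xv \<alpha> (j - p - q)))))"

definition varphi ::
  "nat \<Rightarrow> nat \<Rightarrow> nat \<Rightarrow> nat \<Rightarrow> nat \<Rightarrow> nat \<Rightarrow> (nat \<Rightarrow> nat) \<Rightarrow> (tak free set \<Rightarrow> weyl_op)" where
  "varphi p q m n d d' \<xi> =
     induced_hom (gls_takiff p q m n d' \<xi>) (weylD p q m n d) (varphi_gen p q m n d \<xi>)"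


section \<open>Pseudo-differential operators\<close>

text \<open>
  \<open>f i j\<close> is the coefficient of \<open>z^i \<partial>^j\<close>.  With \<open>t\<close>-th derivative
  \<open>(z^k)^(t) = k (k - 1) \<dots> (k - t + 1) z^(k - t)\<close>, the rule for \<open>\<partial>^j z^k\<close> reads
  \<open>\<partial>^j z^k = (\<Sum>t. (j choose t) k (k - 1) \<dots> (k - t + 1) z^(k - t) \<partial>^(j - t))\<close>,
  and the coefficient of \<open>z^u \<partial>^v\<close> in a product collects the terms with \<open>i + k - t = u\<close> and
  \<open>j + l - t = v\<close>.  Because both factors are bounded above in \<open>z\<close> and \<open>\<partial>\<close>, the index set of
  the sum is finite.
\<close>

definition pdo_coeff :: "int \<Rightarrow> int \<Rightarrow> nat \<Rightarrow> complex" where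
  "pdo_coeff j k t = (of_int j gchoose t) * (\<Prod>s<t. of_int (k - int s))"

definition pdo :: "'a superalg \<Rightarrow> (int \<Rightarrow> int \<Rightarrow> 'a) superalg" where
  "pdo A =
    (let C = {f. (\<forall>i j. f i j \<in> carrier A) \<and>
                 (\<exists>r s. \<forall>i j. i > r \<or> j > s \<longrightarrow> f i j = \<zero>\<^bsub>A\<^esub>)} in
     \<lparr>carrier = C,
      monoid.mult = (\<lambda>f g u v.
        finsum A
          (\<lambda>(i, j, t). pdo_coeff j (u + int t - i) t \<odot>\<^bsub>A\<^esub>
                        (f i j \<otimes>\<^bsub>A\<^esub> g (u + int t - i) (v + int t - j)))
          {(i, j, t). f i j \<noteq> \<zero>\<^bsub>A\<^esub> \<and> g (u + int t - i) (v + int t - j) \<noteq> \<zero>\<^bsub>A\<^esub>}),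
      one = (\<lambda>i j. if i = 0 \<and> j = 0 then \<one>\<^bsub>A\<^esub> else \<zero>\<^bsub>A\<^esub>),
      zero = (\<lambda>i j. \<zero>\<^bsub>A\<^esub>),
      add = (\<lambda>f g i j. f i j \<oplus>\<^bsub>A\<^esub> g i j),
      smult = (\<lambda>c f i j. c \<odot>\<^bsub>A\<^esub> f i j),
      part = (\<lambda>e. {f \<in> C. \<forall>i j. f i j \<in> part A e})\<rparr>)"

definition pdo_dz :: "'a superalg \<Rightarrow> (int \<Rightarrow> int \<Rightarrow> 'a)" where
  "pdo_dz A = (\<lambda>i j. if i = 0 \<and> j = 1 then \<one>\<^bsub>A\<^esub> else \<zero>\<^bsub>A\<^esub>)"

text \<open>
  \<open>x / (z - c)^(k + 1)\<close>, expanded as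
  \<open>(\<Sum>r\<ge>0. (k + r choose k) c^r z^(- k - 1 - r)) x\<close>.
\<close>

definition pdo_frac :: "'a superalg \<Rightarrow> 'a \<Rightarrow> complex \<Rightarrow> nat \<Rightarrow> (int \<Rightarrow> int \<Rightarrow> 'a)" where
  "pdo_frac A x c k = (\<lambda>i j.
     if j = 0 \<and> i \<le> - int k - 1
     then (let r = nat (- int k - 1 - i) in (of_nat ((k + r) choose k) * c ^ r) \<odot>\<^bsub>A\<^esub> x)
     else \<zero>\<^bsub>A\<^esub>)"


section \<open>Determinants\<close>

definition ord_prod :: "('a, 'x) monoid_scheme \<Rightarrow> 'a list \<Rightarrow> 'a" where
  "ord_prod R xs = foldr (\<lambda>x y. x \<otimes>\<^bsub>R\<^esub> y) xs \<one>\<^bsub>R\<^esub>"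

definition cdet :: "'a superalg \<Rightarrow> nat \<Rightarrow> (nat \<times> nat \<Rightarrow> 'a) \<Rightarrow> 'a" where
  "cdet R k M = (\<Oplus>\<^bsub>R\<^esub>\<sigma>\<in>{\<sigma>. \<sigma> permutes {1..k}}.
     of_int (sign \<sigma>) \<odot>\<^bsub>R\<^esub> ord_prod R (map (\<lambda>b. M (\<sigma> b, b)) [1..<k + 1]))"

definition mat_mult ::
  "('a, 'x) ring_scheme \<Rightarrow> nat \<Rightarrow> (nat \<times> nat \<Rightarrow> 'a) \<Rightarrow> (nat \<times> nat \<Rightarrow> 'a) \<Rightarrow> (nat \<times> nat \<Rightarrow> 'a)" where
  "mat_mult R k M N = (\<lambda>(i, j)\<in>{1..k} \<times> {1..k}. \<Oplus>\<^bsub>R\<^esub>h\<in>{1..k}. M (i, h) \<otimes>\<^bsub>R\<^esub> N (h, j))"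

definition mat_one :: "('a, 'x) ring_scheme \<Rightarrow> nat \<Rightarrow> (nat \<times> nat \<Rightarrow> 'a)" where
  "mat_one R k = (\<lambda>(i, j)\<in>{1..k} \<times> {1..k}. if i = j then \<one>\<^bsub>R\<^esub> else \<zero>\<^bsub>R\<^esub>)"

text \<open>The inverse of the upper left \<open>k \<times> k\<close> submatrix of \<open>M\<close>.\<close>

definition mat_inverse ::
  "('a, 'x) ring_scheme \<Rightarrow> nat \<Rightarrow> (nat \<times> nat \<Rightarrow> 'a) \<Rightarrow> (nat \<times> nat \<Rightarrow> 'a)" where
  "mat_inverse R k M = (THE N. N \<in> {1..k} \<times> {1..k} \<rightarrow>\<^sub>E carrier R \<and>
     mat_mult R k M N = mat_one R k \<and> mat_mult R k N M = mat_one R k)"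

definition qminor :: "('a, 'x) ring_scheme \<Rightarrow> (nat \<times> nat \<Rightarrow> 'a) \<Rightarrow> nat \<Rightarrow> 'a" where
  "qminor R M i = inv\<^bsub>R\<^esub> (mat_inverse R i M (i, i))"

definition berezinian ::
  "('a, 'x) ring_scheme \<Rightarrow> nat \<Rightarrow> (nat \<Rightarrow> bit) \<Rightarrow> (nat \<times> nat \<Rightarrow> 'a) \<Rightarrow> 'a" where
  "berezinian R N s M = ord_prod R
     (map (\<lambda>i. if s i = 0 then qminor R M i else inv\<^bsub>R\<^esub> (qminor R M i)) [1..<N + 1])"


section \<open>Gaudin algebras\<close>

definition jordan_block :: "complex \<Rightarrow> nat \<Rightarrow> nat \<Rightarrow> complex" where
  "jordan_block c i j = (if i = j then c else if j = i + 1 then 1 else 0)"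

text \<open>The block diagonal matrix with Jordan blocks of size \<open>\<gamma> i\<close> and eigenvalue \<open>z i\<close>, \<open>1 \<le> i \<le> l\<close>.\<close>

definition jordan :: "nat \<Rightarrow> (nat \<Rightarrow> nat) \<Rightarrow> (nat \<Rightarrow> complex) \<Rightarrow> nat \<Rightarrow> nat \<Rightarrow> complex" where
  "jordan l \<gamma> z a b = (\<Sum>i\<in>{1..l}.
     if a \<in> {psum \<gamma> i + 1..psum \<gamma> (i + 1)} \<and> b \<in> {psum \<gamma> i + 1..psum \<gamma> (i + 1)}
     then jordan_block (z i) (a - psum \<gamma> i) (b - psum \<gamma> i) else 0)"

definition gl_matrix ::
  "nat \<Rightarrow> nat \<Rightarrow> nat \<Rightarrow> (nat \<Rightarrow> complex) \<Rightarrow> (nat \<Rightarrow> nat) \<Rightarrow> (nat \<Rightarrow> complex) \<Rightarrow> (nat \<Rightarrow> nat) \<Rightarrow>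
   (nat \<times> nat \<Rightarrow> (int \<Rightarrow> int \<Rightarrow> tak free set))" where
  "gl_matrix d d' l w \<xi> z \<gamma> =
    (let g = gl_takiff d l \<gamma>; U = univ_env g; P = pdo U in
     (\<lambda>(a, b).
       (if a = b then pdo_dz U else \<zero>\<^bsub>P\<^esub>)
       \<ominus>\<^bsub>P\<^esub> (jordan d' \<xi> w a b \<odot>\<^bsub>P\<^esub> \<one>\<^bsub>P\<^esub>)
       \<ominus>\<^bsub>P\<^esub> (\<Oplus>\<^bsub>P\<^esub>i\<in>{1..l}. \<Oplus>\<^bsub>P\<^esub>k\<in>{..<\<gamma> i}. pdo_frac U (env_gen g (tak i a b k)) (z i) k)))"

definition gaudin_gl ::
  "nat \<Rightarrow> nat \<Rightarrow> nat \<Rightarrow> (nat \<Rightarrow> complex) \<Rightarrow> (nat \<Rightarrow> nat) \<Rightarrow> (nat \<Rightarrow> complex) \<Rightarrow> (nat \<Rightarrow> nat) \<Rightarrow>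
   tak free set set" where
  "gaudin_gl d d' l w \<xi> z \<gamma> =
    (let U = univ_env (gl_takiff d l \<gamma>);
         C = cdet (pdo U) d (gl_matrix d d' l w \<xi> z \<gamma>) in
     gen_alg U {C k (int i - 1) | k i. i \<in> {1..d}})"

definition gls_matrix ::
  "nat \<Rightarrow> nat \<Rightarrow> nat \<Rightarrow> nat \<Rightarrow> nat \<Rightarrow> nat \<Rightarrow>
   (nat \<Rightarrow> complex) \<Rightarrow> (nat \<Rightarrow> nat) \<Rightarrow> (nat \<Rightarrow> complex) \<Rightarrow> (nat \<Rightarrow> nat) \<Rightarrow>
   (nat \<times> nat \<Rightarrow> (int \<Rightarrow> int \<Rightarrow> tak free set))" where
  "gls_matrix p q m n d' l w \<xi> z \<gamma> =
    (let g = gls_takiff p q m n d' \<xi>; U = univ_env g; P = pdo U in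
     (\<lambda>(i, j).
       (if i = j then pdo_dz U else \<zero>\<^bsub>P\<^esub>)
       \<ominus>\<^bsub>P\<^esub> (jordan l \<gamma> z i j \<odot>\<^bsub>P\<^esub> \<one>\<^bsub>P\<^esub>)
       \<ominus>\<^bsub>P\<^esub> (psign (idx_par p q m i) \<odot>\<^bsub>P\<^esub>
             (\<Oplus>\<^bsub>P\<^esub>a\<in>{1..d'}. \<Oplus>\<^bsub>P\<^esub>k\<in>{..<\<xi> a}. pdo_frac U (env_gen g (tak a i j k)) (w a) k))))"

text \<open>The parity sequence of the indices is \<open>(0^p, 1^q, 0^m, 1^n)\<close>.\<close>

definition gaudin_gls ::
  "nat \<Rightarrow> nat \<Rightarrow> nat \<Rightarrow> nat \<Rightarrow> nat \<Rightarrow> nat \<Rightarrow>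
   (nat \<Rightarrow> complex) \<Rightarrow> (nat \<Rightarrow> nat) \<Rightarrow> (nat \<Rightarrow> complex) \<Rightarrow> (nat \<Rightarrow> nat) \<Rightarrow> tak free set set" where
  "gaudin_gls p q m n d' l w \<xi> z \<gamma> =
    (let U = univ_env (gls_takiff p q m n d' \<xi>);
         B = berezinian (pdo U) (p + q + m + n) (idx_par p q m)
               (gls_matrix p q m n d' l w \<xi> z \<gamma>) in
     gen_alg U {B k i | k i. i \<le> int p + int m - int q - int n})"

end

(*
Write X_i^a, P_i^a (flavour i, colour a) for the generators of the Weyl superalgebra, so that P X - (+-) X P = 1.
Both images are coefficients of determinants of matrices over pseudo-differential operators with entries bilinear in X and P,
contracted with the resolvent of one Jordan matrix and shifted by the other.  Let f be the product of (z - z_i)^(+-1) over the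
flavours, g the product of z - w_a over the colours, and tau the linear map z^i d^j -> z^j d^i.  The core is the identity
tau(cdet(L1) f) = g Ber(L2).  Conjugation by f turns the entries of L1 into normally ordered ones; then cdet is an iterated product of commuting
operators, which tau carries to the corresponding determinant with z and d exchanged; finally the flavours are removed one at a time,
each contributing one factor of the Berezinian (a Schur complement argument for Manin matrices).  As f and g are invertible with scalar
coefficients, both sides generate the same algebra.
*)
theory Submission
  imports Defs "HOL-Computational_Algebra.Formal_Power_Series"
begin

text \<open>The exchange tau is not multiplicative. It only turns left multiplication by z into
  right multiplication by d and right multiplication by d into left multiplication by z; so a
  determinant can be carried across only after it is written as a composition of operators acting
  with X and z from the left and with P and d from the right. Reordering the entries costs a
  diagonal term, the supertrace of the resolvent, and f is the function with exactly this
  logarithmic derivative: here the factor f originates, while g is the determinant left when all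
  flavours are gone. The y variables are Fourier transformed (X is a derivative, P a signed
  multiplication), so one set of relations serves all flavours. The generators on the Berezinian
  side are coefficients up to a prescribed order in d, so its order must be bounded, by means of the
  degree in z before the exchange. Finally, the algebras of the statement are records of cosets and
  operators, whereas the calculations need rings as types; surjective homomorphisms from types onto
  the records carry determinants, matrix inverses and definite descriptions across.\<close>

section \<open>Complex algebras and the associativity of pseudo-differential multiplication\<close>

class calg = ring_1 +
  fixes scal :: "complex \<Rightarrow> 'a"
  assumes scal_add: "scal (c + e) = scal c + scal e"
    and scal_mult: "scal (c * e) = scal c * scal e"
    and scal_one [simp]: "scal 1 = 1"
    and scal_central: "scal c * x = x * scal c"
begin

lemma scal_0 [simp]: "scal 0 = 0"
  using scal_add[of 0 0] by simp

lemma scal_minus: "scal (- c) = - scal c"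
  using scal_add[of c "- c"] by (simp add: eq_neg_iff_add_eq_0 add.commute)

lemma scal_diff: "scal (c - e) = scal c - scal e"
  using scal_add[of c "- e"] by (simp add: scal_minus)

lemma scal_sum: "scal (sum f A) = (\<Sum>x\<in>A. scal (f x))"
  by (induction A rule: infinite_finite_induct) (auto simp: scal_add)

lemma scal_left_commute: "x * (scal c * y) = scal c * (x * y)"
  by (metis mult.assoc scal_central)

lemma scal_scal: "scal c * (scal e * y) = scal (c * e) * y"
  by (simp add: scal_mult mult.assoc)

end

text \<open>The falling factorial of \<open>k\<close> is \<open>fact t\<close> times a binomial
  coefficient; in this form the identities for binomial coefficients with complex upper argument
  apply.\<close>

lemma pdo_coeff_gbinomial:
  "pdo_coeff j k t = fact t * (of_int j gchoose t) * (of_int k gchoose t)"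
  by (simp add: pdo_coeff_def gbinomial_prod_rev atLeast0LessThan)

text \<open>Both sides count the ways to contract T derivatives with powers of z in the product d^a
  z^k d^l z^m, worked out from the left and from the right. In the common refinement
  \<open>F u r s\<close>, u derivatives of d^a hit z^k, r of them hit z^m, and s derivatives of d^l
  hit z^m.\<close>

lemma pdo_coeff_assoc_aux:
  fixes a k l m :: complex
  shows "(\<Sum>t\<le>T. fact t * (a gchoose t) * (k gchoose t) *
            (fact (T - t) * (a + l - of_nat t gchoose (T - t)) * (m gchoose (T - t))))
       = (\<Sum>s\<le>T. fact s * (l gchoose s) * (m gchoose s) *
            (fact (T - s) * (a gchoose (T - s)) * (k + m - of_nat s gchoose (T - s))))"
proof -
  define F where "F u r s = fact u * (a gchoose u) * (k gchoose u) * (fact (r + s) * (m gchoose (r + s)))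
        * ((a - of_nat u gchoose r) * (l gchoose s))" for u r s
  have rhs: "fact s * (l gchoose s) * (m gchoose s) *
            (fact n * (a gchoose n) * (k + m - of_nat s gchoose n))
       = (\<Sum>u\<le>n. F u (n - u) s)" for s n
  proof -
    \<comment> \<open>Vandermonde distributes the n derivatives taken from d^a over z^k and what is
      left of z^m.\<close>
    have vd: "(k + m - of_nat s gchoose n) = (\<Sum>u\<le>n. (k gchoose u) * (m - of_nat s gchoose (n - u)))"
      using gbinomial_Vandermonde[of k "m - of_nat s" n] by (simp add: algebra_simps atLeast0AtMost)
    have "fact s * (l gchoose s) * (m gchoose s) *
            (fact n * (a gchoose n) * ((k gchoose u) * (m - of_nat s gchoose (n - u)))) = F u (n - u) s"
      if "u \<le> n" for u
    proof -
      define r where "r = n - u"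
      have n: "n = u + r" using that by (simp add: r_def)
      have 1: "fact n * (a gchoose n) = fact u * (a gchoose u) * (fact r * (a - of_nat u gchoose r))"
      proof -
        have "(a gchoose n) * (of_nat n gchoose u) = (a gchoose u) * (a - of_nat u gchoose r)"
          using gbinomial_trinomial_revision[of u n a] that by (simp add: r_def)
        moreover have "(of_nat n gchoose u :: complex) = fact n / (fact u * fact r)"
          using binomial_fact[OF that, where 'a = complex] by (simp add: r_def binomial_gbinomial)
        ultimately show ?thesis by (simp add: field_simps)
      qed
      have 2: "fact s * (m gchoose s) * (m - of_nat s gchoose r) * fact r = fact (r + s) * (m gchoose (r + s))"
      proof -
        have "(m gchoose (r + s)) * (of_nat (r + s) gchoose s) = (m gchoose s) * (m - of_nat s gchoose r)"
          using gbinomial_trinomial_revision[of s "r + s" m] by simp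
        moreover have "(of_nat (r + s) gchoose s :: complex) = fact (r + s) / (fact s * fact r)"
          using binomial_fact[of s "r + s", where 'a = complex] by (simp add: binomial_gbinomial)
        ultimately have "(m gchoose (r + s)) * (fact (r + s) / (fact s * fact r)) = (m gchoose s) * (m - of_nat s gchoose r)"
          by metis
        then show ?thesis by (simp add: field_simps)
      qed
      have "fact s * (l gchoose s) * (m gchoose s) *
            (fact n * (a gchoose n) * ((k gchoose u) * (m - of_nat s gchoose (n - u))))
          = (fact n * (a gchoose n)) * (k gchoose u) * (l gchoose s) * (fact s * (m gchoose s) * (m - of_nat s gchoose r))"
        by (simp add: r_def algebra_simps)
      also have "\<dots> = fact u * (a gchoose u) * (a - of_nat u gchoose r) * (k gchoose u) * (l gchoose s)
          * (fact s * (m gchoose s) * (m - of_nat s gchoose r) * fact r)"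
        unfolding 1 by (simp add: algebra_simps)
      also have "\<dots> = F u r s" unfolding 2 by (simp add: F_def algebra_simps)
      finally show ?thesis by (simp add: r_def)
    qed
    then show ?thesis by (simp add: vd sum_distrib_left)
  qed
  have lhs: "fact t * (a gchoose t) * (k gchoose t) *
            (fact n * (a + l - of_nat t gchoose n) * (m gchoose n)) = (\<Sum>s\<le>n. F t (n - s) s)" for t n
  proof -
    \<comment> \<open>Here Vandermonde distributes the n derivatives that hit z^m over d^l and what
      is left of d^a.\<close>
    have "(a + l - of_nat t gchoose n) = (\<Sum>s\<le>n. (l gchoose s) * (a - of_nat t gchoose (n - s)))"
      using gbinomial_Vandermonde[of l "a - of_nat t" n] by (simp add: algebra_simps atLeast0AtMost)
    then show ?thesis by (simp add: F_def sum_distrib_left sum_distrib_right algebra_simps)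
  qed
  have "(\<Sum>t\<le>T. \<Sum>s\<le>T - t. F t (T - t - s) s) = (\<Sum>s\<le>T. \<Sum>t\<le>T - s. F t (T - s - t) s)"
    unfolding sum.Sigma[OF finite_atMost ballI[OF finite_atMost]]
    by (rule sum.reindex_bij_witness[where i = "\<lambda>(a, b). (b, a)" and j = "\<lambda>(a, b). (b, a)"])
       (auto simp: add.commute)
  then show ?thesis by (simp add: rhs lhs)
qed

lemma pdo_coeff_assoc:
  "(\<Sum>t\<le>T. pdo_coeff j k t * pdo_coeff (j + l - int t) m (T - t))
     = (\<Sum>t\<le>T. pdo_coeff l m (T - t) * pdo_coeff j (k + m - int (T - t)) t)"
proof -
  have "(\<Sum>t\<le>T. pdo_coeff l m (T - t) * pdo_coeff j (k + m - int (T - t)) t)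
      = (\<Sum>s\<le>T. pdo_coeff l m s * pdo_coeff j (k + m - int s) (T - s))"
    by (rule sum.reindex_bij_witness[where i = "\<lambda>s. T - s" and j = "\<lambda>s. T - s"]) auto
  then show ?thesis
    using pdo_coeff_assoc_aux[where a = "of_int j" and k = "of_int k" and l = "of_int l" and m = "of_int m" and T = T]
    by (simp add: pdo_coeff_gbinomial)
qed

lemma pdo_coeff_0 [simp]: "pdo_coeff j k 0 = 1"
  by (simp add: pdo_coeff_def)

lemma pdo_coeff_zero_left [simp]: "t \<noteq> 0 \<Longrightarrow> pdo_coeff 0 k t = 0"
  by (cases t) (simp_all add: pdo_coeff_gbinomial)

lemma pdo_coeff_zero_right [simp]: "t \<noteq> 0 \<Longrightarrow> pdo_coeff j 0 t = 0"
  by (cases t) (simp_all add: pdo_coeff_gbinomial)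

definition bounded_by :: "int \<Rightarrow> int \<Rightarrow> (int \<Rightarrow> int \<Rightarrow> 'a::zero) \<Rightarrow> bool" where
  "bounded_by r s f \<longleftrightarrow> (\<forall>i j. i > r \<or> j > s \<longrightarrow> f i j = 0)"

lemma bounded_byD: "bounded_by r s f \<Longrightarrow> f i j \<noteq> 0 \<Longrightarrow> i \<le> r \<and> j \<le> s"
  unfolding bounded_by_def by (meson not_le)

text \<open>The product of \<open>pdo\<close>, for coefficients in a type. The index set is kept in
  the same shape, so that the two products can be compared term by term later.\<close>

definition conv :: "(int \<Rightarrow> int \<Rightarrow> 'a::calg) \<Rightarrow> (int \<Rightarrow> int \<Rightarrow> 'a) \<Rightarrow> int \<Rightarrow> int \<Rightarrow> 'a" where
  "conv f g u v = (\<Sum>(i, j, t)\<in>{(i, j, t). f i j \<noteq> 0 \<and> g (u + int t - i) (v + int t - j) \<noteq> 0}.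
     scal (pdo_coeff j (u + int t - i) t) * (f i j * g (u + int t - i) (v + int t - j)))"

lemma conv_support:
  assumes "bounded_by r s f" "bounded_by r' s' g"
  shows "{(i, j, t). f i j \<noteq> 0 \<and> g (u + int t - i) (v + int t - j) \<noteq> 0}
     \<subseteq> {u - r'..r} \<times> {v - s'..s} \<times> {..nat (r + r' - u)}"
proof (clarify, intro SigmaI conjI)
  fix i j t assume *: "f i j \<noteq> 0" "g (u + int t - i) (v + int t - j) \<noteq> 0"
  then show "i \<in> {u - r'..r}" "j \<in> {v - s'..s}" "t \<in> {..nat (r + r' - u)}"
    using bounded_byD[OF assms(1) *(1)] bounded_byD[OF assms(2) *(2)] by auto
qed

text \<open>The index set of a product depends on the factors. Replacing it by any sufficiently
  large box puts sums for different factors over the same index set, as distributivity and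
  associativity require.\<close>

lemma conv_box:
  assumes "bounded_by r s f" "bounded_by r' s' g"
    and "finite I" "finite J" "{u - r'..r} \<subseteq> I" "{v - s'..s} \<subseteq> J" "nat (r + r' - u) \<le> n"
  shows "conv f g u v = (\<Sum>(i, j, t)\<in>I \<times> J \<times> {..n}.
     scal (pdo_coeff j (u + int t - i) t) * (f i j * g (u + int t - i) (v + int t - j)))"
  unfolding conv_def
proof (rule sum.mono_neutral_left)
  have "{u - r'..r} \<times> {v - s'..s} \<times> {..nat (r + r' - u)} \<subseteq> I \<times> J \<times> {..n}"
    using assms(5-7) by (intro Sigma_mono) auto
  then show "{(i, j, t). f i j \<noteq> 0 \<and> g (u + int t - i) (v + int t - j) \<noteq> 0} \<subseteq> I \<times> J \<times> {..n}"
    using conv_support[OF assms(1,2), of u v] by (rule subset_trans[rotated])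
qed (use assms in auto)

lemma bounded_by_conv:
  assumes "bounded_by r s f" "bounded_by r' s' g"
  shows "bounded_by (r + r') (s + s') (conv f g)"
proof -
  have "conv f g u v = 0" if "u > r + r' \<or> v > s + s'" for u v
  proof -
    have e: "{(i, j, t). f i j \<noteq> 0 \<and> g (u + int t - i) (v + int t - j) \<noteq> 0} = {}"
      using conv_support[OF assms, of u v] bounded_byD[OF assms(1)] bounded_byD[OF assms(2)] that
      by (fastforce)
    show ?thesis unfolding conv_def e by simp
  qed
  then show ?thesis by (auto simp: bounded_by_def)
qed

lemma square_sum_diagonals:
  fixes c :: "nat \<Rightarrow> nat \<Rightarrow> 'a::comm_monoid_add"
  assumes "\<And>s t. s + t > n \<Longrightarrow> c s t = 0"
  shows "(\<Sum>t\<le>n. \<Sum>s\<le>n. c s t) = (\<Sum>T\<le>n. \<Sum>t\<le>T. c (T - t) t)"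
  unfolding sum.Sigma[OF finite_atMost ballI[OF finite_atMost]]
  by (rule sum.reindex_bij_witness_not_neutral[where i = "\<lambda>(T, t). (t, T - t)" and j = "\<lambda>(t, s). (s + t, t)"
        and S' = "{(t, s). t \<le> n \<and> s \<le> n \<and> s + t > n}" and T' = "{}"])
     (use assms in \<open>auto intro!: finite_subset[of "{(t, s). t \<le> n \<and> s \<le> n \<and> s + t > n}" "{..n} \<times> {..n}"] simp: not_le\<close>)

lemma sum_triple_triple:
  "(\<Sum>(a, b, c)\<in>A. \<Sum>(i, j, k)\<in>B. F a b c i j k) = (\<Sum>((a, b, c), (i, j, k))\<in>A \<times> B. F a b c i j k)"
proof -
  define G where "G x y = (case x of (a, b, c) \<Rightarrow> case y of (i, j, k) \<Rightarrow> F a b c i j k)" for x y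
  have "(\<Sum>x\<in>A. \<Sum>y\<in>B. G x y) = (\<Sum>(x, y)\<in>A \<times> B. G x y)"
    by (rule sum.cartesian_product)
  then show ?thesis by (simp add: G_def case_prod_unfold)
qed

lemma sum_quadruple_pair:
  "(\<Sum>(a, b, c, d)\<in>A. \<Sum>t\<in>B. \<Sum>s\<in>C. F a b c d t s)
     = (\<Sum>((a, b, c, d), t, s)\<in>A \<times> (B \<times> C). F a b c d t s)"
proof -
  define G where "G x y = (case x of (a, b, c, d) \<Rightarrow> case y of (t, s) \<Rightarrow> F a b c d t s)" for x y
  have "(\<Sum>x\<in>A. \<Sum>t\<in>B. \<Sum>s\<in>C. G x (t, s)) = (\<Sum>x\<in>A. \<Sum>y\<in>B \<times> C. G x y)"
    using sum.cartesian_product[of "\<lambda>t s. G _ (t, s)" C B] by simp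
  also have "\<dots> = (\<Sum>(x, y)\<in>A \<times> (B \<times> C). G x y)"
    by (rule sum.cartesian_product)
  finally show ?thesis by (simp add: G_def case_prod_unfold)
qed

text \<open>Both bracketings become sums over a monomial z^i d^j of f, a monomial z^k d^l of g and
  two numbers of contractions. For a fixed total T of contractions the coefficients enter through
  the same product \<open>\<phi> i j k l T\<close>, so the claim reduces to
  \<open>pdo_coeff_assoc\<close>.\<close>

lemma conv_assoc:
  assumes f: "bounded_by r1 s1 f" and g: "bounded_by r2 s2 g" and h: "bounded_by r3 s3 h"
  shows "conv (conv f g) h = conv f (conv g h)"
proof (intro ext)
  fix u v
  \<comment> \<open>Boxes that contain all non-zero terms of both bracketings; \<open>n\<close>
    bounds the total number of contractions.\<close>
  define n where "n = nat (r1 + r2 + r3 - u)"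
  define I J K L where "I = {u - r3 - r2..r1}" and "J = {v - s3 - s2..s1}"
    and "K = {u - r3 - r1..r2}" and "L = {v - s3 - s1..s2}"
  define I' J' where "I' = {u - r3..r1 + r2}" and "J' = {v - s3..s1 + s2}"
  define \<phi> where "\<phi> i j k l T = f i j * (g k l * h (u + int T - i - k) (v + int T - j - l))" for i j k l T
  have fin: "finite I" "finite J" "finite K" "finite L" "finite I'" "finite J'"
    by (auto simp: I_def J_def K_def L_def I'_def J'_def)
  have \<phi>0: "\<phi> i j k l T = 0" if "T > n" for i j k l T
  proof (rule ccontr)
    assume "\<phi> i j k l T \<noteq> 0"
    then have "f i j \<noteq> 0" "g k l \<noteq> 0" "h (u + int T - i - k) (v + int T - j - l) \<noteq> 0"
      by (auto simp: \<phi>_def)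
    then show False
      using that bounded_byD[OF f] bounded_byD[OF g] bounded_byD[OF h] by (fastforce simp: n_def)
  qed
  have "conv (conv f g) h u v = (\<Sum>(i', j', s)\<in>I' \<times> J' \<times> {..n}.
      scal (pdo_coeff j' (u + int s - i') s) * (conv f g i' j' * h (u + int s - i') (v + int s - j')))"
    by (rule conv_box[OF bounded_by_conv[OF f g] h]) (auto simp: I'_def J'_def n_def)
  also have "\<dots> = (\<Sum>(i', j', s)\<in>I' \<times> J' \<times> {..n}. \<Sum>(i, j, t)\<in>I \<times> J \<times> {..n}.
      scal (pdo_coeff j (i' + int t - i) t * pdo_coeff j' (u + int s - i') s) *
        (f i j * (g (i' + int t - i) (j' + int t - j) * h (u + int s - i') (v + int s - j'))))"
  proof (rule sum.cong[OF refl], clarify)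
    fix i' j' s assume ij: "i' \<in> I'" "j' \<in> J'"
    have "conv f g i' j' = (\<Sum>(i, j, t)\<in>I \<times> J \<times> {..n}.
     scal (pdo_coeff j (i' + int t - i) t) * (f i j * g (i' + int t - i) (j' + int t - j)))"
      by (rule conv_box[OF f g]) (use ij in \<open>auto simp: I_def J_def I'_def J'_def n_def\<close>)
    then show "scal (pdo_coeff j' (u + int s - i') s) * (conv f g i' j' * h (u + int s - i') (v + int s - j'))
      = (\<Sum>(i, j, t)\<in>I \<times> J \<times> {..n}.
      scal (pdo_coeff j (i' + int t - i) t * pdo_coeff j' (u + int s - i') s) *
        (f i j * (g (i' + int t - i) (j' + int t - j) * h (u + int s - i') (v + int s - j'))))"
      by (simp add: sum_distrib_left sum_distrib_right split_def mult.assoc scal_scal mult.commute[of "pdo_coeff j' _ s"])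
  qed
  also have "\<dots> = (\<Sum>((i', j', s), (i, j, t))\<in>(I' \<times> J' \<times> {..n}) \<times> (I \<times> J \<times> {..n}).
      scal (pdo_coeff j (i' + int t - i) t * pdo_coeff j' (u + int s - i') s) *
        (f i j * (g (i' + int t - i) (j' + int t - j) * h (u + int s - i') (v + int s - j'))))"
    by (rule sum_triple_triple)
  also have "\<dots> = (\<Sum>((i, j, k, l), t, s)\<in>(I \<times> J \<times> K \<times> L) \<times> ({..n} \<times> {..n}).
      scal (pdo_coeff j k t * pdo_coeff (j + l - int t) (u + int (s + t) - i - k) s) * \<phi> i j k l (s + t))"
    (is "sum ?F _ = sum ?G _")
  \<comment> \<open>A monomial z^i' d^j' of f g is traded for the monomial z^k d^l of g with i' = i
    + k - t and j' = j + l - t. The boxes do not correspond exactly under this change of indices, so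
    the zero terms are exempted.\<close>
  proof (rule sum.reindex_bij_witness_not_neutral[where
        i = "\<lambda>((i, j, k, l), t, s). ((i + k - int t, j + l - int t, s), (i, j, t))" and
        j = "\<lambda>((i', j', s), (i, j, t)). ((i, j, i' + int t - i, j' + int t - j), t, s)" and
        S' = "{x \<in> (I' \<times> J' \<times> {..n}) \<times> (I \<times> J \<times> {..n}). ?F x = 0}" and
        T' = "{x \<in> (I \<times> J \<times> K \<times> L) \<times> ({..n} \<times> {..n}). ?G x = 0}"])
    show "((\<lambda>((i', j', s), (i, j, t)). ((i, j, i' + int t - i, j' + int t - j), t, s)) x)
        \<in> (I \<times> J \<times> K \<times> L) \<times> ({..n} \<times> {..n}) - {x \<in> (I \<times> J \<times> K \<times> L) \<times> ({..n} \<times> {..n}). ?G x = 0}"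
      if x: "x \<in> (I' \<times> J' \<times> {..n}) \<times> (I \<times> J \<times> {..n}) - {x \<in> (I' \<times> J' \<times> {..n}) \<times> (I \<times> J \<times> {..n}). ?F x = 0}" for x
    proof -
      obtain i' j' s i j t where [simp]: "x = ((i', j', s), (i, j, t))" by (metis prod.exhaust)
      from x have *: "f i j \<noteq> 0" "g (i' + int t - i) (j' + int t - j) \<noteq> 0" "h (u + int s - i') (v + int s - j') \<noteq> 0"
        and nz: "?F x \<noteq> 0" and mem: "i \<in> I" "j \<in> J" "s \<le> n" "t \<le> n"
        by auto
      have "i' + int t - i \<in> K" "j' + int t - j \<in> L"
        using bounded_byD[OF f *(1)] bounded_byD[OF g *(2)] bounded_byD[OF h *(3)] by (auto simp: K_def L_def)
      moreover have "u + int (s + t) - i - (i' + int t - i) = u + int s - i'"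
        "v + int (s + t) - j - (j' + int t - j) = v + int s - j'"
        "j + (j' + int t - j) - int t = j'" by simp_all
      ultimately show ?thesis using mem nz by (simp add: \<phi>_def add_diff_eq)
    qed
    show "((\<lambda>((i, j, k, l), t, s). ((i + k - int t, j + l - int t, s), (i, j, t))) x)
        \<in> (I' \<times> J' \<times> {..n}) \<times> (I \<times> J \<times> {..n}) - {x \<in> (I' \<times> J' \<times> {..n}) \<times> (I \<times> J \<times> {..n}). ?F x = 0}"
      if x: "x \<in> (I \<times> J \<times> K \<times> L) \<times> ({..n} \<times> {..n}) - {x \<in> (I \<times> J \<times> K \<times> L) \<times> ({..n} \<times> {..n}). ?G x = 0}" for x
    proof -
      obtain i j k l t s where [simp]: "x = ((i, j, k, l), t, s)" by (metis prod.exhaust)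
      from x have *: "f i j \<noteq> 0" "g k l \<noteq> 0" "h (u + int (s + t) - i - k) (v + int (s + t) - j - l) \<noteq> 0"
        and nz: "?G x \<noteq> 0" and mem: "i \<in> I" "j \<in> J" "s \<le> n" "t \<le> n"
        by (auto simp: \<phi>_def)
      have "i + k - int t \<in> I'" "j + l - int t \<in> J'"
        using bounded_byD[OF f *(1)] bounded_byD[OF g *(2)] bounded_byD[OF h *(3)] by (auto simp: I'_def J'_def)
      moreover have e: "u + int s - (i + k - int t) = u + (int s + int t) - i - k"
        "v + int s - (j + l - int t) = v + (int s + int t) - j - l"
        "i + k - int t + int t - i = k" "j + l - int t + int t - j = l" by simp_all
      moreover have "?F ((\<lambda>((i, j, k, l), t, s). ((i + k - int t, j + l - int t, s), (i, j, t))) x) = ?G x"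
        by (simp only: \<phi>_def case_prod_conv e of_nat_add \<open>x = ((i, j, k, l), t, s)\<close>)
      ultimately show ?thesis using mem nz by simp
    qed
    show "?G ((\<lambda>((i', j', s), (i, j, t)). ((i, j, i' + int t - i, j' + int t - j), t, s)) x) = ?F x"
      if "x \<in> (I' \<times> J' \<times> {..n}) \<times> (I \<times> J \<times> {..n})" for x
    proof -
      obtain i' j' s i j t where [simp]: "x = ((i', j', s), (i, j, t))" by (metis prod.exhaust)
      have [simp]: "u + int (s + t) - i - (i' + int t - i) = u + int s - i'"
        "v + int (s + t) - j - (j' + int t - j) = v + int s - j'"
        "j + (j' + int t - j) - int t = j'" by simp_all
      show ?thesis by (simp add: \<phi>_def add_diff_eq)
    qed
  next
    show "finite {x \<in> (I' \<times> J' \<times> {..n}) \<times> (I \<times> J \<times> {..n}). ?F x = 0}"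
      "finite {x \<in> (I \<times> J \<times> K \<times> L) \<times> ({..n} \<times> {..n}). ?G x = 0}"
      using fin by simp_all
  qed (auto split: prod.splits)
  also have "\<dots> = (\<Sum>(i, j, k, l)\<in>I \<times> J \<times> K \<times> L. \<Sum>t\<le>n. \<Sum>s\<le>n.
      scal (pdo_coeff j k t * pdo_coeff (j + l - int t) (u + int (s + t) - i - k) s) * \<phi> i j k l (s + t))"
    by (rule sum_quadruple_pair[symmetric])
  also have "\<dots> = (\<Sum>(i, j, k, l)\<in>I \<times> J \<times> K \<times> L. \<Sum>t\<le>n. \<Sum>s\<le>n.
      scal (pdo_coeff l (u + int (s + t) - i - k) s * pdo_coeff j (u + int t - i) t) * \<phi> i j k l (s + t))"
  \<comment> \<open>For fixed monomials the two numbers of contractions are grouped by their total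
    T, and the coefficient identity is applied for each T.\<close>
  proof (rule sum.cong[OF refl], clarify)
    fix i j k l
    have "(\<Sum>t\<le>n. \<Sum>s\<le>n.
      scal (pdo_coeff j k t * pdo_coeff (j + l - int t) (u + int (s + t) - i - k) s) * \<phi> i j k l (s + t))
      = (\<Sum>T\<le>n. scal (\<Sum>t\<le>T. pdo_coeff j k t * pdo_coeff (j + l - int t) (u + int T - i - k) (T - t)) * \<phi> i j k l T)"
      by (subst square_sum_diagonals) (simp_all add: \<phi>0 scal_sum sum_distrib_right)
    also have "\<dots> = (\<Sum>T\<le>n. scal (\<Sum>t\<le>T. pdo_coeff l (u + int T - i - k) (T - t) * pdo_coeff j (u + int t - i) t) * \<phi> i j k l T)"
    proof (rule sum.cong[OF refl])
      fix T assume "T \<in> {..n}"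
      have "(\<Sum>t\<le>T. pdo_coeff j k t * pdo_coeff (j + l - int t) (u + int T - i - k) (T - t))
          = (\<Sum>t\<le>T. pdo_coeff l (u + int T - i - k) (T - t) * pdo_coeff j (k + (u + int T - i - k) - int (T - t)) t)"
        by (rule pdo_coeff_assoc)
      also have "\<dots> = (\<Sum>t\<le>T. pdo_coeff l (u + int T - i - k) (T - t) * pdo_coeff j (u + int t - i) t)"
        by (intro sum.cong refl arg_cong2[where f = times] arg_cong2[where f = "\<lambda>x. pdo_coeff j x"]) (auto simp: of_nat_diff)
      finally show "scal (\<Sum>t\<le>T. pdo_coeff j k t * pdo_coeff (j + l - int t) (u + int T - i - k) (T - t)) * \<phi> i j k l T
          = scal (\<Sum>t\<le>T. pdo_coeff l (u + int T - i - k) (T - t) * pdo_coeff j (u + int t - i) t) * \<phi> i j k l T"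
        by (rule arg_cong[where f = "\<lambda>x. scal x * \<phi> i j k l T"])
    qed
    also have "\<dots> = (\<Sum>t\<le>n. \<Sum>s\<le>n.
      scal (pdo_coeff l (u + int (s + t) - i - k) s * pdo_coeff j (u + int t - i) t) * \<phi> i j k l (s + t))"
      by (subst square_sum_diagonals) (simp_all add: \<phi>0 scal_sum sum_distrib_right)
    finally show "(\<Sum>t\<le>n. \<Sum>s\<le>n.
      scal (pdo_coeff j k t * pdo_coeff (j + l - int t) (u + int (s + t) - i - k) s) * \<phi> i j k l (s + t))
      = (\<Sum>t\<le>n. \<Sum>s\<le>n.
      scal (pdo_coeff l (u + int (s + t) - i - k) s * pdo_coeff j (u + int t - i) t) * \<phi> i j k l (s + t))" .
  qed
  also have "\<dots> = (\<Sum>((i, j, k, l), t, s)\<in>(I \<times> J \<times> K \<times> L) \<times> ({..n} \<times> {..n}).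
      scal (pdo_coeff l (u + int (s + t) - i - k) s * pdo_coeff j (u + int t - i) t) * \<phi> i j k l (s + t))"
    by (rule sum_quadruple_pair)
  also have "\<dots> = (\<Sum>((i, j, t), (k, l, s))\<in>(I \<times> J \<times> {..n}) \<times> (K \<times> L \<times> {..n}).
      scal (pdo_coeff l (u + int (s + t) - i - k) s * pdo_coeff j (u + int t - i) t) * \<phi> i j k l (s + t))"
    by (rule sum.reindex_bij_witness[where i = "\<lambda>((i, j, t), (k, l, s)). ((i, j, k, l), t, s)"
          and j = "\<lambda>((i, j, k, l), t, s). ((i, j, t), (k, l, s))"]) auto
  also have "\<dots> = (\<Sum>(i, j, t)\<in>I \<times> J \<times> {..n}. \<Sum>(k, l, s)\<in>K \<times> L \<times> {..n}.
      scal (pdo_coeff l (u + int (s + t) - i - k) s * pdo_coeff j (u + int t - i) t) * \<phi> i j k l (s + t))"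
    by (rule sum_triple_triple[symmetric])
  also have "\<dots> = (\<Sum>(i, j, t)\<in>I \<times> J \<times> {..n}.
      scal (pdo_coeff j (u + int t - i) t) * (f i j * conv g h (u + int t - i) (v + int t - j)))"
  proof (rule sum.cong[OF refl], clarify)
    fix i j t assume ij: "i \<in> I" "j \<in> J"
    have cgh: "conv g h (u + int t - i) (v + int t - j) = (\<Sum>(k, l, s)\<in>K \<times> L \<times> {..n}.
     scal (pdo_coeff l (u + int t - i + int s - k) s) * (g k l * h (u + int t - i + int s - k) (v + int t - j + int s - l)))"
      by (rule conv_box[OF g h]) (use ij in \<open>auto simp: I_def J_def K_def L_def n_def\<close>)
    show "(\<Sum>(k, l, s)\<in>K \<times> L \<times> {..n}.
      scal (pdo_coeff l (u + int (s + t) - i - k) s * pdo_coeff j (u + int t - i) t) * \<phi> i j k l (s + t))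
      = scal (pdo_coeff j (u + int t - i) t) * (f i j * conv g h (u + int t - i) (v + int t - j))"
    proof (subst cgh, simp only: sum_distrib_left case_prod_unfold, intro sum.cong refl)
      fix x :: "int \<times> int \<times> nat"
      obtain k l s where x: "x = (k, l, s)" by (metis prod.exhaust)
      have e: "u + int t - i + int s - k = u + (int s + int t) - i - k" "v + int t - j + int s - l = v + (int s + int t) - j - l"
        by simp_all
      show "scal (pdo_coeff (fst (snd x)) (u + int (snd (snd x) + t) - i - fst x) (snd (snd x)) * pdo_coeff j (u + int t - i) t) * \<phi> i j (fst x) (fst (snd x)) (snd (snd x) + t)
        = scal (pdo_coeff j (u + int t - i) t) * (f i j * (scal (pdo_coeff (fst (snd x)) (u + int t - i + int (snd (snd x)) - fst x) (snd (snd x)))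
            * (g (fst x) (fst (snd x)) * h (u + int t - i + int (snd (snd x)) - fst x) (v + int t - j + int (snd (snd x)) - fst (snd x)))))"
        unfolding x fst_conv snd_conv
        by (simp only: \<phi>_def e of_nat_add scal_left_commute[of "f i j"] scal_scal mult.commute[of "pdo_coeff l _ _"])
    qed
  qed
  also have "\<dots> = conv f (conv g h) u v"
    by (rule conv_box[OF f bounded_by_conv[OF g h], symmetric]) (auto simp: I_def J_def n_def)
  finally show "conv (conv f g) h u v = conv f (conv g h) u v" .
qed

section \<open>The algebra of pseudo-differential series as a type\<close>

typedef (overloaded) 'a psd = "{f :: int \<Rightarrow> int \<Rightarrow> 'a::calg. \<exists>r s. bounded_by r s f}"
  morphisms coef Psd
  by (rule exI[of _ "\<lambda>_ _. 0"]) (auto simp: bounded_by_def)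

lemma psd_eqI: "(\<And>i j. coef f i j = coef g i j) \<Longrightarrow> f = g"
  by (metis coef_inject ext)

lemma coef_bounded: obtains r s where "bounded_by r s (coef f)"
  using coef[of f] by auto

lemma coef_Psd: "bounded_by r s f \<Longrightarrow> coef (Psd f) = f"
  by (rule Psd_inverse) auto

lemma bounded_by_add: "bounded_by r s f \<Longrightarrow> bounded_by r' s' g \<Longrightarrow>
    bounded_by (max r r') (max s s') (\<lambda>i j. f i j + (g i j :: 'a::monoid_add))"
  by (auto simp: bounded_by_def)

instantiation psd :: (calg) ring_1
begin

definition "0 = Psd (\<lambda>_ _. 0)"
definition "1 = Psd (\<lambda>i j. if i = 0 \<and> j = 0 then 1 else 0)"
definition "f + g = Psd (\<lambda>i j. coef f i j + coef g i j)"
definition "- f = Psd (\<lambda>i j. - coef f i j)"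
definition "f - g = Psd (\<lambda>i j. coef f i j - coef g i j)" for f g :: "'a psd"
definition "f * g = Psd (conv (coef f) (coef g))"

lemma coef_0 [simp]: "coef 0 i j = 0"
  unfolding zero_psd_def by (subst coef_Psd[of 0 0]) (auto simp: bounded_by_def)

lemma coef_1: "coef 1 i j = (if i = 0 \<and> j = 0 then 1 else 0)"
  unfolding one_psd_def by (subst coef_Psd[of 0 0]) (auto simp: bounded_by_def)

lemma coef_add [simp]: "coef (f + g) i j = coef f i j + coef g i j"
proof -
  obtain r s r' s' where "bounded_by r s (coef f)" "bounded_by r' s' (coef g)"
    by (metis coef_bounded)
  then show ?thesis unfolding plus_psd_def by (subst coef_Psd[OF bounded_by_add]) auto
qed

lemma coef_uminus [simp]: "coef (- f) i j = - coef f i j"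
proof -
  obtain r s where "bounded_by r s (coef f)" by (metis coef_bounded)
  then show ?thesis unfolding uminus_psd_def by (subst coef_Psd[of r s]) (auto simp: bounded_by_def)
qed

lemma coef_diff [simp]: "coef (f - g) i j = coef f i j - coef g i j"
proof -
  obtain r s r' s' where "bounded_by r s (coef f)" "bounded_by r' s' (coef g)"
    by (metis coef_bounded)
  then show ?thesis unfolding minus_psd_def
    by (subst coef_Psd[of "max r r'" "max s s'"]) (auto simp: bounded_by_def)
qed

lemma coef_mult: "coef (f * g) = conv (coef f) (coef g)"
proof -
  obtain r s r' s' where "bounded_by r s (coef f)" "bounded_by r' s' (coef g)"
    by (metis coef_bounded)
  then show ?thesis unfolding times_psd_def by (subst coef_Psd[OF bounded_by_conv]) auto
qed

lemma coef_mult_left_single: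
  assumes f: "\<And>i j. coef f i j \<noteq> 0 \<Longrightarrow> i = a \<and> j = b" and g: "bounded_by r s (coef g)"
    and n: "nat (a + r - u) \<le> n"
  shows "coef (f * g) u v = (\<Sum>t\<le>n. scal (pdo_coeff b (u + int t - a) t) * (coef f a b * coef g (u + int t - a) (v + int t - b)))"
proof -
  have "coef (f * g) u v = (\<Sum>(i, j, t)\<in>{a} \<times> {b} \<times> {..n}.
     scal (pdo_coeff j (u + int t - i) t) * (coef f i j * coef g (u + int t - i) (v + int t - j)))"
    unfolding coef_mult conv_def
  proof (rule sum.mono_neutral_left)
    show "{(i, j, t). coef f i j \<noteq> 0 \<and> coef g (u + int t - i) (v + int t - j) \<noteq> 0} \<subseteq> {a} \<times> {b} \<times> {..n}"
      using f bounded_byD[OF g] n by fastforce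
  qed auto
  also have "\<dots> = (\<Sum>(i, j, t)\<in>(\<lambda>t. (a, b, t)) ` {..n}.
     scal (pdo_coeff j (u + int t - i) t) * (coef f i j * coef g (u + int t - i) (v + int t - j)))"
    by (rule sum.cong) auto
  also have "\<dots> = (\<Sum>t\<le>n. scal (pdo_coeff b (u + int t - a) t) * (coef f a b * coef g (u + int t - a) (v + int t - b)))"
    by (subst sum.reindex) (auto simp: inj_on_def)
  finally show ?thesis .
qed

text \<open>Powers of z on the left are already in normal order: nothing is contracted, and the
  coefficients are only shifted and multiplied. Powers of d on the right behave in the same way in
  the next lemma.\<close>

lemma coef_mult_left_z:
  assumes "\<And>i j. coef f i j \<noteq> 0 \<Longrightarrow> i = a \<and> j = 0"
  shows "coef (f * g) u v = coef f a 0 * coef g (u - a) v"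
proof -
  obtain r s where g: "bounded_by r s (coef g)" by (metis coef_bounded)
  show ?thesis
    by (subst coef_mult_left_single[OF assms g order_refl], assumption, subst sum.atMost_shift)
       (simp add: scal_one)
qed

lemma coef_mult_right_d:
  assumes g: "\<And>i j. coef g i j \<noteq> 0 \<Longrightarrow> i = 0 \<and> j = b"
  shows "coef (f * g) u v = coef f u (v - b) * coef g 0 b"
proof -
  let ?H = "\<lambda>(i, j, t). scal (pdo_coeff j (u + int t - i) t) * (coef f i j * coef g (u + int t - i) (v + int t - j))"
  obtain r s where f: "bounded_by r s (coef f)" by (metis coef_bounded)
  have gb: "bounded_by 0 b (coef g)" using g by (force simp: bounded_by_def)
  let ?S = "{(i, j, t). coef f i j \<noteq> 0 \<and> coef g (u + int t - i) (v + int t - j) \<noteq> 0}"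
  have "coef (f * g) u v = sum ?H (?S \<union> {(u, v - b, 0)})"
    unfolding coef_mult conv_def
    by (rule sum.mono_neutral_left) (use finite_subset[OF conv_support[OF f gb]] in auto)
  also have "\<dots> = sum ?H {(u, v - b, 0)}"
  proof (rule sum.mono_neutral_right)
    show "finite (?S \<union> {(u, v - b, 0)})" using finite_subset[OF conv_support[OF f gb]] by auto
    show "\<forall>x\<in>?S \<union> {(u, v - b, 0)} - {(u, v - b, 0)}. ?H x = 0"
    proof (rule ballI)
      fix x assume x: "x \<in> ?S \<union> {(u, v - b, 0)} - {(u, v - b, 0)}"
      obtain i j t where [simp]: "x = (i, j, t)" by (metis prod.exhaust)
      from x have *: "i = u \<longrightarrow> j = v - b \<longrightarrow> 0 < t" "coef g (u + int t - i) (v + int t - j) \<noteq> 0" by auto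
      from g[OF *(2)] have "u + int t - i = 0" "v + int t - j = b" by auto
      with * have "t \<noteq> 0" by auto
      with \<open>u + int t - i = 0\<close> show "?H x = 0" by simp
    qed
  qed auto
  finally show ?thesis by simp
qed

instance
proof
  fix f g h :: "'a psd"
  show "f * g * h = f * (g * h)"
  proof (rule psd_eqI)
    obtain r s r' s' r'' s'' where "bounded_by r s (coef f)" "bounded_by r' s' (coef g)" "bounded_by r'' s'' (coef h)"
      by (metis coef_bounded)
    then show "coef (f * g * h) i j = coef (f * (g * h)) i j" for i j
      by (simp add: coef_mult conv_assoc)
  qed
  show "(f + g) * h = f * h + g * h"
  proof (rule psd_eqI)
    fix u v
    obtain r s r' s' r'' s'' where b: "bounded_by r s (coef f)" "bounded_by r' s' (coef g)" "bounded_by r'' s'' (coef h)"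
      by (metis coef_bounded)
    let ?r = "max r r'" and ?s = "max s s'"
    have b': "bounded_by ?r ?s (coef f)" "bounded_by ?r ?s (coef g)" "bounded_by ?r ?s (coef (f + g))"
      using b by (auto simp: bounded_by_def)
    show "coef ((f + g) * h) u v = coef (f * h + g * h) u v"
      unfolding coef_add[of "_ * _" "_ * _"] coef_mult
      unfolding conv_box[OF b'(1) b(3) finite_atLeastAtMost_int finite_atLeastAtMost_int order_refl order_refl order_refl]
        conv_box[OF b'(2) b(3) finite_atLeastAtMost_int finite_atLeastAtMost_int order_refl order_refl order_refl]
        conv_box[OF b'(3) b(3) finite_atLeastAtMost_int finite_atLeastAtMost_int order_refl order_refl order_refl]
      by (simp add: sum.distrib[symmetric] split_def distrib_left distrib_right)
  qed
  show "f * (g + h) = f * g + f * h"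
  proof (rule psd_eqI)
    fix u v
    obtain r s r' s' r'' s'' where b: "bounded_by r s (coef f)" "bounded_by r' s' (coef g)" "bounded_by r'' s'' (coef h)"
      by (metis coef_bounded)
    let ?r = "max r' r''" and ?s = "max s' s''"
    have b': "bounded_by ?r ?s (coef g)" "bounded_by ?r ?s (coef h)" "bounded_by ?r ?s (coef (g + h))"
      using b by (auto simp: bounded_by_def)
    show "coef (f * (g + h)) u v = coef (f * g + f * h) u v"
      unfolding coef_add[of "_ * _" "_ * _"] coef_mult
      unfolding conv_box[OF b(1) b'(1) finite_atLeastAtMost_int finite_atLeastAtMost_int order_refl order_refl order_refl]
        conv_box[OF b(1) b'(2) finite_atLeastAtMost_int finite_atLeastAtMost_int order_refl order_refl order_refl]
        conv_box[OF b(1) b'(3) finite_atLeastAtMost_int finite_atLeastAtMost_int order_refl order_refl order_refl]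
      by (simp add: sum.distrib[symmetric] split_def distrib_left distrib_right)
  qed
  show "1 * f = f"
    by (rule psd_eqI, subst coef_mult_left_z[where a = 0]) (auto simp: coef_1 split: if_splits)
  show "f * 1 = f"
    by (rule psd_eqI, subst coef_mult_right_d[where b = 0]) (auto simp: coef_1 split: if_splits)
  show "(0 :: 'a psd) \<noteq> 1"
    by (metis coef_0 coef_1 zero_neq_one)
qed (auto intro!: psd_eqI simp: add.assoc add.commute)

end

lemma coef_sum [simp]: "coef (sum f A) i j = (\<Sum>x\<in>A. coef (f x) i j)"
  by (induction A rule: infinite_finite_induct) auto

definition psd_monom :: "int \<Rightarrow> int \<Rightarrow> 'a::calg \<Rightarrow> 'a psd" where
  "psd_monom a b x = Psd (\<lambda>i j. if i = a \<and> j = b then x else 0)"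

lemma coef_monom: "coef (psd_monom a b x) i j = (if i = a \<and> j = b then x else 0)"
  unfolding psd_monom_def by (subst coef_Psd[of a b]) (auto simp: bounded_by_def)

abbreviation "psd_const \<equiv> psd_monom 0 0"
abbreviation "psd_z \<equiv> psd_monom 1 0 1"
abbreviation "psd_d \<equiv> psd_monom 0 1 1"

lemma coef_monom_z_mult: "coef (psd_monom a 0 x * f) u v = x * coef f (u - a) v"
  by (subst coef_mult_left_z[where a = a]) (auto simp: coef_monom split: if_splits)

lemma coef_mult_monom_d: "coef (f * psd_monom 0 b x) u v = coef f u (v - b) * x"
  by (subst coef_mult_right_d[where b = b]) (auto simp: coef_monom split: if_splits)

lemma coef_d_mult: "coef (psd_d * f) u v = coef f u (v - 1) + scal (of_int (u + 1)) * coef f (u + 1) v"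
proof -
  obtain r s where f: "bounded_by r s (coef f)" by (metis coef_bounded)
  have pc: "pdo_coeff 1 k t = 0" if "t > 1" for k t
  proof -
    have "(1 :: complex) gchoose t = of_nat (1 choose t)"
      using binomial_gbinomial[of 1 t, where 'a = complex] by simp
    then show ?thesis using that by (simp add: pdo_coeff_gbinomial binomial_eq_0)
  qed
  have "coef (psd_d * f) u v = (\<Sum>t\<le>Suc (nat (r - u)). scal (pdo_coeff 1 (u + int t - 0) t) * (coef psd_d 0 1 * coef f (u + int t - 0) (v + int t - 1)))"
    by (rule coef_mult_left_single[OF _ f]) (auto simp: coef_monom split: if_splits)
  also have "\<dots> = (\<Sum>t\<in>{0, 1}. scal (pdo_coeff 1 (u + int t - 0) t) * (coef psd_d 0 1 * coef f (u + int t - 0) (v + int t - 1)))"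
    by (rule sum.mono_neutral_right) (auto simp: pc)
  finally show ?thesis by (simp add: coef_monom pdo_coeff_def)
qed

instantiation psd :: (calg) calg
begin

definition "scal c = psd_const (scal c)"

instance
proof
  fix c e :: complex and x :: "'a psd"
  show "scal c * x = x * scal c"
    by (rule psd_eqI) (simp add: scal_psd_def coef_monom_z_mult coef_mult_monom_d, rule scal_central)
qed (auto intro!: psd_eqI simp: scal_psd_def coef_monom coef_1 scal_add scal_mult coef_monom_z_mult)

end

lemma psd_const_add: "psd_const (a + b) = psd_const a + psd_const b"
  and psd_const_diff: "psd_const (a - b) = psd_const a - psd_const b"
  and psd_const_uminus: "psd_const (- a) = - psd_const a"
  and psd_const_0 [simp]: "psd_const 0 = 0"
  and psd_const_1 [simp]: "psd_const 1 = 1"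
  and psd_const_mult: "psd_const (a * b) = psd_const a * psd_const b"
  and psd_const_scal: "psd_const (scal c) = scal c"
  by (auto intro!: psd_eqI simp: coef_monom coef_1 coef_monom_z_mult scal_psd_def)

lemma coef_scal_mult [simp]: "coef (scal c * f) i j = scal c * coef f i j"
  by (simp add: scal_psd_def coef_monom_z_mult)

lemma psd_const_sum: "psd_const (\<Sum>x\<in>A. f x) = (\<Sum>x\<in>A. psd_const (f x))"
  by (induction A rule: infinite_finite_induct) (auto simp: psd_const_add)

lemma psd_const_z: "psd_const a * psd_z = psd_z * psd_const a"
  by (rule psd_eqI) (simp add: coef_monom_z_mult coef_monom)

lemma psd_const_d: "psd_const a * psd_d = psd_d * psd_const a"
  by (rule psd_eqI) (simp add: coef_mult_monom_d coef_d_mult coef_monom)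

lemma psd_d_z: "psd_d * psd_z = psd_z * psd_d + 1"
  by (rule psd_eqI) (simp add: coef_monom_z_mult coef_d_mult coef_monom coef_1)

section \<open>The exchange of z and d\<close>

definition psd_swap :: "'a::calg psd \<Rightarrow> 'a psd" where
  "psd_swap f = Psd (\<lambda>i j. coef f j i)"

lemma coef_swap [simp]: "coef (psd_swap f) i j = coef f j i"
proof -
  obtain r s where "bounded_by r s (coef f)" by (metis coef_bounded)
  then show ?thesis unfolding psd_swap_def by (subst coef_Psd[of s r]) (auto simp: bounded_by_def)
qed

text \<open>The products with constants on either side, with z on the left and with d on the right
  involve no contraction; these are the products that the exchange respects.\<close>

lemma swap_add: "psd_swap (f + g) = psd_swap f + psd_swap g"
  and swap_diff: "psd_swap (f - g) = psd_swap f - psd_swap g"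
  and swap_uminus: "psd_swap (- f) = - psd_swap f"
  and swap_0 [simp]: "psd_swap 0 = 0"
  and swap_1 [simp]: "psd_swap 1 = 1"
  and swap_swap [simp]: "psd_swap (psd_swap f) = f"
  and swap_const_mult: "psd_swap (psd_const a * f) = psd_const a * psd_swap f"
  and swap_scal_mult: "psd_swap (scal c * f) = scal c * psd_swap f"
  and swap_mult_const: "psd_swap (f * psd_const a) = psd_swap f * psd_const a"
  and swap_z_mult: "psd_swap (psd_z * f) = psd_swap f * psd_d"
  and swap_mult_d: "psd_swap (f * psd_d) = psd_z * psd_swap f"
  by (auto intro!: psd_eqI simp: coef_1 coef_monom_z_mult coef_mult_monom_d)

lemma swap_sum: "psd_swap (\<Sum>x\<in>A. f x) = (\<Sum>x\<in>A. psd_swap (f x))"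
  by (induction A rule: infinite_finite_induct) (auto simp: swap_add)

section \<open>Series of non-positive order and Neumann series\<close>

definition psd_O :: "'a::calg psd set" where
  "psd_O = {f. bounded_by 0 0 (coef f)}"

lemma psd_OI: "(\<And>i j. coef f i j \<noteq> 0 \<Longrightarrow> i \<le> 0 \<and> j \<le> 0) \<Longrightarrow> f \<in> psd_O"
  unfolding psd_O_def bounded_by_def mem_Collect_eq by (meson not_le)

lemma psd_O_D: "f \<in> psd_O \<Longrightarrow> coef f i j \<noteq> 0 \<Longrightarrow> i \<le> 0 \<and> j \<le> 0"
  unfolding psd_O_def using bounded_byD by blast

lemma psd_O_add: "f \<in> psd_O \<Longrightarrow> g \<in> psd_O \<Longrightarrow> f + g \<in> psd_O"
  and psd_O_diff: "f \<in> psd_O \<Longrightarrow> g \<in> psd_O \<Longrightarrow> f - g \<in> psd_O"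
  and psd_O_uminus: "f \<in> psd_O \<Longrightarrow> - f \<in> psd_O"
  and psd_O_0: "0 \<in> psd_O"
  unfolding psd_O_def bounded_by_def by auto

lemma psd_O_monom: "i \<le> 0 \<Longrightarrow> j \<le> 0 \<Longrightarrow> psd_monom i j x \<in> psd_O"
  unfolding psd_O_def bounded_by_def by (auto simp: coef_monom)

lemma psd_O_1: "1 \<in> psd_O"
  using psd_O_monom[of 0 0 1] by simp

lemma psd_O_scal: "scal c \<in> psd_O"
  using psd_O_monom[of 0 0 "scal c"] by (simp add: psd_const_scal)

lemma psd_O_mult: "f \<in> psd_O \<Longrightarrow> g \<in> psd_O \<Longrightarrow> f * g \<in> psd_O"
  unfolding psd_O_def mem_Collect_eq coef_mult using bounded_by_conv[of 0 0 "coef f" 0 0 "coef g"] by simp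

lemma psd_O_sum: "(\<And>x. x \<in> A \<Longrightarrow> f x \<in> psd_O) \<Longrightarrow> (\<Sum>x\<in>A. f x) \<in> psd_O"
  by (induction A rule: infinite_finite_induct) (auto simp: psd_O_0 psd_O_add)

lemmas psd_O_closed = psd_O_add psd_O_diff psd_O_uminus psd_O_0 psd_O_1 psd_O_scal psd_O_mult psd_O_sum

text \<open>Contractions can only lower the total degree, so it is subadditive. Among monomials of
  non-positive order in z and in d only finitely many have a given total degree, which makes series
  of decreasing total degree converge.\<close>

definition tdeg_le :: "int \<Rightarrow> 'a::calg psd \<Rightarrow> bool" where
  "tdeg_le e f \<longleftrightarrow> (\<forall>i j. coef f i j \<noteq> 0 \<longrightarrow> i + j \<le> e)"

lemma tdeg_le_mult:
  assumes f: "tdeg_le e f" and g: "tdeg_le e' g"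
  shows "tdeg_le (e + e') (f * g)"
  unfolding tdeg_le_def
proof (intro allI impI)
  fix u v assume "coef (f * g) u v \<noteq> 0"
  then have "{(i, j, t). coef f i j \<noteq> 0 \<and> coef g (u + int t - i) (v + int t - j) \<noteq> 0} \<noteq> {}"
    unfolding coef_mult conv_def by (metis (no_types, lifting) sum.empty)
  then obtain i j t where "coef f i j \<noteq> 0" "coef g (u + int t - i) (v + int t - j) \<noteq> 0" by blast
  then show "u + v \<le> e + e'" using f g unfolding tdeg_le_def by fastforce
qed

lemma tdeg_le_add: "tdeg_le e f \<Longrightarrow> tdeg_le e g \<Longrightarrow> tdeg_le e (f + g)"
  and tdeg_le_diff: "tdeg_le e f \<Longrightarrow> tdeg_le e g \<Longrightarrow> tdeg_le e (f - g)"
  and tdeg_le_0: "tdeg_le e 0"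
  unfolding tdeg_le_def by (auto, (metis add_0 diff_0 minus_zero)+)

lemma tdeg_le_sum: "(\<And>x. x \<in> A \<Longrightarrow> tdeg_le e (f x)) \<Longrightarrow> tdeg_le e (\<Sum>x\<in>A. f x)"
  by (induction A rule: infinite_finite_induct) (auto simp: tdeg_le_0 tdeg_le_add)

lemma tdeg_le_O: "f \<in> psd_O \<Longrightarrow> tdeg_le 0 f"
  unfolding tdeg_le_def using psd_O_D by fastforce

lemma tdeg_le_monom: "i + j \<le> e \<Longrightarrow> tdeg_le e (psd_monom i j x)"
  by (auto simp: tdeg_le_def coef_monom)

text \<open>Neumann series: the coefficient of total degree \<open>e\<close> in \<open>Y\<^sup>k\<close> vanishes for \<open>k > - e\<close>.\<close>

fun mat_pow :: "'i set \<Rightarrow> ('i \<Rightarrow> 'i \<Rightarrow> 'a::ring_1) \<Rightarrow> nat \<Rightarrow> 'i \<Rightarrow> 'i \<Rightarrow> 'a" where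
  "mat_pow K Y 0 = (\<lambda>i j. if i = j then 1 else 0)"
| "mat_pow K Y (Suc n) = (\<lambda>i j. \<Sum>h\<in>K. Y i h * mat_pow K Y n h j)"

lemma mat_pow_Suc_right:
  assumes "finite K" "i \<in> K" "j \<in> K"
  shows "mat_pow K Y (Suc n) i j = (\<Sum>h\<in>K. mat_pow K Y n i h * Y h j)"
  using assms(2)
proof (induction n arbitrary: i)
  case 0
  have "(\<Sum>h\<in>K. Y i h * (if h = j then 1 else 0)) = Y i j"
    using assms by (simp add: if_distrib[of "times _"] sum.delta cong: if_cong)
  moreover have "(\<Sum>h\<in>K. (if i = h then 1 else 0) * Y h j) = Y i j"
    using assms 0 by (simp add: if_distrib[of "\<lambda>x. x * _"] sum.delta' cong: if_cong)
  ultimately show ?case by simp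
next
  case (Suc n)
  have "mat_pow K Y (Suc (Suc n)) i j = (\<Sum>h\<in>K. Y i h * (\<Sum>h'\<in>K. mat_pow K Y n h h' * Y h' j))"
    unfolding mat_pow.simps(2)[of K Y "Suc n"] by (intro sum.cong refl arg_cong2[where f = times] Suc.IH)
  also have "\<dots> = (\<Sum>h'\<in>K. \<Sum>h\<in>K. Y i h * mat_pow K Y n h h' * Y h' j)"
    by (subst sum.swap) (simp add: sum_distrib_left mult.assoc)
  also have "\<dots> = (\<Sum>h\<in>K. mat_pow K Y (Suc n) i h * Y h j)"
    by (simp add: sum_distrib_right)
  finally show ?case .
qed

lemma neumann_series:
  fixes Y :: "'i \<Rightarrow> 'i \<Rightarrow> 'a::calg psd"
  assumes K: "finite K" and O: "\<And>i j. Y i j \<in> psd_O" and d: "\<And>i j. tdeg_le (- 1) (Y i j)"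
  obtains N where "\<And>i j. N i j \<in> psd_O"
    "\<And>i j. i \<in> K \<Longrightarrow> j \<in> K \<Longrightarrow> N i j - (\<Sum>h\<in>K. Y i h * N h j) = (if i = j then 1 else 0)"
    "\<And>i j. i \<in> K \<Longrightarrow> j \<in> K \<Longrightarrow> N i j - (\<Sum>h\<in>K. N i h * Y h j) = (if i = j then 1 else 0)"
proof -
  have PO: "mat_pow K Y n i j \<in> psd_O" for n i j
    by (induction n arbitrary: i) (auto intro!: psd_O_closed O)
  have Pd: "tdeg_le (- int n) (mat_pow K Y n i j)" for n i j
  proof (induction n arbitrary: i)
    case (Suc n)
    have "tdeg_le (- 1 + - int n) (Y i h * mat_pow K Y n h j)" for h
      by (rule tdeg_le_mult[OF d Suc.IH])
    then show ?case by (auto intro!: tdeg_le_sum simp: algebra_simps)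
  qed (auto simp: tdeg_le_O psd_O_closed)
  define S where "S n i j = (\<Sum>k\<le>n. mat_pow K Y k i j)" for n i j
  \<comment> \<open>The coefficients of total degree e do not change any more from the partial sum
    with n = - e on, so the limit is read off from a finite partial sum.\<close>
  define N where "N i j = Psd (\<lambda>u v. coef (S (nat (- (u + v))) i j) u v)" for i j
  have SO: "S n i j \<in> psd_O" for n i j
    unfolding S_def by (intro psd_O_closed PO)
  have "bounded_by 0 0 (\<lambda>u v. coef (S (nat (- (u + v))) i j) u v)" for i j
    using SO unfolding psd_O_def bounded_by_def by blast
  note cN = coef_Psd[OF this, folded N_def]
  have NO: "N i j \<in> psd_O" for i j
    unfolding psd_O_def mem_Collect_eq cN by fact
  have stable: "coef (S m i j) u v = coef (S n i j) u v" if "n \<le> m" "- (u + v) \<le> int n" for m n i j u v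
    using that
  proof (induction m rule: dec_induct)
    case (step m)
    then have "coef (mat_pow K Y (Suc m) i j) u v = 0"
      using Pd[of "Suc m" i j] unfolding tdeg_le_def by force
    with step show ?case unfolding S_def by (simp del: mat_pow.simps)
  qed simp
  have NS: "tdeg_le (- int (Suc n)) (N i j - S n i j)" for n i j
    unfolding tdeg_le_def
  proof (intro allI impI)
    fix u v assume nz: "coef (N i j - S n i j) u v \<noteq> 0"
    show "u + v \<le> - int (Suc n)"
    proof (rule ccontr)
      assume "\<not> u + v \<le> - int (Suc n)"
      then have "coef (S n i j) u v = coef (S (nat (- (u + v))) i j) u v"
        by (intro stable) auto
      with nz show False by (simp add: cN)
    qed
  qed
  have S1: "S n i j - (\<Sum>h\<in>K. Y i h * S n h j) = (if i = j then 1 else 0) - mat_pow K Y (Suc n) i j" for n i j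
  proof -
    have "(\<Sum>h\<in>K. Y i h * S n h j) = (\<Sum>k\<le>n. mat_pow K Y (Suc k) i j)"
      unfolding S_def sum_distrib_left by (subst sum.swap) simp
    moreover have "(\<Sum>k\<le>Suc n. mat_pow K Y k i j) = mat_pow K Y 0 i j + (\<Sum>k\<le>n. mat_pow K Y (Suc k) i j)"
      by (rule sum.atMost_Suc_shift)
    ultimately show ?thesis unfolding S_def by (simp add: algebra_simps del: mat_pow.simps(2))
  qed
  have S2: "S n i j - (\<Sum>h\<in>K. S n i h * Y h j) = (if i = j then 1 else 0) - mat_pow K Y (Suc n) i j"
    if ij: "i \<in> K" "j \<in> K" for n i j
  proof -
    have "(\<Sum>h\<in>K. S n i h * Y h j) = (\<Sum>k\<le>n. mat_pow K Y (Suc k) i j)"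
      unfolding S_def sum_distrib_right mat_pow_Suc_right[OF K ij] by (rule sum.swap)
    moreover have "(\<Sum>k\<le>Suc n. mat_pow K Y k i j) = mat_pow K Y 0 i j + (\<Sum>k\<le>n. mat_pow K Y (Suc k) i j)"
      by (rule sum.atMost_Suc_shift)
    ultimately show ?thesis unfolding S_def by (simp add: algebra_simps del: mat_pow.simps(2))
  qed
  \<comment> \<open>A series of arbitrarily low total degree vanishes; hence the two identities for
    N need only be checked up to a remainder of total degree at most - (n + 1), where N may be
    replaced by a partial sum.\<close>
  have zero: "f = 0" if "\<And>n. tdeg_le (- int (Suc n)) f" for f :: "'a psd"
  proof (rule psd_eqI)
    fix u v show "coef f u v = coef 0 u v"
    proof (rule ccontr)
      assume "coef f u v \<noteq> coef 0 u v"
      then have "u + v \<le> - int (Suc n)" for n using that[of n] unfolding tdeg_le_def by auto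
      from this[of "nat (- (u + v))"] show False by linarith
    qed
  qed
  have Yn: "tdeg_le (- int (Suc n)) (Y i h * f)" "tdeg_le (- int (Suc n)) (f * Y i h)"
    if "tdeg_le (- int (Suc n)) f" for f i h n
    using tdeg_le_mult[OF tdeg_le_O[OF O] that] tdeg_le_mult[OF that tdeg_le_O[OF O]] by auto
  show ?thesis
  proof (rule that[of N])
    fix i j assume ij: "i \<in> K" "j \<in> K"
    have "tdeg_le (- int (Suc n)) (N i j - (\<Sum>h\<in>K. Y i h * N h j) - (if i = j then 1 else 0))" for n
    proof -
      have "N i j - (\<Sum>h\<in>K. Y i h * N h j) - (if i = j then 1 else 0)
          = (N i j - S n i j) - (\<Sum>h\<in>K. Y i h * (N h j - S n h j)) - mat_pow K Y (Suc n) i j"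
        using S1[of n i j] by (simp add: right_diff_distrib sum_subtractf algebra_simps del: mat_pow.simps)
      then show ?thesis by (simp only:) (intro tdeg_le_diff tdeg_le_sum Yn NS Pd)
    qed
    from zero[OF this] show "N i j - (\<Sum>h\<in>K. Y i h * N h j) = (if i = j then 1 else 0)" by simp
    have "tdeg_le (- int (Suc n)) (N i j - (\<Sum>h\<in>K. N i h * Y h j) - (if i = j then 1 else 0))" for n
    proof -
      have "N i j - (\<Sum>h\<in>K. N i h * Y h j) - (if i = j then 1 else 0)
          = (N i j - S n i j) - (\<Sum>h\<in>K. (N i h - S n i h) * Y h j) - mat_pow K Y (Suc n) i j"
        using S2[OF ij, of n] by (simp add: left_diff_distrib sum_subtractf algebra_simps del: mat_pow.simps)
      then show ?thesis by (simp only:) (intro tdeg_le_diff tdeg_le_sum Yn NS Pd)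
    qed
    from zero[OF this] show "N i j - (\<Sum>h\<in>K. N i h * Y h j) = (if i = j then 1 else 0)" by simp
  qed (rule NO)
qed

section \<open>Invertible elements and fractions\<close>

definition unit :: "'a::ring_1 \<Rightarrow> bool" where
  "unit x \<longleftrightarrow> (\<exists>y. x * y = 1 \<and> y * x = 1)"

definition uinv :: "'a::ring_1 \<Rightarrow> 'a" where
  "uinv x = (SOME y. x * y = 1 \<and> y * x = 1)"

lemma uinv: assumes "unit x" shows uinv_right: "x * uinv x = 1" and uinv_left: "uinv x * x = 1"
  using someI_ex[OF assms[unfolded unit_def]] unfolding uinv_def by auto

lemma uinv_cancel: assumes "unit x"
  shows uinv_left_cancel: "uinv x * (x * y) = y" and uinv_right_cancel: "x * (uinv x * y) = y"
    and uinv_cancel_right1: "(y * x) * uinv x = y" and uinv_cancel_right2: "(y * uinv x) * x = y"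
  using uinv[OF assms] by (simp_all add: mult.assoc) (simp_all flip: mult.assoc)

lemma unitI: "x * y = 1 \<Longrightarrow> y * x = 1 \<Longrightarrow> unit x"
  unfolding unit_def by blast

lemma uinv_eqI: assumes "x * y = 1" "y * x = 1" shows "uinv x = y"
  using uinv_left_cancel[OF unitI[OF assms], of y] assms by simp

lemma uinv_eqI_right: "unit x \<Longrightarrow> x * y = 1 \<Longrightarrow> uinv x = y"
  using uinv_left_cancel[of x y] by simp

lemma unit_mult: "unit x \<Longrightarrow> unit y \<Longrightarrow> unit (x * y)"
  by (rule unitI[of _ "uinv y * uinv x"]) (simp_all add: mult.assoc uinv_left_cancel uinv_right_cancel uinv)

lemma unit_uinv: "unit x \<Longrightarrow> unit (uinv x)"
  by (rule unitI[of _ x]) (auto simp: uinv)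

lemma uinv_uinv: "unit x \<Longrightarrow> uinv (uinv x) = x"
  by (rule uinv_eqI) (auto simp: uinv)

lemma uinv_commute: assumes "unit x" "x * y = y * x" shows "uinv x * y = y * uinv x"
  by (metis assms mult.assoc uinv_cancel_right1 uinv_left_cancel)

text \<open>Factor t out: the matrix is t (1 - t' o'), and t' o' has total degree at most - 1, so
  that the Neumann series applies. This serves t = z and t = d alike.\<close>

lemma matrix_invertible:
  fixes M :: "'i \<Rightarrow> 'i \<Rightarrow> 'a::calg psd"
  assumes K: "finite K" and t: "t * t' = 1" "t' * t = 1" "t' \<in> psd_O" "tdeg_le (- 1) t'"
    and O: "\<And>i j. o' i j \<in> psd_O"
  obtains N where "\<And>i j. N i j \<in> psd_O"
    "\<And>i j. tdeg_le (- 1) (N i j)"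
    "\<And>i j. i \<in> K \<Longrightarrow> j \<in> K \<Longrightarrow> (\<Sum>h\<in>K. ((if i = h then t else 0) - o' i h) * N h j) = (if i = j then 1 else 0)"
    "\<And>i j. i \<in> K \<Longrightarrow> j \<in> K \<Longrightarrow> (\<Sum>h\<in>K. N i h * ((if h = j then t else 0) - o' h j)) = (if i = j then 1 else 0)"
proof -
  have td: "tdeg_le (- 1) (t' * o' i j)" for i j
    using tdeg_le_mult[OF t(4) tdeg_le_O[OF O]] by simp
  obtain N where N: "\<And>i j. N i j \<in> psd_O"
    "\<And>i j. i \<in> K \<Longrightarrow> j \<in> K \<Longrightarrow> N i j - (\<Sum>h\<in>K. t' * o' i h * N h j) = (if i = j then 1 else 0)"
    "\<And>i j. i \<in> K \<Longrightarrow> j \<in> K \<Longrightarrow> N i j - (\<Sum>h\<in>K. N i h * (t' * o' h j)) = (if i = j then 1 else 0)"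
    by (rule neumann_series[OF K, of "\<lambda>i j. t' * o' i j", OF psd_O_mult[OF t(3) O] td]) blast
  have tt: "t * (t' * x) = x" "x * t' * t = x" for x
    using t by (simp_all add: mult.assoc) (simp_all flip: mult.assoc)
  show ?thesis
  proof (rule that[of "\<lambda>i j. N i j * t'"])
    show "N i j * t' \<in> psd_O" for i j by (intro psd_O_mult N t)
    show "tdeg_le (- 1) (N i j * t')" for i j using tdeg_le_mult[OF tdeg_le_O[OF N(1)] t(4)] by simp
    fix i j assume ij: "i \<in> K" "j \<in> K"
    have "(\<Sum>h\<in>K. ((if i = h then t else 0) - o' i h) * (N h j * t'))
        = t * (N i j - (\<Sum>h\<in>K. t' * o' i h * N h j)) * t'"
    proof -
      have "(\<Sum>h\<in>K. (if i = h then t else 0) * (N h j * t')) = t * N i j * t'"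
        using ij K by (simp add: if_distrib[of "\<lambda>x. x * _"] sum.delta' mult.assoc cong: if_cong)
      then show ?thesis
        by (simp add: left_diff_distrib right_diff_distrib sum_subtractf sum_distrib_left sum_distrib_right mult.assoc tt(1))
    qed
    also have "\<dots> = (if i = j then 1 else 0)" by (simp add: N(2)[OF ij] t)
    finally show "(\<Sum>h\<in>K. ((if i = h then t else 0) - o' i h) * (N h j * t')) = (if i = j then 1 else 0)" .
    have "(\<Sum>h\<in>K. (N i h * t') * ((if h = j then t else 0) - o' h j)) = N i j - (\<Sum>h\<in>K. N i h * (t' * o' h j))"
    proof -
      have "(\<Sum>h\<in>K. N i h * t' * (if h = j then t else 0)) = N i j"
        using ij K by (simp add: if_distrib[of "times _"] sum.delta tt cong: if_cong)
      then show ?thesis by (simp add: right_diff_distrib sum_subtractf mult.assoc)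
    qed
    then show "(\<Sum>h\<in>K. (N i h * t') * ((if h = j then t else 0) - o' h j)) = (if i = j then 1 else 0)"
      by (simp add: N(3)[OF ij])
  qed
qed

abbreviation "psd_z_inv \<equiv> psd_monom (- 1) 0 1"
abbreviation "psd_d_inv \<equiv> psd_monom 0 (- 1) 1"

lemma psd_z_inv: "psd_z * psd_z_inv = 1" "psd_z_inv * psd_z = 1"
  by (auto intro!: psd_eqI simp: coef_monom_z_mult coef_monom coef_1)

lemma psd_d_inv: "psd_d * psd_d_inv = 1" "psd_d_inv * psd_d = 1"
  by (auto intro!: psd_eqI simp: coef_mult_monom_d coef_monom coef_1)

text \<open>The 1 x 1 case, with the one-element type as index set.\<close>

lemma unit_diff_O:
  assumes t: "t * t' = 1" "t' * t = 1" "t' \<in> psd_O" "tdeg_le (- 1) t'" and "x \<in> psd_O"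
  shows "unit (t - x)" "uinv (t - x) \<in> psd_O"
proof -
  obtain N where N: "\<And>i j :: unit. N i j \<in> psd_O"
    "\<And>i j. i \<in> UNIV \<Longrightarrow> j \<in> UNIV \<Longrightarrow> (\<Sum>h\<in>UNIV. ((if i = h then t else 0) - x) * N h j) = (if i = j then 1 else 0)"
    "\<And>i j. i \<in> UNIV \<Longrightarrow> j \<in> UNIV \<Longrightarrow> (\<Sum>h\<in>UNIV. N i h * ((if h = j then t else 0) - x)) = (if i = j then 1 else 0)"
    by (rule matrix_invertible[OF _ t, of "UNIV :: unit set" "\<lambda>_ _. x"]) (use assms in auto)
  have 1: "(t - x) * N () () = 1" "N () () * (t - x) = 1"
    using N(2,3)[of "()" "()"] by (simp_all add: UNIV_unit)
  then show "unit (t - x)" "uinv (t - x) \<in> psd_O"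
    using N(1) uinv_eqI[OF 1] by (auto intro: unitI)
qed

lemma unit_z_diff_O: "x \<in> psd_O \<Longrightarrow> unit (psd_z - x)" "x \<in> psd_O \<Longrightarrow> uinv (psd_z - x) \<in> psd_O"
  by (rule unit_diff_O[OF psd_z_inv], auto simp: psd_O_monom tdeg_le_monom)+

lemma unit_d_diff_O: "x \<in> psd_O \<Longrightarrow> unit (psd_d - x)" "x \<in> psd_O \<Longrightarrow> uinv (psd_d - x) \<in> psd_O"
  by (rule unit_diff_O[OF psd_d_inv], auto simp: psd_O_monom tdeg_le_monom)+

definition psd_frac :: "'a::calg \<Rightarrow> complex \<Rightarrow> nat \<Rightarrow> 'a psd" where
  "psd_frac x c k = Psd (\<lambda>i j. if j = 0 \<and> i \<le> - int k - 1
     then (let r = nat (- int k - 1 - i) in scal (of_nat ((k + r) choose k) * c ^ r) * x) else 0)"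

lemma coef_frac: "coef (psd_frac x c k) i j = (if j = 0 \<and> i \<le> - int k - 1
     then (let r = nat (- int k - 1 - i) in scal (of_nat ((k + r) choose k) * c ^ r) * x) else 0)"
  unfolding psd_frac_def by (subst coef_Psd[of 0 0]) (auto simp: bounded_by_def)

lemma frac_0: "(psd_z - scal c) * psd_frac 1 c 0 = 1"
proof (rule psd_eqI)
  fix i j
  show "coef ((psd_z - scal c) * psd_frac 1 c 0) i j = coef 1 i j"
  proof (cases "j = 0 \<and> i < 0")
    case True
    then have "nat (- i) = Suc (nat (- 1 - i))" by linarith
    with True show ?thesis
      by (simp add: left_diff_distrib coef_monom_z_mult coef_frac coef_1 flip: scal_mult scal_diff)
  qed (auto simp: left_diff_distrib coef_monom_z_mult coef_frac coef_1)
qed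

text \<open>Pascal's rule for the expansion coefficients.\<close>

lemma frac_Suc: "(psd_z - scal c) * psd_frac 1 c (Suc k) = psd_frac 1 c k"
proof (rule psd_eqI)
  fix i j
  show "coef ((psd_z - scal c) * psd_frac 1 c (Suc k)) i j = coef (psd_frac 1 c k) i j"
  proof (cases "j = 0 \<and> i < - int k - 1")
    case True
    define r where "r = nat (- int k - 1 - i) - 1"
    have r: "nat (- int k - 1 - i) = Suc r" "nat (- int (Suc k) - 1 - i) = r" "nat (- int (Suc k) - i) = Suc r"
      using True unfolding r_def by linarith+
    have "i - 1 \<le> - int (Suc k) - 1" "i \<le> - int (Suc k) - 1" "i \<le> - int k - 1" using True by auto
    moreover have "of_nat (Suc k + Suc r choose Suc k) * c ^ Suc r - c * (of_nat (Suc k + r choose Suc k) * c ^ r)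
        = of_nat (k + Suc r choose k) * c ^ Suc r"
      by (simp add: algebra_simps)
    ultimately show ?thesis using True
      by (simp add: left_diff_distrib coef_monom_z_mult coef_frac r Let_def flip: scal_mult scal_diff del: of_nat_Suc power_Suc binomial_Suc_Suc)
  qed (auto simp: left_diff_distrib coef_monom_z_mult coef_frac binomial_eq_0)
qed

lemma frac_const: "psd_frac x c k = psd_frac 1 c k * psd_const x"
  by (rule psd_eqI) (simp add: coef_mult_monom_d coef_frac Let_def)

lemma unit_z_scal: "unit (psd_z - scal c)" "unit (psd_d - scal c)"
  using unit_z_diff_O[OF psd_O_scal] unit_d_diff_O[OF psd_O_scal] by auto

lemma frac_eq_power: "psd_frac (1 :: 'a::calg) c k = uinv (psd_z - scal c) ^ Suc k"
proof (induction k)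
  case 0
  show ?case by (simp add: uinv_eqI_right[OF unit_z_scal(1) frac_0])
next
  case (Suc k)
  have "psd_frac (1 :: 'a) c (Suc k) = uinv (psd_z - scal c) * psd_frac 1 c k"
    using uinv_left_cancel[OF unit_z_scal(1), of c "psd_frac 1 c (Suc k)"] unfolding frac_Suc by (rule sym)
  then show ?case by (simp only: Suc power_Suc)
qed

section \<open>Antisymmetrised compositions of operators\<close>

lemma calg_neg_self: "x = - x \<Longrightarrow> x = (0 :: 'a::calg)"
proof -
  assume "x = - x"
  then have "scal 1 * x + scal 1 * x = 0" by (simp add: add_eq_0_iff)
  then have "scal (1 + 1) * x = 0" unfolding scal_add distrib_right .
  then have "scal 2 * x = 0" by simp
  then have "scal (1/2) * (scal 2 * x) = 0" by simp
  then show "x = 0" by (simp add: scal_scal)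
qed

text \<open>
  Antisymmetrised composition of operators: \<open>C b a\<close> is the operator in row \<open>a\<close> of column \<open>b\<close>, and
  the columns are composed in the order of the list.
\<close>

definition asum :: "'i list \<Rightarrow> ('i \<Rightarrow> 'i \<Rightarrow> 'a::ring_1 \<Rightarrow> 'a) \<Rightarrow> 'a \<Rightarrow> 'a" where
  "asum js C v = (\<Sum>\<sigma> | \<sigma> permutes set js. of_int (sign \<sigma>) * foldr (\<lambda>b. C b (\<sigma> b)) js v)"

text \<open>Composition with the transposition of b and c pairs permutations of opposite sign, so
  the sum equals its own negative.\<close>

lemma sum_sign_zero:
  fixes F :: "('i \<Rightarrow> 'i) \<Rightarrow> 'a::calg"
  assumes "finite S" "b \<in> S" "c \<in> S" "b \<noteq> c"
    and F: "\<And>\<sigma>. \<sigma> permutes S \<Longrightarrow> F (\<sigma> \<circ> transpose b c) = F \<sigma>"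
  shows "(\<Sum>\<sigma> | \<sigma> permutes S. of_int (sign \<sigma>) * F \<sigma>) = 0"
proof (rule calg_neg_self)
  let ?t = "transpose b c"
  have t: "?t permutes S" using assms by (intro permutes_swap_id) auto
  have "(\<Sum>\<sigma> | \<sigma> permutes S. of_int (sign \<sigma>) * F \<sigma>) = (\<Sum>\<sigma> | \<sigma> permutes S. of_int (sign (\<sigma> \<circ> ?t)) * F (\<sigma> \<circ> ?t))"
    by (rule sum.reindex_bij_witness[where i = "\<lambda>\<sigma>. \<sigma> \<circ> ?t" and j = "\<lambda>\<sigma>. \<sigma> \<circ> ?t"])
       (auto simp: comp_assoc permutes_compose[OF t])
  also have "\<dots> = (\<Sum>\<sigma> | \<sigma> permutes S. - (of_int (sign \<sigma>) * F \<sigma>))"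
  proof (rule sum.cong[OF refl])
    fix \<sigma> assume "\<sigma> \<in> {\<sigma>. \<sigma> permutes S}"
    then have s: "\<sigma> permutes S" by simp
    have "sign (\<sigma> \<circ> ?t) = - sign \<sigma>"
      using sign_compose[of \<sigma> ?t] s t assms permutation_permutes sign_swap_id[of b c] by auto
    then show "of_int (sign (\<sigma> \<circ> ?t)) * F (\<sigma> \<circ> ?t) = - (of_int (sign \<sigma>) * F \<sigma>)"
      by (simp add: F[OF s])
  qed
  finally show "(\<Sum>\<sigma> | \<sigma> permutes S. of_int (sign \<sigma>) * F \<sigma>) = - (\<Sum>\<sigma> | \<sigma> permutes S. of_int (sign \<sigma>) * F \<sigma>)"
    by (simp add: sum_negf)
qed

definition additive :: "('a::ab_group_add \<Rightarrow> 'a) \<Rightarrow> bool" where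
  "additive f \<longleftrightarrow> (\<forall>x y. f (x + y) = f x + f y)"

lemma additiveD: "additive f \<Longrightarrow> f (x + y) = f x + f y"
  by (simp add: additive_def)

lemma additive_0: "additive f \<Longrightarrow> f 0 = 0"
  using additiveD[of f 0 0] by simp

lemma additive_uminus: "additive f \<Longrightarrow> f (- x) = - f x"
  using additiveD[of f x "- x"] additive_0[of f] by (simp add: eq_neg_iff_add_eq_0 add.commute)

lemma additive_diff: "additive f \<Longrightarrow> f (x - y) = f x - f y"
  using additiveD[of f x "- y"] additive_uminus[of f y] by simp

lemma additive_sum: "additive f \<Longrightarrow> f (sum g A) = (\<Sum>x\<in>A. f (g x))"
  by (induction A rule: infinite_finite_induct) (auto simp: additiveD additive_0)

lemma additive_foldr: "(\<And>b. b \<in> set js \<Longrightarrow> additive (f b)) \<Longrightarrow> additive (foldr f js)"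
  by (induction js) (auto simp: additive_def)

lemma foldr_same: "(\<And>b. b \<in> set js \<Longrightarrow> f b = g b) \<Longrightarrow> foldr f js = foldr g js"
  by (induction js) auto

lemma foldr_transpose:
  "b \<notin> set js \<Longrightarrow> c \<notin> set js \<Longrightarrow> foldr (\<lambda>x. C x ((\<sigma> \<circ> transpose b c) x)) js = foldr (\<lambda>x. C x (\<sigma> x)) js"
  by (rule foldr_same) (auto simp: transpose_def)

text \<open>The sign of \<sigma> does not see the order of composition, so exchanging two neighbours
  changes the sum only by commutators of column b with column c. These are symmetric in the two
  rows, and the alternating sum of a symmetric expression vanishes. The hypothesis is the Manin
  condition in operator form.\<close>

lemma asum_swap:
  fixes C :: "'i \<Rightarrow> 'i \<Rightarrow> 'a::calg \<Rightarrow> 'a"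
  assumes "distinct (us @ b # c # vs)" and add: "\<And>b a. additive (C b a)"
    and comm: "\<And>a a' x. C b a (C c a' x) - C c a' (C b a x) = C b a' (C c a x) - C c a (C b a' x)"
  shows "asum (us @ b # c # vs) C v = asum (us @ c # b # vs) C v"
proof -
  let ?S = "set (us @ b # c # vs)"
  let ?A = "\<lambda>\<sigma>. foldr (\<lambda>b. C b (\<sigma> b)) us" and ?B = "\<lambda>\<sigma>. foldr (\<lambda>b. C b (\<sigma> b)) vs v"
  have S: "set (us @ c # b # vs) = ?S" by auto
  have "asum (us @ b # c # vs) C v - asum (us @ c # b # vs) C v
      = (\<Sum>\<sigma> | \<sigma> permutes ?S. of_int (sign \<sigma>) * ?A \<sigma> (C b (\<sigma> b) (C c (\<sigma> c) (?B \<sigma>)) - C c (\<sigma> c) (C b (\<sigma> b) (?B \<sigma>))))"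
    unfolding asum_def S
    by (simp add: additive_diff[OF additive_foldr[OF add]] right_diff_distrib sum_subtractf)
  also have "\<dots> = 0"
  proof (rule sum_sign_zero[where b = b and c = c])
    fix \<sigma> assume "\<sigma> permutes ?S"
    have "?A (\<sigma> \<circ> transpose b c) = ?A \<sigma>" "?B (\<sigma> \<circ> transpose b c) = ?B \<sigma>"
      using foldr_transpose[of b us c C \<sigma>] foldr_transpose[of b vs c C \<sigma>] assms(1) by auto
    then show "?A (\<sigma> \<circ> transpose b c) (C b ((\<sigma> \<circ> transpose b c) b) (C c ((\<sigma> \<circ> transpose b c) c) (?B (\<sigma> \<circ> transpose b c)))
        - C c ((\<sigma> \<circ> transpose b c) c) (C b ((\<sigma> \<circ> transpose b c) b) (?B (\<sigma> \<circ> transpose b c))))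
      = ?A \<sigma> (C b (\<sigma> b) (C c (\<sigma> c) (?B \<sigma>)) - C c (\<sigma> c) (C b (\<sigma> b) (?B \<sigma>)))"
      using comm by simp
  qed (use assms(1) in auto)
  finally show ?thesis by simp
qed

lemma asum_move:
  fixes C :: "'i \<Rightarrow> 'i \<Rightarrow> 'a::calg \<Rightarrow> 'a"
  assumes "distinct (us @ b # cs @ vs)" and add: "\<And>b a. additive (C b a)"
    and comm: "\<And>c a a' x. c \<in> set cs \<Longrightarrow>
      C b a (C c a' x) - C c a' (C b a x) = C b a' (C c a x) - C c a (C b a' x)"
  shows "asum (us @ b # cs @ vs) C v = asum (us @ cs @ b # vs) C v"
  using assms(1,3)
proof (induction cs arbitrary: us)
  case (Cons c cs)
  have "asum (us @ b # (c # cs) @ vs) C v = asum ((us @ [c]) @ b # cs @ vs) C v"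
    using asum_swap[of us b c "cs @ vs" C v] Cons.prems add by auto
  also have "\<dots> = asum ((us @ [c]) @ cs @ b # vs) C v"
    by (rule Cons.IH) (use Cons.prems in auto)
  finally show ?case by simp
qed simp

text \<open>The analogue of a determinant with two proportional columns: the composition of the
  neighbours is symmetric in the two rows.\<close>

lemma asum_adjacent_zero:
  fixes C :: "'i \<Rightarrow> 'i \<Rightarrow> 'a::calg \<Rightarrow> 'a"
  assumes "distinct (us @ b # c # vs)"
    and comm: "\<And>a a' x. C b a (C c a' x) = C b a' (C c a x)"
  shows "asum (us @ b # c # vs) C v = 0"
  unfolding asum_def
proof (rule sum_sign_zero[where b = b and c = c])
  let ?A = "\<lambda>\<sigma>. foldr (\<lambda>b. C b (\<sigma> b)) us" and ?B = "\<lambda>\<sigma>. foldr (\<lambda>b. C b (\<sigma> b)) vs v"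
  fix \<sigma> assume "\<sigma> permutes set (us @ b # c # vs)"
  have "?A (\<sigma> \<circ> transpose b c) = ?A \<sigma>" "?B (\<sigma> \<circ> transpose b c) = ?B \<sigma>"
    using foldr_transpose[of b us c C \<sigma>] foldr_transpose[of b vs c C \<sigma>] assms(1) by auto
  then show "foldr (\<lambda>ba. C ba ((\<sigma> \<circ> transpose b c) ba)) (us @ b # c # vs) v = foldr (\<lambda>b. C b (\<sigma> b)) (us @ b # c # vs) v"
    using comm by simp
qed (use assms(1) in auto)

text \<open>The last column of the list acts first, directly on v.\<close>

lemma asum_last_zero:
  fixes C :: "'i \<Rightarrow> 'i \<Rightarrow> 'a::calg \<Rightarrow> 'a"
  assumes add: "\<And>b a. additive (C b a)" and "\<And>a. C b a v = 0"
  shows "asum (us @ [b]) C v = 0"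
  unfolding asum_def
  by (simp add: assms(2) additive_0[OF additive_foldr[OF add]])

lemma asum_column_diff:
  fixes C :: "'i \<Rightarrow> 'i \<Rightarrow> 'a::calg \<Rightarrow> 'a"
  assumes "distinct (us @ b # vs)" and add: "\<And>b a. additive (C b a)"
  shows "asum (us @ b # vs) (C(b := \<lambda>a x. f a x - g a x)) v
     = asum (us @ b # vs) (C(b := f)) v - asum (us @ b # vs) (C(b := g)) v"
proof -
  have "foldr (\<lambda>ba. (C(b := h)) ba (\<sigma> ba)) (us @ b # vs) v
     = foldr (\<lambda>c. C c (\<sigma> c)) us (h (\<sigma> b) (foldr (\<lambda>c. C c (\<sigma> c)) vs v))" for h \<sigma>
  proof -
    have "foldr (\<lambda>ba. (C(b := h)) ba (\<sigma> ba)) ks = foldr (\<lambda>c. C c (\<sigma> c)) ks" if "b \<notin> set ks" for ks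
      using that by (intro foldr_same) auto
    from this[of us] this[of vs] show ?thesis using assms(1) by simp
  qed
  note * = this
  show ?thesis
    unfolding asum_def * by (simp add: additive_diff[OF additive_foldr[OF add]] right_diff_distrib sum_subtractf)
qed

lemma asum_cong: "(\<And>b a x. b \<in> set js \<Longrightarrow> C b a x = C' b a x) \<Longrightarrow> asum js C v = asum js C' v"
  unfolding asum_def by (intro sum.cong refl arg_cong2[where f = times] foldr_cong) auto

text \<open>
  Columns of \<open>L\<close> may be replaced by those of \<open>m\<close>, one after the other: the difference column can be
  moved to the far right, where it annihilates \<open>v\<close>.
\<close>

lemma asum_normal_order:
  fixes L m :: "'i \<Rightarrow> 'i \<Rightarrow> 'a::calg \<Rightarrow> 'a"
  assumes "distinct js" and L: "\<And>b a. additive (L b a)" and m: "\<And>b a. additive (m b a)"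
    and comm: "\<And>b c a a' x. b \<noteq> c \<Longrightarrow> b \<in> set js \<Longrightarrow> c \<in> set js \<Longrightarrow>
       (L b a (m c a' x) - m b a (m c a' x)) - m c a' (L b a x - m b a x)
       = (L b a' (m c a x) - m b a' (m c a x)) - m c a (L b a' x - m b a' x)"
    and kill: "\<And>b a. b \<in> set js \<Longrightarrow> L b a v = m b a v"
  shows "asum js L v = asum js m v"
proof -
  \<comment> \<open>The columns of the prefix \<open>us\<close> belong to L, the others to m.
    Growing the prefix one column at a time ensures that a difference column on its way to the right
    passes only columns of m, for which \<open>comm\<close> is stated.\<close>
  have "asum (us @ vs) (\<lambda>b. if b \<in> set us then L b else m b) v = asum (us @ vs) m v" if "js = us @ vs" for us vs
    using that
  proof (induction us arbitrary: vs rule: rev_induct)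
    case (snoc b us)
    let ?C = "\<lambda>b. if b \<in> set us then L b else m b"
    have d: "distinct (us @ b # vs)" using snoc assms(1) by simp
    have add: "additive (?C b a)" for b a using L m by simp
    let ?D = "?C(b := \<lambda>a x. L b a x - m b a x)"
    have addD: "additive (?D b a)" for b a
      using L m by (auto simp: additive_def algebra_simps)
    have "asum (us @ b # vs) ?D v = asum (us @ vs @ [b]) ?D v"
    proof -
      have "?D b a (?D c a' x) - ?D c a' (?D b a x) = ?D b a' (?D c a x) - ?D c a (?D b a' x)"
        if "c \<in> set vs" for c a a' x
      proof -
        have "c \<noteq> b" "c \<notin> set us" using that d by auto
        then have "?D c = m c" "?D b = (\<lambda>a x. L b a x - m b a x)" by auto
        then show ?thesis using comm[of b c a a' x] \<open>c \<noteq> b\<close> that snoc.prems by simp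
      qed
      then show ?thesis using asum_move[of us b vs "[]" ?D v] d addD by simp
    qed
    also have "\<dots> = 0"
      using asum_last_zero[of ?D b v "us @ vs"] addD kill[of b] snoc.prems by simp
    finally have 0: "asum (us @ b # vs) (?C(b := L b)) v = asum (us @ b # vs) (?C(b := m b)) v"
      using asum_column_diff[OF d, of ?C "L b" "m b" v] add by simp
    have "asum ((us @ [b]) @ vs) (\<lambda>c. if c \<in> set (us @ [b]) then L c else m c) v = asum (us @ b # vs) (?C(b := L b)) v"
      by (simp, rule asum_cong) auto
    also have "\<dots> = asum (us @ b # vs) ?C v"
      unfolding 0 by (rule asum_cong) (use d in auto)
    also have "\<dots> = asum ((us @ [b]) @ vs) m v"
      using snoc.IH[of "b # vs"] snoc.prems by simp
    finally show ?case .
  qed simp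
  from this[of js "[]"] have "asum js (\<lambda>b. if b \<in> set js then L b else m b) v = asum js m v" by simp
  moreover have "asum js (\<lambda>b. if b \<in> set js then L b else m b) v = asum js L v"
    by (rule asum_cong) simp
  ultimately show ?thesis by simp
qed

text \<open>When all operators commute, the factors may be sorted by rows instead of columns. This
  replaces \<sigma> by its inverse, which has the same sign.\<close>

lemma asum_transpose:
  assumes "distinct js" "set ks = set js" "distinct ks"
    and comm: "\<And>b c a a' x. m b a (m c a' x) = m c a' (m b a x)"
  shows "asum js m v = asum ks (\<lambda>b a. m a b) v"
proof -
  have "foldr (\<lambda>b. m b (\<sigma> b)) js v = foldr (\<lambda>b. m (Hilbert_Choice.inv \<sigma> b) b) ks v" if s: "\<sigma> permutes set js" for \<sigma>
  proof -
    have "foldr (\<lambda>b. m b (\<sigma> b)) js v = foldr (\<lambda>b. m (Hilbert_Choice.inv \<sigma> b) b) (map \<sigma> js) v"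
      by (simp add: foldr_map comp_def permutes_inverses[OF s])
    also have "\<dots> = foldr (\<lambda>b. m (Hilbert_Choice.inv \<sigma> b) b) ks v"
    proof -
      have "mset (rev (map \<sigma> js)) = mset (rev ks)"
        using assms s by (intro set_eq_iff_mset_eq_distinct[THEN iffD1])
          (auto simp: distinct_map permutes_image permutes_inj_on)
      then have "fold (\<lambda>b. m (Hilbert_Choice.inv \<sigma> b) b) (rev (map \<sigma> js)) = fold (\<lambda>b. m (Hilbert_Choice.inv \<sigma> b) b) (rev ks)"
        by (intro fold_permuted_eq[THEN ext] fold_multiset_equiv) (auto simp: fun_eq_iff comm)
      then show ?thesis by (simp add: foldr_conv_fold)
    qed
    finally show ?thesis .
  qed
  then have "asum js m v = (\<Sum>\<sigma> | \<sigma> permutes set js. of_int (sign \<sigma>) * foldr (\<lambda>b. m (Hilbert_Choice.inv \<sigma> b) b) ks v)"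
    unfolding asum_def by simp
  also have "\<dots> = (\<Sum>\<sigma> | \<sigma> permutes set js. of_int (sign \<sigma>) * foldr (\<lambda>b. m (\<sigma> b) b) ks v)"
    by (rule sum.reindex_bij_witness[where i = Hilbert_Choice.inv and j = Hilbert_Choice.inv])
       (auto simp: permutes_inv permutes_inv_inv sign_inverse[OF permutes_imp_permutation[OF finite_set]])
  finally show ?thesis unfolding asum_def by (simp add: assms(2))
qed

lemma asum_intertwine:
  assumes "additive \<tau>" "\<And>b a x. b \<in> set js \<Longrightarrow> \<tau> (C b a x) = C' b a (\<tau> x)"
  shows "\<tau> (asum js C v) = asum js C' (\<tau> v)"
proof -
  have f: "\<tau> (foldr (\<lambda>b. C b (\<sigma> b)) ks v) = foldr (\<lambda>b. C' b (\<sigma> b)) ks (\<tau> v)" if "set ks \<subseteq> set js" for \<sigma> ks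
    using that by (induction ks) (auto simp: assms)
  have s: "\<tau> (of_int (sign \<sigma>) * x) = of_int (sign \<sigma>) * \<tau> x" for \<sigma> x
    by (auto simp: sign_def additive_uminus[OF assms(1)])
  show ?thesis unfolding asum_def additive_sum[OF assms(1)] by (simp add: s f)
qed

text \<open>The product runs over the columns in the order of the list, \<open>M a b\<close> being
  the entry in row a and column b; this is the ordering of \<open>cdet\<close>.\<close>

definition col_det :: "'i list \<Rightarrow> ('i \<Rightarrow> 'i \<Rightarrow> 'a::ring_1) \<Rightarrow> 'a" where
  "col_det js M = asum js (\<lambda>b a x. M a b * x) 1"

text \<open>The same products built up by right multiplications, which compose in the opposite
  order; hence \<open>rev\<close>. It gives access to operators that act from the right.\<close>

lemma col_det_right: "col_det js M = asum (rev js) (\<lambda>b a x. x * M a b) 1"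
proof -
  have "foldr (\<lambda>b x. f b * x) js y = foldr (\<lambda>b x. x * f b) (rev js) 1 * y" for f :: "'b \<Rightarrow> 'a" and y
  proof (induction js arbitrary: y)
    case (Cons b js)
    have "foldr (\<lambda>b x. x * f b) bs z = z * foldr (\<lambda>b x. x * f b) bs 1" for z bs
      by (induction bs) (auto simp: mult.assoc)
    from this[of "rev js" "f b"] Cons show ?case by (simp add: mult.assoc)
  qed simp
  from this[of _ 1] show ?thesis unfolding col_det_def asum_def by simp
qed

lemma col_det_Nil [simp]: "col_det [] M = 1"
  by (simp add: col_det_def asum_def)

lemma col_det_cong: "(\<And>a b. a \<in> set js \<Longrightarrow> b \<in> set js \<Longrightarrow> M a b = M' a b) \<Longrightarrow> col_det js M = col_det js M'"
  unfolding col_det_def asum_def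
  by (intro sum.cong refl arg_cong2[where f = times] foldr_cong) (auto dest: permutes_in_image)

lemma col_det_alt: "col_det js M = (\<Sum>\<sigma> | \<sigma> permutes set js. of_int (sign \<sigma>) * prod_list (map (\<lambda>b. M (\<sigma> b) b) js))"
proof -
  have "foldr (\<lambda>b x. f b * x) ks 1 = prod_list (map f ks)" for f :: "'b \<Rightarrow> 'a" and ks
    by (induction ks) auto
  then show ?thesis by (simp add: col_det_def asum_def)
qed

text \<open>f passes through each product one factor at a time. In the applications f is a product
  of scalar factors and M, M' differ by a diagonal term.\<close>

lemma col_det_conjugate:
  assumes "\<And>a b. a \<in> set js \<Longrightarrow> b \<in> set js \<Longrightarrow> M a b * f = f * M' a b"
  shows "col_det js M * f = f * col_det js M'"
proof -
  have "prod_list (map (\<lambda>b. M (\<sigma> b) b) ks) * f = f * prod_list (map (\<lambda>b. M' (\<sigma> b) b) ks)"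
    if "\<sigma> permutes set js" "set ks \<subseteq> set js" for \<sigma> ks
    using that(2)
  proof (induction ks)
    case (Cons k ks)
    then have "\<sigma> k \<in> set js" using that(1) by (simp add: permutes_in_image)
    with Cons assms[of "\<sigma> k" k] show ?case by (simp add: mult.assoc) (simp flip: mult.assoc)
  qed simp
  note P = this
  have "of_int (sign \<sigma>) * prod_list (map (\<lambda>b. M (\<sigma> b) b) js) * f
      = f * (of_int (sign \<sigma>) * prod_list (map (\<lambda>b. M' (\<sigma> b) b) js))" if "\<sigma> permutes set js" for \<sigma>
  proof -
    have "of_int (sign \<sigma>) * prod_list (map (\<lambda>b. M (\<sigma> b) b) js) * f
        = (of_int (sign \<sigma>) * f) * prod_list (map (\<lambda>b. M' (\<sigma> b) b) js)"
      by (simp add: P[OF that order_refl] mult.assoc)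
    then show ?thesis by (simp only: mult_of_int_commute[of _ f] mult.assoc)
  qed
  then show ?thesis unfolding col_det_alt sum_distrib_left sum_distrib_right by simp
qed

section \<open>Manin matrices and Schur complements\<close>

lemma calg_commute: "x * y - y * x = y * x - x * y \<Longrightarrow> x * y = y * (x :: 'a::calg)"
  using calg_neg_self[of "x * y - y * x"] by (simp add: algebra_simps)

text \<open>
  Both sides are antisymmetrised products of three columns: after multiplication by the pivot \<open>t\<close> the
  \<open>2 \<times> 2\<close> minors of the Schur complement become \<open>3 \<times> 3\<close> minors of the original matrix.
\<close>

lemma schur_minor:
  fixes t p :: "'a::ring_1"
  assumes p: "p * t = 1" "t * p = 1"
    and col: "t * a1 = a1 * t" "t * c1 = c1 * t" "a1 * c1 = c1 * a1"
    and r: "t * ab - ab * t = a1 * xb - xb * a1" "t * cb - cb * t = c1 * xb - xb * c1"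
      "ab * c1 - c1 * ab = cb * a1 - a1 * cb"
  shows "t * ((ab - a1 * p * xb) * (cd - c1 * p * xd) - (cb - c1 * p * xb) * (ad - a1 * p * xd))
    = (t * ab - a1 * xb) * cd - (t * cb - c1 * xb) * ad + (a1 * cb - c1 * ab) * xd"
proof -
  have 1: "t * (ab - a1 * p * xb) = t * ab - a1 * xb" "t * (cb - c1 * p * xb) = t * cb - c1 * xb"
    using p col by (simp_all add: right_diff_distrib mult.assoc[symmetric]) (simp_all add: mult.assoc)
  have 2: "(t * ab - a1 * xb) * c1 - (t * cb - c1 * xb) * a1 = - ((a1 * cb - c1 * ab) * t)"
  proof -
    have "(t * ab - a1 * xb) * c1 - (t * cb - c1 * xb) * a1
      = t * (ab * c1 - cb * a1) - a1 * (xb * c1) + c1 * (xb * a1)"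
      by (simp add: algebra_simps)
    also have "ab * c1 - cb * a1 = c1 * ab - a1 * cb"
      using r(3) by (simp add: algebra_simps)
    also have "t * (c1 * ab - a1 * cb) = c1 * (t * ab) - a1 * (t * cb)"
      using col by (simp add: right_diff_distrib mult.assoc[symmetric])
    also have "c1 * (t * ab) - a1 * (t * cb) - a1 * (xb * c1) + c1 * (xb * a1)
       = c1 * (t * ab - ab * t + xb * a1) - a1 * (t * cb - cb * t + xb * c1) - (a1 * cb - c1 * ab) * t"
      by (simp add: algebra_simps)
    also have "c1 * (t * ab - ab * t + xb * a1) - a1 * (t * cb - cb * t + xb * c1) = 0"
      using col(3) unfolding r(1,2) by (simp add: mult.assoc[symmetric])
    finally show ?thesis by simp
  qed
  have "t * ((ab - a1 * p * xb) * (cd - c1 * p * xd) - (cb - c1 * p * xb) * (ad - a1 * p * xd))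
    = (t * (ab - a1 * p * xb)) * (cd - c1 * p * xd) - (t * (cb - c1 * p * xb)) * (ad - a1 * p * xd)"
    by (simp only: right_diff_distrib[of t "_ * _" "_ * _"] mult.assoc[of t])
  also have "\<dots> = (t * ab - a1 * xb) * cd - (t * cb - c1 * xb) * ad
      - ((t * ab - a1 * xb) * c1 - (t * cb - c1 * xb) * a1) * (p * xd)"
    unfolding 1 by (simp add: algebra_simps)
  also have "((t * ab - a1 * xb) * c1 - (t * cb - c1 * xb) * a1) * (p * xd) = - ((a1 * cb - c1 * ab) * xd)"
    unfolding 2 using p by (simp add: mult.assoc) (simp add: mult.assoc[symmetric])
  finally show ?thesis by simp
qed

text \<open>The Manin relation says that a 2 x 2 minor is antisymmetric in its columns b and d. By
  \<open>schur_minor\<close>, t times the sum of the minors for (b, d) and (d, b) is a combination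
  of Manin relations between columns b and d of the original matrix, hence zero, and t can be
  cancelled.\<close>

lemma schur_manin_local:
  fixes t p :: "'a::ring_1"
  assumes p: "p * t = 1" "t * p = 1"
    and col: "t * a1 = a1 * t" "t * c1 = c1 * t" "a1 * c1 = c1 * a1"
    and rb: "t * ab - ab * t = a1 * xb - xb * a1" "t * cb - cb * t = c1 * xb - xb * c1"
      "ab * c1 - c1 * ab = cb * a1 - a1 * cb"
    and rd: "t * ad - ad * t = a1 * xd - xd * a1" "t * cd - cd * t = c1 * xd - xd * c1"
      "ad * c1 - c1 * ad = cd * a1 - a1 * cd"
    and bd: "xb * ad - ad * xb = ab * xd - xd * ab" "xb * cd - cd * xb = cb * xd - xd * cb"
      "ab * cd - cd * ab = cb * ad - ad * cb"
  shows "(ab - a1 * p * xb) * (cd - c1 * p * xd) - (cd - c1 * p * xd) * (ab - a1 * p * xb)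
       = (cb - c1 * p * xb) * (ad - a1 * p * xd) - (ad - a1 * p * xd) * (cb - c1 * p * xb)"
proof -
  let ?A = "(ab - a1 * p * xb) * (cd - c1 * p * xd) - (cb - c1 * p * xb) * (ad - a1 * p * xd)"
  let ?B = "(ad - a1 * p * xd) * (cb - c1 * p * xb) - (cd - c1 * p * xd) * (ab - a1 * p * xb)"
  have "t * ?A + t * ?B = t * (ab * cd - cd * ab - (cb * ad - ad * cb))
      + a1 * ((cb * xd - xd * cb) - (xb * cd - cd * xb)) - c1 * ((ab * xd - xd * ab) - (xb * ad - ad * xb))"
    unfolding schur_minor[OF p col rb] schur_minor[OF p col rd] by (simp add: algebra_simps)
  also have "\<dots> = 0" unfolding bd by simp
  finally have "p * (t * (?A + ?B)) = 0" by (simp add: distrib_left)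
  then have "?A + ?B = 0" using p by (simp add: mult.assoc[symmetric])
  then show ?thesis by (simp add: algebra_simps)
qed

text \<open>Moving \<open>X1\<close> past \<open>xb\<close> releases the pivot t, which cancels one
  of the two inverses; the remaining quadratic correction contains \<open>X1\<close> twice and
  vanishes. What is left is linear in the inverse of t, so that anticommutation can be
  verified.\<close>

lemma schur_odd_product:
  fixes t p :: "'a::ring_1"
  assumes p: "p * t = 1" "t * p = 1" and "t * X1 = X1 * t" and "X1 * X1 = 0"
    and "Xb * X1 = - (X1 * Xb)" and "xb * X1 - X1 * xb = Xb * t - t * Xb"
  shows "(Xb - X1 * p * xb) * (Y - X1 * p * y) = Xb * Y - X1 * p * (xb * Y - Xb * y)"
proof -
  have pX: "p * X1 = X1 * p" by (metis assms(1-3) mult.assoc mult_1 mult_1_right)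
  have e: "xb * X1 = X1 * xb + Xb * t - t * Xb" using assms(6) by (simp add: algebra_simps)
  have 1: "X1 * (p * (X1 * w)) = 0" for w
  proof -
    have "X1 * (p * (X1 * w)) = X1 * (p * X1) * w" by (simp add: mult.assoc)
    also have "\<dots> = X1 * X1 * (p * w)" unfolding pX by (simp add: mult.assoc)
    finally show ?thesis using assms(4) by simp
  qed
  have "X1 * p * (xb * X1) * (p * y) = X1 * p * (Xb * y) - X1 * Xb * (p * y)"
  proof -
    have "X1 * p * (xb * X1) * (p * y) = X1 * (p * (X1 * (xb * (p * y)))) + X1 * p * Xb * (t * p) * y - X1 * (p * t) * Xb * (p * y)"
      unfolding e by (simp add: algebra_simps)
    then show ?thesis unfolding 1 p by (simp add: mult.assoc)
  qed
  then have "X1 * (p * (xb * (X1 * (p * y)))) = X1 * (p * (Xb * y)) - X1 * (Xb * (p * y))"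
    by (simp add: mult.assoc)
  moreover have "Xb * (X1 * w) = - (X1 * (Xb * w))" for w
    using assms(5) by (simp add: mult.assoc[symmetric])
  ultimately show ?thesis by (simp add: algebra_simps)
qed

text \<open>The counterpart with the corner on the left: here moving \<open>X1\<close> past
  \<open>Q1\<close> releases the pivot.\<close>

lemma schur_odd_product':
  fixes t p :: "'a::ring_1"
  assumes p: "p * t = 1" "t * p = 1" and "t * X1 = X1 * t" and "X1 * X1 = 0" and "X1 * E = E * X1"
    and "t * E - E * t = X1 * Q1 + Q1 * X1"
  shows "(E - X1 * p * Q1) * (Xb - X1 * p * xb) = E * Xb - X1 * p * (Q1 * Xb + E * xb)"
proof -
  have pX: "p * X1 = X1 * p" by (metis assms(1-3) mult.assoc mult_1 mult_1_right)
  have e: "Q1 * X1 = t * E - E * t - X1 * Q1" using assms(6) by (simp add: algebra_simps)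
  have 1: "X1 * (p * (X1 * w)) = 0" for w
  proof -
    have "X1 * (p * (X1 * w)) = X1 * (p * X1) * w" by (simp add: mult.assoc)
    also have "\<dots> = X1 * X1 * (p * w)" unfolding pX by (simp add: mult.assoc)
    finally show ?thesis using assms(4) by simp
  qed
  have "X1 * p * (Q1 * X1) * (p * xb) = X1 * E * (p * xb) - X1 * p * (E * xb)"
  proof -
    have "X1 * p * (Q1 * X1) * (p * xb) = X1 * (p * t) * E * (p * xb) - X1 * p * E * (t * p) * xb - X1 * (p * (X1 * (Q1 * (p * xb))))"
      unfolding e by (simp add: algebra_simps)
    then show ?thesis unfolding 1 p by (simp add: mult.assoc)
  qed
  then have "X1 * (p * (Q1 * (X1 * (p * xb)))) = X1 * (E * (p * xb)) - X1 * (p * (E * xb))"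
    by (simp add: mult.assoc)
  moreover have "E * (X1 * w) = X1 * (E * w)" for w
    using assms(5) by (simp add: mult.assoc[symmetric])
  ultimately show ?thesis by (simp add: algebra_simps)
qed

text \<open>The four correction terms with two inverse pivots are rewritten in \<open>h1\<close> to
  \<open>h4\<close>: exchanging the two factors between the inverses releases t, which cancels one
  of them. The rest regroups into the relations assumed for the original entries.\<close>

lemma schur_odd_mixed:
  fixes t p :: "'a::ring_1"
  assumes p: "p * t = 1" "t * p = 1"
    and col: "t * X1 = X1 * t" "t * a1 = a1 * t" "a1 * X1 = X1 * a1"
    and r2: "Tab * X1 - X1 * Tab = Xb * a1 - a1 * Xb" "xb * X1 - X1 * xb = Xb * t - t * Xb"
    and r4: "Tab * Q1 - Q1 * Tab = xb * Qa - Qa * xb" "a1 * Q1 - Q1 * a1 = t * Qa - Qa * t"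
    and r5: "Tab * E - E * Tab = Xb * Qa + Qa * Xb" "xb * E - E * xb = Xb * Q1 + Q1 * Xb"
      "a1 * E - E * a1 = X1 * Qa + Qa * X1" "t * E - E * t = X1 * Q1 + Q1 * X1"
    and r1: "xb * a1 - a1 * xb = Tab * t - t * Tab"
  shows "(Tab - a1 * p * xb) * (E - X1 * p * Q1) - (E - X1 * p * Q1) * (Tab - a1 * p * xb)
       = (Xb - X1 * p * xb) * (Qa - a1 * p * Q1) + (Qa - a1 * p * Q1) * (Xb - X1 * p * xb)"
proof -
  have pX: "p * X1 = X1 * p" and pa: "p * a1 = a1 * p"
    by (metis p col mult.assoc mult_1 mult_1_right)+
  have e: "xb * X1 = X1 * xb + Xb * t - t * Xb" "xb * a1 = a1 * xb + Tab * t - t * Tab"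
    "Q1 * a1 = a1 * Q1 - (t * Qa - Qa * t)" "Q1 * X1 = t * E - E * t - X1 * Q1"
    using r2 r1 r4 r5 by (simp_all add: algebra_simps)
  have h1: "a1 * p * (xb * X1) * (p * Q1) = a1 * p * X1 * (xb * (p * Q1)) + a1 * p * (Xb * Q1) - a1 * Xb * (p * Q1)"
  proof -
    have "a1 * p * (xb * X1) * (p * Q1) = a1 * p * X1 * (xb * (p * Q1)) + a1 * p * Xb * (t * p) * Q1 - a1 * (p * t) * Xb * (p * Q1)"
      unfolding e by (simp add: algebra_simps)
    then show ?thesis unfolding p by (simp add: mult.assoc)
  qed
  have h2: "X1 * p * (xb * a1) * (p * Q1) = X1 * p * a1 * (xb * (p * Q1)) + X1 * p * (Tab * Q1) - X1 * Tab * (p * Q1)"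
  proof -
    have "X1 * p * (xb * a1) * (p * Q1) = X1 * p * a1 * (xb * (p * Q1)) + X1 * p * Tab * (t * p) * Q1 - X1 * (p * t) * Tab * (p * Q1)"
      unfolding e by (simp add: algebra_simps)
    then show ?thesis unfolding p by (simp add: mult.assoc)
  qed
  have h3: "X1 * p * (Q1 * a1) * (p * xb) = X1 * p * a1 * (Q1 * (p * xb)) - X1 * Qa * (p * xb) + X1 * p * (Qa * xb)"
  proof -
    have "X1 * p * (Q1 * a1) * (p * xb) = X1 * p * a1 * (Q1 * (p * xb)) - X1 * (p * t) * Qa * (p * xb) + X1 * p * Qa * (t * p) * xb"
      unfolding e by (simp add: algebra_simps)
    then show ?thesis unfolding p by (simp add: mult.assoc)
  qed
  have h4: "a1 * p * (Q1 * X1) * (p * xb) = - (a1 * p * X1 * (Q1 * (p * xb))) + a1 * E * (p * xb) - a1 * p * (E * xb)"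
  proof -
    have "a1 * p * (Q1 * X1) * (p * xb) = - (a1 * p * X1 * (Q1 * (p * xb))) + a1 * (p * t) * E * (p * xb) - a1 * p * E * (t * p) * xb"
      unfolding e by (simp add: algebra_simps)
    then show ?thesis unfolding p by (simp add: mult.assoc)
  qed
  have c: "X1 * p * a1 = a1 * p * X1"
    by (metis pX pa col(3) mult.assoc)
  have "(Tab - a1 * p * xb) * (E - X1 * p * Q1) - (E - X1 * p * Q1) * (Tab - a1 * p * xb)
       - ((Xb - X1 * p * xb) * (Qa - a1 * p * Q1) + (Qa - a1 * p * Q1) * (Xb - X1 * p * xb))
     = (Tab * E - E * Tab - (Xb * Qa + Qa * Xb))
       + a1 * p * (xb * X1) * (p * Q1) - X1 * p * (xb * a1) * (p * Q1)
       - X1 * p * (Q1 * a1) * (p * xb) - a1 * p * (Q1 * X1) * (p * xb)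
       + (Xb * a1 - Tab * X1) * (p * Q1) + (E * a1 + Qa * X1) * (p * xb)
       + a1 * p * (Q1 * Xb - xb * E) + X1 * p * (Q1 * Tab + xb * Qa)"
    by (simp add: algebra_simps)
  also have "\<dots> = (Tab * E - E * Tab - (Xb * Qa + Qa * Xb))
       + ((Xb * a1 - a1 * Xb) - (Tab * X1 - X1 * Tab)) * (p * Q1)
       + (X1 * Qa + Qa * X1 - (a1 * E - E * a1)) * (p * xb)
       + a1 * p * (Xb * Q1 + Q1 * Xb - (xb * E - E * xb))
       + X1 * p * ((xb * Qa - Qa * xb) - (Tab * Q1 - Q1 * Tab))"
    unfolding h1 h2 h3 h4 c by (simp add: algebra_simps)
  also have "\<dots> = 0" unfolding r2 r4 r5 by simp
  finally show ?thesis by simp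
qed

definition manin :: "'i set \<Rightarrow> 'j set \<Rightarrow> ('i \<Rightarrow> 'j \<Rightarrow> 'a::ring_1) \<Rightarrow> bool" where
  "manin I J M \<longleftrightarrow> (\<forall>a\<in>I. \<forall>c\<in>I. \<forall>b\<in>J. \<forall>d\<in>J.
     M a b * M c d - M c d * M a b = M c b * M a d - M a d * M c b)"

definition schur :: "'i \<Rightarrow> ('i \<Rightarrow> 'i \<Rightarrow> 'a::ring_1) \<Rightarrow> 'i \<Rightarrow> 'i \<Rightarrow> 'a" where
  "schur j M a b = M a b - M a j * uinv (M j j) * M j b"

lemma maninD: "manin I J M \<Longrightarrow> a \<in> I \<Longrightarrow> c \<in> I \<Longrightarrow> b \<in> J \<Longrightarrow> d \<in> J \<Longrightarrow>
   M a b * M c d - M c d * M a b = M c b * M a d - M a d * M c b"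
  unfolding manin_def by blast

lemma manin_column_commute:
  fixes M :: "'i \<Rightarrow> 'j \<Rightarrow> 'a::calg"
  shows "manin I J M \<Longrightarrow> a \<in> I \<Longrightarrow> c \<in> I \<Longrightarrow> b \<in> J \<Longrightarrow> M a b * M c b = M c b * M a b"
  by (rule calg_commute) (rule maninD)

lemma manin_schur:
  fixes M :: "'i \<Rightarrow> 'i \<Rightarrow> 'a::calg"
  assumes M: "manin I J M" and j: "j \<in> I" "j \<in> J" "unit (M j j)"
  shows "manin I J (schur j M)"
  unfolding manin_def schur_def
proof (intro ballI)
  fix a c b d assume [simp]: "a \<in> I" "c \<in> I" "b \<in> J" "d \<in> J"
  note [simp] = j(1,2)
  show "(M a b - M a j * uinv (M j j) * M j b) * (M c d - M c j * uinv (M j j) * M j d)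
     - (M c d - M c j * uinv (M j j) * M j d) * (M a b - M a j * uinv (M j j) * M j b)
     = (M c b - M c j * uinv (M j j) * M j b) * (M a d - M a j * uinv (M j j) * M j d)
     - (M a d - M a j * uinv (M j j) * M j d) * (M c b - M c j * uinv (M j j) * M j b)"
    by (rule schur_manin_local[OF uinv_left[OF j(3)] uinv_right[OF j(3)]])
       (rule manin_column_commute[OF M] maninD[OF M]; simp)+
qed

lemma prod_list_map_zero: "b \<in> set js \<Longrightarrow> f b = 0 \<Longrightarrow> prod_list (map f js) = (0 :: 'a::ring_1)"
  by (induction js) auto

text \<open>Only permutations that fix j contribute, since j is hit by no other column.\<close>

lemma col_det_first_pivot:
  fixes M :: "'i \<Rightarrow> 'i \<Rightarrow> 'a::ring_1"
  assumes d: "distinct (j # bs)" and z: "\<And>b. b \<in> set bs \<Longrightarrow> M j b = 0"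
  shows "col_det (j # bs) M = M j j * col_det bs M"
proof -
  let ?f = "\<lambda>\<sigma>. of_int (sign \<sigma>) * prod_list (map (\<lambda>b. M (\<sigma> b) b) (j # bs))"
  have "col_det (j # bs) M = sum ?f {\<sigma>. \<sigma> permutes set bs}"
    unfolding col_det_alt
  proof (rule sum.mono_neutral_right)
    show "{\<sigma>. \<sigma> permutes set bs} \<subseteq> {\<sigma>. \<sigma> permutes set (j # bs)}"
      by (auto intro: permutes_subset)
    show "\<forall>\<sigma>\<in>{\<sigma>. \<sigma> permutes set (j # bs)} - {\<sigma>. \<sigma> permutes set bs}. ?f \<sigma> = 0"
    proof
      fix \<sigma> assume s: "\<sigma> \<in> {\<sigma>. \<sigma> permutes set (j # bs)} - {\<sigma>. \<sigma> permutes set bs}"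
      then have p: "\<sigma> permutes insert j (set bs)" by simp
      have "\<sigma> j \<noteq> j"
      proof
        assume "\<sigma> j = j"
        with p have "\<sigma> permutes set bs" using d by (auto simp: permutes_def)
        with s show False by simp
      qed
      obtain b where b: "\<sigma> b = j" using permutes_surj[OF p] by (metis surjD)
      with \<open>\<sigma> j \<noteq> j\<close> have "b \<in> set bs" using p by (metis insertE insertI1 permutes_not_in)
      with b z have "prod_list (map (\<lambda>b. M (\<sigma> b) b) (j # bs)) = 0"
        by (intro prod_list_map_zero[of b]) auto
      then show "?f \<sigma> = 0" by (simp only: mult_zero_right)
    qed
  qed (auto simp: finite_permutations)
  also have "\<dots> = (\<Sum>\<sigma> | \<sigma> permutes set bs. M j j * (of_int (sign \<sigma>) * prod_list (map (\<lambda>b. M (\<sigma> b) b) bs)))"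
  proof (rule sum.cong[OF refl])
    fix \<sigma> assume "\<sigma> \<in> {\<sigma>. \<sigma> permutes set bs}"
    then have "\<sigma> j = j" using d by (auto simp: permutes_def)
    then show "?f \<sigma> = M j j * (of_int (sign \<sigma>) * prod_list (map (\<lambda>b. M (\<sigma> b) b) bs))"
      using mult_of_int_commute[of "sign \<sigma>" "M j j"] by (simp add: mult.assoc[symmetric])
  qed
  finally show ?thesis by (simp add: col_det_alt sum_distrib_left)
qed

lemma additive_mult: "additive (\<lambda>x. a * x)" for a :: "'a::ring_1"
  by (simp add: additive_def distrib_left)

text \<open>
  Subtracting right multiples of the first column from the others, starting with the last one, so
  that the columns in between are still those of a Manin matrix.
\<close>

lemma col_det_schur:
  fixes M :: "'i \<Rightarrow> 'i \<Rightarrow> 'a::calg"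
  assumes d: "distinct (j # bs)" and M: "manin (set (j # bs)) (set (j # bs)) M" and u: "unit (M j j)"
  shows "col_det (j # bs) M = M j j * col_det bs (schur j M)"
proof -
  let ?J = "set (j # bs)"
  \<comment> \<open>Entries in rows outside the index set are replaced by 0, so that the relations
    hold for all rows, as the operator lemmas demand.\<close>
  define R where "R a b = (if a \<in> ?J then M a b else 0)" for a b
  define y where "y b = uinv (M j j) * M j b" for b
  define N where "N ds b a = (if b \<in> set ds then R a b - R a j * y b else R a b)" for ds b a
  have R: "R a b * R c e - R c e * R a b = R c b * R a e - R a e * R c b" if "b \<in> ?J" "e \<in> ?J" for a b c e
    using maninD[OF M] that unfolding R_def by auto
  have Rj: "R a j * R c j = R c j * R a j" for a c
    by (rule calg_commute) (use R[of j j a c] in simp)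
  have step: "asum (j # bs) (\<lambda>b a x. N ds b a * x) 1 = asum (j # bs) (\<lambda>b a x. R a b * x) 1"
    if "bs = cs @ ds" for cs ds
    using that
  proof (induction ds arbitrary: cs)
    case (Cons b ds)
    let ?C = "\<lambda>b a x. N ds b a * x"
    have bs: "j # bs = (j # cs) @ b # ds" using Cons by simp
    have dist: "distinct ((j # cs) @ b # ds)" using d bs by metis
    have add: "additive (?C b a)" for b a by (rule additive_mult)
    \<comment> \<open>The part subtracted from column b, a right multiple of column j. The columns
      between j and b are not yet reduced, so column j can be moved past them until it stands next
      to b, and there the two columns cancel.\<close>
    let ?D = "?C(b := \<lambda>a x. R a j * (y b * x))"
    have "asum ((j # cs) @ b # ds) ?D 1 = asum (cs @ j # b # ds) ?D 1"
    proof -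
      have "asum ([] @ j # cs @ (b # ds)) ?D 1 = asum ([] @ cs @ j # b # ds) ?D 1"
      proof (rule asum_move)
        show "additive (?D b' a)" for b' a by (auto simp: additive_def algebra_simps)
        fix c a a' x assume c: "c \<in> set cs"
        then have "c \<noteq> b" "c \<notin> set ds" "j \<noteq> b" "j \<notin> set ds" "c \<in> ?J" using dist bs by auto
        then show "?D j a (?D c a' x) - ?D c a' (?D j a x) = ?D j a' (?D c a x) - ?D c a (?D j a' x)"
        proof -
          have "(R a j * R a' c - R a' c * R a j) * x = (R a' j * R a c - R a c * R a' j) * x"
            using R[of j c a a'] \<open>c \<in> ?J\<close> by simp
          then show ?thesis using \<open>c \<noteq> b\<close> \<open>c \<notin> set ds\<close> \<open>j \<noteq> b\<close> \<open>j \<notin> set ds\<close>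
            by (simp add: N_def left_diff_distrib mult.assoc)
        qed
      qed (use dist in auto)
      then show ?thesis by simp
    qed
    also have "\<dots> = 0"
    proof (rule asum_adjacent_zero)
      have "j \<noteq> b" "j \<notin> set ds" using dist by auto
      then show "?D j a (?D b a' x) = ?D j a' (?D b a x)" for a a' x
        using Rj[of a a'] by (simp add: N_def) (simp add: mult.assoc[symmetric])
    qed (use dist in auto)
    finally have z: "asum (j # bs) ?D 1 = 0" by (simp only: bs)
    have "asum (j # bs) (\<lambda>c a x. N (b # ds) c a * x) 1
        = asum ((j # cs) @ b # ds) (?C(b := \<lambda>a x. R a b * x - R a j * (y b * x))) 1"
      unfolding bs by (rule asum_cong) (use dist in \<open>auto simp: N_def algebra_simps\<close>)
    also have "\<dots> = asum ((j # cs) @ b # ds) (?C(b := \<lambda>a x. R a b * x)) 1"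
      using asum_column_diff[OF dist add, where f = "\<lambda>a x. R a b * x" and g = "\<lambda>a x. R a j * (y b * x)" and v = 1] z
      unfolding bs by simp
    also have "\<dots> = asum (j # bs) ?C 1"
      unfolding bs by (rule asum_cong) (use dist in \<open>auto simp: N_def\<close>)
    also have "\<dots> = asum (j # bs) (\<lambda>b a x. R a b * x) 1"
      using Cons.IH[of "cs @ [b]"] Cons.prems by simp
    finally show ?case by (simp add: N_def)
  qed (simp add: N_def)
  have "col_det (j # bs) M = col_det (j # bs) R"
    by (rule col_det_cong) (simp add: R_def)
  also have "\<dots> = col_det (j # bs) (\<lambda>a b. N bs b a)"
    unfolding col_det_def using step[of "[]" bs] by simp
  also have "\<dots> = N bs j j * col_det bs (\<lambda>a b. N bs b a)"
    by (rule col_det_first_pivot[OF d])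
       (simp add: N_def R_def y_def mult.assoc[symmetric] uinv_right[OF u])
  also have "N bs j j = M j j" using d by (simp add: N_def R_def)
  also have "col_det bs (\<lambda>a b. N bs b a) = col_det bs (schur j M)"
    by (rule col_det_cong) (auto simp: N_def R_def schur_def y_def mult.assoc)
  finally show ?thesis .
qed

text \<open>
  The Manin relations of a matrix bordered by the column \<open>Q\<close>, the row \<open>X\<close> and the corner \<open>E\<close>, the
  additional index being even (\<open>od = False\<close>) or odd.
\<close>

definition bordered :: "bool \<Rightarrow> 'i set \<Rightarrow> ('i \<Rightarrow> 'i \<Rightarrow> 'a::ring_1) \<Rightarrow> ('i \<Rightarrow> 'a) \<Rightarrow> ('i \<Rightarrow> 'a) \<Rightarrow> 'a \<Rightarrow> bool" where
  "bordered od J T Q X E \<longleftrightarrow> manin J J T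
     \<and> (\<forall>a\<in>J. \<forall>b\<in>J. \<forall>c\<in>J. T a b * X c - X c * T a b = X b * T a c - T a c * X b)
     \<and> (\<forall>a\<in>J. \<forall>b\<in>J. \<forall>c\<in>J. T a b * Q c - Q c * T a b = T c b * Q a - Q a * T c b)
     \<and> (\<not> od \<longrightarrow> (\<forall>a\<in>J. \<forall>b\<in>J. T a b * E - E * T a b = X b * Q a - Q a * X b)
         \<and> (\<forall>a\<in>J. \<forall>b\<in>J. Q a * Q b = Q b * Q a) \<and> (\<forall>a\<in>J. Q a * E = E * Q a))
     \<and> (od \<longrightarrow> (\<forall>a\<in>J. \<forall>b\<in>J. T a b * E - E * T a b = X b * Q a + Q a * X b)
         \<and> (\<forall>a\<in>J. \<forall>b\<in>J. X a * X b = - (X b * X a)) \<and> (\<forall>a\<in>J. X a * E = E * X a))"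

lemma borderedD:
  assumes "bordered od J T Q X E"
  shows "manin J J T"
    and "a \<in> J \<Longrightarrow> b \<in> J \<Longrightarrow> c \<in> J \<Longrightarrow> T a b * X c - X c * T a b = X b * T a c - T a c * X b"
    and "a \<in> J \<Longrightarrow> b \<in> J \<Longrightarrow> c \<in> J \<Longrightarrow> T a b * Q c - Q c * T a b = T c b * Q a - Q a * T c b"
    and "a \<in> J \<Longrightarrow> b \<in> J \<Longrightarrow> od \<Longrightarrow> T a b * E - E * T a b = X b * Q a + Q a * X b"
    and "a \<in> J \<Longrightarrow> b \<in> J \<Longrightarrow> \<not> od \<Longrightarrow> T a b * E - E * T a b = X b * Q a - Q a * X b"
    and "a \<in> J \<Longrightarrow> b \<in> J \<Longrightarrow> od \<Longrightarrow> X a * X b = - (X b * X a)"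
    and "a \<in> J \<Longrightarrow> od \<Longrightarrow> X a * E = E * X a"
    and "a \<in> J \<Longrightarrow> b \<in> J \<Longrightarrow> \<not> od \<Longrightarrow> Q a * Q b = Q b * Q a"
    and "a \<in> J \<Longrightarrow> \<not> od \<Longrightarrow> Q a * E = E * Q a"
  using assms unfolding bordered_def by blast+

lemma minus_eq_sym: "x - y = z - (w :: 'a::ab_group_add) \<Longrightarrow> y - x = w - z"
  by (metis minus_diff_eq)

text \<open>An even border is one more row and column of a Manin matrix, so the local lemma covers
  all relations. For an odd border the relations that involve the corner or two entries of the
  border row carry signs and need the odd variants.\<close>

lemma bordered_schur:
  fixes T :: "'i \<Rightarrow> 'i \<Rightarrow> 'a::calg"
  assumes B: "bordered od J T Q X E" and j: "j \<in> J" and u: "unit (T j j)"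
  shows "bordered od J (schur j T) (\<lambda>a. Q a - T a j * uinv (T j j) * Q j)
           (\<lambda>b. X b - X j * uinv (T j j) * T j b) (E - X j * uinv (T j j) * Q j)"
proof -
  let ?p = "uinv (T j j)"
  note D = borderedD[OF B]
  note p = uinv_left[OF u] uinv_right[OF u]
  have col: "T a j * T c j = T c j * T a j" if "a \<in> J" "c \<in> J" for a c
    using manin_column_commute[OF D(1) that j] .
  have colX: "T a b * X b = X b * T a b" if "a \<in> J" "b \<in> J" for a b
    by (rule calg_commute) (rule D(2)[OF that that(2)])
  have 1: "manin J J (schur j T)" by (rule manin_schur[OF D(1) j j u])
  note rls = col colX colX[symmetric] D(2) D(3) D(5) maninD[OF D(1)] minus_eq_sym[OF D(3)] minus_eq_sym[OF D(5), symmetric]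
  have 2: "schur j T a b * (X c - X j * ?p * T j c) - (X c - X j * ?p * T j c) * schur j T a b
      = (X b - X j * ?p * T j b) * schur j T a c - schur j T a c * (X b - X j * ?p * T j b)"
    if "a \<in> J" "b \<in> J" "c \<in> J" for a b c
    unfolding schur_def
    by (rule schur_manin_local[OF p]) (rule rls; simp add: j that)+
  have 3: "schur j T a b * (Q c - T c j * ?p * Q j) - (Q c - T c j * ?p * Q j) * schur j T a b
      = schur j T c b * (Q a - T a j * ?p * Q j) - (Q a - T a j * ?p * Q j) * schur j T c b"
    if "a \<in> J" "b \<in> J" "c \<in> J" for a b c
    unfolding schur_def
    by (rule schur_manin_local[OF p]) (rule rls; simp add: j that)+
  have even: "(\<forall>a\<in>J. \<forall>b\<in>J. schur j T a b * (E - X j * ?p * Q j) - (E - X j * ?p * Q j) * schur j T a b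
        = (X b - X j * ?p * T j b) * (Q a - T a j * ?p * Q j) - (Q a - T a j * ?p * Q j) * (X b - X j * ?p * T j b))
      \<and> (\<forall>a\<in>J. \<forall>b\<in>J. (Q a - T a j * ?p * Q j) * (Q b - T b j * ?p * Q j) = (Q b - T b j * ?p * Q j) * (Q a - T a j * ?p * Q j))
      \<and> (\<forall>a\<in>J. (Q a - T a j * ?p * Q j) * (E - X j * ?p * Q j) = (E - X j * ?p * Q j) * (Q a - T a j * ?p * Q j))"
    if od: "\<not> od"
  proof (intro conjI ballI)
    fix a b assume ab: "a \<in> J" "b \<in> J"
    show "schur j T a b * (E - X j * ?p * Q j) - (E - X j * ?p * Q j) * schur j T a b
        = (X b - X j * ?p * T j b) * (Q a - T a j * ?p * Q j) - (Q a - T a j * ?p * Q j) * (X b - X j * ?p * T j b)"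
      unfolding schur_def
      by (rule schur_manin_local[OF p]) (rule rls; simp add: j ab od)+
    \<comment> \<open>Both sides are 0; the shape is that of a Manin relation, so that the local
      lemma can be applied to two entries of the border column.\<close>
    have QQ: "Q a * Q b - Q b * Q a = Q c * Q d - Q d * Q c" if "a \<in> J" "b \<in> J" "c \<in> J" "d \<in> J" for a b c d
      using D(8) that od by simp
    show "(Q a - T a j * ?p * Q j) * (Q b - T b j * ?p * Q j) = (Q b - T b j * ?p * Q j) * (Q a - T a j * ?p * Q j)"
      by (rule calg_commute, rule schur_manin_local[OF p]) (rule rls QQ; simp add: j ab od)+
    have QE: "Q a * E - E * Q a = E * Q b - Q b * E" if "a \<in> J" "b \<in> J" for a b
      using D(9) that od by simp
    show "(Q a - T a j * ?p * Q j) * (E - X j * ?p * Q j) = (E - X j * ?p * Q j) * (Q a - T a j * ?p * Q j)"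
      by (rule calg_commute, rule schur_manin_local[OF p]) (rule rls QQ QE; simp add: j ab od)+
  qed
  have odd: "(\<forall>a\<in>J. \<forall>b\<in>J. schur j T a b * (E - X j * ?p * Q j) - (E - X j * ?p * Q j) * schur j T a b
        = (X b - X j * ?p * T j b) * (Q a - T a j * ?p * Q j) + (Q a - T a j * ?p * Q j) * (X b - X j * ?p * T j b))
      \<and> (\<forall>a\<in>J. \<forall>b\<in>J. (X a - X j * ?p * T j a) * (X b - X j * ?p * T j b) = - ((X b - X j * ?p * T j b) * (X a - X j * ?p * T j a)))
      \<and> (\<forall>a\<in>J. (X a - X j * ?p * T j a) * (E - X j * ?p * Q j) = (E - X j * ?p * Q j) * (X a - X j * ?p * T j a))"
    if od: "od"
  proof (intro conjI ballI)
    fix a b assume ab: "a \<in> J" "b \<in> J"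
    show "schur j T a b * (E - X j * ?p * Q j) - (E - X j * ?p * Q j) * schur j T a b
        = (X b - X j * ?p * T j b) * (Q a - T a j * ?p * Q j) + (Q a - T a j * ?p * Q j) * (X b - X j * ?p * T j b)"
      unfolding schur_def
      by (rule schur_odd_mixed[OF p]) (rule rls D(4); simp add: j ab od)+
    have XX: "X j * X j = 0" using D(6)[OF j j od] by (rule calg_neg_self)
    have L: "(X c - X j * ?p * T j c) * (Y - X j * ?p * y) = X c * Y - X j * ?p * (T j c * Y - X c * y)"
      if "c \<in> J" for c Y y
      by (rule schur_odd_product[OF p]) (rule XX rls D(6); simp add: j that od)+
    have "X a * X b + X b * X a = 0" using D(6)[OF ab od] by simp
    moreover have "(T j a * X b - X a * T j b) + (T j b * X a - X b * T j a) = 0"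
      using D(2)[OF j ab] by (simp add: algebra_simps)
    ultimately have "(X a * X b - X j * ?p * (T j a * X b - X a * T j b)) + (X b * X a - X j * ?p * (T j b * X a - X b * T j a)) = 0 - X j * ?p * 0"
      by (metis (no_types, lifting) add_diff_add distrib_left)
    then show "(X a - X j * ?p * T j a) * (X b - X j * ?p * T j b) = - ((X b - X j * ?p * T j b) * (X a - X j * ?p * T j a))"
      unfolding L[OF ab(1)] L[OF ab(2)] by (simp add: add_eq_0_iff2)
    have L': "(E - X j * ?p * Q j) * (X a - X j * ?p * T j a) = E * X a - X j * ?p * (Q j * X a + E * T j a)"
      by (rule schur_odd_product'[OF p]) (rule XX rls D(7) D(4); simp add: j ab od)+
    have "T j a * E - X a * Q j = Q j * X a + E * T j a"
      using D(4)[OF j ab(1) od] by (simp add: algebra_simps)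
    then show "(X a - X j * ?p * T j a) * (E - X j * ?p * Q j) = (E - X j * ?p * Q j) * (X a - X j * ?p * T j a)"
      unfolding L[OF ab(1)] L' using D(7)[OF ab(1) od] by simp
  qed
  show ?thesis
    unfolding bordered_def using 1 2 3 even odd by blast
qed

text \<open>Eliminating the corner and then the pivot gives the same as the opposite order. Both are
  read off from the solution (\<alpha>, \<beta>) of the 2 x 2 system t \<alpha> + Q1 \<beta> = xb,
  X1 \<alpha> + E \<beta> = Xb.\<close>

lemma schur_quotient:
  fixes t E :: "'a::ring_1"
  assumes t: "unit t" and E: "unit E"
    and E': "unit (E - X1 * uinv t * Q1)" and t': "unit (t - Q1 * uinv E * X1)"
  shows "(ab - Qa * uinv E * Xb) - (a1 - Qa * uinv E * X1) * uinv (t - Q1 * uinv E * X1) * (xb - Q1 * uinv E * Xb)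
    = (ab - a1 * uinv t * xb) - (Qa - a1 * uinv t * Q1) * uinv (E - X1 * uinv t * Q1) * (Xb - X1 * uinv t * xb)"
proof -
  define \<beta> where "\<beta> = uinv (E - X1 * uinv t * Q1) * (Xb - X1 * uinv t * xb)"
  define \<alpha> where "\<alpha> = uinv t * (xb - Q1 * \<beta>)"
  have ta: "t * \<alpha> = xb - Q1 * \<beta>" unfolding \<alpha>_def by (rule uinv_right_cancel[OF t])
  have "(E - X1 * uinv t * Q1) * \<beta> = Xb - X1 * uinv t * xb"
    unfolding \<beta>_def by (rule uinv_right_cancel[OF E'])
  then have Eb: "E * \<beta> = Xb - X1 * \<alpha>" unfolding \<alpha>_def by (simp add: algebra_simps)
  then have "Xb = E * \<beta> + X1 * \<alpha>" by simp
  then have "uinv E * Xb = uinv E * (E * \<beta> + X1 * \<alpha>)" by (rule arg_cong)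
  then have b: "uinv E * Xb = \<beta> + uinv E * (X1 * \<alpha>)"
    unfolding distrib_left uinv_left_cancel[OF E] .
  have "(t - Q1 * uinv E * X1) * \<alpha> = xb - Q1 * \<beta> - Q1 * (uinv E * (X1 * \<alpha>))"
    using ta by (simp add: algebra_simps)
  also have "\<dots> = xb - Q1 * uinv E * Xb"
    by (simp add: mult.assoc b distrib_left)
  finally have "uinv (t - Q1 * uinv E * X1) * (xb - Q1 * uinv E * Xb) = \<alpha>"
    using uinv_left_cancel[OF t', of \<alpha>] by simp
  then have "(ab - Qa * uinv E * Xb) - (a1 - Qa * uinv E * X1) * uinv (t - Q1 * uinv E * X1) * (xb - Q1 * uinv E * Xb)
    = ab - Qa * (uinv E * Xb) - (a1 - Qa * uinv E * X1) * \<alpha>"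
    by (simp add: mult.assoc)
  also have "\<dots> = ab - a1 * \<alpha> - Qa * \<beta>"
    unfolding b by (simp add: algebra_simps)
  also have "\<dots> = (ab - a1 * uinv t * xb) - (Qa - a1 * uinv t * Q1) * \<beta>"
    unfolding \<alpha>_def by (simp add: algebra_simps)
  finally show ?thesis by (simp add: \<beta>_def mult.assoc)
qed

lemma manin_subset: "manin I J M \<Longrightarrow> I' \<subseteq> I \<Longrightarrow> J' \<subseteq> J \<Longrightarrow> manin I' J' M"
  unfolding manin_def by blast

lemma bordered_subset:
  assumes B: "bordered od J T Q X E" and sub: "J' \<subseteq> J"
  shows "bordered od J' T Q X E"
  unfolding bordered_def
  by (intro conjI impI ballI manin_subset[OF borderedD(1)[OF B] sub sub])
     (rule borderedD(2-)[OF B]; (assumption | erule subsetD[OF sub]))+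

text \<open>Formally c is - T^-1 Q, so E + X c is the Schur complement of T in the bordered matrix,
  while T - Q E^-1 X is that of E. The formula equates the two factorisations of the bordered
  determinant or, for an odd border, of the Berezinian. The induction eliminates one column of T at
  a time.\<close>

lemma bordered_det:
  fixes T :: "'i \<Rightarrow> 'i \<Rightarrow> 'a::calg psd"
  assumes "distinct js" and "bordered od (set js) T Q X E"
    and "\<And>a b. a \<in> set js \<Longrightarrow> b \<in> set js \<Longrightarrow> (if a = b then psd_z else 0) - T a b \<in> psd_O"
    and "\<And>a. a \<in> set js \<Longrightarrow> Q a \<in> psd_O" and "\<And>a. a \<in> set js \<Longrightarrow> X a \<in> psd_O" and "psd_d - E \<in> psd_O"
    and "manin (set js) (set js) (\<lambda>a b. T a b - Q a * uinv E * X b)"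
  shows "\<exists>c. (\<forall>a\<in>set js. (\<Sum>b\<in>set js. T a b * c b) = - Q a) \<and>
     (if od then col_det js (\<lambda>a b. T a b - Q a * uinv E * X b) * (E + (\<Sum>b\<in>set js. X b * c b)) = E * col_det js T
      else col_det js T * (E + (\<Sum>b\<in>set js. X b * c b)) = E * col_det js (\<lambda>a b. T a b - Q a * uinv E * X b))"
  using assms
proof (induction js arbitrary: T Q X E)
  case Nil
  then show ?case by auto
next
  case (Cons j bs)
  let ?J = "set (j # bs)"
  let ?t = "T j j"
  let ?p = "uinv ?t"
  let ?E' = "E - X j * ?p * Q j"
  let ?Q' = "\<lambda>a. Q a - T a j * ?p * Q j"
  let ?X' = "\<lambda>b. X b - X j * ?p * T j b"
  let ?S = "schur j T"
  let ?T' = "\<lambda>a b. T a b - Q a * uinv E * X b"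
  have j: "j \<in> ?J" "j \<notin> set bs" using Cons.prems(1) by auto
  note B = Cons.prems(2) note TO = Cons.prems(3) note QO = Cons.prems(4) note XO = Cons.prems(5)
  have unz: "unit x" "uinv x \<in> psd_O" if "psd_z - x \<in> psd_O" for x :: "'a psd"
    using unit_z_diff_O[OF that] by simp_all
  have und: "unit x" "uinv x \<in> psd_O" if "psd_d - x \<in> psd_O" for x :: "'a psd"
    using unit_d_diff_O[OF that] by simp_all
  have t: "unit ?t" "?p \<in> psd_O" using unz[of ?t] TO[of j j] by simp_all
  have E: "unit E" "uinv E \<in> psd_O" using und[OF Cons.prems(6)] by simp_all
  have "psd_d - ?E' = (psd_d - E) + X j * ?p * Q j" by simp
  also have "\<dots> \<in> psd_O" by (intro psd_O_closed Cons.prems t QO XO j)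
  finally have E'O: "psd_d - ?E' \<in> psd_O" .
  have t'eq: "psd_z - ?T' j j = (psd_z - ?t) + Q j * uinv E * X j" by simp
  have t'O: "psd_z - ?T' j j \<in> psd_O"
  proof -
    have "psd_z - ?t \<in> psd_O" using TO[of j j] by simp
    then show ?thesis unfolding t'eq by (intro psd_O_add psd_O_mult E QO XO j)
  qed
  have To: "T a b \<in> psd_O" if "a \<in> ?J" "b \<in> ?J" "a \<noteq> b" for a b
    using TO[OF that(1,2)] that(3) psd_O_uminus[of "- T a b"] by simp
  have sub: "set bs \<subseteq> ?J" by auto
  have SO: "(if a = b then psd_z else 0) - ?S a b \<in> psd_O" if "a \<in> set bs" "b \<in> set bs" for a b
  proof -
    have "(if a = b then psd_z else 0) - ?S a b = ((if a = b then psd_z else 0) - T a b) + T a j * ?p * T j b"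
      by (simp add: schur_def)
    also have "\<dots> \<in> psd_O"
      using that j by (intro psd_O_add psd_O_mult TO To t) auto
    finally show ?thesis .
  qed
  have QO': "?Q' a \<in> psd_O" if "a \<in> set bs" for a
    using that j by (intro psd_O_closed QO t To) auto
  have XO': "?X' a \<in> psd_O" if "a \<in> set bs" for a
    using that j by (intro psd_O_closed XO t To) auto
  \<comment> \<open>The Schur complement of T - Q E^-1 X is the same expression for the reduced
    border, so the induction hypothesis treats both determinants at once.\<close>
  have quot: "schur j ?T' a b = ?S a b - ?Q' a * uinv ?E' * ?X' b" for a b
    unfolding schur_def
    using schur_quotient[OF t(1) E(1) und(1)[OF E'O] unz(1)[OF t'O]] .
  have M': "manin (set bs) (set bs) (\<lambda>a b. ?S a b - ?Q' a * uinv ?E' * ?X' b)"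
    using manin_subset[OF manin_schur[OF Cons.prems(7) j(1) j(1) unz(1)[OF t'O]] sub sub]
    unfolding quot .
  obtain c where c: "\<And>a. a \<in> set bs \<Longrightarrow> (\<Sum>b\<in>set bs. ?S a b * c b) = - ?Q' a"
    and det: "if od then col_det bs (\<lambda>a b. ?S a b - ?Q' a * uinv ?E' * ?X' b) * (?E' + (\<Sum>b\<in>set bs. ?X' b * c b)) = ?E' * col_det bs ?S
      else col_det bs ?S * (?E' + (\<Sum>b\<in>set bs. ?X' b * c b)) = ?E' * col_det bs (\<lambda>a b. ?S a b - ?Q' a * uinv ?E' * ?X' b)"
    using Cons.IH[OF _ bordered_subset[OF bordered_schur[OF B j(1) t(1)] sub] SO QO' XO' E'O M'] Cons.prems(1)
    by auto
  \<comment> \<open>Back substitution in row j of T c = - Q.\<close>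
  define cj where "cj = - (?p * (Q j + (\<Sum>b\<in>set bs. T j b * c b)))"
  define c' where "c' = c(j := cj)"
  have c's: "(\<Sum>b\<in>?J. f b * c' b) = f j * cj + (\<Sum>b\<in>set bs. f b * c b)" for f
  proof -
    have "(\<Sum>b\<in>set bs. f b * c' b) = (\<Sum>b\<in>set bs. f b * c b)"
      by (rule sum.cong) (use j in \<open>auto simp: c'_def\<close>)
    then show ?thesis using j by (simp add: c'_def)
  qed
  have Tc: "(\<Sum>b\<in>?J. T a b * c' b) = - Q a" if "a \<in> ?J" for a
  proof (cases "a = j")
    case True
    have "?t * cj = - (Q j + (\<Sum>b\<in>set bs. T j b * c b))"
      unfolding cj_def using uinv_right_cancel[OF t(1)] by simp
    then show ?thesis unfolding c's True by simp
  next
    case False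
    then have "(\<Sum>b\<in>set bs. T a b * c b) - T a j * ?p * (\<Sum>b\<in>set bs. T j b * c b) = - ?Q' a"
      using c[of a] that by (simp add: schur_def left_diff_distrib sum_subtractf sum_distrib_left mult.assoc)
    then show ?thesis unfolding c's cj_def by (simp add: algebra_simps)
  qed
  have \<delta>: "E + (\<Sum>b\<in>?J. X b * c' b) = ?E' + (\<Sum>b\<in>set bs. ?X' b * c b)"
    unfolding c's cj_def by (simp add: left_diff_distrib sum_subtractf sum_distrib_left mult.assoc distrib_left right_diff_distrib)
  have fT: "col_det (j # bs) T = ?t * col_det bs ?S"
    by (rule col_det_schur[OF Cons.prems(1) borderedD(1)[OF B] t(1)])
  have fT': "col_det (j # bs) ?T' = ?T' j j * col_det bs (\<lambda>a b. ?S a b - ?Q' a * uinv ?E' * ?X' b)"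
    unfolding col_det_schur[OF Cons.prems(1,7) unz(1)[OF t'O]] quot ..
  have Xt: "X j * ?t = ?t * X j"
    using calg_commute[OF borderedD(2)[OF B j(1) j(1) j(1)]] by simp
  have tX: "?t * X j * ?p = X j" using Xt uinv_right[OF t(1)] by (metis mult.assoc mult_1_right)
  show ?case
  proof (intro exI[of _ c'] conjI ballI Tc)
    show "if od then col_det (j # bs) ?T' * (E + (\<Sum>b\<in>?J. X b * c' b)) = E * col_det (j # bs) T
      else col_det (j # bs) T * (E + (\<Sum>b\<in>?J. X b * c' b)) = E * col_det (j # bs) ?T'"
    \<comment> \<open>Both cases rest on the 1 x 1 identity that moves the pivot past the corner.
      With t' = \<open>?T' j j\<close> and E' = \<open>?E'\<close> it reads t' E' = E t for an odd
      border and t E' = E t' for an even one.\<close>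
    proof (cases od)
      case True
      have r: "?t * E - E * ?t = X j * Q j + Q j * X j" using borderedD(4)[OF B j(1) j(1) True] .
      have XX: "X j * X j = 0" using borderedD(6)[OF B j(1) j(1) True] by (rule calg_neg_self)
      have EX: "uinv E * (X j * E) = X j"
        using borderedD(7)[OF B j(1) True] uinv_left_cancel[OF E(1)] by simp
      have XpQ: "X j * (X j * w) = 0" for w using XX by (simp add: mult.assoc[symmetric])
      have "X j * (X j * ?p * w) = 0" for w using XpQ[of "?p * w"] by (simp add: mult.assoc)
      then have 0: "Q j * uinv E * X j * (X j * ?p * Q j) = 0" by (simp add: mult.assoc)
      have "?T' j j * ?E' = ?t * E - ?t * X j * ?p * Q j - Q j * (uinv E * (X j * E)) + Q j * uinv E * X j * (X j * ?p * Q j)"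
        by (simp add: left_diff_distrib right_diff_distrib mult.assoc)
      also have "\<dots> = E * ?t" unfolding tX EX 0 using r by (simp add: algebra_simps)
      finally have sw: "?T' j j * ?E' = E * ?t" .
      then have "?T' j j * (?E' * col_det bs ?S) = E * (?t * col_det bs ?S)"
        by (simp only: mult.assoc[symmetric])
      then show ?thesis using True det unfolding \<delta> fT fT' by (simp add: mult.assoc)
    next
      case False
      have r: "?t * E - E * ?t = X j * Q j - Q j * X j" using borderedD(5)[OF B j(1) j(1) False] .
      have EQ: "E * Q j * uinv E = Q j"
        using borderedD(9)[OF B j(1) False] uinv_right[OF E(1)] by (metis mult.assoc mult_1_right)
      have "?t * ?E' = ?t * E - ?t * X j * ?p * Q j"
        by (simp add: right_diff_distrib mult.assoc)
      also have "\<dots> = E * ?t - E * Q j * uinv E * X j" unfolding tX EQ using r by (simp add: algebra_simps)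
      also have "\<dots> = E * ?T' j j" by (simp add: right_diff_distrib mult.assoc)
      finally have "?t * (?E' * w) = E * (?T' j j * w)" for w by (simp only: mult.assoc[symmetric])
      then show ?thesis using False det unfolding \<delta> fT fT' by (simp add: mult.assoc)
    qed
  qed
qed

section \<open>Resolvents of triangular matrices\<close>

locale resolvent =
  fixes Z :: "nat \<Rightarrow> nat \<Rightarrow> complex"
  assumes triangular: "j < i \<Longrightarrow> Z i j = 0"
begin

text \<open>The inverse of t - Z for upper triangular Z, computed along row r from left to right.
  Only the elements t - c with scalar c are inverted, so the definition serves t = z and t = d at
  once.\<close>

fun res :: "'a::calg psd \<Rightarrow> nat \<Rightarrow> nat \<Rightarrow> 'a psd" where
  "res t r s = (if s < r then 0 else ((\<Sum>u\<in>{r..<s}. res t r u * scal (Z u s)) + (if r = s then 1 else 0))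
      * uinv (t - scal (Z s s)))"

declare res.simps [simp del]

lemma res_below: "s < r \<Longrightarrow> res t r s = 0"
  by (simp add: res.simps)

lemma res_commute:
  assumes t: "\<And>c. unit (t - scal c)" and y: "t * y = y * t"
  shows "res t r s * y = y * res t r s"
proof (induction s rule: less_induct)
  case (less s)
  have u: "uinv (t - scal c) * y = y * uinv (t - scal c)" for c
    by (rule uinv_commute[OF t]) (simp add: left_diff_distrib right_diff_distrib y scal_central[of _ y])
  have "(\<Sum>u\<in>{r..<s}. res t r u * scal (Z u s)) * y = y * (\<Sum>u\<in>{r..<s}. res t r u * scal (Z u s))"
    unfolding sum_distrib_left sum_distrib_right
  proof (rule sum.cong[OF refl])
    fix u assume "u \<in> {r..<s}"
    then have "res t r u * y = y * res t r u" using less by simp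
    then show "res t r u * scal (Z u s) * y = y * (res t r u * scal (Z u s))"
      by (simp add: mult.assoc scal_central[of _ y]) (simp add: mult.assoc[symmetric])
  qed
  then have "((\<Sum>u\<in>{r..<s}. res t r u * scal (Z u s)) + (if r = s then 1 else 0)) * uinv (t - scal (Z s s)) * y
     = y * (((\<Sum>u\<in>{r..<s}. res t r u * scal (Z u s)) + (if r = s then 1 else 0)) * uinv (t - scal (Z s s)))"
    by (simp add: mult.assoc u) (simp add: mult.assoc[symmetric] distrib_left distrib_right)
  then show ?case
    by (simp add: res.simps[of t r s])
qed

lemma res_parity:
  assumes "\<And>i j. Z i j \<noteq> 0 \<Longrightarrow> \<pi> i = \<pi> j"
  shows "\<pi> r \<noteq> \<pi> s \<Longrightarrow> res t r s = 0"
proof (induction s rule: less_induct)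
  case (less s)
  have "(\<Sum>u\<in>{r..<s}. res t r u * scal (Z u s)) = 0"
  proof (rule sum.neutral, rule ballI)
    fix u assume "u \<in> {r..<s}"
    then show "res t r u * scal (Z u s) = 0"
      using less.IH[of u] less.prems assms[of u s] by (cases "Z u s = 0") auto
  qed
  moreover have "r \<noteq> s" using less.prems by auto
  ultimately show ?case by (simp add: res.simps[of t r s])
qed

lemma res_O:
  assumes "\<And>c. uinv (t - scal c) \<in> psd_O"
  shows "res t r s \<in> psd_O"
proof (induction s rule: less_induct)
  case (less s)
  then show ?case
    by (subst res.simps) (auto intro!: psd_O_closed assms)
qed

text \<open>The exchange turns a left factor (z - c)^-1 into a right factor (d - c)^-1, and the
  entries of the resolvent are built from such factors and scalars. The order of these factors is
  irrelevant, since they commute.\<close>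

lemma res_swap:
  fixes x :: "'a::calg psd"
  shows "psd_swap (res psd_z r s * x) = psd_swap x * res psd_d r s"
proof (induction s arbitrary: x rule: less_induct)
  case (less s)
  have inv: "psd_swap (uinv (psd_z - scal c) * x) = psd_swap x * uinv (psd_d - scal c)" for x and c :: complex
  proof -
    let ?y = "uinv (psd_z - scal c) * x"
    have "psd_swap x = psd_swap ((psd_z - scal c) * ?y)"
      by (simp add: uinv_right_cancel[OF unit_z_scal(1)])
    also have "\<dots> = psd_swap ?y * (psd_d - scal c)"
      by (simp only: left_diff_distrib right_diff_distrib swap_diff swap_z_mult swap_scal_mult scal_central[of c "psd_swap ?y"])
    finally show ?thesis by (simp add: uinv_cancel_right1[OF unit_z_scal(2)])
  qed
  have com: "uinv (t - scal c) * scal e = scal e * uinv (t - scal c)" for t :: "'a psd" and c e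
    by (rule scal_central[symmetric])
  show ?case
  proof (cases "s < r")
    case False
    let ?c = "Z s s"
    define y where "y = uinv (psd_z - scal ?c) * x"
    have y: "psd_swap y = psd_swap x * uinv (psd_d - scal ?c)" unfolding y_def by (rule inv)
    have "psd_swap (res psd_z r s * x) = (\<Sum>u\<in>{r..<s}. psd_swap (res psd_z r u * (scal (Z u s) * y))) + psd_swap ((if r = s then 1 else 0) * y)"
      using False by (subst res.simps) (simp add: y_def[symmetric] mult.assoc distrib_right swap_add swap_sum sum_distrib_right)
    also have "\<dots> = (\<Sum>u\<in>{r..<s}. psd_swap y * (res psd_d r u * scal (Z u s))) + psd_swap y * (if r = s then 1 else 0)"
    proof -
      have "psd_swap (res psd_z r u * (scal (Z u s) * y)) = psd_swap y * (res psd_d r u * scal (Z u s))" if "u < s" for u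
        unfolding less.IH[OF that] swap_scal_mult by (simp only: mult.assoc scal_central[of "Z u s"])
      then show ?thesis by simp
    qed
    also have "\<dots> = psd_swap x * (uinv (psd_d - scal ?c) * ((\<Sum>u\<in>{r..<s}. res psd_d r u * scal (Z u s)) + (if r = s then 1 else 0)))"
      by (simp add: y mult.assoc distrib_left sum_distrib_left)
    also have "uinv (psd_d - scal ?c) * ((\<Sum>u\<in>{r..<s}. res psd_d r u * scal (Z u s)) + (if r = s then 1 else 0)) = (res psd_d r s :: 'a psd)"
    proof -
      have "res psd_d r u * uinv (psd_d - scal ?c) = uinv (psd_d - scal ?c) * (res psd_d r u :: 'a psd)" for u
        by (rule res_commute[OF unit_z_scal(2)], rule uinv_commute[symmetric, OF unit_z_scal(2)])
           (simp add: left_diff_distrib right_diff_distrib scal_central[of _ psd_d])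
      note rc = this
      have "uinv (psd_d - scal ?c) * (res psd_d r u * scal (Z u s)) = res psd_d r u * scal (Z u s) * (uinv (psd_d - scal ?c) :: 'a psd)" for u
        by (simp only: mult.assoc[symmetric] rc[symmetric]) (simp only: mult.assoc com)
      then show ?thesis
        using False by (simp add: res.simps[of psd_d r s] distrib_left distrib_right sum_distrib_left sum_distrib_right)
    qed
    finally show ?thesis .
  qed (simp add: res_below)
qed

lemma res_right:
  assumes t: "\<And>c. unit (t - scal c)" and rv: "r \<in> {1..n}" "v \<in> {1..n}"
  shows "(\<Sum>u\<in>{1..n}. res t r u * ((if u = v then t else 0) - scal (Z u v))) = (if r = v then 1 else 0)"
proof -
  have "(\<Sum>u\<in>{1..n}. res t r u * ((if u = v then t else 0) - scal (Z u v)))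
      = (\<Sum>u\<in>insert v {r..<v}. res t r u * ((if u = v then t else 0) - scal (Z u v)))"
  proof (rule sum.mono_neutral_right)
    show "\<forall>u\<in>{1..n} - insert v {r..<v}. res t r u * ((if u = v then t else 0) - scal (Z u v)) = 0"
    proof
      fix u assume "u \<in> {1..n} - insert v {r..<v}"
      then have "u < r \<or> v < u" "u \<noteq> v" by auto
      then show "res t r u * ((if u = v then t else 0) - scal (Z u v)) = 0"
        by (auto simp: res_below triangular)
    qed
  qed (use rv in auto)
  also have "\<dots> = res t r v * (t - scal (Z v v)) - (\<Sum>u\<in>{r..<v}. res t r u * scal (Z u v))"
    by (subst sum.insert) (auto simp: sum_negf[symmetric] intro!: sum.cong)
  also have "\<dots> = (if r = v then 1 else 0)"
  proof (cases "v < r")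
    case True
    then show ?thesis by (simp add: res_below)
  next
    case False
    then have "res t r v * (t - scal (Z v v)) = (\<Sum>u\<in>{r..<v}. res t r u * scal (Z u v)) + (if r = v then 1 else 0)"
      by (simp add: res.simps[of t r v] uinv_cancel_right2[OF t])
    then show ?thesis by simp
  qed
  finally show ?thesis .
qed

text \<open>The recursion encodes \<open>res_right\<close>; that the factors may be exchanged
  follows by induction on the column v.\<close>

lemma res_left:
  assumes t: "\<And>c. unit (t - scal c)" and rv: "r \<in> {1..n}" "v \<in> {1..n}"
  shows "(\<Sum>u\<in>{1..n}. ((if r = u then t else 0) - scal (Z r u)) * res t u v) = (if r = v then 1 else 0)"
  using rv(2)
proof (induction v rule: less_induct)
  case (less v)
  let ?A = "\<lambda>r u. (if r = u then t else 0) - scal (Z r u)"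
  let ?g = "uinv (t - scal (Z v v))"
  have "res t u v = ((\<Sum>w\<in>{1..<v}. res t u w * scal (Z w v)) + (if u = v then 1 else 0)) * ?g" if "u \<in> {1..n}" for u
  proof -
    have "(\<Sum>w\<in>{1..<v}. res t u w * scal (Z w v)) = (\<Sum>w\<in>{u..<v}. res t u w * scal (Z w v))"
      by (rule sum.mono_neutral_right) (use that in \<open>auto simp: res_below\<close>)
    then show ?thesis by (subst res.simps) (auto simp: sum.neutral res_below)
  qed
  then have "(\<Sum>u\<in>{1..n}. ?A r u * res t u v)
      = (\<Sum>u\<in>{1..n}. ?A r u * ((\<Sum>w\<in>{1..<v}. res t u w * scal (Z w v)) + (if u = v then 1 else 0))) * ?g"
    by (simp add: sum_distrib_right mult.assoc)
  also have "(\<Sum>u\<in>{1..n}. ?A r u * ((\<Sum>w\<in>{1..<v}. res t u w * scal (Z w v)) + (if u = v then 1 else 0)))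
      = (\<Sum>w\<in>{1..<v}. (\<Sum>u\<in>{1..n}. ?A r u * res t u w) * scal (Z w v)) + ?A r v"
  proof -
    have "(\<Sum>u\<in>{1..n}. ?A r u * (if u = v then 1 else 0)) = ?A r v"
      using less.prems by (simp add: if_distrib[of "times _"] sum.delta cong: if_cong)
    moreover have "(\<Sum>u\<in>{1..n}. ?A r u * (\<Sum>w\<in>{1..<v}. res t u w * scal (Z w v)))
        = (\<Sum>w\<in>{1..<v}. (\<Sum>u\<in>{1..n}. ?A r u * res t u w) * scal (Z w v))"
      unfolding sum_distrib_left sum_distrib_right mult.assoc by (rule sum.swap)
    ultimately show ?thesis by (simp only: distrib_left sum.distrib)
  qed
  also have "(\<Sum>w\<in>{1..<v}. (\<Sum>u\<in>{1..n}. ?A r u * res t u w) * scal (Z w v))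
      = (\<Sum>w\<in>{1..<v}. if r = w then scal (Z w v) else 0)"
    using less by (intro sum.cong refl) auto
  also have "\<dots> = (if r < v then scal (Z r v) else 0)"
    using rv(1) by (simp add: sum.delta' if_distrib cong: if_cong)
  finally show ?case
    using triangular[of v r] uinv_right[OF t, of "Z v v"] by (cases r v rule: linorder_cases) auto
qed

text \<open>Apply the derivation [y, -] to G (t - Z) = 1. It sends t - Z to the scalar k times the
  identity, so [y, G] = - k G^2.\<close>

lemma res_derivation:
  assumes t: "\<And>c. unit (t - scal c)" and y: "y * t - t * y = scal k" and rv: "r \<in> {1..n}" "v \<in> {1..n}"
  shows "y * res t r v - res t r v * y = - scal k * (\<Sum>u\<in>{1..n}. res t r u * res t u v)"
proof -
  let ?A = "\<lambda>r u. (if r = u then t else 0) - scal (Z r u)"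
  let ?D = "\<lambda>x. y * x - x * y"
  have A: "?D (?A u w) = (if u = w then scal k else 0)" for u w
    using y by (simp add: algebra_simps scal_central[of _ y])
  have 0: "(\<Sum>u\<in>{1..n}. ?D (res t r u) * ?A u w) = - (res t r w * scal k)" if "w \<in> {1..n}" for w
  proof -
    have "(\<Sum>u\<in>{1..n}. ?D (res t r u) * ?A u w) + (\<Sum>u\<in>{1..n}. res t r u * ?D (?A u w))
        = ?D (\<Sum>u\<in>{1..n}. res t r u * ?A u w)"
      by (simp add: sum_distrib_left sum_distrib_right sum.distrib[symmetric] sum_subtractf[symmetric] algebra_simps)
    also have "\<dots> = 0" unfolding res_right[OF t rv(1) that] by simp
    finally show ?thesis unfolding A using that
      by (simp add: if_distrib[of "times _"] sum.delta add_eq_0_iff2 cong: if_cong)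
  qed
  have "?D (res t r v) = (\<Sum>u\<in>{1..n}. ?D (res t r u) * (if u = v then 1 else 0))"
    using rv(2) by (simp add: if_distrib[of "times _"] sum.delta cong: if_cong)
  also have "\<dots> = (\<Sum>u\<in>{1..n}. ?D (res t r u) * (\<Sum>w\<in>{1..n}. ?A u w * res t w v))"
    by (intro sum.cong refl arg_cong2[where f = times] res_left[OF t, symmetric] rv(2))
  also have "\<dots> = (\<Sum>w\<in>{1..n}. (\<Sum>u\<in>{1..n}. ?D (res t r u) * ?A u w) * res t w v)"
    unfolding sum_distrib_left sum_distrib_right mult.assoc by (rule sum.swap)
  also have "\<dots> = (\<Sum>w\<in>{1..n}. - (res t r w * scal k) * res t w v)"
    by (intro sum.cong refl arg_cong2[where f = times] 0)
  also have "\<dots> = - scal k * (\<Sum>u\<in>{1..n}. res t r u * res t u v)"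
    by (simp add: sum_distrib_left sum_negf scal_central[of k, symmetric] mult.assoc)
  finally show ?thesis .
qed

end

section \<open>Bilinear elements of the Weyl superalgebra\<close>

lemma sum_times: "(\<Sum>q\<in>A \<times> B. f q) = (\<Sum>r\<in>A. \<Sum>u\<in>B. f (r, u))"
  using sum.cartesian_product[of "\<lambda>x y. f (x, y)" B A] by simp

lemma sum_pairs_delta:
  assumes "finite K"
  shows "(\<Sum>q\<in>K \<times> K. \<Sum>q'\<in>K \<times> K. if snd q' = fst q then h (fst q') (fst q) (snd q) else 0)
       = (\<Sum>q\<in>K \<times> K. \<Sum>r\<in>K. h (fst q) r (snd q))"
proof -
  have "(\<Sum>q\<in>K \<times> K. \<Sum>q'\<in>K \<times> K. if snd q' = fst q then h (fst q') (fst q) (snd q) else 0)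
      = (\<Sum>r\<in>K. \<Sum>u\<in>K. \<Sum>i\<in>K. \<Sum>j\<in>K. if j = r then h i r u else 0)"
    by (simp add: sum_times cong: if_cong)
  also have "\<dots> = (\<Sum>r\<in>K. \<Sum>u\<in>K. \<Sum>i\<in>K. h i r u)"
    using assms by (intro sum.cong refl) simp
  also have "\<dots> = (\<Sum>i\<in>K. \<Sum>u\<in>K. \<Sum>r\<in>K. h i r u)"
  proof -
    have "(\<Sum>r\<in>K. \<Sum>u\<in>K. \<Sum>i\<in>K. h i r u) = (\<Sum>r\<in>K. \<Sum>i\<in>K. \<Sum>u\<in>K. h i r u)"
      by (intro sum.cong refl sum.swap)
    also have "\<dots> = (\<Sum>i\<in>K. \<Sum>r\<in>K. \<Sum>u\<in>K. h i r u)" by (rule sum.swap)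
    also have "\<dots> = (\<Sum>i\<in>K. \<Sum>u\<in>K. \<Sum>r\<in>K. h i r u)" by (intro sum.cong refl sum.swap)
    finally show ?thesis .
  qed
  finally show ?thesis by (simp add: sum_times)
qed

text \<open>Scalars are central, and A and every B q commute with R, so only the commutators of B
  with C and of A with C survive. The lemma serves two purposes: the normally ordered columns
  commute with each other, and the difference between a multiplication and its normal order
  satisfies the Manin condition.\<close>

lemma op_commutator:
  fixes A R :: "'a::calg \<Rightarrow> 'a"
  assumes add: "additive A" "additive R" "\<And>q. additive (B q)" "\<And>q. additive (C q)"
    and lin: "\<And>c y. A (scal c * y) = scal c * A y" "\<And>c y. R (scal c * y) = scal c * R y"
      "\<And>c q y. B q (scal c * y) = scal c * B q y" "\<And>c q y. C q (scal c * y) = scal c * C q y"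
    and AR: "\<And>y. A (R y) = R (A y)" and BR: "\<And>q y. B q (R y) = R (B q y)"
    and f: "\<And>y. f y = (if u then A y else 0) - scal w0 * y - (\<Sum>q\<in>I. B q y)"
    and m: "\<And>y. m y = (if v then R y else 0) - scal w * y - (\<Sum>q\<in>I. C q y)"
  shows "f (m y) - m (f y) = (\<Sum>q\<in>I. \<Sum>q'\<in>I. B q (C q' y) - C q' (B q y))
     - (if u then \<Sum>q\<in>I. A (C q y) - C q (A y) else 0)"
proof -
  note D = additive_diff[OF add(1)] additive_diff[OF add(2)] additive_diff[OF add(3)] additive_diff[OF add(4)]
    additive_sum[OF add(1)] additive_sum[OF add(2)] additive_sum[OF add(3)] additive_sum[OF add(4)]
    additive_uminus[OF add(1)] additive_uminus[OF add(2)] additive_uminus[OF add(3)] additive_uminus[OF add(4)]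
    additive_0[OF add(1)] additive_0[OF add(2)] additive_0[OF add(3)] additive_0[OF add(4)]
  have sw: "(\<Sum>q'\<in>I. \<Sum>q\<in>I. C q' (B q y)) = (\<Sum>q\<in>I. \<Sum>q'\<in>I. C q' (B q y))" by (rule sum.swap)
  have ww: "scal w0 * (scal w * y) = scal w * (scal w0 * y)" by (simp add: scal_scal mult.commute)
  show ?thesis
    by (cases u; cases v)
       (simp_all add: f m D lin AR BR sum_subtractf sum_negf sum_distrib_left right_diff_distrib ww sw)
qed

text \<open>All four exchanges carry the same sign \<sigma>, so the signs cancel in pairs and only
  the two contractions remain.\<close>

lemma bilinear_commutator:
  fixes a b c e \<sigma> :: "'a::ring_1"
  assumes "\<sigma> = 1 \<or> \<sigma> = - 1"
    and "b * c = \<sigma> * (c * b) - \<delta>1" "e * a = \<sigma> * (a * e) - \<delta>2" "a * c = \<sigma> * (c * a)" "b * e = \<sigma> * (e * b)"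
    and \<delta>: "\<delta>1 = 0 \<or> \<delta>1 = 1" "\<delta>2 = 0 \<or> \<delta>2 = 1"
  shows "a * b * (c * e) - c * e * (a * b) = \<delta>2 * (c * b) - \<delta>1 * (a * e)"
proof -
  have s: "\<sigma> * x = x * \<sigma>" "\<sigma> * (\<sigma> * x) = x" for x using assms(1) by auto
  have d: "\<delta>1 * x = x * \<delta>1" "\<delta>2 * x = x * \<delta>2" for x using \<delta> by auto
  have "a * b * (c * e) = a * (b * c) * e" by (simp add: mult.assoc)
  also have "\<dots> = \<sigma> * ((a * c) * (b * e)) - \<delta>1 * (a * e)"
    unfolding assms(2) by (simp add: algebra_simps d s(1))
  also have "(a * c) * (b * e) = c * a * (e * b)"
    unfolding assms(4,5) using assms(1) by auto
  finally have 1: "a * b * (c * e) = \<sigma> * (c * a * (e * b)) - \<delta>1 * (a * e)" .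
  have "c * e * (a * b) = c * (e * a) * b" by (simp add: mult.assoc)
  also have "\<dots> = \<sigma> * (c * a * (e * b)) - \<delta>2 * (c * b)"
    unfolding assms(3) by (simp add: algebra_simps d s(1))
  finally show ?thesis unfolding 1 by simp
qed

lemma commutator_expand:
  fixes A C :: "'a::calg"
  shows "(A - scal w - Y) * (C - scal w' - V) - (C - scal w' - V) * (A - scal w - Y)
     = (A * C - C * A) - (A * V - V * A) + (C * Y - Y * C) + (Y * V - V * Y)"
  by (simp add: algebra_simps scal_central[of w C] scal_central[of w V] scal_central[of w' A] scal_central[of w' Y]
      scal_central[of w "scal w'"])

text \<open>Flavours 1..N with parities \<open>s\<close> and colours 1..d. Z is the Jordan matrix of
  the flavours and W that of the colours; they enter through triangularity and, for Z, through the
  fact that it joins only flavours of equal parity.\<close>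

locale super_weyl = resolvent Z for Z :: "nat \<Rightarrow> nat \<Rightarrow> complex" +
  fixes N d :: nat and s :: "nat \<Rightarrow> bool" and X P :: "nat \<Rightarrow> nat \<Rightarrow> 'a::calg" and W :: "nat \<Rightarrow> nat \<Rightarrow> complex"
  assumes XX: "\<And>i j a b. i \<in> {1..N} \<Longrightarrow> j \<in> {1..N} \<Longrightarrow> a \<in> {1..d} \<Longrightarrow> b \<in> {1..d} \<Longrightarrow>
      X i a * X j b = (if s i \<and> s j then - 1 else 1) * (X j b * X i a)"
    and PP: "\<And>i j a b. i \<in> {1..N} \<Longrightarrow> j \<in> {1..N} \<Longrightarrow> a \<in> {1..d} \<Longrightarrow> b \<in> {1..d} \<Longrightarrow>
      P i a * P j b = (if s i \<and> s j then - 1 else 1) * (P j b * P i a)"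
    and PX: "\<And>i j a b. i \<in> {1..N} \<Longrightarrow> j \<in> {1..N} \<Longrightarrow> a \<in> {1..d} \<Longrightarrow> b \<in> {1..d} \<Longrightarrow>
      P i a * X j b = (if s i \<and> s j then - 1 else 1) * (X j b * P i a) + (if i = j \<and> a = b then 1 else 0)"
    and parity: "\<And>i j. Z i j \<noteq> 0 \<Longrightarrow> s i = s j"
    and W_triangular: "\<And>a b. b < a \<Longrightarrow> W a b = 0"
begin

abbreviation "x i a \<equiv> psd_const (X i a)"
abbreviation "p i a \<equiv> psd_const (P i a)"
text \<open>With this sign the contraction in \<open>xh_p\<close> is - 1 for both parities, which
  frees the relations of \<open>bil\<close> from signs.\<close>

abbreviation "xh i a \<equiv> (if s i then - x i a else x i a)"
abbreviation "sg i j \<equiv> (if s i \<and> s j then - 1 else 1 :: 'a psd)"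

lemma sg: "sg i j = 1 \<or> sg i j = - 1" by simp

lemma x_x: "i \<in> {1..N} \<Longrightarrow> j \<in> {1..N} \<Longrightarrow> a \<in> {1..d} \<Longrightarrow> b \<in> {1..d} \<Longrightarrow> x i a * x j b = sg i j * (x j b * x i a)"
  using arg_cong[OF XX[of i j a b], of psd_const] by (auto simp: psd_const_mult psd_const_uminus)

lemma p_p: "i \<in> {1..N} \<Longrightarrow> j \<in> {1..N} \<Longrightarrow> a \<in> {1..d} \<Longrightarrow> b \<in> {1..d} \<Longrightarrow> p i a * p j b = sg i j * (p j b * p i a)"
  using arg_cong[OF PP[of i j a b], of psd_const] by (auto simp: psd_const_mult psd_const_uminus)

lemma p_x: "i \<in> {1..N} \<Longrightarrow> j \<in> {1..N} \<Longrightarrow> a \<in> {1..d} \<Longrightarrow> b \<in> {1..d} \<Longrightarrow>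
    p i a * x j b = sg i j * (x j b * p i a) + (if i = j \<and> a = b then 1 else 0)"
  using arg_cong[OF PX[of i j a b], of psd_const] by (auto simp: psd_const_mult psd_const_uminus psd_const_add psd_const_diff)

lemma xh_xh: "i \<in> {1..N} \<Longrightarrow> j \<in> {1..N} \<Longrightarrow> a \<in> {1..d} \<Longrightarrow> b \<in> {1..d} \<Longrightarrow> xh i a * xh j b = sg i j * (xh j b * xh i a)"
  using x_x[of i j a b] by auto

lemma xh_p: "i \<in> {1..N} \<Longrightarrow> j \<in> {1..N} \<Longrightarrow> a \<in> {1..d} \<Longrightarrow> b \<in> {1..d} \<Longrightarrow>
    xh i a * p j b = sg i j * (p j b * xh i a) - (if i = j \<and> a = b then 1 else 0)"
  using p_x[of j i b a] by auto

abbreviation "idx k \<equiv> {1..k} \<times> {1..k::nat}"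

text \<open>For K the resolvent of Z in z and all flavours included, this is the sum of all
  fractions in one entry of the gl_d matrix, as \<open>frac_sum_gamma\<close> shows.\<close>

definition bil :: "nat \<Rightarrow> (nat \<Rightarrow> nat \<Rightarrow> 'a psd) \<Rightarrow> nat \<Rightarrow> nat \<Rightarrow> 'a psd" where
  "bil k K a b = (\<Sum>q\<in>idx k. K (fst q) (snd q) * (p (fst q) a * xh (snd q) b))"

definition kk :: "nat \<Rightarrow> (nat \<Rightarrow> nat \<Rightarrow> 'a psd) \<Rightarrow> nat \<Rightarrow> nat \<Rightarrow> 'a psd" where
  "kk k K r v = (\<Sum>u\<in>{1..k}. K r u * K u v)"

text \<open>What the resolvents in z and in d have in common. The commutator with the other variable
  is handled separately by \<open>res_derivation\<close>.\<close>

definition kernel :: "(nat \<Rightarrow> nat \<Rightarrow> 'a psd) \<Rightarrow> bool" where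
  "kernel K \<longleftrightarrow> (\<forall>r u w. K r u * psd_const w = psd_const w * K r u) \<and> (\<forall>r u i j. K r u * K i j = K i j * K r u)
     \<and> (\<forall>r u. s r \<noteq> s u \<longrightarrow> K r u = 0)"

lemma kernelD:
  assumes "kernel K"
  shows "K r u * psd_const w = psd_const w * K r u" "K r u * K i j = K i j * K r u" "s r \<noteq> s u \<Longrightarrow> K r u = 0"
  using assms unfolding kernel_def by auto

lemma kernel_xh: "kernel K \<Longrightarrow> K r u * xh i a = xh i a * K r u"
  by (simp add: kernelD)

lemma kernel_res:
  assumes t: "\<And>c. unit (t - scal c)" "\<And>w. t * psd_const w = psd_const w * t"
  shows "kernel (res t)"
  unfolding kernel_def
proof (intro conjI allI impI)
  show 1: "res t r u * psd_const w = psd_const w * res t r u" for r u w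
    by (rule res_commute[OF t])
  have "res t i j * t = t * res t i j" for i j by (rule res_commute[OF t(1)]) simp
  then show "res t r u * res t i j = res t i j * res t r u" for r u i j
    by (intro res_commute[OF t(1)]) simp
  show "res t r u = 0" if "s r \<noteq> s u" for r u
    by (rule res_parity[OF _ that]) (rule parity)
qed

lemma kernel_z: "kernel (res psd_z)" and kernel_d: "kernel (res psd_d)"
  by (rule kernel_res; simp add: unit_z_scal psd_const_z psd_const_d)+

text \<open>The relations of gl_d: contracting the inner generators of two bilinear elements
  multiplies their kernels. Since kernels join equal parities, each summand is even and no signs
  appear.\<close>

lemma bil_commutator:
  assumes K: "kernel K" and k: "k \<le> N" and ab: "a \<in> {1..d}" "b \<in> {1..d}" "c \<in> {1..d}" "e \<in> {1..d}"
  shows "bil k K a b * bil k K c e - bil k K c e * bil k K a b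
     = (if a = e then bil k (kk k K) c b else 0) - (if b = c then bil k (kk k K) a e else 0)"
proof -
  have el: "K r u * (p r a * xh u b) * (K i j * (p i c * xh j e)) - K i j * (p i c * xh j e) * (K r u * (p r a * xh u b))
    = (if j = r then if a = e then K i r * K r u * (p i c * xh u b) else 0 else 0)
      - (if u = i then if b = c then K r u * K u j * (p r a * xh j e) else 0 else 0)"
    if "r \<in> {1..k}" "u \<in> {1..k}" "i \<in> {1..k}" "j \<in> {1..k}" for r u i j
  proof (cases "s r = s u \<and> s i = s j")
    case True
    have m: "r \<in> {1..N}" "u \<in> {1..N}" "i \<in> {1..N}" "j \<in> {1..N}" using that k by auto
    have c: "p r a * xh u b * K i j = K i j * (p r a * xh u b)" "p i c * xh j e * K r u = K r u * (p i c * xh j e)"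
      by (simp_all only: mult.assoc kernel_xh[OF K, symmetric]) (simp_all only: mult.assoc[symmetric] kernelD(1)[OF K])
    have "K r u * (p r a * xh u b) * (K i j * (p i c * xh j e)) - K i j * (p i c * xh j e) * (K r u * (p r a * xh u b))
        = K r u * K i j * ((p r a * xh u b) * (p i c * xh j e)) - K i j * K r u * ((p i c * xh j e) * (p r a * xh u b))"
      by (simp only: mult.assoc[symmetric]) (simp only: mult.assoc[of "K _ _"] c)
    also have "\<dots> = K r u * K i j * (p r a * xh u b * (p i c * xh j e) - p i c * xh j e * (p r a * xh u b))"
      by (simp only: kernelD(2)[OF K, of i j r u] right_diff_distrib)
    also have "p r a * xh u b * (p i c * xh j e) - p i c * xh j e * (p r a * xh u b)
        = (if j = r \<and> e = a then 1 else 0) * (p i c * xh u b) - (if u = i \<and> b = c then 1 else 0) * (p r a * xh j e)"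
      by (rule bilinear_commutator[OF sg[of u i]])
         (use xh_p[OF m(2,3) ab(2,3)] xh_p[OF m(4,1) ab(4,1)] p_p[OF m(1,3) ab(1,3)] xh_xh[OF m(2,4) ab(2,4)] True in auto)
    finally show ?thesis
      using kernelD(2)[OF K, of r u i r] kernelD(2)[OF K, of r i i r] by (simp add: right_diff_distrib)
  qed (use kernelD(3)[OF K] in auto)
  have "bil k K a b * bil k K c e - bil k K c e * bil k K a b
    = (\<Sum>q\<in>idx k. \<Sum>q'\<in>idx k. K (fst q) (snd q) * (p (fst q) a * xh (snd q) b) * (K (fst q') (snd q') * (p (fst q') c * xh (snd q') e))
       - K (fst q') (snd q') * (p (fst q') c * xh (snd q') e) * (K (fst q) (snd q) * (p (fst q) a * xh (snd q) b)))"
    unfolding bil_def sum_product sum_subtractf by (subst (3) sum.swap) (rule refl)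
  also have "\<dots> = (\<Sum>q\<in>idx k. \<Sum>q'\<in>idx k. (if snd q' = fst q then if a = e then K (fst q') (fst q) * K (fst q) (snd q) * (p (fst q') c * xh (snd q) b) else 0 else 0)
      - (if snd q = fst q' then if b = c then K (fst q) (snd q) * K (snd q) (snd q') * (p (fst q) a * xh (snd q') e) else 0 else 0))"
    by (intro sum.cong refl el) auto
  also have "\<dots> = (\<Sum>q\<in>idx k. \<Sum>r\<in>{1..k}. if a = e then K (fst q) r * K r (snd q) * (p (fst q) c * xh (snd q) b) else 0)
      - (\<Sum>q\<in>idx k. \<Sum>r\<in>{1..k}. if b = c then K (fst q) r * K r (snd q) * (p (fst q) a * xh (snd q) e) else 0)"
  proof -
    have 2: "(\<Sum>q\<in>idx k. \<Sum>q'\<in>idx k. if snd q = fst q' then if b = c then K (fst q) (snd q) * K (snd q) (snd q') * (p (fst q) a * xh (snd q') e) else 0 else 0)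
      = (\<Sum>q'\<in>idx k. \<Sum>q\<in>idx k. if snd q = fst q' then if b = c then K (fst q) (fst q') * K (fst q') (snd q') * (p (fst q) a * xh (snd q') e) else 0 else 0)"
      by (subst sum.swap) (intro sum.cong refl, auto)
    show ?thesis
      unfolding sum_subtractf 2
      using sum_pairs_delta[of "{1..k}" "\<lambda>i r u. if a = e then K i r * K r u * (p i c * xh u b) else 0"]
        sum_pairs_delta[of "{1..k}" "\<lambda>i r u. if b = c then K i r * K r u * (p i a * xh u e) else 0"]
      by (simp only: finite_atLeastAtMost)
  qed
  also have "\<dots> = (if a = e then bil k (kk k K) c b else 0) - (if b = c then bil k (kk k K) a e else 0)"
    by (simp add: bil_def kk_def sum_distrib_right)
  finally show ?thesis .
qed

end

lemma sign_commute:
  fixes \<sigma> :: "'a::ring_1"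
  assumes "\<sigma> = 1 \<or> \<sigma> = - 1" "y * z = \<sigma> * (z * y)" "z * w = \<sigma> * (w * z)"
  shows "w * y * z = z * (w * y)"
proof -
  have "w * y * z = w * (\<sigma> * (z * y))" using assms(2) by (simp add: mult.assoc)
  also have "\<dots> = (\<sigma> * (w * z)) * y" using assms(1) by (auto simp: mult.assoc)
  finally show ?thesis unfolding assms(3)[symmetric] by (simp add: mult.assoc)
qed

section \<open>Adding one flavour\<close>

context super_weyl
begin

abbreviation "Gd \<equiv> res (psd_d :: 'a psd)"
abbreviation "Gz \<equiv> res (psd_z :: 'a psd)"

text \<open>The exchanged and transposed matrix, restricted to the first k flavours: z is on the
  diagonal and d in the resolvent.\<close>

definition T :: "nat \<Rightarrow> nat \<Rightarrow> nat \<Rightarrow> 'a psd" where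
  "T k a b = (if a = b then psd_z else 0) - scal (W b a) - bil k Gd a b"

lemma z_d: "psd_z * psd_d - psd_d * psd_z = (scal (- 1) :: 'a psd)"
  by (simp add: psd_d_z scal_minus)

lemma Gd_z: "r \<in> {1..k} \<Longrightarrow> v \<in> {1..k} \<Longrightarrow> psd_z * Gd r v - Gd r v * psd_z = kk k Gd r v"
  using res_derivation[OF unit_z_scal(2) z_d, of r k v] by (simp add: kk_def scal_minus)

lemma Gd_d: "Gd r v * psd_d = psd_d * Gd r v"
  by (rule res_commute[OF unit_z_scal(2)]) simp

lemma xh_z: "xh i a * psd_z = psd_z * xh i a"
  and xh_d: "xh i a * psd_d = psd_d * xh i a"
  by (simp_all add: psd_const_z psd_const_d)

lemma bil_z: "psd_z * bil k Gd a b - bil k Gd a b * psd_z = bil k (kk k Gd) a b"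
proof -
  have "psd_z * (Gd r u * (p r a * xh u b)) - Gd r u * (p r a * xh u b) * psd_z = kk k Gd r u * (p r a * xh u b)"
    if "r \<in> {1..k}" "u \<in> {1..k}" for r u
  proof -
    have "p r a * xh u b * psd_z = psd_z * (p r a * xh u b)"
      by (simp only: mult.assoc xh_z) (simp only: mult.assoc[symmetric] psd_const_z)
    then have "psd_z * (Gd r u * (p r a * xh u b)) - Gd r u * (p r a * xh u b) * psd_z
      = (psd_z * Gd r u - Gd r u * psd_z) * (p r a * xh u b)"
      by (simp only: left_diff_distrib mult.assoc)
    then show ?thesis unfolding Gd_z[OF that] .
  qed
  note el = this
  show ?thesis
    unfolding bil_def sum_distrib_left sum_distrib_right sum_subtractf[symmetric]
    by (intro sum.cong refl el) auto
qed

text \<open>z differentiates the resolvent in d, which yields its square; the contractions yield the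
  square as well. This coincidence makes T a Manin matrix.\<close>

lemma T_commutator:
  assumes "k \<le> N" "a \<in> {1..d}" "b \<in> {1..d}" "c \<in> {1..d}" "e \<in> {1..d}"
  shows "T k a b * T k c e - T k c e * T k a b
     = (if c = e then bil k (kk k Gd) a b else 0) - (if a = b then bil k (kk k Gd) c e else 0)
       + (if a = e then bil k (kk k Gd) c b else 0) - (if b = c then bil k (kk k Gd) a e else 0)"
proof -
  have z: "(if u then psd_z else 0) * bil k Gd a b - bil k Gd a b * (if u then psd_z else 0) = (if u then bil k (kk k Gd) a b else 0)"
    for u a b by (simp add: bil_z)
  have "T k a b * T k c e - T k c e * T k a b
    = 0 - ((if a = b then psd_z else 0) * bil k Gd c e - bil k Gd c e * (if a = b then psd_z else 0))
      + ((if c = e then psd_z else 0) * bil k Gd a b - bil k Gd a b * (if c = e then psd_z else 0))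
      + (bil k Gd a b * bil k Gd c e - bil k Gd c e * bil k Gd a b)"
    unfolding T_def commutator_expand by simp
  then show ?thesis unfolding z bil_commutator[OF kernel_d assms] by simp
qed

lemma T_manin: "k \<le> N \<Longrightarrow> manin {1..d} {1..d} (T k)"
  unfolding manin_def
proof (intro ballI)
  fix a c b e assume k: "k \<le> N" and m: "a \<in> {1..d}" "c \<in> {1..d}" "b \<in> {1..d}" "e \<in> {1..d}"
  show "T k a b * T k c e - T k c e * T k a b = T k c b * T k a e - T k a e * T k c b"
    unfolding T_commutator[OF k m(1,3,2,4)] T_commutator[OF k m(2,3,1,4)] by simp
qed

text \<open>Column k + 1 of Z seen through the resolvent of the first k flavours. With it,
  \<open>Q k\<close>, \<open>xh (Suc k)\<close> and \<open>Ez k\<close> form a border of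
  \<open>T k\<close>, and eliminating the corner of the border gives
  \<open>T (Suc k)\<close>.\<close>

definition q :: "nat \<Rightarrow> nat \<Rightarrow> 'a psd" where
  "q k r = (\<Sum>t\<in>{1..k}. Gd r t * scal (Z t (Suc k)))"

definition Q :: "nat \<Rightarrow> nat \<Rightarrow> 'a psd" where
  "Q k a = p (Suc k) a + (\<Sum>r\<in>{1..k}. p r a * q k r)"

abbreviation "Ez k \<equiv> psd_d - scal (Z (Suc k) (Suc k)) :: 'a psd"

lemma q_const: "q k r * psd_const w = psd_const w * q k r"
proof -
  have "Gd r t * scal c * psd_const w = psd_const w * (Gd r t * scal c)" for t c
    by (simp only: mult.assoc scal_central[of c "psd_const w"]) (simp only: mult.assoc[symmetric] kernelD(1)[OF kernel_d])
  then show ?thesis unfolding q_def sum_distrib_left sum_distrib_right by simp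
qed

lemma q_Gd: "q k r * Gd i j = Gd i j * q k r"
proof -
  have "Gd r t * scal c * Gd i j = Gd i j * (Gd r t * scal c)" for t c
    by (simp only: mult.assoc scal_central[of c "Gd i j"]) (simp only: mult.assoc[symmetric] kernelD(2)[OF kernel_d, of r t])
  then show ?thesis unfolding q_def sum_distrib_left sum_distrib_right by simp
qed

lemma q_q: "q k r * q k i = q k i * q k r"
proof -
  have "q k r * (Gd i t * scal c) = Gd i t * scal c * q k r" for t c
    by (simp only: mult.assoc scal_central[of c "q k r"]) (simp only: mult.assoc[symmetric] q_Gd)
  then show ?thesis unfolding q_def[of k i] sum_distrib_left sum_distrib_right by simp
qed

lemma q_d: "q k r * psd_d = psd_d * q k r"
proof -
  have "Gd r t * scal c * psd_d = psd_d * (Gd r t * scal c)" for t c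
    by (simp only: mult.assoc scal_central[of c psd_d]) (simp only: mult.assoc[symmetric] Gd_d)
  then show ?thesis unfolding q_def sum_distrib_left sum_distrib_right by simp
qed

lemma q_parity: "s r \<noteq> s (Suc k) \<Longrightarrow> q k r = 0"
  unfolding q_def
proof (rule sum.neutral, rule ballI)
  fix t assume "s r \<noteq> s (Suc k)"
  then show "Gd r t * scal (Z t (Suc k)) = 0"
    using parity[of t "Suc k"] kernelD(3)[OF kernel_d, of r t] by (cases "Z t (Suc k) = 0") auto
qed

lemma q_z: "r \<in> {1..k} \<Longrightarrow> psd_z * q k r - q k r * psd_z = (\<Sum>u\<in>{1..k}. Gd r u * q k u)"
proof -
  assume r: "r \<in> {1..k}"
  have "psd_z * (Gd r t * scal c) - Gd r t * scal c * psd_z = (psd_z * Gd r t - Gd r t * psd_z) * scal c" for t c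
    by (simp only: mult.assoc scal_central[of c psd_z] left_diff_distrib)
  then have "psd_z * q k r - q k r * psd_z = (\<Sum>t\<in>{1..k}. kk k Gd r t * scal (Z t (Suc k)))"
    unfolding q_def sum_distrib_left sum_distrib_right sum_subtractf[symmetric]
    using Gd_z[OF r] by (intro sum.cong refl) auto
  also have "\<dots> = (\<Sum>u\<in>{1..k}. Gd r u * q k u)"
    unfolding kk_def q_def sum_distrib_left sum_distrib_right mult.assoc by (rule sum.swap)
  finally show ?thesis .
qed

lemma res_q: "r \<in> {1..k} \<Longrightarrow> Gd r (Suc k) = q k r * uinv (Ez k)"
  and res_corner: "Gd (Suc k) (Suc k) = uinv (Ez k)"
proof -
  assume r: "r \<in> {1..k}"
  have "(\<Sum>u\<in>{r..<Suc k}. Gd r u * scal (Z u (Suc k))) = q k r"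
    unfolding q_def by (rule sum.mono_neutral_left) (use r in \<open>auto simp: res_below\<close>)
  then show "Gd r (Suc k) = q k r * uinv (Ez k)" using r by (subst res.simps) auto
qed (subst res.simps, simp)

lemma bil_Suc: "bil (Suc k) Gd a b = bil k Gd a b + Q k a * uinv (Ez k) * xh (Suc k) b"
proof -
  have I: "{1..Suc k} = insert (Suc k) {1..k}" by auto
  have "bil (Suc k) Gd a b = (\<Sum>r\<in>{1..Suc k}. \<Sum>u\<in>{1..Suc k}. Gd r u * (p r a * xh u b))"
    by (simp add: bil_def sum_times cong: if_cong)
  also have "\<dots> = (\<Sum>r\<in>{1..Suc k}. (\<Sum>u\<in>{1..k}. Gd r u * (p r a * xh u b)) + Gd r (Suc k) * (p r a * xh (Suc k) b))"
    by (intro sum.cong refl) simp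
  also have "\<dots> = (\<Sum>r\<in>{1..k}. \<Sum>u\<in>{1..k}. Gd r u * (p r a * xh u b)) + (\<Sum>u\<in>{1..k}. Gd (Suc k) u * (p (Suc k) a * xh u b))
      + (\<Sum>r\<in>{1..Suc k}. Gd r (Suc k) * (p r a * xh (Suc k) b))"
    unfolding sum.distrib by (subst (1) I) simp
  also have "(\<Sum>u\<in>{1..k}. Gd (Suc k) u * (p (Suc k) a * xh u b)) = 0"
    by (rule sum.neutral) (auto simp: res_below)
  also have "(\<Sum>r\<in>{1..Suc k}. Gd r (Suc k) * (p r a * xh (Suc k) b)) = Q k a * uinv (Ez k) * xh (Suc k) b"
  proof -
    have e: "Gd r (Suc k) * (p r a * y) = p r a * Gd r (Suc k) * y" for r y
      by (simp only: mult.assoc[symmetric] kernelD(1)[OF kernel_d])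
    have "(\<Sum>r\<in>{1..k}. p r a * Gd r (Suc k) * xh (Suc k) b) = (\<Sum>r\<in>{1..k}. p r a * q k r) * uinv (Ez k) * xh (Suc k) b"
      unfolding sum_distrib_right by (intro sum.cong refl) (simp only: res_q mult.assoc)
    then show ?thesis unfolding e Q_def distrib_right by (subst I) (simp add: res_corner)
  qed
  finally show ?thesis by (simp add: bil_def sum_times cong: if_cong)
qed

lemma T_Suc: "T (Suc k) a b = T k a b - Q k a * uinv (Ez k) * xh (Suc k) b"
  by (simp add: T_def bil_Suc)

lemma bil_p:
  assumes k: "k \<le> N" and m: "r \<in> {1..N}" "a \<in> {1..d}" "b \<in> {1..d}" "c \<in> {1..d}"
  shows "bil k Gd a b * p r c - p r c * bil k Gd a b
     = - (if b = c \<and> r \<le> k then \<Sum>u\<in>{1..k}. Gd u r * p u a else 0)"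
proof -
  have el: "Gd i j * (p i a * xh j b) * p r c - p r c * (Gd i j * (p i a * xh j b)) = (if j = r then if b = c then - (Gd i j * p i a) else 0 else 0)"
    if "i \<in> {1..k}" "j \<in> {1..k}" for i j
  proof (cases "s i = s j")
    case True
    have ij: "i \<in> {1..N}" "j \<in> {1..N}" using that k by auto
    have "p r c * (Gd i j * (p i a * xh j b)) = Gd i j * (p r c * p i a * xh j b)"
      by (simp only: mult.assoc[symmetric] kernelD(1)[OF kernel_d, symmetric])
    moreover have "p i a * xh j b * p r c = p r c * p i a * xh j b - (if j = r \<and> b = c then p i a else 0)"
      using xh_p[OF ij(2) m(1,3,4)] p_p[OF ij(1) m(1,2,4)] True
      by (auto simp: mult.assoc right_diff_distrib) (auto simp: mult.assoc[symmetric])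
    ultimately show ?thesis by (simp add: mult.assoc right_diff_distrib)
  qed (use kernelD(3)[OF kernel_d] in auto)
  have "bil k Gd a b * p r c - p r c * bil k Gd a b
      = (\<Sum>i\<in>{1..k}. \<Sum>j\<in>{1..k}. Gd i j * (p i a * xh j b) * p r c - p r c * (Gd i j * (p i a * xh j b)))"
    by (simp add: bil_def sum_times sum_distrib_left sum_distrib_right sum_subtractf cong: if_cong)
  also have "\<dots> = (\<Sum>i\<in>{1..k}. \<Sum>j\<in>{1..k}. if j = r then if b = c then - (Gd i j * p i a) else 0 else 0)"
    by (intro sum.cong refl el)
  also have "\<dots> = - (if b = c \<and> r \<le> k then \<Sum>u\<in>{1..k}. Gd u r * p u a else 0)"
    using m(1) by (cases "b = c"; cases "r \<le> k") (auto simp: sum_negf)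
  finally show ?thesis .
qed

text \<open>Flavour k + 1 does not occur in \<open>bil k\<close>, so nothing is contracted, and the
  two signs cancel because the kernel joins equal parities.\<close>

lemma bil_xh:
  assumes k: "k < N" and m: "a \<in> {1..d}" "b \<in> {1..d}" "c \<in> {1..d}"
  shows "bil k Gd a b * xh (Suc k) c = xh (Suc k) c * bil k Gd a b"
proof -
  have el: "Gd i j * (p i a * xh j b) * xh (Suc k) c = xh (Suc k) c * (Gd i j * (p i a * xh j b))"
    if "i \<in> {1..k}" "j \<in> {1..k}" for i j
  proof (cases "s i = s j")
    case True
    have ij: "i \<in> {1..N}" "j \<in> {1..N}" "Suc k \<in> {1..N}" "Suc k \<noteq> i" using that k by auto
    have "xh (Suc k) c * (Gd i j * (p i a * xh j b)) = Gd i j * (xh (Suc k) c * (p i a * xh j b))"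
      by (simp only: mult.assoc[symmetric] kernel_xh[OF kernel_d])
    moreover have "p i a * xh j b * xh (Suc k) c = xh (Suc k) c * (p i a * xh j b)"
      by (rule sign_commute[OF sg[of j "Suc k"] xh_xh[OF ij(2,3) m(2,3)]])
         (use xh_p[OF ij(3,1) m(3,1)] True ij(4) in auto)
    ultimately show ?thesis by (simp add: mult.assoc)
  qed (use kernelD(3)[OF kernel_d] in auto)
  show ?thesis unfolding bil_def sum_distrib_left sum_distrib_right
    by (intro sum.cong refl el) auto
qed

lemma bil_d: "bil k Gd a b * psd_d = psd_d * bil k Gd a b"
proof -
  have "Gd i j * (p i a * xh j b) * psd_d = psd_d * (Gd i j * (p i a * xh j b))" for i j
    by (simp only: mult.assoc xh_d) (simp only: mult.assoc[symmetric] psd_const_d Gd_d)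
  then show ?thesis unfolding bil_def sum_distrib_left sum_distrib_right by simp
qed

lemma z_p_q: "r \<in> {1..k} \<Longrightarrow> psd_z * (p r c * q k r) - p r c * q k r * psd_z = p r c * (\<Sum>u\<in>{1..k}. Gd r u * q k u)"
proof -
  assume r: "r \<in> {1..k}"
  have "psd_z * (p r c * q k r) = p r c * (psd_z * q k r)" by (simp only: mult.assoc[symmetric] psd_const_z)
  then show ?thesis unfolding q_z[OF r, symmetric] by (simp add: right_diff_distrib mult.assoc)
qed

text \<open>The derivative of \<open>q\<close> with respect to d, caused by z, and the contraction
  with \<open>bil\<close> produce the same expression with a and c exchanged. This symmetry is what
  the border relations ask for.\<close>

lemma T_Q:
  assumes k: "k < N" and m: "a \<in> {1..d}" "b \<in> {1..d}" "c \<in> {1..d}"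
  shows "T k a b * Q k c - Q k c * T k a b
    = (if a = b then \<Sum>r\<in>{1..k}. p r c * (\<Sum>u\<in>{1..k}. Gd r u * q k u) else 0)
      + (if b = c then \<Sum>r\<in>{1..k}. p r a * (\<Sum>u\<in>{1..k}. Gd r u * q k u) else 0)"
proof -
  have z: "psd_z * Q k c - Q k c * psd_z = (\<Sum>r\<in>{1..k}. p r c * (\<Sum>u\<in>{1..k}. Gd r u * q k u))"
  proof -
    have "psd_z * Q k c - Q k c * psd_z = (\<Sum>r\<in>{1..k}. psd_z * (p r c * q k r) - p r c * q k r * psd_z)"
      by (simp add: Q_def distrib_left distrib_right sum_distrib_left sum_distrib_right sum_subtractf psd_const_z)
    also have "\<dots> = (\<Sum>r\<in>{1..k}. p r c * (\<Sum>u\<in>{1..k}. Gd r u * q k u))"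
      by (intro sum.cong refl z_p_q)
    finally show ?thesis .
  qed
  have b: "bil k Gd a b * Q k c - Q k c * bil k Gd a b
      = - (if b = c then \<Sum>r\<in>{1..k}. p r a * (\<Sum>u\<in>{1..k}. Gd r u * q k u) else 0)"
  proof -
    have qb: "q k r * bil k Gd a b = bil k Gd a b * q k r" for r
    proof -
      have "q k r * (Gd i j * (p i a * xh j b)) = Gd i j * (p i a * xh j b) * q k r" for i j
      proof -
        have "xh j b * q k r = q k r * xh j b" by (simp add: q_const)
        then show ?thesis
          by (simp only: mult.assoc) (simp only: mult.assoc[symmetric] q_const[symmetric] q_Gd)
      qed
      then show ?thesis unfolding bil_def sum_distrib_left sum_distrib_right by simp
    qed
    have "bil k Gd a b * Q k c - Q k c * bil k Gd a b
      = (bil k Gd a b * p (Suc k) c - p (Suc k) c * bil k Gd a b)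
        + (\<Sum>r\<in>{1..k}. (bil k Gd a b * p r c - p r c * bil k Gd a b) * q k r)"
      by (simp add: Q_def distrib_left distrib_right sum_distrib_left sum_distrib_right sum_subtractf left_diff_distrib mult.assoc qb)
    also have "\<dots> = (\<Sum>r\<in>{1..k}. - (if b = c then (\<Sum>u\<in>{1..k}. Gd u r * p u a) * q k r else 0))"
    proof -
      have "bil k Gd a b * p (Suc k) c - p (Suc k) c * bil k Gd a b = 0"
        using bil_p[of k "Suc k" a b c] k m by simp
      moreover have "(bil k Gd a b * p r c - p r c * bil k Gd a b) * q k r = - (if b = c then (\<Sum>u\<in>{1..k}. Gd u r * p u a) * q k r else 0)"
        if "r \<in> {1..k}" for r
        using bil_p[of k r a b c] that k m by simp
      ultimately show ?thesis by simp
    qed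
    also have "\<dots> = - (if b = c then \<Sum>r\<in>{1..k}. p r a * (\<Sum>u\<in>{1..k}. Gd r u * q k u) else 0)"
    proof -
      have "(\<Sum>r\<in>{1..k}. (\<Sum>u\<in>{1..k}. Gd u r * p u a) * q k r) = (\<Sum>r\<in>{1..k}. p r a * (\<Sum>u\<in>{1..k}. Gd r u * q k u))"
        unfolding kernelD(1)[OF kernel_d] sum_distrib_left sum_distrib_right mult.assoc by (rule sum.swap)
      then show ?thesis by (simp add: sum_negf)
    qed
    finally show ?thesis .
  qed
  have "T k a b * Q k c - Q k c * T k a b
    = ((if a = b then psd_z else 0) * Q k c - Q k c * (if a = b then psd_z else 0)) - (bil k Gd a b * Q k c - Q k c * bil k Gd a b)"
    by (simp add: T_def left_diff_distrib right_diff_distrib scal_central[of "W b a" "Q k c"])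
  then show ?thesis unfolding b using z by auto
qed

lemma xh_Q:
  assumes k: "k < N" and m: "a \<in> {1..d}" "b \<in> {1..d}"
  shows "xh (Suc k) b * Q k a = sg (Suc k) (Suc k) * (Q k a * xh (Suc k) b) - (if a = b then 1 else 0)"
proof -
  have K: "Suc k \<in> {1..N}" using k by simp
  have el: "xh (Suc k) b * (p r a * q k r) = sg (Suc k) (Suc k) * (p r a * q k r * xh (Suc k) b)" if "r \<in> {1..k}" for r
  proof (cases "s r = s (Suc k)")
    case True
    have r: "r \<in> {1..N}" "Suc k \<noteq> r" using that k by auto
    have qx: "q k r * xh (Suc k) b = xh (Suc k) b * q k r" by (simp add: q_const)
    have "xh (Suc k) b * (p r a * q k r) = sg (Suc k) (Suc k) * (p r a * (xh (Suc k) b * q k r))"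
      using xh_p[OF K r(1) m(2,1)] True r(2) by (auto simp: mult.assoc[symmetric])
    then show ?thesis unfolding qx[symmetric] by (simp add: mult.assoc)
  qed (use q_parity in auto)
  have "xh (Suc k) b * Q k a = xh (Suc k) b * p (Suc k) a + (\<Sum>r\<in>{1..k}. xh (Suc k) b * (p r a * q k r))"
    by (simp only: Q_def distrib_left sum_distrib_left)
  also have "(\<Sum>r\<in>{1..k}. xh (Suc k) b * (p r a * q k r)) = (\<Sum>r\<in>{1..k}. sg (Suc k) (Suc k) * (p r a * q k r * xh (Suc k) b))"
    by (intro sum.cong refl el)
  also have "xh (Suc k) b * p (Suc k) a = sg (Suc k) (Suc k) * (p (Suc k) a * xh (Suc k) b) - (if a = b then 1 else 0)"
    using xh_p[OF K K m(2,1)] by auto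
  finally show ?thesis
    by (simp only: Q_def distrib_left distrib_right sum_distrib_left sum_distrib_right) simp
qed

text \<open>By \<open>q_parity\<close> only even flavours contribute to \<open>Q k\<close>, and
  their momenta commute.\<close>

lemma Q_Q:
  assumes k: "k < N" and m: "a \<in> {1..d}" "b \<in> {1..d}" and e: "\<not> s (Suc k)"
  shows "Q k a * Q k b = Q k b * Q k a"
proof -
  define q' where "q' r = (if r = Suc k then 1 else q k r)" for r
  have Q: "Q k a = (\<Sum>r\<in>{1..Suc k}. p r a * q' r)" for a
  proof -
    have "(\<Sum>r\<in>{1..k}. p r a * q' r) = (\<Sum>r\<in>{1..k}. p r a * q k r)"
      by (rule sum.cong) (auto simp: q'_def)
    then show ?thesis by (simp add: Q_def q'_def)
  qed
  have el: "p r a * q' r * (p i b * q' i) = p i b * q' i * (p r a * q' r)" if "r \<in> {1..Suc k}" "i \<in> {1..Suc k}" for r i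
  proof (cases "s r \<or> s i")
    case True
    then have "q' r = 0 \<or> q' i = 0" using q_parity[of r k] q_parity[of i k] e by (auto simp: q'_def)
    then show ?thesis by auto
  next
    case False
    have c: "q' r * psd_const w = psd_const w * q' r" "q' r * q' i = q' i * q' r" for r i w
      by (simp_all add: q'_def q_const q_q)
    have pp: "p r a * p i b = p i b * p r a"
      using p_p[of r i a b] that k m False by auto
    have "p r a * q' r * (p i b * q' i) = p r a * p i b * (q' r * q' i)"
      by (simp only: mult.assoc) (simp only: mult.assoc[symmetric] c(1))
    also have "\<dots> = p i b * p r a * (q' i * q' r)" by (simp only: pp c(2))
    also have "\<dots> = p i b * q' i * (p r a * q' r)"
      by (simp only: mult.assoc) (simp only: mult.assoc[symmetric] c(1))
    finally show ?thesis .
  qed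
  show ?thesis unfolding Q sum_product
    by (subst (2) sum.swap) (intro sum.cong refl el)
qed

text \<open>The border row commutes with T and with the corner. What has to match is the commutator
  of T with the corner, which comes from [z, d] alone, and the contraction of the border row with
  the border column; both are a negative Kronecker delta.\<close>

lemma T_bordered:
  assumes k: "k < N"
  shows "bordered (s (Suc k)) {1..d} (T k) (Q k) (xh (Suc k)) (Ez k)"
proof -
  have K: "Suc k \<in> {1..N}" using k by simp
  have TX: "T k a b * xh (Suc k) c = xh (Suc k) c * T k a b" if "a \<in> {1..d}" "b \<in> {1..d}" "c \<in> {1..d}" for a b c
  proof -
    have "(if a = b then psd_z else 0) * xh (Suc k) c = xh (Suc k) c * (if a = b then psd_z else 0)"
      using xh_z[of "Suc k" c] by auto
    then show ?thesis
      unfolding T_def left_diff_distrib right_diff_distrib bil_xh[OF k that] scal_central[of _ "xh (Suc k) c"]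
      by (simp only:)
  qed
  have TE: "T k a b * Ez k - Ez k * T k a b = - (if a = b then 1 else 0)" for a b
  proof -
    have sc: "scal c * psd_d = psd_d * scal c" for c by (rule scal_central)
    have "T k a b * Ez k - Ez k * T k a b = T k a b * psd_d - psd_d * T k a b"
      by (simp add: left_diff_distrib right_diff_distrib scal_central[of _ "T k a b"])
    also have "\<dots> = - (if a = b then 1 else 0)"
      unfolding T_def using z_d by (simp add: left_diff_distrib right_diff_distrib sc bil_d scal_minus)
    finally show ?thesis .
  qed
  show ?thesis
    unfolding bordered_def
  proof (intro conjI ballI impI)
    show "manin {1..d} {1..d} (T k)" using k by (intro T_manin) simp
  next
    fix a b c assume m: "a \<in> {1..d}" "b \<in> {1..d}" "c \<in> {1..d}"
    show "T k a b * xh (Suc k) c - xh (Suc k) c * T k a b = xh (Suc k) b * T k a c - T k a c * xh (Suc k) b"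
      using TX[OF m] TX[OF m(1,3,2)] by (simp only: diff_self)
    show "T k a b * Q k c - Q k c * T k a b = T k c b * Q k a - Q k a * T k c b"
      unfolding T_Q[OF k m] T_Q[OF k m(3,2,1)] by (auto simp: add.commute)
  next
    fix a b assume m: "a \<in> {1..d}" "b \<in> {1..d}" and o: "\<not> s (Suc k)"
    show "T k a b * Ez k - Ez k * T k a b = xh (Suc k) b * Q k a - Q k a * xh (Suc k) b"
      unfolding TE xh_Q[OF k m] using o by simp
    show "Q k a * Q k b = Q k b * Q k a" by (rule Q_Q[OF k m o])
  next
    fix a assume m: "a \<in> {1..d}"
    show "Q k a * Ez k = Ez k * Q k a"
    proof -
      have "p r a * q k r * psd_d = psd_d * (p r a * q k r)" for r
        by (simp only: mult.assoc q_d) (simp only: mult.assoc[symmetric] psd_const_d)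
      then have "Q k a * psd_d = psd_d * Q k a"
        by (simp add: Q_def distrib_left distrib_right sum_distrib_left sum_distrib_right psd_const_d)
      then show ?thesis
        unfolding left_diff_distrib right_diff_distrib by (simp add: scal_central[of _ "Q k a"])
    qed
  next
    fix a b assume m: "a \<in> {1..d}" "b \<in> {1..d}" and o: "s (Suc k)"
    show "T k a b * Ez k - Ez k * T k a b = xh (Suc k) b * Q k a + Q k a * xh (Suc k) b"
      unfolding TE xh_Q[OF k m] using o by simp
    show "xh (Suc k) a * xh (Suc k) b = - (xh (Suc k) b * xh (Suc k) a)"
      using xh_xh[OF K K m] o by simp
  next
    fix a assume m: "a \<in> {1..d}"
    show "xh (Suc k) a * Ez k = Ez k * xh (Suc k) a"
      unfolding left_diff_distrib right_diff_distrib xh_d scal_central[of _ "xh (Suc k) a"] ..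
  qed
qed

end

section \<open>From the determinant to the Berezinian\<close>

lemma asum_cong_rows:
  assumes "\<And>b a x. b \<in> set js \<Longrightarrow> a \<in> set js \<Longrightarrow> C b a x = C' b a x"
  shows "asum js C v = asum js C' v"
proof -
  have "foldr (\<lambda>b. C b (\<sigma> b)) ks v = foldr (\<lambda>b. C' b (\<sigma> b)) ks v" if "\<sigma> permutes set js" "set ks \<subseteq> set js" for \<sigma> ks
    using that(2) by (induction ks) (auto simp: assms permutes_in_image[OF that(1)])
  then show ?thesis unfolding asum_def by simp
qed

lemma asum_normal_order_rows:
  fixes L m :: "'i \<Rightarrow> 'i \<Rightarrow> 'a::calg \<Rightarrow> 'a"
  assumes "distinct js" and L: "\<And>b a. additive (L b a)" and m: "\<And>b a. additive (m b a)"
    and comm: "\<And>b c a a' x. b \<noteq> c \<Longrightarrow> b \<in> set js \<Longrightarrow> c \<in> set js \<Longrightarrow> a \<in> set js \<Longrightarrow> a' \<in> set js \<Longrightarrow>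
       (L b a (m c a' x) - m b a (m c a' x)) - m c a' (L b a x - m b a x)
       = (L b a' (m c a x) - m b a' (m c a x)) - m c a (L b a' x - m b a' x)"
    and kill: "\<And>b a. b \<in> set js \<Longrightarrow> a \<in> set js \<Longrightarrow> L b a v = m b a v"
  shows "asum js L v = asum js m v"
proof -
  let ?L = "\<lambda>b a x. if a \<in> set js then L b a x else 0"
  let ?m = "\<lambda>b a x. if a \<in> set js then m b a x else 0"
  have "asum js ?L v = asum js ?m v"
  proof (rule asum_normal_order[OF assms(1)])
    show "additive (?L b a)" "additive (?m b a)" for b a
      using L m by (auto simp: additive_def)
    show "?L b a v = ?m b a v" if "b \<in> set js" for b a using kill that by simp
    fix b c a a' x assume "b \<noteq> c" "b \<in> set js" "c \<in> set js"
    then show "(?L b a (?m c a' x) - ?m b a (?m c a' x)) - ?m c a' (?L b a x - ?m b a x)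
       = (?L b a' (?m c a x) - ?m b a' (?m c a x)) - ?m c a (?L b a' x - ?m b a' x)"
      by (cases "a \<in> set js"; cases "a' \<in> set js") (simp_all add: comm additive_0[OF L] additive_0[OF m])
  qed
  moreover have "asum js L v = asum js ?L v" "asum js m v = asum js ?m v"
    by (rule asum_cong_rows; simp)+
  ultimately show ?thesis by simp
qed

lemma asum_transpose_rows:
  fixes m :: "'i \<Rightarrow> 'i \<Rightarrow> 'a::calg \<Rightarrow> 'a"
  assumes "distinct js" "set ks = set js" "distinct ks" and m: "\<And>b a. additive (m b a)"
    and comm: "\<And>b c a a' x. b \<in> set js \<Longrightarrow> c \<in> set js \<Longrightarrow> a \<in> set js \<Longrightarrow> a' \<in> set js \<Longrightarrow>
      m b a (m c a' x) = m c a' (m b a x)"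
  shows "asum js m v = asum ks (\<lambda>b a. m a b) v"
proof -
  let ?m = "\<lambda>b a x. if a \<in> set js \<and> b \<in> set js then m b a x else 0"
  have "asum js m v = asum js ?m v" by (rule asum_cong_rows) simp
  also have "\<dots> = asum ks (\<lambda>b a. ?m a b) v"
    by (rule asum_transpose[OF assms(1-3)]) (auto simp: comm additive_0[OF m])
  also have "\<dots> = asum ks (\<lambda>b a. m a b) v" by (rule asum_cong_rows) (simp add: assms(2))
  finally show ?thesis .
qed

lemma col_det_triangular:
  assumes "\<And>a b. a < b \<Longrightarrow> M a b = 0"
  shows "col_det [m..<n] M = prod_list (map (\<lambda>a. M a a) [m..<n])"
proof (induction "n - m" arbitrary: m)
  case (Suc k)
  then have "[m..<n] = m # [Suc m..<n]" by (simp add: upt_conv_Cons)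
  moreover have "col_det [Suc m..<n] M = prod_list (map (\<lambda>a. M a a) [Suc m..<n])"
    using Suc by (intro Suc.hyps) simp
  ultimately show ?case
    using col_det_first_pivot[of m "[Suc m..<n]" M] assms by simp
qed simp

lemma commute_uinv_shift:
  assumes t: "\<And>c. unit (t - scal c)" and y: "y * t = t * (y :: 'a::calg)"
  shows "uinv (t - scal c) * y = y * uinv (t - scal c)"
  by (rule uinv_commute[OF t]) (simp add: left_diff_distrib right_diff_distrib y scal_central[of _ y])

context super_weyl
begin

abbreviation "cs \<equiv> [1..<Suc d]"

lemma set_cs: "set cs = {1..d}" by auto

text \<open>The entries of the resolvent in d lie in \<open>psd_O\<close>, so T k differs from z
  times the identity by elements of \<open>psd_O\<close>; this provides the invertible pivots that
  \<open>bordered_det\<close> needs.\<close>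

lemma T_step:
  assumes k: "k < N"
  shows "\<exists>c. (\<forall>a\<in>{1..d}. (\<Sum>b\<in>{1..d}. T k a b * c b) = - Q k a) \<and>
    (if s (Suc k) then col_det cs (T (Suc k)) * (Ez k + (\<Sum>b\<in>{1..d}. xh (Suc k) b * c b)) = Ez k * col_det cs (T k)
     else col_det cs (T k) * (Ez k + (\<Sum>b\<in>{1..d}. xh (Suc k) b * c b)) = Ez k * col_det cs (T (Suc k)))"
proof -
  have GO: "Gd r u \<in> psd_O" for r u
    by (rule res_O) (rule unit_d_diff_O(2)[OF psd_O_scal])
  have xO: "psd_const w \<in> psd_O" for w by (rule psd_O_monom) auto
  have xhO: "xh i b \<in> psd_O" for i b using xO[of "X i b"] psd_O_uminus[OF xO[of "X i b"]] by simp
  have TO: "(if a = b then psd_z else 0) - T k a b \<in> psd_O" for a b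
  proof -
    have "(if a = b then psd_z else 0) - T k a b = scal (W b a) + bil k Gd a b" by (simp add: T_def)
    also have "\<dots> \<in> psd_O" unfolding bil_def by (intro psd_O_closed GO xO xhO)
    finally show ?thesis .
  qed
  have QO: "Q k a \<in> psd_O" for a
    unfolding Q_def q_def by (intro psd_O_closed GO xO)
  have EO: "psd_d - Ez k \<in> psd_O" using psd_O_scal by simp
  have M: "manin {1..d} {1..d} (\<lambda>a b. T k a b - Q k a * uinv (Ez k) * xh (Suc k) b)"
    using T_manin[of "Suc k"] k unfolding T_Suc by simp
  show ?thesis
    using bordered_det[of cs "s (Suc k)" "T k" "Q k" "xh (Suc k)" "Ez k", unfolded set_cs, OF _ T_bordered[OF k] TO QO xhO EO M]
    unfolding T_Suc[symmetric] by simp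
qed

text \<open>With H the transposed resolvent of W in z, this is the image of the matrix in the
  Berezinian, by \<open>BF_map\<close>.\<close>

definition M :: "(nat \<Rightarrow> nat \<Rightarrow> 'a psd) \<Rightarrow> nat \<Rightarrow> nat \<Rightarrow> 'a psd" where
  "M H i j = (if i = j then psd_d else 0) - scal (Z i j) - (\<Sum>b\<in>{1..d}. \<Sum>a\<in>{1..d}. xh i b * H b a * p j a)"

definition W_inverse :: "(nat \<Rightarrow> nat \<Rightarrow> 'a psd) \<Rightarrow> bool" where
  "W_inverse H \<longleftrightarrow> (\<forall>b\<in>{1..d}. \<forall>c\<in>{1..d}.
     (\<Sum>a\<in>{1..d}. H b a * ((if a = c then psd_z else 0) - scal (W c a))) = (if b = c then 1 else 0))"

text \<open>
  A null vector of the first \<open>k\<close> rows of \<open>M\<close>, obtained from the solution \<open>c\<close> of \<open>T c = - Q\<close> by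
  eliminating the flavours \<open>1, \<dots>, k\<close>.
\<close>

lemma M_vector:
  assumes H: "W_inverse H" and c: "\<And>a. a \<in> {1..d} \<Longrightarrow> (\<Sum>b\<in>{1..d}. T k a b * c b) = - Q k a"
  shows "\<exists>v. v (Suc k) = 1 \<and> (\<forall>i\<in>{1..Suc k}. (\<Sum>j\<in>{1..Suc k}. M H i j * v j)
     = (if i = Suc k then Ez k + (\<Sum>b\<in>{1..d}. xh (Suc k) b * c b) else 0))"
proof -
  \<comment> \<open>The right-hand side of the equations (d - Z) v = y for the flavours 1..k, once v
    has last component 1; the resolvent in d solves them.\<close>
  define y where "y t = scal (Z t (Suc k)) - (\<Sum>b\<in>{1..d}. xh t b * c b)" for t
  define v where "v j = (if j = Suc k then 1 else \<Sum>t\<in>{1..k}. Gd j t * y t)" for j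
  have I: "{1..Suc k} = insert (Suc k) {1..k}" by auto
  have vs: "(\<Sum>j\<in>{1..Suc k}. f j * v j) = f (Suc k) + (\<Sum>j\<in>{1..k}. f j * (\<Sum>t\<in>{1..k}. Gd j t * y t))" for f
  proof -
    have "(\<Sum>j\<in>{1..k}. f j * v j) = (\<Sum>j\<in>{1..k}. f j * (\<Sum>t\<in>{1..k}. Gd j t * y t))"
      by (rule sum.cong) (auto simp: v_def)
    then show ?thesis unfolding I by (subst sum.insert) (auto simp: v_def)
  qed
  \<comment> \<open>This is T c = - Q rewritten in terms of v. As H inverts z minus the transpose of
    W, applying H gives H p v = - c.\<close>
  have pv: "(\<Sum>j\<in>{1..Suc k}. p j a * v j) = - (\<Sum>b\<in>{1..d}. ((if a = b then psd_z else 0) - scal (W b a)) * c b)"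
    if a: "a \<in> {1..d}" for a
  proof -
    have b: "(\<Sum>j\<in>{1..k}. p j a * (\<Sum>t\<in>{1..k}. Gd j t * (\<Sum>b\<in>{1..d}. xh t b * c b))) = (\<Sum>b\<in>{1..d}. bil k Gd a b * c b)"
    proof -
      have "(\<Sum>j\<in>{1..k}. p j a * (\<Sum>t\<in>{1..k}. Gd j t * (\<Sum>b\<in>{1..d}. xh t b * c b)))
        = (\<Sum>j\<in>{1..k}. \<Sum>t\<in>{1..k}. \<Sum>b\<in>{1..d}. Gd j t * (p j a * xh t b) * c b)"
      proof -
        have "p j a * (Gd j t * w) = Gd j t * (p j a * w)" for j t w
          by (simp only: mult.assoc[symmetric] kernelD(1)[OF kernel_d])
        then show ?thesis by (simp only: sum_distrib_left mult.assoc)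
      qed
      also have "\<dots> = (\<Sum>j\<in>{1..k}. \<Sum>b\<in>{1..d}. \<Sum>t\<in>{1..k}. Gd j t * (p j a * xh t b) * c b)"
        by (intro sum.cong refl sum.swap)
      also have "\<dots> = (\<Sum>b\<in>{1..d}. \<Sum>j\<in>{1..k}. \<Sum>t\<in>{1..k}. Gd j t * (p j a * xh t b) * c b)"
        by (rule sum.swap)
      finally show ?thesis by (simp only: bil_def sum_times sum_distrib_right fst_conv snd_conv)
    qed
    have "(\<Sum>j\<in>{1..Suc k}. p j a * v j) = p (Suc k) a + (\<Sum>j\<in>{1..k}. p j a * (\<Sum>t\<in>{1..k}. Gd j t * scal (Z t (Suc k))))
        - (\<Sum>j\<in>{1..k}. p j a * (\<Sum>t\<in>{1..k}. Gd j t * (\<Sum>b\<in>{1..d}. xh t b * c b)))"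
      unfolding vs y_def by (simp only: right_diff_distrib sum_subtractf add_diff_eq)
    also have "\<dots> = Q k a - (\<Sum>b\<in>{1..d}. bil k Gd a b * c b)"
      unfolding b by (simp only: Q_def q_def)
    also have "\<dots> = - (\<Sum>b\<in>{1..d}. ((if a = b then psd_z else 0) - scal (W b a)) * c b)"
      using c[OF a] unfolding T_def by (simp add: left_diff_distrib[of _ "bil _ _ _ _"] sum_subtractf sum.distrib algebra_simps)
    finally show ?thesis .
  qed
  have Hpv: "(\<Sum>a\<in>{1..d}. H b a * (\<Sum>j\<in>{1..Suc k}. p j a * v j)) = - c b" if b: "b \<in> {1..d}" for b
  proof -
    have "(\<Sum>a\<in>{1..d}. H b a * (\<Sum>j\<in>{1..Suc k}. p j a * v j))
      = (\<Sum>a\<in>{1..d}. - (\<Sum>e\<in>{1..d}. H b a * ((if a = e then psd_z else 0) - scal (W e a)) * c e))"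
      by (intro sum.cong refl) (simp only: pv sum_distrib_left mult.assoc mult_minus_right)
    also have "\<dots> = - (\<Sum>e\<in>{1..d}. (\<Sum>a\<in>{1..d}. H b a * ((if a = e then psd_z else 0) - scal (W e a))) * c e)"
      unfolding sum_negf sum_distrib_right by (subst sum.swap) (rule refl)
    also have "\<dots> = - (\<Sum>e\<in>{1..d}. (if b = e then 1 else 0) * c e)"
      using H b unfolding W_inverse_def by simp
    also have "\<dots> = - c b" using b by (simp add: if_distrib[of "\<lambda>x. x * _"] cong: if_cong)
    finally show ?thesis .
  qed
  \<comment> \<open>Hence the bilinear part of M acts on v as - x c, and M v = (d - Z) v + x
    c.\<close>
  have MV: "(\<Sum>j\<in>{1..Suc k}. M H i j * v j) = (\<Sum>j\<in>{1..Suc k}. ((if i = j then psd_d else 0) - scal (Z i j)) * v j) + (\<Sum>b\<in>{1..d}. xh i b * c b)"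
    for i
  proof -
    have "(\<Sum>j\<in>{1..Suc k}. (\<Sum>b\<in>{1..d}. \<Sum>a\<in>{1..d}. xh i b * H b a * p j a) * v j)
      = (\<Sum>b\<in>{1..d}. xh i b * (\<Sum>a\<in>{1..d}. H b a * (\<Sum>j\<in>{1..Suc k}. p j a * v j)))"
    proof -
      have "(\<Sum>j\<in>{1..Suc k}. (\<Sum>b\<in>{1..d}. \<Sum>a\<in>{1..d}. xh i b * H b a * p j a) * v j)
        = (\<Sum>j\<in>{1..Suc k}. \<Sum>b\<in>{1..d}. \<Sum>a\<in>{1..d}. xh i b * (H b a * (p j a * v j)))"
        by (simp only: sum_distrib_right mult.assoc)
      also have "\<dots> = (\<Sum>b\<in>{1..d}. \<Sum>j\<in>{1..Suc k}. \<Sum>a\<in>{1..d}. xh i b * (H b a * (p j a * v j)))"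
        by (rule sum.swap)
      also have "\<dots> = (\<Sum>b\<in>{1..d}. \<Sum>a\<in>{1..d}. \<Sum>j\<in>{1..Suc k}. xh i b * (H b a * (p j a * v j)))"
        by (intro sum.cong refl sum.swap)
      finally show ?thesis by (simp only: sum_distrib_left)
    qed
    also have "\<dots> = (\<Sum>b\<in>{1..d}. - (xh i b * c b))"
      by (intro sum.cong refl) (simp only: Hpv mult_minus_right)
    finally show ?thesis unfolding M_def left_diff_distrib[of _ "sum _ _"] sum_subtractf[of "\<lambda>j. _ j * v j"] sum_negf by simp
  qed
  have "(\<Sum>j\<in>{1..Suc k}. ((if i = j then psd_d else 0) - scal (Z i j)) * v j) + (\<Sum>b\<in>{1..d}. xh i b * c b)
     = (if i = Suc k then Ez k + (\<Sum>b\<in>{1..d}. xh (Suc k) b * c b) else 0)" if i: "i \<in> {1..Suc k}" for i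
  proof (cases "i = Suc k")
    case True
    have "(\<Sum>j\<in>{1..k}. ((if i = j then psd_d else 0) - scal (Z i j)) * (\<Sum>t\<in>{1..k}. Gd j t * y t)) = 0"
      by (rule sum.neutral) (use True in \<open>auto simp: triangular\<close>)
    from this[unfolded True] show ?thesis unfolding vs True by simp
  next
    case False
    then have i': "i \<in> {1..k}" using i by auto
    have "(\<Sum>j\<in>{1..k}. ((if i = j then psd_d else 0) - scal (Z i j)) * (\<Sum>t\<in>{1..k}. Gd j t * y t))
      = (\<Sum>t\<in>{1..k}. (\<Sum>j\<in>{1..k}. ((if i = j then psd_d else 0) - scal (Z i j)) * Gd j t) * y t)"
      unfolding sum_distrib_left sum_distrib_right mult.assoc by (rule sum.swap)
    also have "\<dots> = (\<Sum>t\<in>{1..k}. (if i = t then 1 else 0) * y t)"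
      by (intro sum.cong refl arg_cong2[where f = times] res_left[OF unit_z_scal(2) i'])
    also have "\<dots> = y i" using i' by (simp add: if_distrib[of "\<lambda>x. x * _"] cong: if_cong)
    finally show ?thesis unfolding vs using False by (simp add: y_def)
  qed
  then have "\<forall>i\<in>{1..Suc k}. (\<Sum>j\<in>{1..Suc k}. M H i j * v j) = (if i = Suc k then Ez k + (\<Sum>b\<in>{1..d}. xh (Suc k) b * c b) else 0)"
    unfolding MV by blast
  then show ?thesis by (intro exI[of _ v]) (simp add: v_def)
qed

text \<open>The scalar function f. With t = z it conjugates \<open>L1\<close> into normal order;
  with t = d it collects the corners that are split off together with the flavours.\<close>

definition fpr :: "'a psd \<Rightarrow> nat \<Rightarrow> 'a psd" where
  "fpr t n = prod_list (map (\<lambda>i. if s i then uinv (t - scal (Z i i)) else t - scal (Z i i)) [1..<Suc n])"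

definition ber :: "(nat \<Rightarrow> nat \<Rightarrow> 'a psd) \<Rightarrow> nat \<Rightarrow> 'a psd" where
  "ber R n = prod_list (map (\<lambda>k. if s k then R k k else uinv (R k k)) [1..<Suc n])"

text \<open>\<open>R k\<close> is the last row of the inverse of the upper left k x k block, so
  \<open>R k k\<close> is the inverse of the k-th factor d_k of the Berezinian. A left inverse
  suffices; its existence is settled over the free algebra in
  \<open>berezinian_exists\<close>.\<close>

definition M_last_rows :: "(nat \<Rightarrow> nat \<Rightarrow> 'a psd) \<Rightarrow> (nat \<Rightarrow> nat \<Rightarrow> 'a psd) \<Rightarrow> bool" where
  "M_last_rows H R \<longleftrightarrow> (\<forall>k\<in>{1..N}. unit (R k k) \<and>
     (\<forall>j\<in>{1..k}. (\<Sum>i\<in>{1..k}. R k i * M H i j) = (if k = j then 1 else 0)))"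

text \<open>For each flavour, \<open>T_step\<close> compares the determinants of T (k + 1) and T k
  through one element \<delta>. Applying the last row of the inverse of the (k + 1)-block to M v =
  \<delta> e_(k+1) identifies \<delta> with the inverse of \<open>R (Suc k) (Suc k)\<close>, that
  is, with d_(k+1).\<close>

lemma det_ber:
  assumes H: "W_inverse H" and R: "M_last_rows H R"
  shows "n \<le> N \<Longrightarrow> fpr psd_d n * col_det cs (T n) = col_det cs (T 0) * ber R n"
proof (induction n)
  case 0
  then show ?case by (simp add: fpr_def ber_def)
next
  case (Suc k)
  then have k: "k < N" by simp
  let ?K = "Suc k"
  obtain c where c: "\<And>a. a \<in> {1..d} \<Longrightarrow> (\<Sum>b\<in>{1..d}. T k a b * c b) = - Q k a"
    and det: "if s ?K then col_det cs (T ?K) * (Ez k + (\<Sum>b\<in>{1..d}. xh ?K b * c b)) = Ez k * col_det cs (T k)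
     else col_det cs (T k) * (Ez k + (\<Sum>b\<in>{1..d}. xh ?K b * c b)) = Ez k * col_det cs (T ?K)"
    using T_step[OF k] by blast
  define \<delta> where "\<delta> = Ez k + (\<Sum>b\<in>{1..d}. xh ?K b * c b)"
  obtain v where v: "v ?K = 1" "\<And>i. i \<in> {1..?K} \<Longrightarrow> (\<Sum>j\<in>{1..?K}. M H i j * v j) = (if i = ?K then \<delta> else 0)"
    using M_vector[OF H c] unfolding \<delta>_def by blast
  have K: "?K \<in> {1..N}" using k by simp
  have u: "unit (R ?K ?K)" using R K unfolding M_last_rows_def by blast
  have "R ?K ?K * \<delta> = (\<Sum>i\<in>{1..?K}. R ?K i * (\<Sum>j\<in>{1..?K}. M H i j * v j))"
  proof -
    have "(\<Sum>i\<in>{1..?K}. R ?K i * (\<Sum>j\<in>{1..?K}. M H i j * v j)) = (\<Sum>i\<in>{1..?K}. R ?K i * (if i = ?K then \<delta> else 0))"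
      by (intro sum.cong refl arg_cong2[where f = times] v)
    then show ?thesis by (simp add: if_distrib[of "times _"] cong: if_cong)
  qed
  also have "\<dots> = (\<Sum>j\<in>{1..?K}. (\<Sum>i\<in>{1..?K}. R ?K i * M H i j) * v j)"
    unfolding sum_distrib_left sum_distrib_right mult.assoc by (rule sum.swap)
  also have "\<dots> = (\<Sum>j\<in>{1..?K}. (if ?K = j then 1 else 0) * v j)"
  proof -
    have "(\<Sum>i\<in>{1..?K}. R ?K i * M H i j) = (if ?K = j then 1 else 0)" if "j \<in> {1..?K}" for j
      using R K that unfolding M_last_rows_def by blast
    then show ?thesis by (intro sum.cong refl arg_cong2[where f = times])
  qed
  also have "\<dots> = 1" using v(1) by (simp add: if_distrib[of "\<lambda>x. x * _"] cong: if_cong)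
  finally have \<delta>: "\<delta> = uinv (R ?K ?K)" using uinv_eqI_right[OF u] by simp
  have E: "unit (Ez k)" by (rule unit_z_scal)
  note IH = Suc.IH[OF less_imp_le[OF k]]
  show ?case
  proof (cases "s ?K")
    case True
    have "col_det cs (T ?K) * \<delta> = Ez k * col_det cs (T k)" using det True unfolding \<delta>_def by simp
    then have "col_det cs (T ?K) = Ez k * col_det cs (T k) * R ?K ?K"
      using uinv_cancel_right2[OF u, of "col_det cs (T ?K)"] unfolding \<delta> by simp
    then have "uinv (Ez k) * col_det cs (T ?K) = col_det cs (T k) * R ?K ?K"
      using uinv_left_cancel[OF E] by (simp add: mult.assoc)
    moreover have "fpr psd_d ?K = fpr psd_d k * uinv (Ez k)" "ber R ?K = ber R k * R ?K ?K"
      using True by (simp_all add: fpr_def ber_def)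
    ultimately show ?thesis using IH by (simp add: mult.assoc del: upt_Suc) (simp add: mult.assoc[symmetric] del: upt_Suc)
  next
    case False
    have "Ez k * col_det cs (T ?K) = col_det cs (T k) * \<delta>" using det False unfolding \<delta>_def by simp
    moreover have "fpr psd_d ?K = fpr psd_d k * Ez k" "ber R ?K = ber R k * \<delta>"
      using False by (simp_all add: fpr_def ber_def \<delta>)
    ultimately show ?thesis using IH by (simp add: mult.assoc del: upt_Suc) (simp add: mult.assoc[symmetric] del: upt_Suc)
  qed
qed

lemma det_T0: "col_det cs (T 0) = prod_list (map (\<lambda>a. psd_z - scal (W a a)) cs)"
proof -
  have T0: "T 0 a b = (if a = b then psd_z else 0) - scal (W b a)" for a b by (simp add: T_def bil_def)
  show ?thesis
    by (subst col_det_triangular) (auto simp: T0 W_triangular simp del: upt_Suc)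
qed

end

section \<open>Normal ordering and the exchange\<close>

lemma swap_uinv_z: "psd_swap (uinv (psd_z - scal c) * x) = psd_swap x * uinv (psd_d - scal c)"
proof -
  let ?y = "uinv (psd_z - scal c) * x"
  have "psd_swap x = psd_swap ((psd_z - scal c) * ?y)"
    by (simp add: uinv_right_cancel[OF unit_z_scal(1)])
  also have "\<dots> = psd_swap ?y * (psd_d - scal c)"
    by (simp only: left_diff_distrib right_diff_distrib swap_diff swap_z_mult swap_scal_mult scal_central[of c "psd_swap ?y"])
  finally show ?thesis by (simp add: uinv_cancel_right1[OF unit_z_scal(2)])
qed

lemma commutator_uinv:
  assumes u: "unit a" and k: "y * a - a * y = k" and c: "k * uinv a = uinv a * k"
  shows "y * uinv a - uinv a * y = - (k * (uinv a * uinv a))"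
proof -
  have "uinv a * (y * a - a * y) * uinv a = uinv a * y - y * uinv a"
    by (simp add: left_diff_distrib right_diff_distrib mult.assoc uinv_right[OF u] uinv_left_cancel[OF u])
  moreover have "uinv a * (y * a - a * y) * uinv a = k * (uinv a * uinv a)"
    unfolding k c[symmetric] by (simp add: mult.assoc)
  ultimately show ?thesis by simp
qed

lemma sum_diag: "finite K \<Longrightarrow> (\<Sum>q\<in>K \<times> K. if snd q = fst q then g (fst q) else 0) = (\<Sum>r\<in>K. g r)"
  by (simp add: sum_times cong: if_cong)

context super_weyl
begin

definition nbil :: "(nat \<Rightarrow> nat \<Rightarrow> 'a psd) \<Rightarrow> nat \<Rightarrow> nat \<Rightarrow> 'a psd" where
  "nbil K a b = (\<Sum>q\<in>idx N. x (snd q) b * (p (fst q) a * K (fst q) (snd q)))"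

definition str :: "'a psd \<Rightarrow> nat \<Rightarrow> 'a psd" where
  "str t n = (\<Sum>i\<in>{1..n}. if s i then - uinv (t - scal (Z i i)) else uinv (t - scal (Z i i)))"

lemma res_diag: "res t r r = uinv (t - scal (Z r r))"
  by (subst res.simps) simp

text \<open>Reordering contracts only equal flavours of equal colour, and the diagonal entries of
  the triangular resolvent are (t - Z r r)^-1. The signs of the contractions make the total a
  supertrace.\<close>

lemma bil_nbil:
  assumes K: "kernel (res t)" and m: "a \<in> {1..d}" "b \<in> {1..d}"
  shows "bil N (res t) a b = nbil (res t) a b + (if a = b then str t N else 0)"
proof -
  have el: "res t r u * (p r a * xh u b) = x u b * (p r a * res t r u)
      + (if u = r then if a = b then if s r then - uinv (t - scal (Z r r)) else uinv (t - scal (Z r r)) else 0 else 0)"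
    if "r \<in> {1..N}" "u \<in> {1..N}" for r u
  proof (cases "s r = s u")
    case True
    have c: "res t r u * (p r a * xh u b) = p r a * xh u b * res t r u"
    proof -
      have "res t r u * p r a = p r a * res t r u" "res t r u * xh u b = xh u b * res t r u"
        by (rule kernelD(1)[OF K] kernel_xh[OF K])+
      note cc = this
      have "res t r u * (p r a * xh u b) = p r a * res t r u * xh u b" by (simp only: mult.assoc[symmetric] cc(1))
      then show ?thesis by (simp only: mult.assoc cc(2))
    qed
    have px: "p r a * xh u b = x u b * p r a + (if u = r \<and> a = b then if s r then - 1 else 1 else 0)"
      using p_x[OF that m] True by (cases "s u") simp_all
    show ?thesis unfolding c unfolding px by (auto simp: distrib_right mult.assoc res_diag)
  next
    case False
    then have "res t r u = 0" "u \<noteq> r" using kernelD(3)[OF K, of r u] by auto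
    then show ?thesis by simp
  qed
  have "bil N (res t) a b = (\<Sum>q\<in>idx N. x (snd q) b * (p (fst q) a * res t (fst q) (snd q))
      + (if snd q = fst q then if a = b then if s (fst q) then - uinv (t - scal (Z (fst q) (fst q))) else uinv (t - scal (Z (fst q) (fst q))) else 0 else 0))"
    unfolding bil_def by (intro sum.cong refl el) auto
  also have "\<dots> = nbil (res t) a b + (\<Sum>r\<in>{1..N}. if a = b then if s r then - uinv (t - scal (Z r r)) else uinv (t - scal (Z r r)) else 0)"
    unfolding nbil_def sum.distrib
    using sum_diag[of "{1..N}" "\<lambda>r. if a = b then if s r then - uinv (t - scal (Z r r)) else uinv (t - scal (Z r r)) else 0"]
    by simp
  finally show ?thesis by (simp add: str_def)
qed

lemma fpr_commute:
  assumes t: "\<And>c. unit (t - scal c)" and y: "y * t = t * y"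
  shows "fpr t n * y = y * fpr t n"
proof (induction n)
  case (Suc n)
  have "uinv (t - scal c) * y = y * uinv (t - scal c)" for c by (rule commute_uinv_shift[OF t y])
  moreover have "(t - scal c) * y = y * (t - scal c)" for c
    by (simp add: left_diff_distrib right_diff_distrib y scal_central[of _ y])
  ultimately have "(if s (Suc n) then uinv (t - scal (Z (Suc n) (Suc n))) else t - scal (Z (Suc n) (Suc n))) * y
     = y * (if s (Suc n) then uinv (t - scal (Z (Suc n) (Suc n))) else t - scal (Z (Suc n) (Suc n)))" by auto
  moreover have "fpr t (Suc n) = fpr t n * (if s (Suc n) then uinv (t - scal (Z (Suc n) (Suc n))) else t - scal (Z (Suc n) (Suc n)))"
    by (simp add: fpr_def)
  ultimately show ?case using Suc by (simp only: mult.assoc) (simp only: mult.assoc[symmetric])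
qed (simp add: fpr_def)

text \<open>Logarithmic differentiation: each factor contributes its own term of \<open>str\<close>,
  and all factors commute.\<close>

lemma fpr_derivation:
  assumes t: "\<And>c. unit (t - scal c)" and y: "y * t - t * y = scal c"
  shows "y * fpr t n - fpr t n * y = scal c * (fpr t n * str t n)"
proof (induction n)
  case (Suc n)
  let ?z = "scal (Z (Suc n) (Suc n))"
  let ?u = "uinv (t - ?z)"
  have u: "unit (t - ?z)" by (rule t)
  have yz: "y * (t - ?z) - (t - ?z) * y = scal c"
    using y by (simp add: left_diff_distrib right_diff_distrib scal_central[of _ y])
  have yu: "y * ?u - ?u * y = - (scal c * (?u * ?u))"
    by (rule commutator_uinv[OF u yz scal_central])
  define e where "e = (if s (Suc n) then ?u else t - ?z)"
  define w where "w = (if s (Suc n) then - ?u else ?u)"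
  have e: "y * e - e * y = scal c * (e * w)"
    using yz yu uinv_right[OF u] by (auto simp: e_def w_def)
  have fs: "fpr t (Suc n) = fpr t n * e" "str t (Suc n) = str t n + w"
    by (simp_all add: fpr_def str_def e_def w_def)
  have ew: "str t n * e = e * str t n"
  proof -
    have te: "e * t = t * e" unfolding e_def
      using commute_uinv_shift[OF t, of t "Z (Suc n) (Suc n)"] scal_central[of "Z (Suc n) (Suc n)" t] by (auto simp: left_diff_distrib right_diff_distrib)
    have "uinv (t - scal c) * e = e * uinv (t - scal c)" for c by (rule commute_uinv_shift[OF t te])
    then show ?thesis unfolding str_def sum_distrib_left sum_distrib_right by (intro sum.cong refl) auto
  qed
  have "y * fpr t (Suc n) - fpr t (Suc n) * y = (y * fpr t n - fpr t n * y) * e + fpr t n * (y * e - e * y)"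
    unfolding fs by (simp add: left_diff_distrib right_diff_distrib mult.assoc)
  also have "\<dots> = scal c * (fpr t n * (str t n * e)) + scal c * (fpr t n * (e * w))"
    unfolding Suc e by (simp add: mult.assoc scal_left_commute[of "fpr t n"])
  also have "\<dots> = scal c * (fpr t (Suc n) * str t (Suc n))"
    unfolding fs ew by (simp add: distrib_left mult.assoc)
  finally show ?case .
qed (simp add: fpr_def str_def)

definition L1 :: "nat \<Rightarrow> nat \<Rightarrow> 'a psd" where
  "L1 a b = (if a = b then psd_d else 0) - scal (W a b) - bil N Gz b a"

definition Lt :: "nat \<Rightarrow> nat \<Rightarrow> 'a psd" where
  "Lt a b = (if a = b then psd_d else 0) - scal (W a b) - nbil Gz b a"

definition Tt :: "nat \<Rightarrow> nat \<Rightarrow> 'a psd" where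
  "Tt a b = (if a = b then psd_z else 0) - scal (W b a) - nbil Gd a b"

lemma nbil_fpr:
  assumes t: "\<And>c. unit (t - scal c)" "\<And>w. t * psd_const w = psd_const w * t"
  shows "nbil (res t) a b * fpr t n = fpr t n * nbil (res t) a b"
proof -
  have f: "fpr t n * psd_const w = psd_const w * fpr t n" for w by (rule fpr_commute[OF t(1)]) (simp add: t)
  have fl: "fpr t n * (psd_const w * y) = psd_const w * (fpr t n * y)" for w y
    by (simp only: mult.assoc[symmetric] f)
  have r: "fpr t n * res t r u = res t r u * fpr t n" for r u
    by (rule fpr_commute[OF t(1)]) (rule res_commute[OF t(1)], simp)
  have "x u b * (p v a * res t i j) * fpr t n = fpr t n * (x u b * (p v a * res t i j))" for u v i j
    by (simp only: mult.assoc r[symmetric] fl)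
  then show ?thesis unfolding nbil_def sum_distrib_left sum_distrib_right by simp
qed

text \<open>The commutator [d, f] = f str cancels the supertrace that separates \<open>bil\<close>
  from \<open>nbil\<close>.\<close>

lemma L1_conjugate: "col_det cs L1 * fpr psd_z N = fpr psd_z N * col_det cs Lt"
proof (rule col_det_conjugate)
  fix a b assume "a \<in> set cs" "b \<in> set cs"
  then have m: "b \<in> {1..d}" "a \<in> {1..d}" unfolding set_cs by auto
  let ?f = "fpr psd_z N"
  have dz: "psd_d * psd_z - psd_z * psd_d = (scal 1 :: 'a psd)" by (simp add: psd_d_z)
  have df: "psd_d * ?f - ?f * psd_d = ?f * str psd_z N"
    using fpr_derivation[OF unit_z_scal(1) dz] by simp
  have sf: "str psd_z N * ?f = ?f * str psd_z N"
  proof -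
    have zu: "psd_z * uinv (psd_z - scal c) = uinv (psd_z - scal c) * (psd_z :: 'a psd)" for c
      by (rule commute_uinv_shift[OF unit_z_scal(1), symmetric]) simp
    have "uinv (psd_z - scal c) * ?f = ?f * uinv (psd_z - scal c)" for c
      using fpr_commute[OF unit_z_scal(1) zu[symmetric], of N c] by simp
    then show ?thesis unfolding str_def sum_distrib_left sum_distrib_right by (intro sum.cong refl) auto
  qed
  have nf: "nbil Gz b a * ?f = ?f * nbil Gz b a"
    by (rule nbil_fpr[OF unit_z_scal(1)]) (simp add: psd_const_z)
  have "L1 a b * ?f = (if a = b then psd_d * ?f - str psd_z N * ?f else 0) - scal (W a b) * ?f - nbil Gz b a * ?f"
    unfolding L1_def bil_nbil[OF kernel_z m] by (simp add: left_diff_distrib distrib_right)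
  also have "\<dots> = ?f * Lt a b"
    unfolding nf sf Lt_def using df by (simp add: right_diff_distrib scal_central[of _ ?f] algebra_simps)
  finally show "L1 a b * ?f = ?f * Lt a b" .
qed

text \<open>Now z differentiates a function of d, with the opposite sign: [z, f] = - f str.
  Therefore f passes from the right of the normally ordered matrix to the left of
  \<open>T N\<close>.\<close>

lemma Tt_conjugate: "col_det cs Tt * fpr psd_d N = fpr psd_d N * col_det cs (T N)"
proof (rule col_det_conjugate)
  fix a b assume "a \<in> set cs" "b \<in> set cs"
  then have m: "a \<in> {1..d}" "b \<in> {1..d}" unfolding set_cs by auto
  let ?f = "fpr psd_d N"
  have zf: "psd_z * ?f - ?f * psd_z = - (?f * str psd_d N)"
    using fpr_derivation[OF unit_z_scal(2) z_d] by (simp add: scal_minus)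
  have nf: "nbil Gd a b * ?f = ?f * nbil Gd a b"
    by (rule nbil_fpr[OF unit_z_scal(2)]) (simp add: psd_const_d)
  have "?f * T N a b = (if a = b then ?f * psd_z - ?f * str psd_d N else 0) - ?f * scal (W b a) - ?f * nbil Gd a b"
    unfolding T_def bil_nbil[OF kernel_d m] by (simp add: right_diff_distrib distrib_left)
  also have "\<dots> = Tt a b * ?f"
    unfolding nf[symmetric] Tt_def using zf by (simp add: left_diff_distrib scal_central[of _ ?f] algebra_simps)
  finally show "Tt a b * ?f = ?f * T N a b" by simp
qed

text \<open>The entry in row a and column b in normal order: x and the resolvent in z multiply y
  from the left, p and d from the right. The exchange turns \<open>m1 a b\<close> into
  \<open>m2 b a\<close>.\<close>

definition m1 :: "nat \<Rightarrow> nat \<Rightarrow> 'a psd \<Rightarrow> 'a psd" where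
  "m1 b a y = (if a = b then y * psd_d else 0) - scal (W a b) * y
     - (\<Sum>q\<in>idx N. x (snd q) a * (Gz (fst q) (snd q) * (y * p (fst q) b)))"

definition m2 :: "nat \<Rightarrow> nat \<Rightarrow> 'a psd \<Rightarrow> 'a psd" where
  "m2 b a y = (if a = b then psd_z * y else 0) - scal (W b a) * y
     - (\<Sum>q\<in>idx N. x (snd q) b * (y * (p (fst q) a * Gd (fst q) (snd q))))"

lemma additive_m: "additive (m1 b a)" "additive (m2 b a)"
  unfolding additive_def m1_def m2_def by (auto simp: distrib_left distrib_right sum.distrib)

lemma Gz_c: "Gz r u * psd_const w = psd_const w * Gz r u"
  and Gd_c: "Gd r u * psd_const w = psd_const w * Gd r u"
  by (simp_all add: kernelD(1)[OF kernel_z] kernelD(1)[OF kernel_d])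

lemma Gz_par: "s r \<noteq> s u \<Longrightarrow> Gz r u = 0" and Gd_par: "s r \<noteq> s u \<Longrightarrow> Gd r u = 0"
  by (simp_all add: kernelD(3)[OF kernel_z] kernelD(3)[OF kernel_d])

lemma Gz_left: "Gz r u * (psd_const w * y) = psd_const w * (Gz r u * y)"
  and Gd_left: "Gd r u * (psd_const w * y) = psd_const w * (Gd r u * y)"
  by (simp_all only: mult.assoc[symmetric] Gz_c Gd_c)

lemma const_left: "psd_const w * (psd_z * y) = psd_z * (psd_const w * y)"
  "psd_const w * (psd_d * y) = psd_d * (psd_const w * y)"
  by (simp_all only: mult.assoc[symmetric] psd_const_z psd_const_d)

text \<open>Exchanging the two x on the left and the two p on the right gives the same sign twice;
  left and right multiplications do not interfere.\<close>

lemma m1_commute: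
  assumes m: "b \<in> {1..d}" "c \<in> {1..d}" "a \<in> {1..d}" "a' \<in> {1..d}"
  shows "m1 b a (m1 c a' y) = m1 c a' (m1 b a y)"
proof -
  have el: "x u a * (Gz r u * (x j a' * (Gz i j * (y * p i c)) * p r b)) = x j a' * (Gz i j * (x u a * (Gz r u * (y * p r b)) * p i c))"
    if "r \<in> {1..N}" "u \<in> {1..N}" "i \<in> {1..N}" "j \<in> {1..N}" for r u i j y
  proof (cases "s r = s u \<and> s i = s j")
    case True
    have xx: "x u a * (x j a' * w) = sg r i * (x j a' * (x u a * w))" for w
      using x_x[OF that(2,4) m(3,4)] True by (auto simp: mult.assoc[symmetric])
    have pp: "p i c * p r b = sg r i * (p r b * p i c)"
      using p_p[OF that(3,1) m(2,1)] by auto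
    have gg: "Gz r u * (Gz i j * w) = Gz i j * (Gz r u * w)" for w
      by (simp only: mult.assoc[symmetric] kernelD(2)[OF kernel_z, of r u])
    show ?thesis
      by (simp only: mult.assoc Gz_left xx pp gg) auto
  qed (auto simp: Gz_par)
  have "m1 b a (m1 c a' y) - m1 c a' (m1 b a y)
    = (\<Sum>q\<in>idx N. \<Sum>q'\<in>idx N. x (snd q) a * (Gz (fst q) (snd q) * (x (snd q') a' * (Gz (fst q') (snd q') * (y * p (fst q') c)) * p (fst q) b))
        - x (snd q') a' * (Gz (fst q') (snd q') * (x (snd q) a * (Gz (fst q) (snd q) * (y * p (fst q) b)) * p (fst q') c)))
      - (if a = b then \<Sum>q\<in>idx N. x (snd q) a' * (Gz (fst q) (snd q) * (y * p (fst q) c)) * psd_d - x (snd q) a' * (Gz (fst q) (snd q) * (y * psd_d * p (fst q) c)) else 0)"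
    by (rule op_commutator[where R = "\<lambda>y. y * psd_d"])
       (auto simp: additive_def distrib_left distrib_right mult.assoc psd_const_d m1_def scal_left_commute)
  also have "\<dots> = 0"
  proof -
    have "(\<Sum>q\<in>idx N. \<Sum>q'\<in>idx N. x (snd q) a * (Gz (fst q) (snd q) * (x (snd q') a' * (Gz (fst q') (snd q') * (y * p (fst q') c)) * p (fst q) b))
        - x (snd q') a' * (Gz (fst q') (snd q') * (x (snd q) a * (Gz (fst q) (snd q) * (y * p (fst q) b)) * p (fst q') c))) = 0"
      by (intro sum.neutral ballI) (subst el, auto)
    then show ?thesis by (simp add: mult.assoc psd_const_d)
  qed
  finally show ?thesis by simp
qed

text \<open>The difference contains y only through its commutators with d and with p, so it vanishes
  at y = 1. This is the starting condition of the normal ordering.\<close>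

lemma Lt_m1: "Lt a b * y - m1 b a y = (if a = b then psd_d * y - y * psd_d else 0) - scal 0 * y
      - (\<Sum>q\<in>idx N. x (snd q) a * (Gz (fst q) (snd q) * (p (fst q) b * y - y * p (fst q) b)))"
    by (simp add: Lt_def m1_def nbil_def left_diff_distrib right_diff_distrib sum_subtractf sum_distrib_right mult.assoc Gz_left)

text \<open>Commuting the difference of \<open>Lt\<close> and \<open>m1\<close> with a normally
  ordered column leaves two terms: a contraction of p with x and the derivative of the resolvent by
  d. Both contain the square of the resolvent, and their sum is symmetric in the two rows.\<close>

lemma Lt_normal: "col_det cs Lt = asum cs m1 1"
  unfolding col_det_def
proof (rule asum_normal_order_rows)
  show "additive (\<lambda>y. Lt a b * y)" "additive (m1 b a)" for a b by (rule additive_mult additive_m)+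
  show "Lt a b * 1 = m1 b a 1" for a b
    by (simp add: Lt_def m1_def nbil_def Gz_c[symmetric])
  fix b c a a' y assume bc: "b \<noteq> c" and "b \<in> set cs" "c \<in> set cs" "a \<in> set cs" "a' \<in> set cs"
  then have m: "b \<in> {1..d}" "c \<in> {1..d}" "a \<in> {1..d}" "a' \<in> {1..d}" unfolding set_cs by auto
  define F where "F a = (\<Sum>q\<in>idx N. x (snd q) a * (kk N Gz (fst q) (snd q) * (y * p (fst q) c)))" for a
  have *: "(Lt a b * m1 c a' y - m1 b a (m1 c a' y)) - m1 c a' (Lt a b * y - m1 b a y)
     = (if a' = b then F a else 0) + (if a = b then F a' else 0)" if m': "a \<in> {1..d}" "a' \<in> {1..d}" for a a'
  proof -
    let ?B = "\<lambda>q y. x (snd q) a * (Gz (fst q) (snd q) * (p (fst q) b * y - y * p (fst q) b))"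
    let ?C = "\<lambda>q y. x (snd q) a' * (Gz (fst q) (snd q) * (y * p (fst q) c))"
    have el: "x u a * (Gz r u * (p r b * (x j a' * (Gz i j * (y * p i c))) - x j a' * (Gz i j * (y * p i c)) * p r b))
        - x j a' * (Gz i j * (x u a * (Gz r u * (p r b * y - y * p r b)) * p i c))
      = (if j = r then if a' = b then x u a * (Gz i r * Gz r u * (y * p i c)) else 0 else 0)"
      if "r \<in> {1..N}" "u \<in> {1..N}" "i \<in> {1..N}" "j \<in> {1..N}" for r u i j
    proof (cases "s r = s u \<and> s i = s j")
      case True
      have xx: "x j a' * (x u a * w) = sg r i * (x u a * (x j a' * w))" for w
        using x_x[OF that(4,2) m'(2,1)] True by (auto simp: mult.assoc[symmetric])
      have pp: "p i c * p r b = sg r i * (p r b * p i c)"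
        using p_p[OF that(3,1) m(2,1)] by auto
      have px: "p r b * (x j a' * w) = sg r i * (x j a' * (p r b * w)) + (if r = j \<and> b = a' then 1 else 0) * w" for w
        using p_x[OF that(1,4) m(1) m'(2)] True by (auto simp: mult.assoc[symmetric] distrib_right left_diff_distrib)
      have gg: "Gz i j * (Gz r u * w) = Gz r u * (Gz i j * w)" for w
        by (simp only: mult.assoc[symmetric] kernelD(2)[OF kernel_z, of r u])
      have gp: "Gz i j * (p r b * w) = p r b * (Gz i j * w)" for w by (rule Gz_left)
      have sg2: "sg r i * (sg r i * w) = w" for w by auto
      have e1: "p r b * (x j a' * (Gz i j * (y * p i c))) = sg r i * (x j a' * (Gz i j * (p r b * y * p i c)))
          + (if r = j \<and> b = a' then 1 else 0) * (Gz i j * (y * p i c))"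
        unfolding px by (simp only: mult.assoc gp)
      have e2: "x j a' * (Gz i j * (y * p i c)) * p r b = sg r i * (x j a' * (Gz i j * (y * p r b * p i c)))"
        by (simp only: mult.assoc pp) auto
      have e3: "x j a' * (Gz i j * (x u a * (Gz r u * (p r b * y - y * p r b)) * p i c))
         = x u a * (Gz r u * (sg r i * (x j a' * (Gz i j * ((p r b * y - y * p r b) * p i c)))))"
        by (simp only: mult.assoc Gz_left xx gg) (auto simp: Gz_left)
      have "x u a * (Gz r u * (p r b * (x j a' * (Gz i j * (y * p i c))) - x j a' * (Gz i j * (y * p i c)) * p r b))
        - x j a' * (Gz i j * (x u a * (Gz r u * (p r b * y - y * p r b)) * p i c))
        = x u a * (Gz r u * ((if r = j \<and> b = a' then 1 else 0) * (Gz i j * (y * p i c))))"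
        unfolding e1 e2 e3 by (simp add: right_diff_distrib left_diff_distrib distrib_left mult.assoc)
      then show ?thesis using gg[of "y * p i c"] by (auto simp: mult.assoc)
    qed (auto simp: Gz_par)
    have "(Lt a b * m1 c a' y - m1 b a (m1 c a' y)) - m1 c a' (Lt a b * y - m1 b a y)
      = (\<Sum>q\<in>idx N. \<Sum>q'\<in>idx N. ?B q (?C q' y) - ?C q' (?B q y))
        - (if a = b then \<Sum>q\<in>idx N. (psd_d * ?C q y - ?C q y * psd_d) - ?C q (psd_d * y - y * psd_d) else 0)"
      proof (rule op_commutator[where A = "\<lambda>y. psd_d * y - y * psd_d" and R = "\<lambda>y. y * psd_d" and B = ?B and C = ?C and ?w0.0 = 0
            and u = "a = b" and v = "a' = c" and w = "W a' c" and f = "\<lambda>y. Lt a b * y - m1 b a y" and m = "m1 c a'"])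
      show "Lt a b * v - m1 b a v = (if a = b then psd_d * v - v * psd_d else 0) - scal 0 * v - (\<Sum>q\<in>idx N. ?B q v)" for v by (rule Lt_m1)
      show "m1 c a' v = (if a' = c then v * psd_d else 0) - scal (W a' c) * v - (\<Sum>q\<in>idx N. ?C q v)" for v by (rule m1_def)
    qed (auto simp: additive_def distrib_left distrib_right left_diff_distrib right_diff_distrib mult.assoc psd_const_d scal_left_commute)
    also have "(\<Sum>q\<in>idx N. \<Sum>q'\<in>idx N. ?B q (?C q' y) - ?C q' (?B q y)) = (if a' = b then F a else 0)"
    proof -
      have "(\<Sum>q\<in>idx N. \<Sum>q'\<in>idx N. ?B q (?C q' y) - ?C q' (?B q y))
        = (\<Sum>q\<in>idx N. \<Sum>q'\<in>idx N. if snd q' = fst q then if a' = b then x (snd q) a * (Gz (fst q') (fst q) * Gz (fst q) (snd q) * (y * p (fst q') c)) else 0 else 0)"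
        by (intro sum.cong refl el) auto
      also have "\<dots> = (\<Sum>q\<in>idx N. \<Sum>r\<in>{1..N}. if a' = b then x (snd q) a * (Gz (fst q) r * Gz r (snd q) * (y * p (fst q) c)) else 0)"
        using sum_pairs_delta[of "{1..N}" "\<lambda>i r u. if a' = b then x u a * (Gz i r * Gz r u * (y * p i c)) else 0"] by simp
      also have "\<dots> = (if a' = b then F a else 0)"
        by (simp add: F_def kk_def sum_distrib_left sum_distrib_right)
      finally show ?thesis .
    qed
    also have "(\<Sum>q\<in>idx N. (psd_d * ?C q y - ?C q y * psd_d) - ?C q (psd_d * y - y * psd_d)) = - F a'"
      unfolding F_def sum_negf[symmetric]
    proof (intro sum.cong refl)
      fix q assume "q \<in> idx N"
      then have q: "fst q \<in> {1..N}" "snd q \<in> {1..N}" by auto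
      have dz: "psd_d * psd_z - psd_z * psd_d = (scal 1 :: 'a psd)" by (simp add: psd_d_z)
      have "psd_d * Gz (fst q) (snd q) - Gz (fst q) (snd q) * psd_d = - kk N Gz (fst q) (snd q)"
        using res_derivation[OF unit_z_scal(1) dz q] by (simp add: kk_def)
      then have dG: "psd_d * (Gz (fst q) (snd q) * w) = Gz (fst q) (snd q) * (psd_d * w) - kk N Gz (fst q) (snd q) * w" for w
        by (metis (no_types, lifting) add_diff_cancel_left' diff_add_cancel left_diff_distrib mult.assoc diff_minus_eq_add add.commute uminus_add_conv_diff)
      show "(psd_d * ?C q y - ?C q y * psd_d) - ?C q (psd_d * y - y * psd_d)
         = - (x (snd q) a' * (kk N Gz (fst q) (snd q) * (y * p (fst q) c)))"
        by (simp add: const_left(2)[symmetric] dG left_diff_distrib right_diff_distrib mult.assoc psd_const_d)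
    qed
    finally show ?thesis by simp
  qed
  show "(Lt a b * m1 c a' y - m1 b a (m1 c a' y)) - m1 c a' (Lt a b * y - m1 b a y)
      = (Lt a' b * m1 c a y - m1 b a' (m1 c a y)) - m1 c a (Lt a' b * y - m1 b a' y)"
    unfolding *[OF m(3,4)] *[OF m(4,3)] by (simp add: add.commute)
qed simp

lemma Tt_m2: "y * Tt a b - m2 b a y = (if a = b then y * psd_z - psd_z * y else 0) - scal 0 * y
      - (\<Sum>q\<in>idx N. (y * x (snd q) b - x (snd q) b * y) * (p (fst q) a * Gd (fst q) (snd q)))"
    by (simp add: Tt_def m2_def nbil_def left_diff_distrib right_diff_distrib sum_subtractf sum_distrib_left mult.assoc
        scal_central[of _ y])

text \<open>The mirror image for right multiplications, with the resolvent in d differentiated by z.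
  The list is reversed by \<open>col_det_right\<close>.\<close>

lemma Tt_normal: "col_det cs Tt = asum (rev cs) m2 1"
  unfolding col_det_right
proof (rule asum_normal_order_rows)
  show "additive (\<lambda>y. y * Tt a b)" "additive (m2 b a)" for a b
    by (simp add: additive_def distrib_right, rule additive_m)
  show "1 * Tt a b = m2 b a 1" for a b
    by (simp add: Tt_def m2_def nbil_def)
  fix b c a a' y assume bc: "b \<noteq> c" and "b \<in> set (rev cs)" "c \<in> set (rev cs)" "a \<in> set (rev cs)" "a' \<in> set (rev cs)"
  then have m: "b \<in> {1..d}" "c \<in> {1..d}" "a \<in> {1..d}" "a' \<in> {1..d}" unfolding set_rev set_cs by auto
  define F where "F a = (\<Sum>q\<in>idx N. x (snd q) c * (y * (p (fst q) a * kk N Gd (fst q) (snd q))))" for a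
  have *: "(m2 c a' y * Tt a b - m2 b a (m2 c a' y)) - m2 c a' (y * Tt a b - m2 b a y)
     = (if a' = b then F a else 0) + (if a = b then F a' else 0)" if m': "a \<in> {1..d}" "a' \<in> {1..d}" for a a'
  proof -
    let ?B = "\<lambda>q y. (y * x (snd q) b - x (snd q) b * y) * (p (fst q) a * Gd (fst q) (snd q))"
    let ?C = "\<lambda>q y. x (snd q) c * (y * (p (fst q) a' * Gd (fst q) (snd q)))"
    have el: "(x j c * (y * (p i a' * Gd i j)) * x u b - x u b * (x j c * (y * (p i a' * Gd i j)))) * (p r a * Gd r u)
        - x j c * ((y * x u b - x u b * y) * (p r a * Gd r u) * (p i a' * Gd i j))
      = (if u = i then if a' = b then x j c * (y * (p r a * (Gd r i * Gd i j))) else 0 else 0)"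
      if "r \<in> {1..N}" "u \<in> {1..N}" "i \<in> {1..N}" "j \<in> {1..N}" for r u i j
    proof (cases "s r = s u \<and> s i = s j")
      case True
      have xx: "x u b * (x j c * w) = sg r i * (x j c * (x u b * w))" for w
        using x_x[OF that(2,4) m(1,2)] True by (auto simp: mult.assoc[symmetric])
      have pp: "p i a' * (p r a * w) = sg r i * (p r a * (p i a' * w))" for w
        using p_p[OF that(3,1) m'(2,1)] by (auto simp: mult.assoc[symmetric])
      have px: "p i a' * (x u b * w) = sg r i * (x u b * (p i a' * w)) + (if u = i \<and> a' = b then 1 else 0) * w" for w
        using p_x[OF that(3,2) m'(2) m(1)] True by (auto simp: mult.assoc[symmetric] distrib_right left_diff_distrib)
      have gg: "Gd i j * Gd r u = Gd r u * Gd i j" by (rule kernelD(2)[OF kernel_d])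
      have gg': "Gd i j * (Gd r u * w) = Gd r u * (Gd i j * w)" for w by (simp only: mult.assoc[symmetric] gg)
      have sl: "w * (sg r i * v) = sg r i * (w * v)" for w v by auto
      have e1: "x j c * (y * (p i a' * Gd i j)) * x u b = sg r i * (x j c * (y * x u b * (p i a' * Gd i j)))
          + (if u = i \<and> a' = b then 1 else 0) * (x j c * (y * Gd i j))"
      proof -
        have "x j c * (y * (p i a' * Gd i j)) * x u b = x j c * (y * (p i a' * (x u b * Gd i j)))"
          by (simp only: mult.assoc Gd_c)
        then show ?thesis unfolding px by (simp only: sl distrib_left mult.assoc) auto
      qed
      have e2: "x u b * (x j c * (y * (p i a' * Gd i j))) = sg r i * (x j c * (x u b * y * (p i a' * Gd i j)))"
        by (simp only: xx mult.assoc)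
      have e3: "p i a' * Gd i j * (p r a * Gd r u) = sg r i * (p r a * Gd r u * (p i a' * Gd i j))"
        by (simp only: mult.assoc Gd_left pp gg)
      have "(x j c * (y * (p i a' * Gd i j)) * x u b - x u b * (x j c * (y * (p i a' * Gd i j)))) * (p r a * Gd r u)
        = sg r i * (x j c * ((y * x u b - x u b * y) * (p i a' * Gd i j * (p r a * Gd r u))))
          + (if u = i \<and> a' = b then 1 else 0) * (x j c * (y * Gd i j)) * (p r a * Gd r u)"
        unfolding e1 e2 by (simp add: left_diff_distrib right_diff_distrib distrib_right mult.assoc)
      also have "sg r i * (x j c * ((y * x u b - x u b * y) * (p i a' * Gd i j * (p r a * Gd r u))))
        = x j c * ((y * x u b - x u b * y) * (p r a * Gd r u) * (p i a' * Gd i j))"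
        unfolding e3 by (auto simp: mult.assoc)
      finally show ?thesis by (auto simp: mult.assoc Gd_left gg)
    qed (auto simp: Gd_par)
    have "(m2 c a' y * Tt a b - m2 b a (m2 c a' y)) - m2 c a' (y * Tt a b - m2 b a y)
      = (\<Sum>q\<in>idx N. \<Sum>q'\<in>idx N. ?B q (?C q' y) - ?C q' (?B q y))
        - (if a = b then \<Sum>q\<in>idx N. (?C q y * psd_z - psd_z * ?C q y) - ?C q (y * psd_z - psd_z * y) else 0)"
      proof (rule op_commutator[where A = "\<lambda>y. y * psd_z - psd_z * y" and R = "\<lambda>y. psd_z * y" and B = ?B and C = ?C and ?w0.0 = 0
            and u = "a = b" and v = "a' = c" and w = "W c a'" and f = "\<lambda>y. y * Tt a b - m2 b a y" and m = "m2 c a'"])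
      show "v * Tt a b - m2 b a v = (if a = b then v * psd_z - psd_z * v else 0) - scal 0 * v - (\<Sum>q\<in>idx N. ?B q v)" for v by (rule Tt_m2)
      show "m2 c a' v = (if a' = c then psd_z * v else 0) - scal (W c a') * v - (\<Sum>q\<in>idx N. ?C q v)" for v by (rule m2_def)
    qed (auto simp: additive_def distrib_left distrib_right left_diff_distrib right_diff_distrib mult.assoc psd_const_z const_left scal_left_commute)
    also have "(\<Sum>q\<in>idx N. \<Sum>q'\<in>idx N. ?B q (?C q' y) - ?C q' (?B q y)) = (if a' = b then F a else 0)"
    proof -
      have "(\<Sum>q\<in>idx N. \<Sum>q'\<in>idx N. ?B q (?C q' y) - ?C q' (?B q y))
        = (\<Sum>q\<in>idx N. \<Sum>q'\<in>idx N. if snd q = fst q' then if a' = b then x (snd q') c * (y * (p (fst q) a * (Gd (fst q) (fst q') * Gd (fst q') (snd q')))) else 0 else 0)"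
        by (intro sum.cong refl el) auto
      also have "\<dots> = (\<Sum>q'\<in>idx N. \<Sum>q\<in>idx N. if snd q = fst q' then if a' = b then x (snd q') c * (y * (p (fst q) a * (Gd (fst q) (fst q') * Gd (fst q') (snd q')))) else 0 else 0)"
        by (rule sum.swap)
      also have "\<dots> = (\<Sum>q\<in>idx N. \<Sum>i\<in>{1..N}. if a' = b then x (snd q) c * (y * (p (fst q) a * (Gd (fst q) i * Gd i (snd q)))) else 0)"
        using sum_pairs_delta[of "{1..N}" "\<lambda>r i j. if a' = b then x j c * (y * (p r a * (Gd r i * Gd i j))) else 0"] by simp
      also have "\<dots> = (if a' = b then F a else 0)"
        by (simp add: F_def kk_def sum_distrib_left)
      finally show ?thesis .
    qed
    also have "(\<Sum>q\<in>idx N. (?C q y * psd_z - psd_z * ?C q y) - ?C q (y * psd_z - psd_z * y)) = - F a'"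
      unfolding F_def sum_negf[symmetric]
    proof (intro sum.cong refl)
      fix q assume "q \<in> idx N"
      then have q: "fst q \<in> {1..N}" "snd q \<in> {1..N}" by auto
      have zG: "psd_z * Gd (fst q) (snd q) = Gd (fst q) (snd q) * psd_z + kk N Gd (fst q) (snd q)"
        using Gd_z[OF q] by (simp add: algebra_simps)
      show "(?C q y * psd_z - psd_z * ?C q y) - ?C q (y * psd_z - psd_z * y)
         = - (x (snd q) c * (y * (p (fst q) a' * kk N Gd (fst q) (snd q))))"
        by (simp add: const_left(1) const_left(1)[symmetric] zG left_diff_distrib right_diff_distrib distrib_left mult.assoc del: const_left)
    qed
    finally show ?thesis by simp
  qed
  show "(m2 c a' y * Tt a b - m2 b a (m2 c a' y)) - m2 c a' (y * Tt a b - m2 b a y)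
      = (m2 c a y * Tt a' b - m2 b a' (m2 c a y)) - m2 c a (y * Tt a' b - m2 b a' y)"
    unfolding *[OF m(3,4)] *[OF m(4,3)] by (simp add: add.commute)
qed simp

text \<open>Since the exchange maps \<open>m1 a b\<close> to \<open>m2 b a\<close>, rows have to
  become columns first; this transposition is legitimate because all \<open>m1\<close>
  commute.\<close>

lemma swap_det: "psd_swap (col_det cs Lt) = col_det cs Tt"
proof -
  have sw: "psd_swap (m1 a b y) = m2 b a (psd_swap y)" for a b y
    by (auto simp: m1_def m2_def swap_diff swap_sum swap_scal_mult swap_mult_d swap_const_mult res_swap swap_mult_const mult.assoc)
  have "col_det cs Lt = asum (rev cs) (\<lambda>b a. m1 a b) 1"
    unfolding Lt_normal
    by (rule asum_transpose_rows) (use m1_commute set_cs additive_m in \<open>auto simp del: upt_Suc\<close>)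
  then have "psd_swap (col_det cs Lt) = asum (rev cs) m2 (psd_swap 1)"
    by (simp only:) (rule asum_intertwine, simp_all add: additive_def swap_add sw)
  then show ?thesis unfolding Tt_normal by simp
qed

lemma swap_fpr: "psd_swap (fpr psd_z n * y) = psd_swap y * fpr psd_d n"
proof (induction n arbitrary: y)
  case (Suc n)
  let ?e = "\<lambda>t :: 'a psd. if s (Suc n) then uinv (t - scal (Z (Suc n) (Suc n))) else t - scal (Z (Suc n) (Suc n))"
  have f: "fpr t (Suc n) = fpr t n * ?e t" for t by (simp add: fpr_def)
  have e: "psd_swap (?e psd_z * y) = psd_swap y * ?e psd_d"
    by (simp add: swap_uinv_z left_diff_distrib right_diff_distrib swap_diff swap_z_mult swap_scal_mult scal_central[of _ "psd_swap y"])
  have "(psd_d :: 'a psd) * ?e psd_d = ?e psd_d * psd_d"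
    using commute_uinv_shift[OF unit_z_scal(2) refl, of "Z (Suc n) (Suc n)", symmetric]
    by (cases "s (Suc n)") (simp_all only: if_True if_False left_diff_distrib right_diff_distrib scal_central[of _ "psd_d :: 'a psd"])
  then have "fpr psd_d n * ?e psd_d = ?e psd_d * fpr psd_d n"
    by (intro fpr_commute[OF unit_z_scal(2)]) simp
  then show ?case unfolding f mult.assoc Suc e by (simp add: mult.assoc)
qed (simp add: fpr_def)

text \<open>Each equation leaves f where the next one needs it: conjugation puts f(z) on the left,
  the exchange makes it f(d) on the right, the second conjugation brings f(d) to the left, and there
  \<open>det_ber\<close> absorbs it.\<close>

theorem duality_identity:
  assumes "W_inverse H" "M_last_rows H R"
  shows "psd_swap (col_det cs L1 * fpr psd_z N) = prod_list (map (\<lambda>a. psd_z - scal (W a a)) cs) * ber R N"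
  unfolding L1_conjugate swap_fpr swap_det Tt_conjugate det_ber[OF assms order_refl] det_T0 ..

end

section \<open>Free algebras and evaluation\<close>

instantiation complex :: calg
begin

definition scal_complex :: "complex \<Rightarrow> complex" where "scal_complex c = c"

instance by standard (simp_all add: scal_complex_def mult.commute)

end

lemma poly_mapping_decompose:
  fixes x :: "'a \<Rightarrow>\<^sub>0 'b::comm_monoid_add"
  shows "x = (\<Sum>k\<in>Poly_Mapping.keys x. Poly_Mapping.single k (Poly_Mapping.lookup x k))"
  by (rule poly_mapping_eqI)
     (simp add: lookup_sum lookup_single when_def in_keys_iff)

lemma poly_mapping_single_induct:
  fixes x :: "'a \<Rightarrow>\<^sub>0 'b::comm_monoid_add"
  assumes "\<And>k c. Q (Poly_Mapping.single k c)" "\<And>x y. Q x \<Longrightarrow> Q y \<Longrightarrow> Q (x + y)"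
  shows "Q x"
proof -
  have "Q (\<Sum>k\<in>K. Poly_Mapping.single k (Poly_Mapping.lookup x k))" if "finite K" for K
    using that assms(1)[of undefined 0] by (induction K) (auto intro: assms)
  then show ?thesis by (subst poly_mapping_decompose) simp
qed

instantiation poly_mapping :: (monoid_add, calg) calg
begin

definition scal_poly_mapping :: "complex \<Rightarrow> 'a \<Rightarrow>\<^sub>0 'b" where
  "scal_poly_mapping c = Poly_Mapping.single 0 (scal c)"

instance
proof
  fix c e and x :: "'a \<Rightarrow>\<^sub>0 'b"
  show "scal c * x = x * scal c"
    by (induction x rule: poly_mapping_single_induct)
       (auto simp: scal_poly_mapping_def mult_single scal_central[of c] distrib_left distrib_right)
qed (simp_all add: scal_poly_mapping_def scal_add scal_mult single_add mult_single)

end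

lemma scalar_scal: "scalar c = scal c"
  by (simp add: scalar_def scal_poly_mapping_def scal_complex_def)

definition hom_calg :: "('a::calg \<Rightarrow> 'b::calg) \<Rightarrow> bool" where
  "hom_calg g \<longleftrightarrow> (\<forall>x y. g (x + y) = g x + g y) \<and> (\<forall>x y. g (x * y) = g x * g y) \<and> g 1 = 1 \<and> (\<forall>c. g (scal c) = scal c)"

lemma hom_calgD:
  assumes "hom_calg g"
  shows "g (x + y) = g x + g y" "g (x * y) = g x * g y" "g 1 = 1" "g (scal c) = scal c" "g 0 = 0"
    "g (- x) = - g x" "g (x - y) = g x - g y" "g (sum f A) = (\<Sum>a\<in>A. g (f a))" "g (prod_list xs) = prod_list (map g xs)"
proof -
  show a: "g (x + y) = g x + g y" for x y using assms by (simp add: hom_calg_def)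
  show m: "g (x * y) = g x * g y" "g 1 = 1" "g (scal c) = scal c" for x y using assms by (simp_all add: hom_calg_def)
  show z: "g 0 = 0" using a[of 0 0] by simp
  show u: "g (- x) = - g x" for x using a[of x "- x"] z by (simp add: eq_neg_iff_add_eq_0 add.commute)
  show "g (x - y) = g x - g y" using a[of x "- y"] u by simp
  show "g (sum f A) = (\<Sum>a\<in>A. g (f a))" by (induction A rule: infinite_finite_induct) (simp_all add: a z)
  show "g (prod_list xs) = prod_list (map g xs)" by (induction xs) (simp_all add: m)
qed

definition ev :: "('b \<Rightarrow> 't::calg) \<Rightarrow> 'b free \<Rightarrow> 't" where
  "ev \<theta> x = (\<Sum>u\<in>Poly_Mapping.keys x. scal (Poly_Mapping.lookup x u) * prod_list (map \<theta> (letters u)))"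

lemma ev_superset:
  assumes "finite K" "Poly_Mapping.keys x \<subseteq> K"
  shows "ev \<theta> x = (\<Sum>u\<in>K. scal (Poly_Mapping.lookup x u) * prod_list (map \<theta> (letters u)))"
  unfolding ev_def by (rule sum.mono_neutral_left) (use assms in \<open>auto simp: in_keys_iff\<close>)

lemma ev_single: "ev \<theta> (Poly_Mapping.single u c) = scal c * prod_list (map \<theta> (letters u))"
  by (subst ev_superset[of "{u}"]) auto

lemma ev_add: "ev \<theta> (x + y) = ev \<theta> x + ev \<theta> y"
proof -
  let ?K = "Poly_Mapping.keys x \<union> Poly_Mapping.keys y"
  have "Poly_Mapping.keys (x + y) \<subseteq> ?K" by (auto simp: in_keys_iff lookup_add)
  then show ?thesis
    by (simp add: ev_superset[of ?K] lookup_add scal_add distrib_right sum.distrib)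
qed

lemma hom_ev: "hom_calg (ev \<theta>)"
  unfolding hom_calg_def
proof (intro conjI allI)
  fix x y :: "'a free" and c
  show "ev \<theta> (x + y) = ev \<theta> x + ev \<theta> y" by (rule ev_add)
  show "ev \<theta> (x * y) = ev \<theta> x * ev \<theta> y"
  proof (induction x rule: poly_mapping_single_induct)
    case (1 u c)
    show ?case
    proof (induction y rule: poly_mapping_single_induct)
      case (1 v e)
      show ?case
        by (simp add: mult_single ev_single plus_word_def scal_mult mult.assoc
            scal_left_commute[of "prod_list (map \<theta> (letters u))"])
    qed (simp add: distrib_left ev_add)
  qed (simp add: distrib_right ev_add)
  show "ev \<theta> 1 = 1" unfolding single_one[symmetric] ev_single by (simp add: zero_word_def)
  show "ev \<theta> (scal c) = scal c" by (simp add: scalar_scal[symmetric] scalar_def ev_single zero_word_def)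
qed

lemmas ev_simps = hom_calgD[OF hom_ev]

lemma ev_letter [simp]: "ev \<theta> (letter b) = \<theta> b"
  by (simp add: letter_def ev_single)

lemma single_word: "(Poly_Mapping.single u c :: 'b free) = scal c * prod_list (map letter (letters u))"
proof -
  have "prod_list (map letter l) = Poly_Mapping.single (Word l :: 'b word) (1 :: complex)" for l
    by (induction l) (simp_all add: letter_def mult_single plus_word_def zero_word_def[symmetric])
  then show ?thesis by (simp add: scalar_scal[symmetric] scalar_def mult_single)
qed

lemma free_induct [case_names one letter scal add]:
  fixes x :: "'b free"
  assumes "Q 1" "\<And>b x. Q x \<Longrightarrow> Q (letter b * x)" "\<And>c x. Q x \<Longrightarrow> Q (scal c * x)" "\<And>x y. Q x \<Longrightarrow> Q y \<Longrightarrow> Q (x + y)"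
  shows "Q x"
proof (induction x rule: poly_mapping_single_induct)
  case (1 u c)
  have "Q (prod_list (map letter l))" for l by (induction l) (auto intro: assms)
  then show ?case unfolding single_word by (rule assms(3))
qed (rule assms(4))

section \<open>Transport between types and structures with a carrier\<close>

text \<open>A record algebra A is the image of a subalgebra S of a type under a map that respects
  all operations. The ring axioms of A are inherited, and finite sums, ordered products and inverses
  in A become images of those computed in the type.\<close>

locale cover =
  fixes A :: "'r superalg" and S :: "'t::calg set" and h :: "'t \<Rightarrow> 'r"
  assumes onto: "h ` S = carrier A"
    and closed: "1 \<in> S" "\<And>x y. x \<in> S \<Longrightarrow> y \<in> S \<Longrightarrow> x + y \<in> S"
      "\<And>x y. x \<in> S \<Longrightarrow> y \<in> S \<Longrightarrow> x * y \<in> S" "\<And>c x. x \<in> S \<Longrightarrow> scal c * x \<in> S"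
    and h_add: "\<And>x y. x \<in> S \<Longrightarrow> y \<in> S \<Longrightarrow> h (x + y) = h x \<oplus>\<^bsub>A\<^esub> h y"
    and h_mult: "\<And>x y. x \<in> S \<Longrightarrow> y \<in> S \<Longrightarrow> h (x * y) = h x \<otimes>\<^bsub>A\<^esub> h y"
    and h_0: "h 0 = \<zero>\<^bsub>A\<^esub>" and h_1: "h 1 = \<one>\<^bsub>A\<^esub>"
    and h_scal: "\<And>c x. x \<in> S \<Longrightarrow> h (scal c * x) = c \<odot>\<^bsub>A\<^esub> h x"
begin

lemma S_0: "0 \<in> S" using closed(4)[of 1 0] closed(1) by simp

lemma S_uminus: "x \<in> S \<Longrightarrow> - x \<in> S" using closed(4)[of x "- 1"] by (simp add: scal_minus)

lemma S_minus: "x \<in> S \<Longrightarrow> y \<in> S \<Longrightarrow> x - y \<in> S" using closed(2)[of x "- y"] S_uminus by simp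

lemma S_sum: "(\<And>k. k \<in> K \<Longrightarrow> f k \<in> S) \<Longrightarrow> sum f K \<in> S"
  by (induction K rule: infinite_finite_induct) (auto intro: closed S_0)

lemma S_prod_list: "set xs \<subseteq> S \<Longrightarrow> prod_list xs \<in> S"
  by (induction xs) (auto intro: closed)

lemma h_carrier: "x \<in> S \<Longrightarrow> h x \<in> carrier A" using onto by auto

lemma carrierE: assumes "y \<in> carrier A" obtains x where "x \<in> S" "y = h x" using assms onto by auto

lemma ring: "ring A"
proof (rule ringI)
  show "abelian_group A"
  proof (rule abelian_groupI)
    fix x assume "x \<in> carrier A"
    then obtain x' where x: "x' \<in> S" "x = h x'" by (rule carrierE)
    have "h (- x') \<oplus>\<^bsub>A\<^esub> x = \<zero>\<^bsub>A\<^esub>" using h_add[OF S_uminus[OF x(1)] x(1)] x h_0 by simp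
    then show "\<exists>y\<in>carrier A. y \<oplus>\<^bsub>A\<^esub> x = \<zero>\<^bsub>A\<^esub>" using h_carrier[OF S_uminus[OF x(1)]] by auto
    show "\<zero>\<^bsub>A\<^esub> \<oplus>\<^bsub>A\<^esub> x = x" using h_add[OF S_0 x(1)] x h_0 by simp
  next
    fix x y assume "x \<in> carrier A" "y \<in> carrier A"
    then obtain x' y' where x: "x' \<in> S" "x = h x'" and y: "y' \<in> S" "y = h y'" by (metis carrierE)
    show "x \<oplus>\<^bsub>A\<^esub> y \<in> carrier A" unfolding x y h_add[symmetric, OF x(1) y(1)] by (intro h_carrier closed x y)
    show "x \<oplus>\<^bsub>A\<^esub> y = y \<oplus>\<^bsub>A\<^esub> x" unfolding x y using x y by (simp add: h_add[symmetric] add.commute)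
    fix z assume "z \<in> carrier A"
    then obtain z' where z: "z' \<in> S" "z = h z'" by (rule carrierE)
    show "x \<oplus>\<^bsub>A\<^esub> y \<oplus>\<^bsub>A\<^esub> z = x \<oplus>\<^bsub>A\<^esub> (y \<oplus>\<^bsub>A\<^esub> z)"
      unfolding x y z using x y z by (simp add: h_add[symmetric] closed add.assoc)
  next
    show "\<zero>\<^bsub>A\<^esub> \<in> carrier A" using h_carrier[OF S_0] h_0 by simp
  qed
  show "monoid A"
  proof (rule monoidI)
    fix x y assume "x \<in> carrier A" "y \<in> carrier A"
    then obtain x' y' where x: "x' \<in> S" "x = h x'" and y: "y' \<in> S" "y = h y'" by (metis carrierE)
    show "x \<otimes>\<^bsub>A\<^esub> y \<in> carrier A" unfolding x y h_mult[symmetric, OF x(1) y(1)] by (intro h_carrier closed x y)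
    fix z assume "z \<in> carrier A"
    then obtain z' where z: "z' \<in> S" "z = h z'" by (rule carrierE)
    show "x \<otimes>\<^bsub>A\<^esub> y \<otimes>\<^bsub>A\<^esub> z = x \<otimes>\<^bsub>A\<^esub> (y \<otimes>\<^bsub>A\<^esub> z)"
      unfolding x y z using x y z by (simp add: h_mult[symmetric] closed mult.assoc)
  next
    fix x assume "x \<in> carrier A"
    then obtain x' where x: "x' \<in> S" "x = h x'" by (rule carrierE)
    show "\<one>\<^bsub>A\<^esub> \<otimes>\<^bsub>A\<^esub> x = x" "x \<otimes>\<^bsub>A\<^esub> \<one>\<^bsub>A\<^esub> = x"
      using h_mult[OF closed(1) x(1)] h_mult[OF x(1) closed(1)] x h_1 by simp_all
  next
    show "\<one>\<^bsub>A\<^esub> \<in> carrier A" using h_carrier[OF closed(1)] h_1 by simp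
  qed
next
  fix x y z assume "x \<in> carrier A" "y \<in> carrier A" "z \<in> carrier A"
  then obtain x' y' z' where x: "x' \<in> S" "x = h x'" and y: "y' \<in> S" "y = h y'" and z: "z' \<in> S" "z = h z'" by (metis carrierE)
  show "(x \<oplus>\<^bsub>A\<^esub> y) \<otimes>\<^bsub>A\<^esub> z = x \<otimes>\<^bsub>A\<^esub> z \<oplus>\<^bsub>A\<^esub> y \<otimes>\<^bsub>A\<^esub> z" "z \<otimes>\<^bsub>A\<^esub> (x \<oplus>\<^bsub>A\<^esub> y) = z \<otimes>\<^bsub>A\<^esub> x \<oplus>\<^bsub>A\<^esub> z \<otimes>\<^bsub>A\<^esub> y"
    unfolding x y z using x y z by (simp_all add: h_add[symmetric] h_mult[symmetric] closed distrib_left distrib_right)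
qed

lemma h_uminus: "x \<in> S \<Longrightarrow> h (- x) = \<ominus>\<^bsub>A\<^esub> h x"
proof -
  assume x: "x \<in> S"
  interpret A: ring A by (rule ring)
  have "h (- x) \<oplus>\<^bsub>A\<^esub> h x = \<zero>\<^bsub>A\<^esub>" using h_add[OF S_uminus[OF x] x] h_0 by simp
  then show ?thesis using x S_uminus[OF x] by (intro A.minus_equality[symmetric]) (auto intro: h_carrier)
qed

lemma h_minus: "x \<in> S \<Longrightarrow> y \<in> S \<Longrightarrow> h (x - y) = h x \<ominus>\<^bsub>A\<^esub> h y"
  by (simp add: a_minus_def h_uminus[symmetric] h_add[symmetric] S_uminus)

lemma h_sum: "(\<And>k. k \<in> K \<Longrightarrow> f k \<in> S) \<Longrightarrow> h (sum f K) = (\<Oplus>\<^bsub>A\<^esub>k\<in>K. h (f k))"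
proof (induction K rule: infinite_finite_induct)
  interpret A: ring A by (rule ring)
  {
    case (infinite K) then show ?case by (simp add: h_0 A.finsum_infinite)
  next
    case empty then show ?case by (simp add: h_0)
  next
    case (insert k K) then show ?case by (simp add: h_add S_sum A.finsum_insert h_carrier)
  }
qed

lemma h_sum_cong:
  assumes "\<And>k. k \<in> K \<Longrightarrow> f k \<in> S \<and> g k \<in> S \<and> h (f k) = h (g k)"
  shows "h (sum f K) = h (sum g K)"
  using assms by (induction K rule: infinite_finite_induct) (auto simp: h_add S_sum)

lemma h_prod_list: "set xs \<subseteq> S \<Longrightarrow> ord_prod A (map h xs) = h (prod_list xs)"
  by (induction xs) (auto simp: ord_prod_def h_1 h_mult S_prod_list)

lemma h_uinv:
  assumes "x \<in> S" "uinv x \<in> S" "unit x"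
  shows "inv\<^bsub>A\<^esub> h x = h (uinv x)"
proof -
  interpret A: ring A by (rule ring)
  show ?thesis using assms
    by (intro A.inv_char) (simp_all add: h_carrier h_mult[symmetric] uinv_right uinv_left h_1)
qed

end

lemma prod_list_0: "0 \<in> set xs \<Longrightarrow> prod_list xs = (0 :: 'a::ring_1)"
  by (induction xs) auto

section \<open>Algebras given by generators and relations\<close>

definition restr :: "'b set \<Rightarrow> 'b free \<Rightarrow> 'b free" where
  "restr B = ev (\<lambda>b. if b \<in> B then letter b else 0)"

lemma restr_simps:
  "restr B (x + y) = restr B x + restr B y" "restr B (x * y) = restr B x * restr B y" "restr B 1 = 1" "restr B (scal c) = scal c"
  "restr B (x - y) = restr B x - restr B y" "restr B 0 = 0" "restr B (letter b) = (if b \<in> B then letter b else 0)"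
  by (simp_all add: restr_def ev_simps)

lemma ev_restr: "(\<And>b. b \<notin> B \<Longrightarrow> \<theta> b = 0) \<Longrightarrow> ev \<theta> (restr B x) = ev \<theta> x"
  by (induction x rule: free_induct) (auto simp: restr_simps ev_simps)

locale presentation =
  fixes B :: "'b set" and par :: "'b \<Rightarrow> bit" and R :: "'b free set"
  assumes R: "R \<subseteq> carrier (free_superalg B par)"
begin

abbreviation "F \<equiv> free_superalg B par"

abbreviation "I \<equiv> rel_ideal B par R"

lemma F_add: "x \<in> carrier F \<Longrightarrow> y \<in> carrier F \<Longrightarrow> x + y \<in> carrier F"
proof -
  assume "x \<in> carrier F" "y \<in> carrier F"
  moreover have "Poly_Mapping.keys (x + y) \<subseteq> Poly_Mapping.keys x \<union> Poly_Mapping.keys y"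
    by (auto simp: in_keys_iff lookup_add)
  ultimately show ?thesis by (auto simp: free_superalg_def)
qed

lemma restr_id: "x \<in> carrier F \<Longrightarrow> restr B x = x"
proof -
  assume x: "x \<in> carrier F"
  have "restr B x = (\<Sum>u\<in>Poly_Mapping.keys x. scal (Poly_Mapping.lookup x u) * prod_list (map letter (letters u)))"
    unfolding restr_def ev_def
    by (intro sum.cong refl arg_cong2[where f = "(*)"] arg_cong[where f = prod_list] map_cong)
       (use x in \<open>auto simp: free_superalg_def\<close>)
  also have "\<dots> = x" unfolding single_word[symmetric] by (rule poly_mapping_decompose[symmetric])
  finally show ?thesis .
qed

lemma restr_F: "restr B x \<in> carrier F"
proof (induction x rule: poly_mapping_single_induct)
  case (1 u c)
  show ?case
  proof (cases "set (letters u) \<subseteq> B")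
    case True
    then have "Poly_Mapping.single u c \<in> carrier F" by (auto simp: free_superalg_def)
    then show ?thesis by (simp add: restr_id)
  next
    case False
    then have "0 \<in> set (map (\<lambda>b. if b \<in> B then letter b else (0 :: 'b free)) (letters u))"
      by (force simp: image_iff)
    then have "prod_list (map (\<lambda>b. if b \<in> B then letter b else (0 :: 'b free)) (letters u)) = 0"
      by (rule prod_list_0)
    then show ?thesis by (simp add: restr_def ev_single free_superalg_def)
  qed
qed (simp add: restr_simps F_add)

lemma F_iff: "x \<in> carrier F \<longleftrightarrow> restr B x = x"
  using restr_id restr_F by metis

sublocale F: cover F "carrier F" id
proof
  fix x y c assume "x \<in> carrier F"
  then have x: "restr B x = x" by (simp add: F_iff)
  show "scal c * x \<in> carrier F" by (simp add: F_iff restr_simps x)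
  assume "y \<in> carrier F"
  then have y: "restr B y = y" by (simp add: F_iff)
  show "x + y \<in> carrier F" "x * y \<in> carrier F" by (simp_all add: F_iff restr_simps x y)
next
  show "1 \<in> carrier F" by (simp add: F_iff restr_simps)
qed (simp_all add: free_superalg_def scalar_scal)

lemma ideal: "ideal I F"
  unfolding rel_ideal_def by (rule ring.genideal_ideal[OF F.ring R])

text \<open>Composing with the retraction that kills letters outside B makes the projection total,
  so the presented algebra is covered by the whole type and carrier conditions disappear.\<close>

definition pr :: "'b free \<Rightarrow> 'b free set" where
  "pr x = I +>\<^bsub>F\<^esub> restr B x"

lemma F_simps: "x \<oplus>\<^bsub>F\<^esub> y = x + y" "x \<otimes>\<^bsub>F\<^esub> y = x * y" "\<one>\<^bsub>F\<^esub> = 1" "\<zero>\<^bsub>F\<^esub> = 0"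
  by (simp_all add: free_superalg_def)

lemma presented_simps:
  "carrier (presented B par R) = a_rcosets\<^bsub>F\<^esub> I" "monoid.mult (presented B par R) = rcoset_mult F I"
  "one (presented B par R) = I +>\<^bsub>F\<^esub> \<one>\<^bsub>F\<^esub>" "zero (presented B par R) = I" "add (presented B par R) = set_add F"
  "smult (presented B par R) = (\<lambda>c X. rcoset_mult F I (I +>\<^bsub>F\<^esub> scalar c) X)"
  "part (presented B par R) e = (\<lambda>f. I +>\<^bsub>F\<^esub> f) ` part F e"
  by (simp_all add: presented_def Let_def FactRing_def)

sublocale P: cover "presented B par R" UNIV pr
proof
  interpret ideal I F by (rule ideal)
  have "carrier F = range (restr B)" using restr_F restr_id by (metis (no_types, lifting) image_subset_iff rangeI subsetI subset_antisym)
  then have "(\<lambda>x. I +>\<^bsub>F\<^esub> x) ` carrier F = range pr" by (simp only: image_image pr_def[abs_def])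
  then show "range pr = carrier (presented B par R)"
    by (simp add: presented_simps A_RCOSETS_def' UNION_singleton_eq_range)
  fix x y c
  show "pr (x + y) = pr x \<oplus>\<^bsub>presented B par R\<^esub> pr y"
    using a_rcos_sum[OF restr_F restr_F, of x y] by (simp add: presented_simps pr_def restr_simps F_simps)
  show "pr (x * y) = pr x \<otimes>\<^bsub>presented B par R\<^esub> pr y"
    using rcoset_mult_add[OF restr_F restr_F, of x y] by (simp add: presented_simps pr_def restr_simps F_simps)
  show "pr 0 = \<zero>\<^bsub>presented B par R\<^esub>"
    using ring.a_rcos_zero[OF F.ring ideal, of 0] additive_subgroup.zero_closed[OF is_additive_subgroup]
    by (simp add: presented_simps pr_def restr_simps F_simps)
  show "pr 1 = \<one>\<^bsub>presented B par R\<^esub>" by (simp add: presented_simps pr_def restr_simps F_simps)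
  have "restr B (scal c) = scal c" by (rule restr_simps)
  then have "scal c \<in> carrier F" by (simp only: F_iff)
  from rcoset_mult_add[OF this restr_F, of x] show "pr (scal c * x) = c \<odot>\<^bsub>presented B par R\<^esub> pr x"
    by (simp add: presented_simps pr_def restr_simps F_simps scalar_scal)
qed simp_all

lemma pr_letter: "b \<in> B \<Longrightarrow> pr (letter b) = presented_gen B par R b"
  by (simp add: pr_def restr_simps presented_gen_def)

lemma pr_letter_outside: "b \<notin> B \<Longrightarrow> pr (letter b) = pr 0"
  by (simp add: pr_def restr_simps)

lemma pr_rel: "x \<in> R \<Longrightarrow> pr x = pr 0"
proof -
  assume x: "x \<in> R"
  then have "x \<in> I" "x \<in> carrier F"
    using ring.genideal_self[OF F.ring R] R unfolding rel_ideal_def by auto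
  then show ?thesis using ring.a_rcos_zero[OF F.ring ideal, of x] ring.a_rcos_zero[OF F.ring ideal, of 0]
      additive_subgroup.zero_closed[OF ideal.axioms(1)[OF ideal]]
    by (simp add: pr_def restr_id restr_simps F_simps)
qed

lemma part_eq: "part (presented B par R) e = pr ` part F e"
  unfolding presented_simps pr_def
  by (rule image_cong) (auto simp: restr_id free_superalg_def)

text \<open>The universal property: the kernel of the evaluation is an ideal that contains the
  relations, hence the ideal generated by them.\<close>

lemma pr_eqD:
  assumes \<theta>: "\<And>b. b \<notin> B \<Longrightarrow> \<theta> b = 0" "\<And>x. x \<in> R \<Longrightarrow> ev \<theta> x = 0" and eq: "pr x = pr y"
  shows "ev \<theta> x = ev \<theta> y"
proof -
  interpret r: ring F by (rule F.ring)
  let ?J = "{x \<in> carrier F. ev \<theta> x = 0}"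
  have um: "\<ominus>\<^bsub>F\<^esub> x = - x" if "x \<in> carrier F" for x using F.h_uminus[OF that] by simp
  have "ideal ?J F"
  proof (rule idealI)
    show "subgroup ?J (add_monoid F)"
    proof (unfold_locales)
      show "inv\<^bsub>add_monoid F\<^esub> x \<in> ?J" if "x \<in> ?J" for x
        using that um[of x] F.S_uminus[of x] by (simp add: a_inv_def ev_simps)
    qed (use F.S_0 in \<open>auto simp: F_simps ev_simps F_add\<close>)
  qed (use F.closed in \<open>auto simp: F_simps ev_simps r.ring_axioms\<close>)
  then have J: "I \<subseteq> ?J"
    unfolding rel_ideal_def by (rule r.genideal_minimal) (use R \<theta>(2) in auto)
  have "restr B x \<ominus>\<^bsub>F\<^esub> restr B y \<in> I"
    using eq r.quotient_eq_iff_same_a_r_cos[OF ideal restr_F restr_F] by (simp add: pr_def)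
  then have "restr B x - restr B y \<in> ?J"
    using J F.h_minus[OF restr_F restr_F, of x y] by auto
  then show ?thesis by (simp add: ev_simps ev_restr \<theta>(1))
qed

end

section \<open>Determinants and Berezinians under homomorphisms\<close>

definition psd_map :: "('a::calg \<Rightarrow> 'b::calg) \<Rightarrow> 'a psd \<Rightarrow> 'b psd" where
  "psd_map g f = Psd (\<lambda>i j. g (coef f i j))"

lemma coef_psd_map:
  assumes "hom_calg g"
  shows "coef (psd_map g f) i j = g (coef f i j)"
proof -
  obtain r s where "bounded_by r s (coef f)" by (rule coef_bounded)
  then have "bounded_by r s (\<lambda>i j. g (coef f i j))" by (auto simp: bounded_by_def hom_calgD[OF assms])
  then show ?thesis by (simp add: psd_map_def coef_Psd)
qed

lemma hom_psd_map:
  assumes g: "hom_calg g"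
  shows "hom_calg (psd_map g)"
  unfolding hom_calg_def
proof (intro conjI allI)
  note gs = hom_calgD[OF g]
  fix x y c
  show "psd_map g (x + y) = psd_map g x + psd_map g y" "psd_map g 1 = 1" "psd_map g (scal c) = scal c"
    by (rule psd_eqI; simp add: coef_psd_map[OF g] gs coef_1 scal_psd_def coef_monom)+
  show "psd_map g (x * y) = psd_map g x * psd_map g y"
  proof (rule psd_eqI)
    fix u v
    obtain r s where b1: "bounded_by r s (coef x)" by (rule coef_bounded)
    obtain r' s' where b2: "bounded_by r' s' (coef y)" by (rule coef_bounded)
    have b3: "bounded_by r s (coef (psd_map g x))" "bounded_by r' s' (coef (psd_map g y))"
      using b1 b2 by (auto simp: bounded_by_def coef_psd_map[OF g] gs)
    have fin: "finite {u - r'..r}" "finite {v - s'..s}" by auto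
    show "coef (psd_map g (x * y)) u v = coef (psd_map g x * psd_map g y) u v"
      unfolding coef_psd_map[OF g, of "x * y"] coef_mult
        conv_box[OF b1 b2 fin order_refl order_refl order_refl] conv_box[OF b3 fin order_refl order_refl order_refl]
      by (simp add: gs case_prod_unfold coef_psd_map[OF g])
  qed
qed

lemma psd_map_monom: "hom_calg g \<Longrightarrow> psd_map g (psd_monom a b x) = psd_monom a b (g x)"
  by (rule psd_eqI) (simp add: coef_psd_map coef_monom hom_calgD)

lemma psd_map_frac: "hom_calg g \<Longrightarrow> psd_map g (psd_frac x c k) = psd_frac (g x) c k"
  by (rule psd_eqI) (simp add: coef_psd_map coef_frac hom_calgD Let_def)

lemma hom_unit:
  assumes g: "hom_calg g" and x: "unit x"
  shows "unit (g x)" "uinv (g x) = g (uinv x)"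
proof -
  have "g x * g (uinv x) = 1" "g (uinv x) * g x = 1"
    unfolding hom_calgD(2)[OF g, symmetric] uinv_right[OF x] uinv_left[OF x] by (rule hom_calgD(3)[OF g])+
  then show "unit (g x)" "uinv (g x) = g (uinv x)" by (auto intro: unitI uinv_eqI)
qed

lemma hom_col_det:
  fixes js :: "'i list"
  shows "hom_calg g \<Longrightarrow> g (col_det js M) = col_det js (\<lambda>a b. g (M a b))"
proof -
  assume g: "hom_calg g"
  have "g (of_int (sign \<sigma>)) = of_int (sign \<sigma>)" for \<sigma> :: "'i \<Rightarrow> 'i"
    by (simp add: sign_def hom_calgD[OF g])
  then show ?thesis by (simp add: col_det_alt hom_calgD[OF g] comp_def)
qed

lemma delta_mult: "(if b then x else 0) * y = (if b then x * y else (0 :: 'a::ring_1))"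
  and mult_delta: "y * (if b then x else 0) = (if b then y * x else (0 :: 'a::ring_1))"
  by simp_all

text \<open>The factors of the Berezinian are inverses of diagonal entries of N, so these must be
  units. The equation M N = 1 gives d N_ii = 1 + y with y of negative total degree, and 1 + y is
  inverted by a Neumann series.\<close>

lemma psd_d_matrix_invertible:
  fixes B :: "nat \<Rightarrow> nat \<Rightarrow> 'a::calg psd"
  assumes K: "finite K" and O: "\<And>i j. B i j \<in> psd_O"
  obtains N where
    "\<And>i j. i \<in> K \<Longrightarrow> j \<in> K \<Longrightarrow> (\<Sum>h\<in>K. ((if i = h then psd_d else 0) - B i h) * N h j) = (if i = j then 1 else 0)"
    "\<And>i j. i \<in> K \<Longrightarrow> j \<in> K \<Longrightarrow> (\<Sum>h\<in>K. N i h * ((if h = j then psd_d else 0) - B h j)) = (if i = j then 1 else 0)"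
    "\<And>i. i \<in> K \<Longrightarrow> unit (N i i)"
proof -
  have dO: "psd_d_inv \<in> (psd_O :: 'a psd set)" "tdeg_le (- 1) (psd_d_inv :: 'a psd)"
    by (rule psd_O_monom tdeg_le_monom; simp)+
  obtain N where N: "\<And>i j. N i j \<in> psd_O" "\<And>i j. tdeg_le (- 1) (N i j)"
    "\<And>i j. i \<in> K \<Longrightarrow> j \<in> K \<Longrightarrow> (\<Sum>h\<in>K. ((if i = h then psd_d else 0) - B i h) * N h j) = (if i = j then 1 else 0)"
    "\<And>i j. i \<in> K \<Longrightarrow> j \<in> K \<Longrightarrow> (\<Sum>h\<in>K. N i h * ((if h = j then psd_d else 0) - B h j)) = (if i = j then 1 else 0)"
    using matrix_invertible[where o' = B, OF K psd_d_inv dO O] by blast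
  have "unit (N i i)" if i: "i \<in> K" for i
  proof -
    define y where "y = (\<Sum>h\<in>K. B i h * N h i)"
    have "tdeg_le (0 + - 1) (B i h * N h i)" for h by (rule tdeg_le_mult[OF tdeg_le_O[OF O] N(2)])
    then have y: "y \<in> psd_O" "tdeg_le (- 1) y"
      unfolding y_def by (auto intro!: psd_O_closed O N tdeg_le_sum)
    have "psd_d * N i i - y = (\<Sum>h\<in>K. ((if i = h then psd_d else 0) - B i h) * N h i)"
      unfolding y_def left_diff_distrib sum_subtractf using i K by (simp add: delta_mult)
    then have d: "psd_d * N i i = 1 + y" using N(3)[OF i i] by (simp add: algebra_simps)
    have my: "tdeg_le (- 1) (- y)" using tdeg_le_diff[OF tdeg_le_0 y(2)] by simp
    obtain n where n: "\<And>i j. i \<in> {()} \<Longrightarrow> j \<in> {()} \<Longrightarrow> n i j - (\<Sum>h\<in>{()}. (- y) * n h j) = (if i = j then 1 else 0)"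
      "\<And>i j. i \<in> {()} \<Longrightarrow> j \<in> {()} \<Longrightarrow> n i j - (\<Sum>h\<in>{()}. n i h * (- y)) = (if i = j then 1 else 0)"
      by (rule neumann_series[of "{()}" "\<lambda>_ _. - y"]) (use psd_O_uminus[OF y(1)] my in auto)
    have "(1 + y) * n () () = 1" "n () () * (1 + y) = 1"
      using n(1)[of "()" "()"] n(2)[of "()" "()"] by (simp_all add: distrib_left distrib_right)
    then have "unit (psd_d_inv * (1 + y))" by (intro unit_mult) (auto intro: unitI psd_d_inv)
    moreover have "psd_d_inv * (1 + y) = N i i" unfolding d[symmetric] mult.assoc[symmetric] by (simp add: psd_d_inv)
    ultimately show ?thesis by simp
  qed
  from that[OF N(3,4) this] show ?thesis .
qed

lemma scal_sign: "scal (of_int (sign \<sigma>)) = (of_int (sign \<sigma>) :: 'a::calg)"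
  by (simp add: sign_def scal_minus)

locale full_cover = cover A UNIV h for A :: "'r superalg" and h :: "'t::calg \<Rightarrow> 'r"
begin

text \<open>Coefficients are lifted one by one, with 0 chosen outside the bounds. The product of
  \<open>pdo\<close> runs over pairs of coefficients that are non-zero in A; as h may kill a
  coefficient, this index set can be smaller than that of \<open>conv\<close>, and the surplus terms
  are shown to have image zero.\<close>

lemma pdo_cover: "full_cover (pdo A) (\<lambda>f i j. h (coef f i j))"
proof (unfold full_cover_def, unfold_locales)
  show "range (\<lambda>f i j. h (coef f i j)) = carrier (pdo A)"
  proof (intro equalityI subsetI)
    fix y assume "y \<in> range (\<lambda>f i j. h (coef f i j))"
    then obtain f where y: "y = (\<lambda>i j. h (coef f i j))" by auto
    obtain r s where "bounded_by r s (coef f)" by (rule coef_bounded)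
    then have "\<forall>i j. i > r \<or> j > s \<longrightarrow> y i j = \<zero>\<^bsub>A\<^esub>" by (auto simp: y bounded_by_def h_0)
    then show "y \<in> carrier (pdo A)" by (auto simp: pdo_def y h_carrier)
  next
    fix y assume "y \<in> carrier (pdo A)"
    then have y: "\<And>i j. y i j \<in> carrier A" and "\<exists>r s. \<forall>i j. i > r \<or> j > s \<longrightarrow> y i j = \<zero>\<^bsub>A\<^esub>"
      by (simp_all add: pdo_def)
    then obtain r s where b: "\<And>i j. i > r \<or> j > s \<Longrightarrow> y i j = \<zero>\<^bsub>A\<^esub>" by blast
    have "\<exists>x. h x = y i j" for i j using y[of i j] unfolding onto[symmetric] by auto
    then obtain g where g: "\<And>i j. h (g i j) = y i j" by metis
    define f where "f i j = (if i > r \<or> j > s then 0 else g i j)" for i j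
    have "bounded_by r s f" by (auto simp: f_def bounded_by_def)
    then have "y = (\<lambda>i j. h (coef (Psd f) i j))" using b g by (auto simp: coef_Psd f_def h_0 fun_eq_iff)
    then show "y \<in> range (\<lambda>f i j. h (coef f i j))" by blast
  qed
  fix x y :: "'t psd" and c
  show "(\<lambda>i j. h (coef (x * y) i j)) = (\<lambda>i j. h (coef x i j)) \<otimes>\<^bsub>pdo A\<^esub> (\<lambda>i j. h (coef y i j))"
  proof (intro ext)
    fix u v
    define F where "F = (\<lambda>(i, j, t). scal (pdo_coeff j (u + int t - i) t) * (coef x i j * coef y (u + int t - i) (v + int t - j)))"
    define K where "K = {(i, j, t). coef x i j \<noteq> 0 \<and> coef y (u + int t - i) (v + int t - j) \<noteq> 0}"
    define L where "L = {(i, j, t). h (coef x i j) \<noteq> \<zero>\<^bsub>A\<^esub> \<and> h (coef y (u + int t - i) (v + int t - j)) \<noteq> \<zero>\<^bsub>A\<^esub>}"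
    obtain r s where b1: "bounded_by r s (coef x)" by (rule coef_bounded)
    obtain r' s' where b2: "bounded_by r' s' (coef y)" by (rule coef_bounded)
    have fin: "finite K" unfolding K_def by (rule finite_subset[OF conv_support[OF b1 b2]]) auto
    have LK: "L \<subseteq> K" by (auto simp: L_def K_def h_0)
    have z: "h (a * b) = h 0" if "h a = h 0 \<or> h b = h 0" for a b
      using that h_mult[of a b] h_mult[of 0 b] h_mult[of a 0] by auto
    have zs: "h (scal e * a) = h 0" if "h a = h 0" for e a
      using that h_scal[of a e] h_scal[of 0 e] by simp
    have "h (coef (x * y) u v) = h (sum F K)" unfolding coef_mult conv_def F_def K_def by simp
    also have "\<dots> = h (\<Sum>k\<in>K. if k \<in> L then F k else 0)"
    proof (rule h_sum_cong)
      fix k assume k: "k \<in> K"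
      obtain i j t where kk: "k = (i, j, t)" by (cases k)
      show "F k \<in> UNIV \<and> (if k \<in> L then F k else 0) \<in> UNIV \<and> h (F k) = h (if k \<in> L then F k else 0)"
        by (auto simp: L_def F_def kk h_0[symmetric] intro!: zs z)
    qed
    also have "\<dots> = h (sum F L)"
      using sum.inter_restrict[OF fin, of F L] LK by (simp add: Int_absorb1)
    also have "\<dots> = (\<Oplus>\<^bsub>A\<^esub>k\<in>L. h (F k))" by (rule h_sum) simp
    also have "(\<lambda>k. h (F k)) = (\<lambda>(i, j, t). pdo_coeff j (u + int t - i) t \<odot>\<^bsub>A\<^esub>
                        (h (coef x i j) \<otimes>\<^bsub>A\<^esub> h (coef y (u + int t - i) (v + int t - j))))"
      by (intro ext) (simp add: F_def case_prod_unfold h_scal h_mult[symmetric])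
    finally show "h (coef (x * y) u v) = ((\<lambda>i j. h (coef x i j)) \<otimes>\<^bsub>pdo A\<^esub> (\<lambda>i j. h (coef y i j))) u v"
      by (simp add: pdo_def L_def)
  qed
qed (auto simp: pdo_def h_add h_0 h_1 coef_1 h_scal fun_eq_iff)

lemma cdet_h:
  assumes Mf: "\<And>a b. a \<in> {1..k} \<Longrightarrow> b \<in> {1..k} \<Longrightarrow> Mf (a, b) = h (M a b)"
  shows "cdet A k Mf = h (col_det [1..<Suc k] M)"
proof -
  interpret A: ring A by (rule ring)
  have k: "set [1..<Suc k] = {1..k}" by auto
  have "h (col_det [1..<Suc k] M) = (\<Oplus>\<^bsub>A\<^esub>\<sigma>\<in>{\<sigma>. \<sigma> permutes {1..k}}. h (of_int (sign \<sigma>) * prod_list (map (\<lambda>b. M (\<sigma> b) b) [1..<Suc k])))"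
    unfolding col_det_alt k by (rule h_sum) simp
  also have "\<dots> = cdet A k Mf"
    unfolding cdet_def
  proof (rule A.finsum_cong')
    fix \<sigma> assume "\<sigma> \<in> {\<sigma>. \<sigma> permutes {1..k}}"
    then have "\<sigma> b \<in> {1..k}" if "b \<in> {1..k}" for b using that permutes_in_image[of \<sigma> "{1..k}" b] by blast
    then have "map (\<lambda>b. Mf (\<sigma> b, b)) [1..<k + 1] = map h (map (\<lambda>b. M (\<sigma> b) b) [1..<Suc k])"
      by (auto intro!: Mf simp del: upt_Suc)
    then have "ord_prod A (map (\<lambda>b. Mf (\<sigma> b, b)) [1..<k + 1]) = h (prod_list (map (\<lambda>b. M (\<sigma> b) b) [1..<Suc k]))"
      by (simp only: h_prod_list subset_UNIV)
    then show e: "h (of_int (sign \<sigma>) * prod_list (map (\<lambda>b. M (\<sigma> b) b) [1..<Suc k]))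
      = of_int (sign \<sigma>) \<odot>\<^bsub>A\<^esub> ord_prod A (map (\<lambda>b. Mf (\<sigma> b, b)) [1..<k + 1])"
      by (simp only: h_scal[OF UNIV_I, symmetric] scal_sign)
    have "h (of_int (sign \<sigma>) * prod_list (map (\<lambda>b. M (\<sigma> b) b) [1..<Suc k])) \<in> carrier A" by (simp add: h_carrier)
    then have "of_int (sign \<sigma>) \<odot>\<^bsub>A\<^esub> ord_prod A (map (\<lambda>b. Mf (\<sigma> b, b)) [1..<k + 1]) \<in> carrier A" unfolding e .
    note this
  next
    show "(\<lambda>\<sigma>. of_int (sign \<sigma>) \<odot>\<^bsub>A\<^esub> ord_prod A (map (\<lambda>b. Mf (\<sigma> b, b)) [1..<k + 1])) \<in> {\<sigma>. \<sigma> permutes {1..k}} \<rightarrow> carrier A"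
    proof
      fix \<sigma> assume "\<sigma> \<in> {\<sigma>. \<sigma> permutes {1..k}}"
      then have "\<sigma> b \<in> {1..k}" if "b \<in> {1..k}" for b using that permutes_in_image[of \<sigma> "{1..k}" b] by blast
      then have m: "map (\<lambda>b. Mf (\<sigma> b, b)) [1..<k + 1] = map h (map (\<lambda>b. M (\<sigma> b) b) [1..<Suc k])"
        by (auto intro!: Mf simp del: upt_Suc)
      show "of_int (sign \<sigma>) \<odot>\<^bsub>A\<^esub> ord_prod A (map (\<lambda>b. Mf (\<sigma> b, b)) [1..<k + 1]) \<in> carrier A"
        unfolding m by (simp only: h_prod_list subset_UNIV h_scal[OF UNIV_I, symmetric] h_carrier UNIV_I)
    qed
  qed simp
  finally show ?thesis by simp
qed

text \<open>\<open>mat_inverse\<close> is a definite description, so uniqueness among matrices over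
  A is required. A competitor n is lifted entry by entry, and n = n (M N) = (n M) N = N holds after
  applying h.\<close>

lemma mat_inverse_h:
  assumes Mf: "\<And>i j. i \<in> {1..k} \<Longrightarrow> j \<in> {1..k} \<Longrightarrow> Mf (i, j) = h (M i j)"
    and right: "\<And>i j. i \<in> {1..k} \<Longrightarrow> j \<in> {1..k} \<Longrightarrow> (\<Sum>u\<in>{1..k}. M i u * N u j) = (if i = j then 1 else 0)"
    and left: "\<And>i j. i \<in> {1..k} \<Longrightarrow> j \<in> {1..k} \<Longrightarrow> (\<Sum>u\<in>{1..k}. N i u * M u j) = (if i = j then 1 else 0)"
  shows "mat_inverse A k Mf = (\<lambda>(i, j)\<in>{1..k} \<times> {1..k}. h (N i j))"
proof -
  interpret A: ring A by (rule ring)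
  let ?K = "{1..k}"
  have mm: "mat_mult A k Af Bf = (\<lambda>(i, j)\<in>?K \<times> ?K. h (\<Sum>u\<in>?K. a i u * b u j))"
    if Af: "\<And>i j. i \<in> ?K \<Longrightarrow> j \<in> ?K \<Longrightarrow> Af (i, j) = h (a i j)" and Bf: "\<And>i j. i \<in> ?K \<Longrightarrow> j \<in> ?K \<Longrightarrow> Bf (i, j) = h (b i j)"
    for Af Bf a b
    unfolding mat_mult_def
  proof (rule restrict_ext, clarify)
    fix i j assume ij: "i \<in> ?K" "j \<in> ?K"
    have "h (\<Sum>u\<in>?K. a i u * b u j) = (\<Oplus>\<^bsub>A\<^esub>u\<in>?K. h (a i u * b u j))" by (rule h_sum) simp
    also have "\<dots> = (\<Oplus>\<^bsub>A\<^esub>u\<in>?K. Af (i, u) \<otimes>\<^bsub>A\<^esub> Bf (u, j))"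
      by (rule A.finsum_cong') (use ij in \<open>auto simp: Af Bf h_mult h_carrier\<close>)
    finally show "(\<Oplus>\<^bsub>A\<^esub>u\<in>?K. Af (i, u) \<otimes>\<^bsub>A\<^esub> Bf (u, j)) = h (\<Sum>u\<in>?K. a i u * b u j)" by simp
  qed
  have one: "mat_one A k = (\<lambda>(i, j)\<in>?K \<times> ?K. h (if i = j then 1 else 0))"
    unfolding mat_one_def by (intro restrict_ext) (auto simp: h_1 h_0)
  let ?N = "\<lambda>(i, j)\<in>?K \<times> ?K. h (N i j)"
  show ?thesis
    unfolding mat_inverse_def
  proof (rule the_equality)
    have "mat_mult A k Mf ?N = (\<lambda>(i, j)\<in>?K \<times> ?K. h (\<Sum>u\<in>?K. M i u * N u j))" by (rule mm) (simp_all add: Mf)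
    also have "\<dots> = mat_one A k" unfolding one by (intro restrict_ext, clarify, simp only: right prod.case)
    finally have 1: "mat_mult A k Mf ?N = mat_one A k" .
    have "mat_mult A k ?N Mf = (\<lambda>(i, j)\<in>?K \<times> ?K. h (\<Sum>u\<in>?K. N i u * M u j))" by (rule mm) (simp_all add: Mf)
    also have "\<dots> = mat_one A k" unfolding one by (intro restrict_ext, clarify, simp only: left prod.case)
    finally have "mat_mult A k ?N Mf = mat_one A k" .
    with 1 show "?N \<in> ?K \<times> ?K \<rightarrow>\<^sub>E carrier A \<and> mat_mult A k Mf ?N = mat_one A k \<and> mat_mult A k ?N Mf = mat_one A k"
      by (auto simp: h_carrier)
  next
    fix N' assume N': "N' \<in> ?K \<times> ?K \<rightarrow>\<^sub>E carrier A \<and> mat_mult A k Mf N' = mat_one A k \<and> mat_mult A k N' Mf = mat_one A k"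
    define n where "n i j = (SOME x. h x = N' (i, j))" for i j
    have n: "N' (i, j) = h (n i j)" if "i \<in> ?K" "j \<in> ?K" for i j
    proof -
      have "N' (i, j) \<in> carrier A" using N' that by (auto simp: PiE_def Pi_def)
      then have "\<exists>x. h x = N' (i, j)" unfolding onto[symmetric] by auto
      then show ?thesis unfolding n_def by (metis (mono_tags, lifting) someI_ex)
    qed
    have nM: "h (\<Sum>u\<in>?K. n i u * M u j) = h (if i = j then 1 else 0)" if ij: "i \<in> ?K" "j \<in> ?K" for i j
    proof -
      have "mat_mult A k N' Mf = (\<lambda>(i, j)\<in>?K \<times> ?K. h (\<Sum>u\<in>?K. n i u * M u j))" by (rule mm) (auto simp: n Mf)
      then have "(\<lambda>(i, j)\<in>?K \<times> ?K. h (\<Sum>u\<in>?K. n i u * M u j)) (i, j) = (\<lambda>(i, j)\<in>?K \<times> ?K. h (if i = j then 1 else 0)) (i, j)"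
        using N' one by simp
      then show ?thesis using ij by simp
    qed
    have "N' (i, j) = h (N i j)" if ij: "i \<in> ?K" "j \<in> ?K" for i j
    proof -
      have "n i j = (\<Sum>u\<in>?K. n i u * (if u = j then 1 else 0))"
        using ij by (simp add: mult_delta)
      also have "\<dots> = (\<Sum>u\<in>?K. n i u * (\<Sum>v\<in>?K. M u v * N v j))"
        by (intro sum.cong refl) (simp only: right ij)
      also have "\<dots> = (\<Sum>v\<in>?K. (\<Sum>u\<in>?K. n i u * M u v) * N v j)"
        unfolding sum_distrib_left sum_distrib_right by (subst sum.swap) (simp add: mult.assoc)
      finally have "h (n i j) = h (\<Sum>v\<in>?K. (\<Sum>u\<in>?K. n i u * M u v) * N v j)" by simp
      also have "\<dots> = h (\<Sum>v\<in>?K. (if i = v then 1 else 0) * N v j)"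
        by (rule h_sum_cong) (simp only: h_mult UNIV_I nM ij simp_thms)
      also have "(\<Sum>v\<in>?K. (if i = v then 1 else 0) * N v j) = N i j"
        using ij by (simp add: delta_mult)
      finally show ?thesis using n[OF ij] by simp
    qed
    then show "N' = ?N" using N' by (intro extensionalityI[of _ "?K \<times> ?K"]) (auto simp: PiE_def)
  qed
qed

lemma berezinian_h:
  assumes Mf: "\<And>i j. i \<in> {1..n} \<Longrightarrow> j \<in> {1..n} \<Longrightarrow> Mf (i, j) = h (M i j)"
    and right: "\<And>k i j. k \<le> n \<Longrightarrow> i \<in> {1..k} \<Longrightarrow> j \<in> {1..k} \<Longrightarrow> (\<Sum>u\<in>{1..k}. M i u * N k u j) = (if i = j then 1 else 0)"
    and left: "\<And>k i j. k \<le> n \<Longrightarrow> i \<in> {1..k} \<Longrightarrow> j \<in> {1..k} \<Longrightarrow> (\<Sum>u\<in>{1..k}. N k i u * M u j) = (if i = j then 1 else 0)"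
    and u: "\<And>k. k \<in> {1..n} \<Longrightarrow> unit (N k k k)"
  shows "berezinian A n s Mf = h (prod_list (map (\<lambda>k. if s k = 0 then uinv (N k k k) else N k k k) [1..<Suc n]))"
proof -
  have "(if s k = 0 then qminor A Mf k else inv\<^bsub>A\<^esub> qminor A Mf k) = h (if s k = 0 then uinv (N k k k) else N k k k)"
    if k: "k \<in> {1..n}" for k
  proof -
    have "mat_inverse A k Mf = (\<lambda>(i, j)\<in>{1..k} \<times> {1..k}. h (N k i j))"
      by (rule mat_inverse_h[where M = M]) (use k in \<open>(intro Mf right left; simp)+\<close>)
    then have q: "qminor A Mf k = h (uinv (N k k k))"
      using k by (simp add: qminor_def h_uinv u)
    show ?thesis unfolding q using u[OF k] by (simp add: h_uinv unit_uinv uinv_uinv)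
  qed
  then have m: "map (\<lambda>k. if s k = 0 then qminor A Mf k else inv\<^bsub>A\<^esub> qminor A Mf k) [1..<n + 1]
     = map h (map (\<lambda>k. if s k = 0 then uinv (N k k k) else N k k k) [1..<Suc n])"
    by (auto simp del: upt_Suc)
  show ?thesis unfolding berezinian_def m by (simp only: h_prod_list subset_UNIV)
qed

end

section \<open>The polynomial superalgebra as a type\<close>

lemma psign_simps: "psign 0 = 1" "psign 1 = - 1" by (simp_all add: psign_def)

lemma psign_add: "psign (a + b) = psign a * psign b"
  by (cases "a = 0"; cases "b = 0") (simp_all add: psign_def)

lemma scal_pull: "(scal a * x) * (scal b * y) = scal (a * b) * (x * (y :: 'a::calg))"
  by (simp add: scal_mult mult.assoc scal_left_commute[of x])

lemma ev_twist:
  assumes "\<And>u. u \<in> Poly_Mapping.keys f \<Longrightarrow> prod_list (map \<theta>' (letters u)) = scal c * prod_list (map \<theta> (letters u))"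
  shows "ev \<theta>' f = scal c * ev \<theta> f"
  unfolding ev_def sum_distrib_left
  by (intro sum.cong refl) (simp add: assms scal_left_commute[of "scal _"])

typedef (overloaded) 'a lend = "{T :: 'a::calg \<Rightarrow> 'a. (\<forall>x y. T (x + y) = T x + T y) \<and> (\<forall>c x. T (scal c * x) = scal c * T x)}"
  morphisms app Lend
  by (rule exI[of _ "\<lambda>x. x"]) auto

lemma app_add: "app T (x + y) = app T x + app T y" and app_scal: "app T (scal c * x) = scal c * app T x"
  using app[of T] by auto

lemma app_Lend:
  assumes "\<And>x y. T (x + y) = T x + T y" "\<And>c x. T (scal c * x) = scal c * T x"
  shows "app (Lend T) = T"
  by (rule Lend_inverse) (use assms in auto)

lemma lend_eqI: "(\<And>x. app T x = app U x) \<Longrightarrow> T = U"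
  by (metis app_inject ext)

instantiation lend :: (calg) calg
begin

definition "0 = Lend (\<lambda>_. 0 :: 'a)"
definition "1 = Lend (\<lambda>x :: 'a. x)"
definition "T + U = Lend (\<lambda>x :: 'a. app T x + app U x)"
definition "- T = Lend (\<lambda>x :: 'a. - app T x)"
definition "T - U = Lend (\<lambda>x :: 'a. app T x - app U x)"
definition "T * U = Lend (\<lambda>x :: 'a. app T (app U x))"
definition scal_lend :: "complex \<Rightarrow> 'a lend" where "scal_lend c = Lend (\<lambda>x :: 'a. scal c * x)"

lemma lend_simps:
  "app 0 x = (0 :: 'a)" "app 1 x = x" "app (T + U) x = app T x + app U x" "app (- T) x = - app T x"
  "app (T - U) x = app T x - app U x" "app (T * U) x = app T (app U x)" "app (scal c) x = scal c * x"
  unfolding zero_lend_def one_lend_def plus_lend_def uminus_lend_def minus_lend_def times_lend_def scal_lend_def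
  by (subst app_Lend; simp add: app_add app_scal algebra_simps scal_scal)+

instance
proof
  show "(0 :: 'a lend) \<noteq> 1" using lend_simps(1,2)[of 1] by (metis zero_neq_one)
  fix c e and T :: "'a lend"
  show "scal (c * e) = scal c * (scal e :: 'a lend)" by (rule lend_eqI) (simp add: lend_simps scal_mult mult.assoc)
  show "scal 1 = (1 :: 'a lend)" by (rule lend_eqI) (simp add: lend_simps)
  show "scal c * T = T * scal c" by (rule lend_eqI) (simp add: lend_simps app_scal)
qed (rule lend_eqI; simp add: lend_simps app_add app_scal scal_add scal_mult algebra_simps)+

end

datatype 'a ut = UT (ud1: 'a) (uoff: 'a) (ud2: 'a)

text \<open>
  A twisted derivation \<open>\<delta> (x y) = \<sigma> x \<cdot> \<delta> y + \<delta> x \<cdot> y\<close> is the off-diagonal entry of an algebra homomorphism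
  into the upper triangular \<open>2 \<times> 2\<close> matrices with diagonal \<open>(\<sigma> x, x)\<close>.
\<close>

instantiation ut :: (calg) calg
begin

definition "0 = UT 0 0 (0 :: 'a)"
definition "1 = UT 1 0 (1 :: 'a)"
definition "x + y = UT (ud1 x + ud1 y) (uoff x + uoff y) (ud2 x + ud2 y :: 'a)"
definition "- x = UT (- ud1 x) (- uoff x) (- ud2 x :: 'a)"
definition "x - y = UT (ud1 x - ud1 y) (uoff x - uoff y) (ud2 x - ud2 y :: 'a)"
definition "x * y = UT (ud1 x * ud1 y) (ud1 x * uoff y + uoff x * ud2 y) (ud2 x * ud2 y :: 'a)"
definition scal_ut :: "complex \<Rightarrow> 'a ut" where "scal_ut c = UT (scal c) 0 (scal c)"

lemmas ut_defs = zero_ut_def one_ut_def plus_ut_def uminus_ut_def minus_ut_def times_ut_def scal_ut_def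

instance
  by standard (auto simp: ut_defs algebra_simps scal_add scal_mult intro: scal_central)

end

lemma comm_rels_F: "comm_rels V par \<subseteq> carrier (free_superalg V par)"
proof -
  interpret presentation V par "{}" by unfold_locales simp
  show ?thesis by (auto simp: comm_rels_def F_iff restr_simps scalar_scal)
qed

definition duality_at :: "nat \<Rightarrow> nat \<Rightarrow> nat \<Rightarrow> nat \<Rightarrow> nat \<Rightarrow> bool" where
  "duality_at p q m n d \<longleftrightarrow> (\<forall>d' p' q' m' n' w z \<xi> \<gamma>.
    (\<forall>a\<in>{1..d'}. \<xi> a > 0) \<longrightarrow> (\<Sum>a\<in>{1..d'}. \<xi> a) = d \<longrightarrow>
    (\<forall>i\<in>{1..p' + q' + m' + n'}. \<gamma> i > 0) \<longrightarrow> (\<Sum>i\<in>{1..p'}. \<gamma> i) = p \<longrightarrow> (\<Sum>i\<in>{1..q'}. \<gamma> (p' + i)) = q \<longrightarrow>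
    (\<Sum>i\<in>{1..m'}. \<gamma> (p' + q' + i)) = m \<longrightarrow> (\<Sum>i\<in>{1..n'}. \<gamma> (p' + q' + m' + i)) = n \<longrightarrow>
    phi p q m n d (p' + q') (p' + q' + m' + n') \<gamma> ` gaudin_gl d d' (p' + q' + m' + n') w \<xi> z \<gamma>
       = varphi p q m n d d' \<xi> ` gaudin_gls p q m n d' (p' + q' + m' + n') w \<xi> z \<gamma>)"

text \<open>
  The parameters are fixed as a counterexample to the theorem (arbitrary if there is none), so that
  the polynomial superalgebra becomes a type and no parameter has to be carried by its algebra class.
\<close>

definition counterexample :: "nat \<times> nat \<times> nat \<times> nat \<times> nat" where
  "counterexample = (SOME (p, q, m, n, d). \<not> duality_at p q m n d)"

definition "par_p = fst counterexample"
definition "par_q = fst (snd counterexample)"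
definition "par_m = fst (snd (snd counterexample))"
definition "par_n = fst (snd (snd (snd counterexample)))"
definition "par_d = snd (snd (snd (snd counterexample)))"

lemma duality_at_counterexample:
  assumes "duality_at par_p par_q par_m par_n par_d"
  shows "duality_at p q m n d"
proof (rule ccontr)
  assume "\<not> duality_at p q m n d"
  then have "case (p, q, m, n, d) of (p, q, m, n, d) \<Rightarrow> \<not> duality_at p q m n d" by simp
  then have "case counterexample of (p, q, m, n, d) \<Rightarrow> \<not> duality_at p q m n d"
    unfolding counterexample_def by (rule someI)
  then have "\<not> duality_at par_p par_q par_m par_n par_d"
    by (simp add: case_prod_unfold par_p_def par_q_def par_m_def par_n_def par_d_def)
  with assms show False by contradiction
qed

abbreviation "V \<equiv> vars par_p par_q par_m par_n par_d"
abbreviation "vp \<equiv> var_par par_p par_m"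
abbreviation "SP \<equiv> superpoly V vp"

interpretation SPP: presentation V vp "comm_rels V vp"
  by unfold_locales (rule comm_rels_F)

lemma ev_comm_rel: "ev \<theta> (letter u * letter v - scalar c * (letter v * letter u)) = \<theta> u * \<theta> v - scal c * (\<theta> v * \<theta> u)"
  by (simp add: ev_simps scalar_scal)

text \<open>Assignments that satisfy the supercommutation relations and vanish off the variables; by
  \<open>good_ev\<close> they descend to the polynomial superalgebra.\<close>

definition good :: "(var \<Rightarrow> 't::calg) \<Rightarrow> bool" where
  "good \<theta> \<longleftrightarrow> (\<forall>u. u \<notin> V \<longrightarrow> \<theta> u = 0) \<and> (\<forall>u\<in>V. \<forall>v\<in>V. \<theta> u * \<theta> v = scal (psign (vp u * vp v)) * (\<theta> v * \<theta> u))"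

lemma good_ev: "good \<theta> \<Longrightarrow> SPP.pr x = SPP.pr y \<Longrightarrow> ev \<theta> x = ev \<theta> y"
  by (rule SPP.pr_eqD) (auto simp: good_def comm_rels_def ev_comm_rel)

\<comment> \<open>Two free polynomials are identified when their cosets agree, so
  \<open>spoly_rep\<close> is a bijection onto the carrier of \<open>superpoly V vp\<close>.\<close>
quotient_type spoly = "var free" / "\<lambda>x y. SPP.pr x = SPP.pr y"
  by (rule equivpI) (auto simp: reflp_def symp_def transp_def)

instantiation spoly :: calg
begin

lift_definition zero_spoly :: spoly is 0 .
lift_definition one_spoly :: spoly is 1 .
lift_definition plus_spoly :: "spoly \<Rightarrow> spoly \<Rightarrow> spoly" is "(+)" by (simp add: SPP.P.h_add)
lift_definition times_spoly :: "spoly \<Rightarrow> spoly \<Rightarrow> spoly" is "(*)" by (simp add: SPP.P.h_mult)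
lift_definition uminus_spoly :: "spoly \<Rightarrow> spoly" is uminus by (simp add: SPP.P.h_uminus)
lift_definition minus_spoly :: "spoly \<Rightarrow> spoly \<Rightarrow> spoly" is "(-)" by (simp add: SPP.P.h_minus)
lift_definition scal_spoly :: "complex \<Rightarrow> spoly" is scal .

instance
proof
  show "(0 :: spoly) \<noteq> 1"
  proof transfer
    \<comment> \<open>Setting all variables to 0 separates 1 from 0.\<close>
    have "good (\<lambda>_. 0 :: complex)" by (simp add: good_def)
    then show "SPP.pr 0 \<noteq> SPP.pr 1" using good_ev[of "\<lambda>_. 0 :: complex" 0 1] by (auto simp: ev_simps)
  qed
  fix c and x :: spoly
  show "scal c * x = x * scal c" by transfer (metis scal_central)
qed (transfer; simp add: algebra_simps scal_add scal_mult)+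

end

lift_definition spoly_rep :: "spoly \<Rightarrow> var free set" is SPP.pr by simp

lemma spoly_rep_inject: "spoly_rep x = spoly_rep y \<Longrightarrow> x = y" by transfer

lemma spoly_ex: "\<exists>f. x = abs_spoly f" by (induct x rule: spoly.abs_induct) blast

lemma abs_simps:
  "abs_spoly (f + g) = abs_spoly f + abs_spoly g" "abs_spoly (f * g) = abs_spoly f * abs_spoly g"
  "abs_spoly (f - g) = abs_spoly f - abs_spoly g" "abs_spoly 1 = 1" "abs_spoly 0 = 0" "abs_spoly (scal c) = scal c"
  by (simp_all add: plus_spoly.abs_eq times_spoly.abs_eq minus_spoly.abs_eq one_spoly.abs_eq zero_spoly.abs_eq scal_spoly.abs_eq)

interpretation Q: full_cover SP spoly_rep
proof (unfold full_cover_def, unfold_locales)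
  have "range spoly_rep = range SPP.pr"
  proof (intro equalityI subsetI)
    fix X assume "X \<in> range spoly_rep"
    then obtain x where "X = spoly_rep x" by auto
    then show "X \<in> range SPP.pr" using spoly_ex[of x] by (auto simp: spoly_rep.abs_eq)
  next
    fix X assume "X \<in> range SPP.pr"
    then obtain f where "X = SPP.pr f" by auto
    then have "X = spoly_rep (abs_spoly f)" by (simp add: spoly_rep.abs_eq)
    then show "X \<in> range spoly_rep" by blast
  qed
  then show "range spoly_rep = carrier SP" using SPP.P.onto by (simp add: superpoly_def)
  fix x y c
  show "spoly_rep (x + y) = spoly_rep x \<oplus>\<^bsub>SP\<^esub> spoly_rep y" unfolding superpoly_def by transfer (simp add: SPP.P.h_add)
  show "spoly_rep (x * y) = spoly_rep x \<otimes>\<^bsub>SP\<^esub> spoly_rep y" unfolding superpoly_def by transfer (simp add: SPP.P.h_mult)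
  show "spoly_rep 0 = \<zero>\<^bsub>SP\<^esub>" unfolding superpoly_def by transfer (simp add: SPP.P.h_0)
  show "spoly_rep 1 = \<one>\<^bsub>SP\<^esub>" unfolding superpoly_def by transfer (simp add: SPP.P.h_1)
  show "spoly_rep (scal c * x) = c \<odot>\<^bsub>SP\<^esub> spoly_rep x" unfolding superpoly_def by transfer (simp add: SPP.P.h_scal)
qed auto

definition qv :: "var \<Rightarrow> spoly" where "qv u = abs_spoly (letter u)"

lemma qv_comm:
  assumes "u \<in> V" "v \<in> V"
  shows "qv u * qv v = scal (psign (vp u * vp v)) * (qv v * qv u)"
proof -
  have "letter u * letter v - scalar (psign (vp u * vp v)) * (letter v * letter u) \<in> comm_rels V vp"
    unfolding comm_rels_def using assms by blast
  from SPP.pr_rel[OF this] have "abs_spoly (letter u * letter v - scalar (psign (vp u * vp v)) * (letter v * letter u)) = abs_spoly 0"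
    by (simp only: spoly.abs_eq_iff)
  then show ?thesis by (simp add: abs_simps scalar_scal qv_def)
qed

lemma abs_spoly_ev: "abs_spoly f = ev qv f"
  by (induction f rule: free_induct) (simp_all add: abs_simps ev_simps qv_def)

lemma spoly_induct [case_names one var scal add]:
  assumes "Q 1" "\<And>u x. u \<in> V \<Longrightarrow> Q x \<Longrightarrow> Q (qv u * x)" "\<And>c x. Q x \<Longrightarrow> Q (scal c * x)" "\<And>x y. Q x \<Longrightarrow> Q y \<Longrightarrow> Q (x + y)"
  shows "Q (x :: spoly)"
proof -
  have "Q (abs_spoly f)" for f
  proof (induction f rule: free_induct)
    case (letter b f)
    show ?case
    proof (cases "b \<in> V")
      case False
      then have "abs_spoly (letter b) = abs_spoly 0" using SPP.pr_letter_outside[OF False] by (simp only: spoly.abs_eq_iff)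
      then show ?thesis using assms(3)[of 1 0] assms(1) by (simp add: abs_simps)
    qed (use letter assms(2) in \<open>auto simp: abs_simps qv_def\<close>)
  qed (auto simp: abs_simps intro: assms)
  then show ?thesis using spoly_ex[of x] by auto
qed

definition spoly_lift :: "(var \<Rightarrow> 't::calg) \<Rightarrow> spoly \<Rightarrow> 't" where
  "spoly_lift \<theta> x = ev \<theta> (SOME f. abs_spoly f = x)"

lemma spoly_lift_abs:
  assumes "good \<theta>"
  shows "spoly_lift \<theta> (abs_spoly f) = ev \<theta> f"
proof -
  have "abs_spoly (SOME g. abs_spoly g = abs_spoly f) = abs_spoly f" by (rule someI[of _ f]) simp
  then show ?thesis unfolding spoly_lift_def by (intro good_ev[OF assms]) (simp only: spoly.abs_eq_iff)
qed

lemma spoly_lift: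
  assumes "good \<theta>"
  shows "hom_calg (spoly_lift \<theta>)" "u \<in> V \<Longrightarrow> spoly_lift \<theta> (qv u) = \<theta> u"
proof -
  show "hom_calg (spoly_lift \<theta>)"
    unfolding hom_calg_def
  proof (intro conjI allI)
    fix x y c
    obtain f g where "x = abs_spoly f" "y = abs_spoly g" using spoly_ex by blast
    then show "spoly_lift \<theta> (x + y) = spoly_lift \<theta> x + spoly_lift \<theta> y" "spoly_lift \<theta> (x * y) = spoly_lift \<theta> x * spoly_lift \<theta> y"
      by (simp_all add: abs_simps(1,2)[symmetric] spoly_lift_abs[OF assms] ev_simps)
    show "spoly_lift \<theta> 1 = 1" "spoly_lift \<theta> (scal c) = scal c"
      using spoly_lift_abs[OF assms, of 1] spoly_lift_abs[OF assms, of "scal c"] by (simp_all add: abs_simps ev_simps)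
  qed
  show "spoly_lift \<theta> (qv u) = \<theta> u" by (simp add: qv_def spoly_lift_abs[OF assms])
qed

definition der_gen :: "var \<Rightarrow> var \<Rightarrow> spoly ut" where
  "der_gen v u = (if u \<in> V then UT (scal (psign (vp v * vp u)) * qv u) (if u = v then 1 else 0) (qv u) else 0)"

lemma good_der_gen: "good (der_gen v)"
  unfolding good_def
proof (intro conjI ballI allI impI)
  fix u w assume uw: "u \<in> V" "w \<in> V"
  show "der_gen v u * der_gen v w = scal (psign (vp u * vp w)) * (der_gen v w * der_gen v u)"
    using uw qv_comm[OF uw]
    by (cases "vp u = 0"; cases "vp v = 0"; cases "vp w = 0")
       (auto simp: der_gen_def ut_defs psign_simps scal_minus)
qed (simp add: der_gen_def)

definition Dq :: "var \<Rightarrow> spoly \<Rightarrow> spoly" where "Dq v x = uoff (spoly_lift (der_gen v) x)"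
definition Sq :: "var \<Rightarrow> spoly \<Rightarrow> spoly" where "Sq v x = ud1 (spoly_lift (der_gen v) x)"

lemmas der_hom = hom_calgD[OF spoly_lift(1)[OF good_der_gen]]

lemma ud2_der: "ud2 (spoly_lift (der_gen v) x) = x"
  by (induction x rule: spoly_induct)
     (simp_all add: der_hom spoly_lift(2)[OF good_der_gen] ut_defs, simp add: der_gen_def)

lemma Dq_simps:
  "Dq v (x + y) = Dq v x + Dq v y" "Dq v (scal c * x) = scal c * Dq v x" "Dq v 1 = 0" "Dq v 0 = 0"
  "Dq v (x * y) = Sq v x * Dq v y + Dq v x * y"
  by (simp_all add: Dq_def Sq_def der_hom ut_defs ud2_der[unfolded ut_defs] ud2_der)

lemma Dq_qv: "u \<in> V \<Longrightarrow> Dq v (qv u) = (if u = v then 1 else 0)"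
  by (simp add: Dq_def spoly_lift(2)[OF good_der_gen] der_gen_def)

lemma Dq_diff: "Dq v (x - y) = Dq v x - Dq v y"
  by (simp add: Dq_def der_hom ut_defs)

lemma Sq_simps: "Sq v (x * y) = Sq v x * Sq v y" "u \<in> V \<Longrightarrow> Sq v (qv u) = scal (psign (vp v * vp u)) * qv u"
  by (simp add: Sq_def der_hom ut_defs) (simp add: Sq_def spoly_lift(2)[OF good_der_gen] der_gen_def)

lemma Dq_var: "u \<in> V \<Longrightarrow> Dq v (qv u * x) = scal (psign (vp v * vp u)) * (qv u * Dq v x) + (if u = v then x else 0)"
  by (simp add: Dq_simps(5) Dq_qv Sq_simps mult.assoc)

text \<open>These values define the grading automorphism. The homogeneous components are its
  eigenspaces, so membership in \<open>part\<close> can be replaced by an equation.\<close>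

definition parity_gen :: "var \<Rightarrow> spoly" where "parity_gen u = (if u \<in> V then scal (psign (vp u)) * qv u else 0)"
definition parity_op :: "spoly \<Rightarrow> spoly" where "parity_op = spoly_lift parity_gen"

lemma good_parity_gen: "good parity_gen"
  unfolding good_def
proof (intro conjI ballI allI impI)
  fix u w assume uw: "u \<in> V" "w \<in> V"
  show "parity_gen u * parity_gen w = scal (psign (vp u * vp w)) * (parity_gen w * parity_gen u)"
    using uw qv_comm[OF uw]
    by (cases "vp u = 0"; cases "vp w = 0") (auto simp: parity_gen_def psign_simps scal_minus)
qed (simp add: parity_gen_def)

lemmas parity_hom = hom_calgD[OF spoly_lift(1)[OF good_parity_gen], folded parity_op_def]

lemma parity_var: "u \<in> V \<Longrightarrow> parity_op (qv u) = scal (psign (vp u)) * qv u"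
  by (simp add: parity_op_def spoly_lift(2)[OF good_parity_gen] parity_gen_def)

lemma parity_part_free:
  assumes f: "f \<in> part SPP.F e"
  shows "ev parity_gen f = scal (psign e) * ev qv f"
proof (rule ev_twist)
  fix u assume "u \<in> Poly_Mapping.keys f"
  then have u: "set (letters u) \<subseteq> V" "sum_list (map vp (letters u)) = e" using f by (auto simp: free_superalg_def)
  have "prod_list (map parity_gen l) = scal (psign (sum_list (map vp l))) * prod_list (map qv l)" if "set l \<subseteq> V" for l
    using that
  proof (induction l)
    case (Cons a l)
    have IH: "prod_list (map parity_gen l) = scal (psign (sum_list (map vp l))) * prod_list (map qv l)"
      using Cons by simp
    have a: "parity_gen a = scal (psign (vp a)) * qv a" using Cons.prems by (simp add: parity_gen_def)
    show ?case by (simp only: list.map prod_list.Cons sum_list.Cons psign_add a IH scal_pull)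
  qed (simp add: psign_simps)
  from this[OF u(1)] show "prod_list (map parity_gen (letters u)) = scal (psign e) * prod_list (map qv (letters u))" by (simp only: u(2))
qed

text \<open>For the converse, a representative is split into words of parity e and words of parity e
  + 1. The second part gives an eigenvector of the opposite sign, so it vanishes in the quotient,
  and words of parity e suffice.\<close>

lemma part_iff: "spoly_rep x \<in> part SP e \<longleftrightarrow> parity_op x = scal (psign e) * x"
proof
  assume "spoly_rep x \<in> part SP e"
  then obtain f where f: "f \<in> part SPP.F e" "spoly_rep x = SPP.pr f"
    by (auto simp: superpoly_def SPP.part_eq)
  then have x: "x = abs_spoly f" by (intro spoly_rep_inject) (simp add: spoly_rep.abs_eq)
  show "parity_op x = scal (psign e) * x"
    unfolding parity_op_def x unfolding spoly_lift_abs[OF good_parity_gen] unfolding parity_part_free[OF f(1)] abs_spoly_ev ..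
next
  assume par: "parity_op x = scal (psign e) * x"
  obtain f0 where f0: "x = abs_spoly f0" using spoly_ex by blast
  define f where "f = restr V f0"
  have f: "f \<in> carrier SPP.F" unfolding f_def by (rule SPP.restr_F)
  have "SPP.pr f = SPP.pr f0" by (simp add: f_def SPP.pr_def SPP.restr_id[OF SPP.restr_F])
  then have x: "x = abs_spoly f" unfolding f0 by (simp only: spoly.abs_eq_iff)
  let ?w = "\<lambda>u. sum_list (map vp (letters u))"
  define g where "g e = (\<Sum>u\<in>{u \<in> Poly_Mapping.keys f. ?w u = e}. Poly_Mapping.single u (Poly_Mapping.lookup f u))" for e
  have fin: "finite {u \<in> Poly_Mapping.keys f. ?w u = e}" for e by simp
  have lg: "Poly_Mapping.lookup (g e) u = (if ?w u = e then Poly_Mapping.lookup f u else 0)" for e u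
    unfolding g_def lookup_sum lookup_single when_def using fin[of e] by (auto simp: in_keys_iff)
  have gp: "g e \<in> part SPP.F e" for e
    using f by (auto simp: free_superalg_def in_keys_iff lg split: if_splits)
  define e1 where "e1 = e + 1"
  have pe: "psign e1 = - psign e" unfolding e1_def psign_add by (simp add: psign_simps)
  have fg: "f = g e + g e1"
    by (rule poly_mapping_eqI) (auto simp: lookup_add lg e1_def)
  let ?a = "abs_spoly (g e)" and ?b = "abs_spoly (g e1)"
  have "parity_op x = scal (psign e) * ?a - scal (psign e) * ?b"
    unfolding x parity_op_def spoly_lift_abs[OF good_parity_gen] using parity_part_free[OF gp[of e]] parity_part_free[OF gp[of e1]]
    by (subst fg) (simp add: ev_simps abs_spoly_ev pe scal_minus)
  moreover have xab: "x = ?a + ?b" unfolding x by (subst fg) (rule abs_simps)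
  ultimately have "scal (psign e) * ?a - scal (psign e) * ?b = scal (psign e) * ?a + scal (psign e) * ?b"
    using par by (simp add: distrib_left)
  then have "scal (psign e) * ?b + scal (psign e) * ?b = 0" by (simp add: algebra_simps)
  then have "scal (psign e / 2) * (scal (psign e) * ?b + scal (psign e) * ?b) = 0" by simp
  then have "scal (psign e / 2 * psign e) * ?b + scal (psign e / 2 * psign e) * ?b = 0"
    by (simp only: scal_scal distrib_left)
  moreover have "psign e / 2 * psign e + psign e / 2 * psign e = 1" by (simp add: psign_def)
  ultimately have b: "?b = 0" unfolding distrib_right[symmetric] scal_add[symmetric] by simp
  then have "x = abs_spoly (g e)" using xab by simp
  then show "spoly_rep x \<in> part SP e" using gp[of e] by (simp add: superpoly_def SPP.part_eq spoly_rep.abs_eq)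
qed

text \<open>The twist of the derivation \<open>Dq v\<close> is the identity for even v and the
  grading automorphism for odd v.\<close>

lemma Sq_part: "parity_op x = scal (psign e) * x \<Longrightarrow> Sq v x = scal (psign (vp v * e)) * x"
proof -
  have "Sq v x = (if vp v = 0 then x else parity_op x)"
    by (induction x rule: spoly_induct)
       (auto simp: Sq_def der_hom parity_hom ut_defs spoly_lift(2)[OF good_der_gen] parity_var der_gen_def psign_simps)
  then show "parity_op x = scal (psign e) * x \<Longrightarrow> ?thesis" by (auto simp: psign_simps)
qed

section \<open>Endomorphisms and the Weyl superalgebra\<close>

definition spoly_of :: "var free set \<Rightarrow> spoly" where "spoly_of X = (SOME x. spoly_rep x = X)"

lemma spoly_of_rep [simp]: "spoly_of (spoly_rep x) = x"
  unfolding spoly_of_def by (rule some_equality) (auto dest: spoly_rep_inject)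

definition lend_rep :: "spoly lend \<Rightarrow> weyl_op" where
  "lend_rep T = (\<lambda>X\<in>carrier SP. spoly_rep (app T (spoly_of X)))"

lemma SP_carrier: "X \<in> carrier SP \<longleftrightarrow> (\<exists>x. X = spoly_rep x)"
  using Q.onto by auto

lemma rep_carrier [simp]: "spoly_rep x \<in> carrier SP"
  by (auto simp: SP_carrier)

lemma lend_rep_app: "lend_rep T (spoly_rep x) = spoly_rep (app T x)"
  by (simp add: lend_rep_def)

lemma op_eqI: "E \<in> extensional (carrier SP) \<Longrightarrow> E' \<in> extensional (carrier SP) \<Longrightarrow>
    (\<And>x. E (spoly_rep x) = E' (spoly_rep x)) \<Longrightarrow> E = E'"
  by (rule extensionalityI[of _ "carrier SP"]) (auto simp: SP_carrier)

lemma lend_rep_ext [simp]: "lend_rep T \<in> extensional (carrier SP)"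
  by (simp add: lend_rep_def)

lemma end_carrier: "E \<in> carrier (end_superalg SP) \<longleftrightarrow> (\<exists>T. E = lend_rep T)"
proof
  assume E: "E \<in> carrier (end_superalg SP)"
  then have E1: "E \<in> extensional (carrier SP)" "E \<in> carrier SP \<rightarrow> carrier SP"
    and E2: "\<And>f g. f \<in> carrier SP \<Longrightarrow> g \<in> carrier SP \<Longrightarrow> E (f \<oplus>\<^bsub>SP\<^esub> g) = E f \<oplus>\<^bsub>SP\<^esub> E g"
    and E3: "\<And>c f. f \<in> carrier SP \<Longrightarrow> E (c \<odot>\<^bsub>SP\<^esub> f) = c \<odot>\<^bsub>SP\<^esub> E f"
    by (simp_all add: end_superalg_def Let_def PiE_def)
  define f where "f x = spoly_of (E (spoly_rep x))" for x
  have f: "E (spoly_rep x) = spoly_rep (f x)" for x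
  proof -
    have "E (spoly_rep x) \<in> carrier SP" using E1(2) rep_carrier by (rule funcset_mem)
    then obtain y where "E (spoly_rep x) = spoly_rep y" by (auto simp: SP_carrier)
    then show ?thesis by (simp add: f_def)
  qed
  have 1: "f (x + y) = f x + f y" for x y
    using E2[of "spoly_rep x" "spoly_rep y"] by (intro spoly_rep_inject) (simp add: Q.h_add f[symmetric])
  have 2: "f (scal c * x) = scal c * f x" for c x
    using E3[of "spoly_rep x" c] by (intro spoly_rep_inject) (simp add: Q.h_scal f[symmetric])
  have "E = lend_rep (Lend f)"
    by (rule op_eqI) (simp_all add: E1 lend_rep_app f app_Lend[OF 1 2])
  then show "\<exists>T. E = lend_rep T" by blast
next
  assume "\<exists>T. E = lend_rep T"
  then obtain T where "E = lend_rep T" by blast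
  then show "E \<in> carrier (end_superalg SP)"
    by (auto simp: end_superalg_def Let_def PiE_def Pi_def SP_carrier lend_rep_app app_add app_scal
        Q.h_add[symmetric] Q.h_scal[symmetric])
qed

interpretation EN: full_cover "end_superalg SP" lend_rep
proof (unfold full_cover_def, unfold_locales)
  show "range lend_rep = carrier (end_superalg SP)" by (auto simp: end_carrier)
qed (auto intro!: op_eqI simp: end_superalg_def Let_def compose_def lend_rep_app lend_simps Q.h_add Q.h_scal Q.h_0)

definition Mo :: "var \<Rightarrow> spoly lend" where "Mo u = Lend (\<lambda>x. qv u * x)"
definition De :: "var \<Rightarrow> spoly lend" where "De v = Lend (Dq v)"

lemma app_Mo: "app (Mo u) x = qv u * x"
  unfolding Mo_def by (subst app_Lend) (simp_all add: distrib_left scal_left_commute[of "qv u"])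

lemma app_De: "app (De v) x = Dq v x"
  unfolding De_def by (subst app_Lend) (simp_all add: Dq_simps(1,2))

lemma superpoly_var_rep: "u \<in> V \<Longrightarrow> superpoly_var V vp u = spoly_rep (qv u)"
  using SPP.pr_letter[of u] by (simp add: superpoly_var_def qv_def spoly_rep.abs_eq)

lemma mul_op_rep: "u \<in> V \<Longrightarrow> mul_op V vp u = lend_rep (Mo u)"
  by (rule op_eqI) (simp_all add: mul_op_def lend_rep_app app_Mo Q.h_mult superpoly_var_rep)

lemma partE:
  assumes "X \<in> part SP e"
  obtains x where "X = spoly_rep x" "parity_op x = scal (psign e) * x"
proof -
  obtain f where "X = SPP.pr f" using assms by (auto simp: superpoly_def SPP.part_eq)
  then have X: "X = spoly_rep (abs_spoly f)" by (simp add: spoly_rep.abs_eq)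
  from assms have "parity_op (abs_spoly f) = scal (psign e) * abs_spoly f" unfolding X part_iff .
  with X show ?thesis by (rule that)
qed

text \<open>The definite description in \<open>der_op\<close> requires existence and uniqueness:
  \<open>Dq v\<close> has the required properties, and these determine an operator on all products
  of variables.\<close>

lemma der_op_rep:
  assumes v: "v \<in> V"
  shows "der_op V vp v = lend_rep (De v)"
  unfolding der_op_def Let_def
proof (rule the_equality)
  have "lend_rep (De v) (f \<otimes>\<^bsub>SP\<^esub> g) = (lend_rep (De v) f \<otimes>\<^bsub>SP\<^esub> g) \<oplus>\<^bsub>SP\<^esub> (psign (vp v * e) \<odot>\<^bsub>SP\<^esub> (f \<otimes>\<^bsub>SP\<^esub> lend_rep (De v) g))"
    if fg: "f \<in> part SP e" "g \<in> carrier SP" for e f g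
  proof -
    obtain x where x: "f = spoly_rep x" "parity_op x = scal (psign e) * x" by (rule partE[OF fg(1)])
    obtain y where y: "g = spoly_rep y" using fg(2) by (auto simp: SP_carrier)
    have "Dq v (x * y) = Dq v x * y + scal (psign (vp v * e)) * (x * Dq v y)"
      by (simp add: Dq_simps Sq_part[OF x(2)] mult.assoc add.commute)
    then show ?thesis
      unfolding x(1) y by (simp add: Q.h_mult[symmetric] Q.h_add[symmetric] Q.h_scal[symmetric] lend_rep_app app_De)
  qed
  moreover have "lend_rep (De v) (superpoly_var V vp u) = (if u = v then \<one>\<^bsub>SP\<^esub> else \<zero>\<^bsub>SP\<^esub>)" if "u \<in> V" for u
    using that by (simp add: superpoly_var_rep lend_rep_app app_De Dq_qv Q.h_1[symmetric] Q.h_0[symmetric])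
  ultimately show "lend_rep (De v) \<in> carrier (end_superalg SP) \<and>
    (\<forall>u\<in>V. lend_rep (De v) (superpoly_var V vp u) = (if u = v then \<one>\<^bsub>SP\<^esub> else \<zero>\<^bsub>SP\<^esub>)) \<and>
    (\<forall>e. \<forall>f\<in>part SP e. \<forall>g\<in>carrier SP. lend_rep (De v) (f \<otimes>\<^bsub>SP\<^esub> g) =
      (lend_rep (De v) f \<otimes>\<^bsub>SP\<^esub> g) \<oplus>\<^bsub>SP\<^esub> (psign (vp v * e) \<odot>\<^bsub>SP\<^esub> (f \<otimes>\<^bsub>SP\<^esub> lend_rep (De v) g)))"
    by (auto simp: end_carrier)
next
  fix E assume E: "E \<in> carrier (end_superalg SP) \<and>
    (\<forall>u\<in>V. E (superpoly_var V vp u) = (if u = v then \<one>\<^bsub>SP\<^esub> else \<zero>\<^bsub>SP\<^esub>)) \<and>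
    (\<forall>e. \<forall>f\<in>part SP e. \<forall>g\<in>carrier SP. E (f \<otimes>\<^bsub>SP\<^esub> g) = (E f \<otimes>\<^bsub>SP\<^esub> g) \<oplus>\<^bsub>SP\<^esub> (psign (vp v * e) \<odot>\<^bsub>SP\<^esub> (f \<otimes>\<^bsub>SP\<^esub> E g)))"
  then obtain T where T: "E = lend_rep T" by (auto simp: end_carrier)
  have L: "app T (x * y) = app T x * y + scal (psign (vp v * e)) * (x * app T y)" if "parity_op x = scal (psign e) * x" for e x y
  proof (rule spoly_rep_inject)
    have "spoly_rep x \<in> part SP e" using that by (simp add: part_iff)
    then have "E (spoly_rep x \<otimes>\<^bsub>SP\<^esub> spoly_rep y) = (E (spoly_rep x) \<otimes>\<^bsub>SP\<^esub> spoly_rep y) \<oplus>\<^bsub>SP\<^esub> (psign (vp v * e) \<odot>\<^bsub>SP\<^esub> (spoly_rep x \<otimes>\<^bsub>SP\<^esub> E (spoly_rep y)))"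
      using E by auto
    then show "spoly_rep (app T (x * y)) = spoly_rep (app T x * y + scal (psign (vp v * e)) * (x * app T y))"
      unfolding T by (simp add: Q.h_mult[symmetric] Q.h_add[symmetric] Q.h_scal[symmetric] lend_rep_app)
  qed
  have Tv: "app T (qv u) = (if u = v then 1 else 0)" if "u \<in> V" for u
  proof (rule spoly_rep_inject)
    have "E (superpoly_var V vp u) = (if u = v then \<one>\<^bsub>SP\<^esub> else \<zero>\<^bsub>SP\<^esub>)" using E that by auto
    then show "spoly_rep (app T (qv u)) = spoly_rep (if u = v then 1 else 0)"
      using that by (simp add: T superpoly_var_rep lend_rep_app Q.h_1 Q.h_0)
  qed
  have "app T x = Dq v x" for x
  proof (induction x rule: spoly_induct)
    case one
    \<comment> \<open>The Leibniz rule for 1 = 1 1 forces the value 0 at 1.\<close>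
    show ?case using L[of 1 0 1] by (simp add: parity_hom psign_simps Dq_simps)
  next
    case (var u x)
    then show ?case using L[OF parity_var, of u x] by (simp add: Tv Dq_var)
  qed (simp_all add: app_add app_scal Dq_simps(1,2))
  then have "T = De v" by (intro lend_eqI) (simp add: app_De)
  then show "E = lend_rep (De v)" by (simp add: T)
qed

abbreviation "DD \<equiv> weylD par_p par_q par_m par_n par_d"

text \<open>The Weyl superalgebra is covered by a subalgebra of the endomorphisms; this is the
  reason for the set S in \<open>cover\<close>.\<close>

definition SD :: "spoly lend set" where "SD = {T. lend_rep T \<in> carrier DD}"

lemma DD_simps:
  "carrier DD = gen_alg (end_superalg SP) (mul_op V vp ` V \<union> der_op V vp ` V)"
  "monoid.mult DD = monoid.mult (end_superalg SP)" "one DD = one (end_superalg SP)" "zero DD = zero (end_superalg SP)"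
  "add DD = add (end_superalg SP)" "smult DD = smult (end_superalg SP)"
  "part DD e = part (end_superalg SP) e \<inter> carrier DD"
  by (simp_all add: weylD_def weyl_superalg_def Let_def)

lemma gen_alg_range:
  "E \<in> gen_alg (end_superalg SP) (mul_op V vp ` V \<union> der_op V vp ` V) \<Longrightarrow> E \<in> range lend_rep"
proof (induction rule: gen_alg.induct)
  case one then show ?case unfolding EN.h_1[symmetric] by blast
next
  case (incl x) then show ?case by (auto simp: mul_op_rep der_op_rep)
next
  case (add x y) then show ?case by (auto simp: EN.h_add[symmetric])
next
  case (mult x y) then show ?case by (auto simp: EN.h_mult[symmetric])
next
  case (smult x c) then show ?case by (auto simp: EN.h_scal[symmetric])
qed

interpretation D: cover DD SD lend_rep
proof
  show "lend_rep ` SD = carrier DD"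
    unfolding SD_def using gen_alg_range by (auto simp: DD_simps(1))
  show "scal c * x \<in> SD" "lend_rep (scal c * x) = c \<odot>\<^bsub>DD\<^esub> lend_rep x" if "x \<in> SD" for c x
    using that by (auto simp: SD_def DD_simps EN.h_scal intro: gen_alg.smult)
qed (auto simp: SD_def DD_simps EN.h_add EN.h_mult EN.h_0 EN.h_1 intro: gen_alg.intros)

lemma SD_gens: "u \<in> V \<Longrightarrow> Mo u \<in> SD" "u \<in> V \<Longrightarrow> De u \<in> SD"
  by (auto simp: SD_def DD_simps(1) mul_op_rep[symmetric] der_op_rep[symmetric] intro!: gen_alg.incl)

text \<open>Homogeneity expressed as commutation, up to sign, with the grading automorphism. Being
  an identity, it passes easily to sums and products.\<close>

definition has_parity :: "spoly lend \<Rightarrow> bit \<Rightarrow> bool" where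
  "has_parity T e \<longleftrightarrow> (\<forall>x. parity_op (app T x) = scal (psign e) * app T (parity_op x))"

lemma has_parity_part:
  assumes "has_parity T e" "T \<in> SD"
  shows "lend_rep T \<in> part DD e"
proof -
  have "lend_rep T X \<in> part SP (e + e')" if X: "X \<in> part SP e'" for X e'
  proof -
    obtain x where x: "X = spoly_rep x" "parity_op x = scal (psign e') * x" by (rule partE[OF X])
    show ?thesis
      unfolding x(1) lend_rep_app part_iff psign_add using assms(1) by (simp add: has_parity_def x(2) app_scal scal_scal)
  qed
  then have "\<forall>e'. lend_rep T ` part SP e' \<subseteq> part SP (e + e')" by blast
  moreover have "lend_rep T \<in> carrier (end_superalg SP)" by (auto simp: end_carrier)
  moreover have "part (end_superalg SP) e = {T \<in> carrier (end_superalg SP). \<forall>e'. T ` part SP e' \<subseteq> part SP (e + e')}"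
    by (simp add: end_superalg_def Let_def)
  ultimately show ?thesis using assms(2) unfolding DD_simps(7) SD_def by blast
qed

lemma has_parity_add: "has_parity T e \<Longrightarrow> has_parity U e \<Longrightarrow> has_parity (T + U) e"
  by (simp add: has_parity_def lend_simps parity_hom(1) distrib_left)

lemma has_parity_0: "has_parity 0 e" and has_parity_1: "has_parity 1 0"
  by (simp_all add: has_parity_def lend_simps parity_hom psign_simps)

lemma has_parity_mult: "has_parity T e \<Longrightarrow> has_parity U e' \<Longrightarrow> has_parity (T * U) (e + e')"
  unfolding has_parity_def psign_add by (simp add: lend_simps app_scal scal_scal)

lemma has_parity_scal: "has_parity T e \<Longrightarrow> has_parity (scal c * T) e"
  by (simp add: has_parity_def lend_simps parity_hom(2,4) scal_scal mult.commute[of c])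

lemmas has_parity_simps = has_parity_add has_parity_0 has_parity_1 has_parity_mult has_parity_scal

lemma has_parity_Mo: "u \<in> V \<Longrightarrow> has_parity (Mo u) (vp u)"
  by (simp add: has_parity_def app_Mo parity_hom parity_var mult.assoc)

lemma has_parity_De: "v \<in> V \<Longrightarrow> has_parity (De v) (vp v)"
  unfolding has_parity_def app_De
proof
  fix x assume v: "v \<in> V"
  show "parity_op (Dq v x) = scal (psign (vp v)) * Dq v (parity_op x)"
  proof (induction x rule: spoly_induct)
    case (var u x)
    have m: "Dq v (- y) = - Dq v y" for y using Dq_simps(2)[of v "- 1" y] by (simp add: scal_minus)
    show ?case using var v
      by (cases "vp u = 0"; cases "vp v = 0")
         (auto simp: Dq_var Dq_simps(1) m parity_hom(1,2,4,5,6,7) parity_var psign_simps scal_minus mult.assoc)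
  next
    case (scal c x)
    then show ?case by (simp add: Dq_simps(2) parity_hom(2,4) scal_scal mult.commute[of c])
  qed (simp_all add: Dq_simps(1,3,4) parity_hom(1,3,5) distrib_left)
qed

lemma Mo_Mo: "u \<in> V \<Longrightarrow> w \<in> V \<Longrightarrow> Mo u * Mo w = scal (psign (vp u * vp w)) * (Mo w * Mo u)"
  by (rule lend_eqI) (simp add: lend_simps app_Mo mult.assoc[symmetric] qv_comm[of u w])

lemma De_Mo: "u \<in> V \<Longrightarrow> De v * Mo u = scal (psign (vp v * vp u)) * (Mo u * De v) + (if u = v then 1 else 0)"
  by (rule lend_eqI) (simp add: lend_simps app_Mo app_De Dq_var)

lemma De_De:
  assumes vw: "v \<in> V" "w \<in> V"
  shows "De v * De w = scal (psign (vp v * vp w)) * (De w * De v)"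
proof (rule lend_eqI)
  fix x
  have "Dq v (Dq w x) = scal (psign (vp v * vp w)) * Dq w (Dq v x)"
  proof (induction x rule: spoly_induct)
    case (var u x)
    have m: "Dq t (- y) = - Dq t y" for t y using Dq_simps(2)[of t "- 1" y] by (simp add: scal_minus)
    show ?case using var
      by (cases "vp u = 0"; cases "vp v = 0"; cases "vp w = 0")
         (auto simp: Dq_var Dq_simps(1,4) Dq_diff m psign_simps scal_minus)
  next
    case (scal c x)
    then show ?case by (simp add: Dq_simps(2) scal_scal mult.commute[of c])
  qed (simp_all add: Dq_simps(1,3,4) distrib_left)
  then show "app (De v * De w) x = app (scal (psign (vp v * vp w)) * (De w * De v)) x"
    by (simp add: lend_simps app_De)
qed

section \<open>Homomorphisms out of enveloping superalgebras\<close>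

definition lin :: "('b \<Rightarrow> 't::calg) \<Rightarrow> ('b \<Rightarrow>\<^sub>0 complex) \<Rightarrow> 't" where
  "lin \<theta> v = (\<Sum>b\<in>Poly_Mapping.keys v. scal (Poly_Mapping.lookup v b) * \<theta> b)"

lemma lin_superset:
  assumes "finite K" "Poly_Mapping.keys v \<subseteq> K"
  shows "lin \<theta> v = (\<Sum>b\<in>K. scal (Poly_Mapping.lookup v b) * \<theta> b)"
  unfolding lin_def by (rule sum.mono_neutral_left) (use assms in \<open>auto simp: in_keys_iff\<close>)

lemma lin_single: "lin \<theta> (Poly_Mapping.single b c) = scal c * \<theta> b"
  by (subst lin_superset[of "{b}"]) auto

lemma lin_0 [simp]: "lin \<theta> 0 = 0" by (simp add: lin_def)

lemma lin_diff: "lin \<theta> (v - v') = lin \<theta> v - lin \<theta> v'"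
proof -
  let ?K = "Poly_Mapping.keys v \<union> Poly_Mapping.keys v'"
  have "Poly_Mapping.keys (v - v') \<subseteq> ?K" by (auto simp: in_keys_iff lookup_minus)
  then show ?thesis
    by (simp add: lin_superset[of ?K] lookup_minus scal_diff left_diff_distrib sum_subtractf)
qed

lemma lin_add: "lin \<theta> (v + v') = lin \<theta> v + lin \<theta> v'"
  using lin_diff[of \<theta> "v + v'" v'] by simp

lemma lin_sum: "lin \<theta> (sum f A) = (\<Sum>a\<in>A. lin \<theta> (f a))"
  by (induction A rule: infinite_finite_induct) (simp_all add: lin_add)

lemma lin_push: "lin \<theta> (push f v) = lin (\<lambda>b. \<theta> (f b)) v"
  unfolding push_def lin_sum lin_single by (simp only: lin_def)

lemma ev_push: "ev \<theta> (push (\<lambda>x. Word [x]) v) = lin \<theta> v"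
  by (simp add: push_def ev_simps ev_single lin_def)

lemma (in presentation) pr_induct [case_names one letter scal add]:
  assumes "Q (pr 1)" "\<And>b x. b \<in> B \<Longrightarrow> Q (pr x) \<Longrightarrow> Q (pr (letter b * x))"
    "\<And>c x. Q (pr x) \<Longrightarrow> Q (pr (scal c * x))" "\<And>x y. Q (pr x) \<Longrightarrow> Q (pr y) \<Longrightarrow> Q (pr (x + y))"
  shows "Q (pr x)"
proof (induction x rule: free_induct)
  case (letter b x)
  show ?case
  proof (cases "b \<in> B")
    case False
    then have "pr (letter b * x) = pr (scal 0 * 1)" by (simp add: pr_def restr_simps)
    then show ?thesis using assms(3)[OF assms(1), of 0] by simp
  qed (use letter assms(2) in auto)
qed (auto intro: assms)

lemma env_presentation:
  assumes "\<And>b c. b \<in> basis g \<Longrightarrow> c \<in> basis g \<Longrightarrow> Poly_Mapping.keys (bracket g b c) \<subseteq> basis g"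
  shows "presentation (basis g) (bpar g) (env_rels g)"
proof
  interpret E: presentation "basis g" "bpar g" "{}" by unfold_locales simp
  have "restr (basis g) (push (\<lambda>x. Word [x]) (bracket g b c)) = push (\<lambda>x. Word [x]) (bracket g b c)"
    if "b \<in> basis g" "c \<in> basis g" for b c
  proof (rule E.restr_id)
    have "push (\<lambda>x. Word [x]) v \<in> carrier E.F" if "Poly_Mapping.keys v \<subseteq> basis g" for v
      unfolding push_def by (rule E.F.S_sum) (use that in \<open>auto simp: free_superalg_def\<close>)
    then show "push (\<lambda>x. Word [x]) (bracket g b c) \<in> carrier E.F" using assms that by blast
  qed
  then show "env_rels g \<subseteq> carrier E.F"
    by (auto simp: env_rels_def E.F_iff restr_simps scalar_scal)
qed

text \<open>\<open>induced_hom\<close> is a definite description. The evaluation at \<theta>'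
  respects the relations by \<open>rel\<close> and the grading by \<open>par\<close>, which gives
  existence; a homomorphism is determined by its values on the generators, which gives
  uniqueness.\<close>

lemma (in cover) induced_hom_eval:
  assumes pres: "presentation (basis g) (bpar g) (env_rels g)"
    and \<theta>: "\<And>b. b \<in> basis g \<Longrightarrow> \<theta>' b \<in> S" "\<And>b. b \<notin> basis g \<Longrightarrow> \<theta>' b = 0" "\<And>b. b \<in> basis g \<Longrightarrow> \<theta> b = h (\<theta>' b)"
    and rel: "\<And>b c. b \<in> basis g \<Longrightarrow> c \<in> basis g \<Longrightarrow>
      \<theta>' b * \<theta>' c - scal (psign (bpar g b * bpar g c)) * (\<theta>' c * \<theta>' b) = lin \<theta>' (bracket g b c)"
    and par: "\<And>e f. f \<in> part (free_superalg (basis g) (bpar g)) e \<Longrightarrow> h (ev \<theta>' f) \<in> part A e"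
  shows "induced_hom g A \<theta> (presentation.pr (basis g) (bpar g) (env_rels g) x) = h (ev \<theta>' x)"
proof -
  interpret presentation "basis g" "bpar g" "env_rels g" by (rule pres)
  interpret A: ring A by (rule ring)
  have U: "univ_env g = presented (basis g) (bpar g) (env_rels g)" by (simp add: univ_env_def)
  have S: "ev \<theta>' x \<in> S" for x
    by (induction x rule: free_induct) (use \<theta> in \<open>auto simp: ev_simps intro: closed S_0 split: if_splits\<close>, metis S_0 closed(3) \<theta>(1,2))
  have wd: "ev \<theta>' x = ev \<theta>' y" if "pr x = pr y" for x y
  proof (rule pr_eqD[OF \<theta>(2) _ that])
    fix r assume "r \<in> env_rels g"
    then obtain b c where bc: "b \<in> basis g" "c \<in> basis g"
      and r: "r = letter b * letter c - scalar (psign (bpar g b * bpar g c)) * (letter c * letter b) - push (\<lambda>x. Word [x]) (bracket g b c)"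
      unfolding env_rels_def by blast
    show "ev \<theta>' r = 0" unfolding r scalar_scal by (simp only: ev_simps ev_letter ev_push rel[OF bc] diff_self)
  qed
  define H where "H = (\<lambda>X\<in>carrier (univ_env g). h (ev \<theta>' (SOME x. pr x = X)))"
  have H: "H (pr x) = h (ev \<theta>' x)" for x
  proof -
    have "pr (SOME y. pr y = pr x) = pr x" by (rule someI[of _ x]) simp
    from wd[OF this] show ?thesis using P.h_carrier[of x] by (simp add: H_def U)
  qed
  have "induced_hom g A \<theta> = H"
    unfolding induced_hom_def
  proof (rule the_equality)
    have "H \<in> ring_hom (univ_env g) A"
    proof (rule ring_hom_memI)
      show "H X \<in> carrier A" if "X \<in> carrier (univ_env g)" for X
        using that P.onto by (auto simp: U H h_carrier S elim!: P.carrierE)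
      show "H (X \<otimes>\<^bsub>univ_env g\<^esub> Y) = H X \<otimes>\<^bsub>A\<^esub> H Y" "H (X \<oplus>\<^bsub>univ_env g\<^esub> Y) = H X \<oplus>\<^bsub>A\<^esub> H Y"
        if "X \<in> carrier (univ_env g)" "Y \<in> carrier (univ_env g)" for X Y
        using that unfolding U by (auto elim!: P.carrierE simp: P.h_mult[symmetric] P.h_add[symmetric] H h_mult h_add S ev_simps)
      show "H \<one>\<^bsub>univ_env g\<^esub> = \<one>\<^bsub>A\<^esub>" unfolding U P.h_1[symmetric] H by (simp add: ev_simps h_1)
    qed
    moreover have "H (c \<odot>\<^bsub>univ_env g\<^esub> X) = c \<odot>\<^bsub>A\<^esub> H X" if "X \<in> carrier (univ_env g)" for c X
    proof -
      obtain x where x: "X = pr x" using \<open>X \<in> carrier _\<close> unfolding U by (rule P.carrierE)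
      have "H (pr (scal c * x)) = c \<odot>\<^bsub>A\<^esub> H (pr x)" unfolding H by (simp only: ev_simps h_scal S)
      then show ?thesis unfolding x U by (simp only: P.h_scal UNIV_I)
    qed
    moreover have "H ` part (univ_env g) e \<subseteq> part A e" for e
      unfolding U part_eq using par by (auto simp: H)
    ultimately have "H \<in> superalg_hom (univ_env g) A" by (simp add: superalg_hom_def)
    moreover have "H (env_gen g b) = \<theta> b" if "b \<in> basis g" for b
      unfolding env_gen_def pr_letter[OF that, symmetric] H using \<theta>(3)[OF that] by simp
    ultimately show "H \<in> superalg_hom (univ_env g) A \<and> H \<in> extensional (carrier (univ_env g)) \<and> (\<forall>b\<in>basis g. H (env_gen g b) = \<theta> b)"
      by (simp add: H_def)
  next
    fix H' assume H': "H' \<in> superalg_hom (univ_env g) A \<and> H' \<in> extensional (carrier (univ_env g)) \<and> (\<forall>b\<in>basis g. H' (env_gen g b) = \<theta> b)"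
    then have hom: "H' \<in> ring_hom (univ_env g) A" and sm: "\<And>c X. X \<in> carrier (univ_env g) \<Longrightarrow> H' (c \<odot>\<^bsub>univ_env g\<^esub> X) = c \<odot>\<^bsub>A\<^esub> H' X"
      by (auto simp: superalg_hom_def)
    have c: "pr x \<in> carrier (univ_env g)" for x unfolding U by (rule P.h_carrier) simp
    have eq: "H' (pr x) = H (pr x)" for x
    proof (rule pr_induct[where Q = "\<lambda>X. H' X = H X"])
      show "H' (pr 1) = H (pr 1)"
        using ring_hom_one[OF hom] unfolding U H by (simp add: P.h_1 ev_simps h_1)
      show "H' (pr (letter b * x)) = H (pr (letter b * x))" if b: "b \<in> basis g" and x: "H' (pr x) = H (pr x)" for b x
      proof -
        have "H' (pr (letter b)) = h (\<theta>' b)" using H' b \<theta>(3)[OF b] by (simp add: env_gen_def pr_letter)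
        moreover have "H' (pr (letter b * x)) = H' (pr (letter b)) \<otimes>\<^bsub>A\<^esub> H' (pr x)"
          using ring_hom_mult[OF hom c c, of "letter b" x] unfolding U by (simp add: P.h_mult)
        ultimately show ?thesis using \<theta>(1)[OF b] by (simp add: x H ev_simps h_mult S)
      qed
      show "H' (pr (scal c * x)) = H (pr (scal c * x))" if "H' (pr x) = H (pr x)" for c x
      proof -
        have "H' (pr (scal c * x)) = c \<odot>\<^bsub>A\<^esub> H' (pr x)"
          using sm[OF c, of c x] unfolding U by (simp only: P.h_scal[OF UNIV_I])
        moreover have "H (pr (scal c * x)) = c \<odot>\<^bsub>A\<^esub> H (pr x)" unfolding H by (simp only: ev_simps h_scal S)
        ultimately show ?thesis using that by simp
      qed
      show "H' (pr (x + y)) = H (pr (x + y))" if "H' (pr x) = H (pr x)" "H' (pr y) = H (pr y)" for x y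
      proof -
        have "H' (pr (x + y)) = H' (pr x) \<oplus>\<^bsub>A\<^esub> H' (pr y)"
          using ring_hom_add[OF hom c c, of x y] unfolding U by (simp only: P.h_add[OF UNIV_I UNIV_I])
        moreover have "H (pr (x + y)) = H (pr x) \<oplus>\<^bsub>A\<^esub> H (pr y)" unfolding H by (simp only: ev_simps h_add S)
        ultimately show ?thesis using that by simp
      qed
    qed
    show "H' = H"
    proof (rule extensionalityI[of _ "carrier (univ_env g)"])
      show "H' \<in> extensional (carrier (univ_env g))" using H' by blast
      show "H \<in> extensional (carrier (univ_env g))" by (simp add: H_def)
      fix X assume X: "X \<in> carrier (univ_env g)"
      obtain x where "X = pr x" using X unfolding U by (rule P.carrierE)
      then show "H' X = H X" by (simp only: eq)
    qed
  qed
  then show ?thesis by (simp add: H)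
qed

text \<open>The graded form of \<open>bilinear_commutator\<close>: the four exchanges may carry
  different signs, and their product is the sign of the graded commutator. The last hypothesis
  allows the signs s2, s3, s4 to be moved across the equation.\<close>

lemma super_commutator:
  fixes a b c e :: "'a::calg"
  assumes bc: "b * c = scal s1 * (c * b) + scal t1" and ea: "e * a = scal s2 * (a * e) + scal t2"
    and ac: "c * a = scal s3 * (a * c)" and be: "e * b = scal s4 * (b * e)"
    and s: "(s2 * s3 * s4) * (s2 * s3 * s4) = 1"
  shows "a * b * (c * e) - scal (s1 * (s2 * s3 * s4)) * (c * e * (a * b)) = scal t1 * (a * e) - scal (s1 * (s2 * s3 * s4) * t2) * (c * b)"
proof -
  have "a * b * (c * e) = a * (b * c) * e" by (simp add: mult.assoc)
  also have "\<dots> = scal s1 * (a * c * (b * e)) + scal t1 * (a * e)"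
    unfolding bc by (simp add: distrib_left distrib_right mult.assoc scal_left_commute[of a] scal_central[of t1, symmetric])
  finally have 1: "a * b * (c * e) = scal s1 * (a * c * (b * e)) + scal t1 * (a * e)" .
  have "c * e * (a * b) = c * (e * a) * b" by (simp add: mult.assoc)
  also have "\<dots> = scal s2 * (c * a * (e * b)) + scal t2 * (c * b)"
    unfolding ea by (simp add: distrib_left distrib_right mult.assoc scal_left_commute[of c] scal_central[of t2, symmetric])
  also have "c * a * (e * b) = scal (s3 * s4) * (a * c * (b * e))"
    unfolding ac be by (rule scal_pull)
  finally have 2: "c * e * (a * b) = scal (s2 * s3 * s4) * (a * c * (b * e)) + scal t2 * (c * b)"
    by (simp add: scal_scal mult.assoc)
  have "s1 * (s2 * s3 * s4) * (s2 * s3 * s4) = s1" using s by (simp add: mult.assoc)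
  then have e: "scal (s1 * (s2 * s3 * s4)) * (scal (s2 * s3 * s4) * y) = scal s1 * (y :: 'a)" for y
    by (simp only: scal_scal)
  show ?thesis unfolding 1 2 distrib_left e by (simp only: scal_scal add_diff_cancel_left)
qed

section \<open>Canonical generators for all flavours\<close>

abbreviation "pq \<equiv> par_p + par_q"
abbreviation "NN \<equiv> par_p + par_q + par_m + par_n"
abbreviation "ix \<equiv> idx_par par_p par_q par_m"

definition va :: "nat \<Rightarrow> nat \<Rightarrow> var" where "va i a = (if i \<le> pq then Yv a i else Xv a (i - pq))"

lemma va_V: "i \<in> {1..NN} \<Longrightarrow> a \<in> {1..par_d} \<Longrightarrow> va i a \<in> V"
  by (auto simp: va_def vars_def)

lemma vp_va: "i \<in> {1..NN} \<Longrightarrow> vp (va i a) = ix i"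
  by (auto simp: va_def var_par_def idx_par_def)

lemma va_eq: "i \<in> {1..NN} \<Longrightarrow> j \<in> {1..NN} \<Longrightarrow> va i a = va j b \<longleftrightarrow> i = j \<and> a = b"
  by (auto simp: va_def split: if_splits)

text \<open>A Fourier transform in the y variables: for flavours up to p + q, X is the derivative
  and P the multiplication. The sign in \<open>Po\<close> compensates the sign that arises when the
  two change places, so the contraction of P with X is 1 for every flavour.\<close>

definition Xo :: "nat \<Rightarrow> nat \<Rightarrow> spoly lend" where
  "Xo i a = (if i \<le> pq then De (va i a) else Mo (va i a))"

definition Po :: "nat \<Rightarrow> nat \<Rightarrow> spoly lend" where
  "Po i a = (if i \<le> pq then scal (psign (ix i + 1)) * Mo (va i a) else De (va i a))"

lemma Mo_De:
  assumes "u \<in> V" "v \<in> V"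
  shows "Mo u * De v = scal (psign (vp u * vp v)) * (De v * Mo u) - (if u = v then scal (psign (vp u)) else 0)"
  using De_Mo[OF assms(1), of v]
  by (cases "vp u = 0"; cases "vp v = 0") (auto simp: psign_simps scal_minus)

lemma psign_sq: "psign e * psign e = 1" "e * e = (e :: bit)"
  by (cases "e = 0"; simp add: psign_def)+

lemma Xo_Po_relations:
  assumes ij: "i \<in> {1..NN}" "j \<in> {1..NN}" and ab: "a \<in> {1..par_d}" "b \<in> {1..par_d}"
  shows "Xo i a * Xo j b = scal (psign (ix i * ix j)) * (Xo j b * Xo i a)"
    and "Po i a * Po j b = scal (psign (ix i * ix j)) * (Po j b * Po i a)"
    and "Po i a * Xo j b = scal (psign (ix i * ix j)) * (Xo j b * Po i a) + scal (if i = j \<and> a = b then 1 else 0)"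
proof -
  note v = va_V[OF ij(1) ab(1)] va_V[OF ij(2) ab(2)]
  note V = vp_va[OF ij(1)] vp_va[OF ij(2)] va_eq[OF ij]
  have sw: "ix j * ix i = ix i * ix j" by (rule mult.commute)
  have ne: "va i a \<noteq> va j b" "va j b \<noteq> va i a" if "(i \<le> pq) \<noteq> (j \<le> pq)" using that V(3)[of a b] by auto
  note R = Mo_Mo[OF v] De_De[OF v] De_Mo[OF v(2), of "va i a"] Mo_De[OF v]
  show "Xo i a * Xo j b = scal (psign (ix i * ix j)) * (Xo j b * Xo i a)"
    using R ne by (auto simp: Xo_def V)
  show "Po i a * Po j b = scal (psign (ix i * ix j)) * (Po j b * Po i a)"
    using R ne by (auto simp: Po_def V scal_pull mult.assoc scal_left_commute[of "Mo _"] scal_left_commute[of "De _"] scal_scal mult.commute)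
  show "Po i a * Xo j b = scal (psign (ix i * ix j)) * (Xo j b * Po i a) + scal (if i = j \<and> a = b then 1 else 0)"
    using R ne by (cases "ix i = 0"; cases "ix j = 0")
      (auto simp: Po_def Xo_def V psign_simps scal_minus distrib_left right_diff_distrib)
qed

lemma Xo_Po:
  assumes ij: "i \<in> {1..NN}" "j \<in> {1..NN}" and ab: "a \<in> {1..par_d}" "b \<in> {1..par_d}"
  shows "Xo i a * Po j b = scal (psign (ix i * ix j)) * (Po j b * Xo i a) + scal (if i = j \<and> a = b then - psign (ix i) else 0)"
  using Xo_Po_relations(3)[OF ij(2,1) ab(2,1)]
  by (cases "ix i = 0"; cases "ix j = 0") (auto simp: psign_simps scal_minus)

lemma Xo_SD: "i \<in> {1..NN} \<Longrightarrow> a \<in> {1..par_d} \<Longrightarrow> Xo i a \<in> SD \<and> has_parity (Xo i a) (ix i)"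
  and Po_SD: "i \<in> {1..NN} \<Longrightarrow> a \<in> {1..par_d} \<Longrightarrow> Po i a \<in> SD \<and> has_parity (Po i a) (ix i)"
  using SD_gens[of "va i a"] has_parity_Mo[of "va i a"] has_parity_De[of "va i a"] va_V[of i a] vp_va[of i a]
  by (auto simp: Xo_def Po_def intro: D.closed has_parity_scal)

section \<open>Blocks of indices and Jordan matrices\<close>

lemma psum_Suc: "i \<ge> 1 \<Longrightarrow> psum f (Suc i) = psum f i + f i"
  by (simp add: psum_def)

lemma psum_mono: "i \<le> j \<Longrightarrow> psum f i \<le> psum f j"
  unfolding psum_def by (rule sum_mono2) auto

lemma psum_add: "psum f (Suc (a + b)) = psum f (Suc a) + (\<Sum>i\<in>{1..b}. f (a + i))"
  by (induction b) (simp_all add: psum_Suc)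

abbreviation "blk f i \<equiv> {psum f i + 1..psum f (i + 1)}"

lemma blk_disjoint: "r \<in> blk f i \<Longrightarrow> r \<in> blk f j \<Longrightarrow> i = j"
  using psum_mono[of "i + 1" j f] psum_mono[of "j + 1" i f] by (cases i j rule: linorder_cases) auto

lemma blk_bounds: "i \<in> {1..l} \<Longrightarrow> r \<in> blk f i \<Longrightarrow> r \<in> {1..psum f (Suc l)}"
  using psum_mono[of "i + 1" "Suc l" f] by auto

lemma blk_shift: "i \<in> {1..l} \<Longrightarrow> k < f i \<Longrightarrow> r \<in> {psum f i + 1..psum f (i + 1) - k} \<longleftrightarrow> r \<in> blk f i \<and> r + k \<in> blk f i"
  using psum_Suc[of i f] by auto

lemma blk_ex: "r \<in> {1..psum f (Suc l)} \<Longrightarrow> \<exists>i\<in>{1..l}. r \<in> blk f i"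
proof (induction l)
  case (Suc l)
  show ?case
  proof (cases "r \<le> psum f (Suc l)")
    case True
    with Suc obtain i where "i \<in> {1..l}" "r \<in> blk f i" by auto
    then show ?thesis by (intro bexI[of _ i]) auto
  next
    case False
    then show ?thesis using Suc.prems by (intro bexI[of _ "Suc l"]) auto
  qed
qed (simp add: psum_def)

text \<open>Pairs r \<le> u in a common block correspond to triples of a block i, a distance k = u -
  r and the smaller index r; all other pairs contribute 0. This translates sums weighted by a Jordan
  resolvent into sums over the degrees k of a truncated current algebra.\<close>

lemma block_sum:
  fixes F :: "nat \<Rightarrow> nat \<Rightarrow> 'a::comm_monoid_add"
  assumes F: "\<And>i r k. i \<in> {1..l} \<Longrightarrow> r \<in> blk f i \<Longrightarrow> r + k \<in> blk f i \<Longrightarrow> F r (r + k) = G i k r"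
    and 0: "\<And>r u. r \<in> {1..psum f (Suc l)} \<Longrightarrow> u \<in> {1..psum f (Suc l)} \<Longrightarrow> (\<And>i. i \<in> {1..l} \<Longrightarrow> r \<in> blk f i \<Longrightarrow> u \<in> blk f i \<Longrightarrow> r \<le> u \<Longrightarrow> False) \<Longrightarrow> F r u = 0"
  shows "(\<Sum>q\<in>{1..psum f (Suc l)} \<times> {1..psum f (Suc l)}. F (fst q) (snd q))
    = (\<Sum>i\<in>{1..l}. \<Sum>k\<in>{..<f i}. \<Sum>r\<in>{psum f i + 1..psum f (i + 1) - k}. G i k r)"
proof -
  let ?n = "psum f (Suc l)"
  define T where "T = (SIGMA i:{1..l}. SIGMA k:{..<f i}. {psum f i + 1..psum f (i + 1) - k})"
  define j where "j = (\<lambda>(i :: nat, k :: nat, r :: nat). (r, r + k))"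
  have T: "i \<in> {1..l}" "k < f i" "r \<in> blk f i" "r + k \<in> blk f i" if "(i, k, r) \<in> T" for i k r
    using that blk_shift[of i l k f r] by (auto simp: T_def)
  have "(\<Sum>i\<in>{1..l}. \<Sum>k\<in>{..<f i}. \<Sum>r\<in>{psum f i + 1..psum f (i + 1) - k}. G i k r)
    = (\<Sum>i\<in>{1..l}. \<Sum>(k, r)\<in>(SIGMA k:{..<f i}. {psum f i + 1..psum f (i + 1) - k}). G i k r)"
  proof (rule sum.cong[OF refl])
    fix i
    show "(\<Sum>k\<in>{..<f i}. \<Sum>r\<in>{psum f i + 1..psum f (i + 1) - k}. G i k r)
      = (\<Sum>(k, r)\<in>(SIGMA k:{..<f i}. {psum f i + 1..psum f (i + 1) - k}). G i k r)"
      by (rule sum.Sigma) simp_all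
  qed
  also have "\<dots> = (\<Sum>(i, k, r)\<in>T. G i k r)"
    unfolding T_def by (rule sum.Sigma) simp_all
  also have "\<dots> = (\<Sum>t\<in>T. F (fst (j t)) (snd (j t)))"
  proof (rule sum.cong[OF refl])
    fix t assume t: "t \<in> T"
    obtain i k r where e: "t = (i, k, r)" by (cases t)
    show "(case t of (i, k, r) \<Rightarrow> G i k r) = F (fst (j t)) (snd (j t))"
      using F[OF T(1,3,4)[OF t[unfolded e]]] by (simp add: e j_def)
  qed
  also have "\<dots> = (\<Sum>q\<in>j ` T. F (fst q) (snd q))"
  proof (rule sum.reindex[unfolded comp_def, symmetric])
    show "inj_on j T"
    proof (rule inj_onI)
      fix t t' assume t: "t \<in> T" "t' \<in> T" "j t = j t'"
      obtain i k r where e: "t = (i, k, r)" by (cases t)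
      obtain i' k' r' where e': "t' = (i', k', r')" by (cases t')
      have r: "r' = r" "k' = k" using t(3) by (simp_all add: e e' j_def)
      have "i = i'" using T(3)[OF t(1)[unfolded e]] T(3)[OF t(2)[unfolded e']] unfolding r by (rule blk_disjoint)
      then show "t = t'" by (simp add: e e' r)
    qed
  qed
  also have "\<dots> = (\<Sum>q\<in>{1..?n} \<times> {1..?n}. F (fst q) (snd q))"
  proof (rule sum.mono_neutral_left)
    show "j ` T \<subseteq> {1..?n} \<times> {1..?n}"
    proof
      fix q assume "q \<in> j ` T"
      then obtain t where t: "t \<in> T" "q = j t" by blast
      obtain i k r where e: "t = (i, k, r)" by (cases t)
      note t' = T[OF t(1)[unfolded e]]
      show "q \<in> {1..?n} \<times> {1..?n}" using blk_bounds[OF t'(1,3)] blk_bounds[OF t'(1,4)] by (simp add: t(2) e j_def)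
    qed
    show "\<forall>q\<in>{1..?n} \<times> {1..?n} - j ` T. F (fst q) (snd q) = 0"
    proof (rule ballI, rule 0)
      fix q assume q: "q \<in> {1..?n} \<times> {1..?n} - j ` T"
      then show "fst q \<in> {1..?n}" "snd q \<in> {1..?n}" by auto
      fix i assume i: "i \<in> {1..l}" "fst q \<in> blk f i" "snd q \<in> blk f i" "fst q \<le> snd q"
      have "(i, snd q - fst q, fst q) \<in> T" using i psum_Suc[of i f] by (auto simp: T_def)
      then have "j (i, snd q - fst q, fst q) \<in> j ` T" by (rule imageI)
      moreover have "j (i, snd q - fst q, fst q) = q" using i(4) by (simp add: j_def)
      ultimately show False using q by simp
    qed
  qed simp
  finally show ?thesis by simp
qed

lemma jordan_block_col:
  assumes j: "j \<in> {1..l}" "v \<in> blk f j"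
  shows "jordan l f z u v = (if u \<in> blk f j then if u = v then z j else if v = u + 1 then 1 else 0 else 0)"
proof -
  have "jordan l f z u v = (\<Sum>i\<in>{1..l}. if i = j then (if u \<in> blk f j then if u = v then z j else if v = u + 1 then 1 else 0 else 0) else 0)"
    unfolding jordan_def
  proof (intro sum.cong refl)
    fix i assume "i \<in> {1..l}"
    show "(if u \<in> blk f i \<and> v \<in> blk f i then jordan_block (z i) (u - psum f i) (v - psum f i) else 0)
      = (if i = j then (if u \<in> blk f j then if u = v then z j else if v = u + 1 then 1 else 0 else 0) else 0)"
    proof (cases "i = j")
      case False
      then have "v \<notin> blk f i" using blk_disjoint[OF _ j(2), of i] by metis
      then show ?thesis using False by (simp only: simp_thms if_False)
    qed (use j in \<open>auto simp: jordan_block_def\<close>)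
  qed
  then show ?thesis using j by simp
qed

lemma jordan_same_block:
  assumes "jordan l f z u v \<noteq> 0"
  obtains i where "i \<in> {1..l}" "u \<in> blk f i" "v \<in> blk f i" "u \<le> v"
proof -
  obtain i where i: "i \<in> {1..l}"
    "(if u \<in> blk f i \<and> v \<in> blk f i then jordan_block (z i) (u - psum f i) (v - psum f i) else 0) \<noteq> 0"
    by (rule sum.not_neutral_contains_not_neutral[OF assms[unfolded jordan_def]])
  have uv: "u \<in> blk f i" "v \<in> blk f i" "jordan_block (z i) (u - psum f i) (v - psum f i) \<noteq> 0"
    using i(2) by (metis (mono_tags, lifting))+
  have "u \<le> v" using uv(1,2) uv(3)[unfolded jordan_block_def] by (simp split: if_splits)
  with i(1) uv(1,2) show ?thesis by (rule that)
qed

lemma resolvent_jordan: "resolvent (jordan l f z)"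
proof
  fix i j :: nat assume "j < i"
  show "jordan l f z i j = 0"
  proof (rule ccontr)
    assume "jordan l f z i j \<noteq> 0"
    then have "i \<le> j" by (rule jordan_same_block)
    then show False using \<open>j < i\<close> by simp
  qed
qed

text \<open>In a Jordan block the recursion has the single predecessor v - 1, with coefficient 1, so
  each step to the right contributes one more factor (z - z_j)^-1.\<close>

lemma res_jordan:
  assumes j: "j \<in> {1..l}" "v \<in> blk f j"
  shows "resolvent.res (jordan l f z) (psd_z :: 'a::calg psd) r v = (if r \<in> blk f j \<and> r \<le> v then psd_frac 1 (z j) (v - r) else 0)"
  using j(2)
proof (induction v rule: less_induct)
  case (less v)
  interpret J: resolvent "jordan l f z" by (rule resolvent_jordan)
  note Z = jordan_block_col[OF j(1) less.prems, of z]
  show ?case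
  proof (cases "r \<le> v")
    case True
    have "(\<Sum>u\<in>{r..<v}. J.res psd_z r u * scal (jordan l f z u v)) = (\<Sum>u\<in>{r..<v}. if u = v - 1 then (if v - 1 \<in> blk f j then J.res psd_z r u else 0) else (0 :: 'a psd))"
      by (intro sum.cong refl) (auto simp: Z)
    also have "\<dots> = (if r < v \<and> v - 1 \<in> blk f j then J.res psd_z r (v - 1) else 0)"
      using True by auto
    finally have e: "(\<Sum>u\<in>{r..<v}. J.res psd_z r u * scal (jordan l f z u v)) = (if r < v \<and> v - 1 \<in> blk f j then J.res (psd_z :: 'a psd) r (v - 1) else 0)" .
    have "J.res (psd_z :: 'a psd) r v = ((\<Sum>u\<in>{r..<v}. J.res psd_z r u * scal (jordan l f z u v)) + (if r = v then 1 else 0)) * uinv (psd_z - scal (jordan l f z v v))"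
      using True by (subst J.res.simps) simp
    also have "jordan l f z v v = z j" using Z[of v] less.prems by simp
    finally have s: "J.res (psd_z :: 'a psd) r v = ((if r < v \<and> v - 1 \<in> blk f j then J.res psd_z r (v - 1) else 0) + (if r = v then 1 else 0)) * uinv (psd_z - scal (z j))"
      unfolding e .
    show ?thesis
    proof (cases "r < v \<and> v - 1 \<in> blk f j")
      case t: True
      then have IH: "J.res (psd_z :: 'a psd) r (v - 1) = (if r \<in> blk f j \<and> r \<le> v - 1 then psd_frac 1 (z j) (v - 1 - r) else 0)"
        using less.IH[of "v - 1"] by (metis diff_less less_nat_zero_code linorder_not_less zero_less_one nat_neq_iff)
      have m: "v - r = Suc (v - 1 - r)" "r \<le> v - 1" "r \<noteq> v" using t by auto
      have fr: "psd_frac 1 (z j) (v - r) = psd_frac 1 (z j) (v - 1 - r) * (uinv (psd_z - scal (z j)) :: 'a psd)"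
        unfolding frac_eq_power m(1) by (rule power_Suc2)
      have "J.res (psd_z :: 'a psd) r v = (if r \<in> blk f j then psd_frac 1 (z j) (v - 1 - r) else 0) * uinv (psd_z - scal (z j))"
        unfolding s IH if_P[OF t] using m(2,3) by (simp only: simp_thms if_False add_0_right)
      then show ?thesis unfolding fr using True by (cases "r \<in> blk f j") (simp_all only: if_True if_False simp_thms mult_zero_left)
    next
      case f: False
      show ?thesis
      proof (cases "r = v")
        case True
        then show ?thesis unfolding s if_not_P[OF f] using less.prems by (simp add: frac_eq_power)
      next
        case False
        then have "r \<notin> blk f j" using f \<open>r \<le> v\<close> less.prems by auto
        then show ?thesis unfolding s if_not_P[OF f] using False by (simp only: simp_thms if_False add_0_right mult_zero_left)
      qed
    qed
  qed (simp add: J.res_below)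
qed

lemma frac_commute: "psd_frac 1 c k * psd_const x = psd_const x * psd_frac (1 :: 'a::calg) c k"
  unfolding frac_const[symmetric]
  by (rule psd_eqI) (simp add: coef_monom_z_mult coef_frac Let_def scal_central[of _ x])

section \<open>Generated subalgebras and bounds on degrees\<close>

inductive_set alg_hull :: "'a::calg set \<Rightarrow> 'a set" for G where
  one: "1 \<in> alg_hull G"
| incl: "x \<in> G \<Longrightarrow> x \<in> alg_hull G"
| add: "x \<in> alg_hull G \<Longrightarrow> y \<in> alg_hull G \<Longrightarrow> x + y \<in> alg_hull G"
| mult: "x \<in> alg_hull G \<Longrightarrow> y \<in> alg_hull G \<Longrightarrow> x * y \<in> alg_hull G"
| smult: "x \<in> alg_hull G \<Longrightarrow> scal c * x \<in> alg_hull G"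

lemma alg_hull_scal: "scal c \<in> alg_hull G"
  using alg_hull.smult[OF alg_hull.one, of c G] by simp

lemma alg_hull_0: "0 \<in> alg_hull G" using alg_hull_scal[of 0 G] by simp

lemma alg_hull_uminus: "x \<in> alg_hull G \<Longrightarrow> - x \<in> alg_hull G"
  using alg_hull.smult[of x G "- 1"] by (simp add: scal_minus)

lemma alg_hull_diff: "x \<in> alg_hull G \<Longrightarrow> y \<in> alg_hull G \<Longrightarrow> x - y \<in> alg_hull G"
  using alg_hull.add[OF _ alg_hull_uminus, of x G y] by simp

lemma alg_hull_sum: "(\<And>k. k \<in> K \<Longrightarrow> f k \<in> alg_hull G) \<Longrightarrow> sum f K \<in> alg_hull G"
  by (induction K rule: infinite_finite_induct) (auto intro: alg_hull_0 alg_hull.add)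

lemma alg_hull_subset: "G \<subseteq> alg_hull H \<Longrightarrow> alg_hull G \<subseteq> alg_hull H"
proof
  fix x assume "G \<subseteq> alg_hull H" "x \<in> alg_hull G"
  from this(2,1) show "x \<in> alg_hull H" by induction (auto intro: alg_hull.intros)
qed

lemma hom_alg_hull:
  assumes g: "hom_calg g"
  shows "g ` alg_hull G = alg_hull (g ` G)"
proof (intro equalityI subsetI)
  fix y assume "y \<in> g ` alg_hull G"
  then obtain x where "x \<in> alg_hull G" "y = g x" by blast
  then show "y \<in> alg_hull (g ` G)"
    by (induction arbitrary: y) (auto simp: hom_calgD[OF g] intro: alg_hull.intros)
next
  fix y assume "y \<in> alg_hull (g ` G)"
  then show "y \<in> g ` alg_hull G"
  proof induction
    case one
    show ?case by (rule image_eqI[of _ _ 1]) (simp_all add: hom_calgD[OF g] alg_hull.one)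
  next
    case (add x y)
    then obtain x' y' where "x' \<in> alg_hull G" "x = g x'" "y' \<in> alg_hull G" "y = g y'" by blast
    then show ?case by (intro image_eqI[of _ _ "x' + y'"]) (simp_all add: hom_calgD[OF g] alg_hull.add)
  next
    case (mult x y)
    then obtain x' y' where "x' \<in> alg_hull G" "x = g x'" "y' \<in> alg_hull G" "y = g y'" by blast
    then show ?case by (intro image_eqI[of _ _ "x' * y'"]) (simp_all add: hom_calgD[OF g] alg_hull.mult)
  next
    case (smult x c)
    then obtain x' where "x' \<in> alg_hull G" "x = g x'" by blast
    then show ?case by (intro image_eqI[of _ _ "scal c * x'"]) (simp_all add: hom_calgD[OF g] alg_hull.smult)
  qed (auto intro: alg_hull.incl)
qed

lemma (in full_cover) gen_alg_h: "gen_alg A (h ` G) = h ` alg_hull G"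
proof (intro equalityI subsetI)
  fix y assume "y \<in> gen_alg A (h ` G)"
  then show "y \<in> h ` alg_hull G"
  proof induction
    case one
    show ?case by (rule image_eqI[of _ _ 1]) (simp_all add: h_1 alg_hull.one)
  next
    case (add x y)
    then obtain x' y' where "x' \<in> alg_hull G" "x = h x'" "y' \<in> alg_hull G" "y = h y'" by blast
    then show ?case by (intro image_eqI[of _ _ "x' + y'"]) (simp_all add: h_add alg_hull.add)
  next
    case (mult x y)
    then obtain x' y' where "x' \<in> alg_hull G" "x = h x'" "y' \<in> alg_hull G" "y = h y'" by blast
    then show ?case by (intro image_eqI[of _ _ "x' * y'"]) (simp_all add: h_mult alg_hull.mult)
  next
    case (smult x c)
    then obtain x' where "x' \<in> alg_hull G" "x = h x'" by blast
    then show ?case by (intro image_eqI[of _ _ "scal c * x'"]) (simp_all only: h_scal UNIV_I alg_hull.smult)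
  qed (auto intro: alg_hull.incl)
next
  fix y assume "y \<in> h ` alg_hull G"
  then obtain x where "x \<in> alg_hull G" "y = h x" by blast
  then show "y \<in> gen_alg A (h ` G)"
  proof (induction arbitrary: y)
    case (smult x c)
    then show ?case by (simp only: h_scal UNIV_I gen_alg.smult)
  qed (auto simp: h_1 h_add h_mult intro: gen_alg.intros)
qed

lemma (in cover) finsum_h:
  assumes "\<And>r. r \<in> K \<Longrightarrow> f r = h (g r)" "\<And>r. r \<in> K \<Longrightarrow> g r \<in> S"
  shows "(\<Oplus>\<^bsub>A\<^esub>r\<in>K. f r) = h (sum g K)"
proof -
  interpret A: ring A by (rule ring)
  have "(\<Oplus>\<^bsub>A\<^esub>r\<in>K. f r) = (\<Oplus>\<^bsub>A\<^esub>r\<in>K. h (g r))"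
    by (rule A.finsum_cong') (use assms in \<open>auto intro: h_carrier\<close>)
  also have "\<dots> = h (sum g K)" by (rule h_sum[symmetric]) (rule assms(2))
  finally show ?thesis .
qed

lemma (in full_cover) pdo_dz_h: "pdo_dz A = (\<lambda>i j. h (coef psd_d i j))"
  by (auto simp: pdo_dz_def coef_monom h_0 h_1 fun_eq_iff)

lemma (in full_cover) pdo_frac_h: "pdo_frac A (h x) c k = (\<lambda>i j. h (coef (psd_frac x c k) i j))"
  by (intro ext) (simp only: pdo_frac_def coef_frac Let_def h_scal[OF UNIV_I, symmetric] h_0[symmetric] if_distrib[of h])

text \<open>These operators are closed under products and under the exchange and contain the scalar
  factors f and g. Comparing two generated subalgebras thus amounts to expressing either operator
  through the other.\<close>

definition psd_over :: "'a::calg set \<Rightarrow> 'a psd \<Rightarrow> bool" where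
  "psd_over G f \<longleftrightarrow> (\<forall>i j. coef f i j \<in> alg_hull G)"

lemma psd_over_mult: "psd_over G f \<Longrightarrow> psd_over G g \<Longrightarrow> psd_over G (f * g)"
  unfolding psd_over_def coef_mult conv_def
  by (intro allI alg_hull_sum, clarify, intro alg_hull.smult alg_hull.mult) blast+

lemma psd_over_monom: "psd_over G (psd_monom i j (scal c))"
  by (simp add: psd_over_def coef_monom alg_hull_scal alg_hull_0)

lemma psd_over_scal: "psd_over G (scal c)" and psd_over_1: "psd_over G 1" and psd_over_z: "psd_over G psd_z"
  using psd_over_monom[of G 0 0 c] psd_over_monom[of G 0 0 1] psd_over_monom[of G 1 0 1]
  by (simp_all add: scal_psd_def)

lemma psd_over_diff: "psd_over G f \<Longrightarrow> psd_over G g \<Longrightarrow> psd_over G (f - g)"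
  by (simp add: psd_over_def alg_hull_diff)

lemma uinv_z_frac: "uinv (psd_z - scal c) = psd_frac 1 c 0"
  by (simp add: frac_eq_power)

lemma psd_over_uinv_z: "psd_over G (uinv (psd_z - scal c))"
  unfolding uinv_z_frac psd_over_def coef_frac Let_def by (auto intro: alg_hull_scal alg_hull_0)

lemma psd_over_prod_list: "(\<And>x. x \<in> set xs \<Longrightarrow> psd_over G x) \<Longrightarrow> psd_over G (prod_list xs)"
  by (induction xs) (auto intro: psd_over_1 psd_over_mult)

lemma psd_over_swap: "psd_over G (psd_swap f) \<longleftrightarrow> psd_over G f"
  unfolding psd_over_def by auto

text \<open>A common form for f and g; \<open>True\<close> marks a factor in the
  denominator.\<close>

definition z_factors :: "(complex \<times> bool) list \<Rightarrow> 'a::calg psd" where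
  "z_factors cs = prod_list (map (\<lambda>(c, b). if b then uinv (psd_z - scal c) else psd_z - scal c) cs)"

lemma psd_over_factors: "psd_over G (z_factors cs)"
  unfolding z_factors_def
proof (rule psd_over_prod_list)
  fix x :: "'a psd" assume "x \<in> set (map (\<lambda>(c, b). if b then uinv (psd_z - scal c) else psd_z - scal c) cs)"
  then obtain c b where x: "x = (if b then uinv (psd_z - scal c) else psd_z - scal c)" by auto
  show "psd_over G x"
    unfolding x by (cases b) (simp_all add: psd_over_uinv_z psd_over_diff psd_over_z psd_over_scal)
qed

lemma z_factors_inverse:
  "\<exists>cs'. z_factors cs * z_factors cs' = (1 :: 'a::calg psd) \<and> z_factors cs' * z_factors cs = (1 :: 'a psd)"
proof (induction cs)
  case Nil
  show ?case by (rule exI[of _ "[]"]) (simp add: z_factors_def)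
next
  case (Cons x cs)
  then obtain cs' where cs': "z_factors cs * z_factors cs' = (1 :: 'a psd)" "z_factors cs' * z_factors cs = (1 :: 'a psd)" by blast
  obtain c b where x: "x = (c, b)" by (cases x)
  define e :: "'a psd" where "e = (if b then uinv (psd_z - scal c) else psd_z - scal c)"
  define e' :: "'a psd" where "e' = (if \<not> b then uinv (psd_z - scal c) else psd_z - scal c)"
  have ee: "e * e' = 1" "e' * e = 1"
    unfolding e_def e'_def by (cases b; simp add: uinv_left uinv_right unit_z_scal)+
  have 1: "z_factors (x # cs) = e * z_factors cs" "z_factors (cs' @ [(c, \<not> b)]) = z_factors cs' * e'"
    by (simp_all add: z_factors_def x e_def e'_def)
  have "e * z_factors cs * (z_factors cs' * e') = e * (z_factors cs * z_factors cs') * e'" by (simp only: mult.assoc)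
  moreover have "z_factors cs' * e' * (e * z_factors cs) = z_factors cs' * (e' * e) * z_factors cs" by (simp only: mult.assoc)
  ultimately have "z_factors (x # cs) * z_factors (cs' @ [(c, \<not> b)]) = (1 :: 'a psd)" "z_factors (cs' @ [(c, \<not> b)]) * z_factors (x # cs) = (1 :: 'a psd)"
    unfolding 1 cs'(1) ee by (simp_all only: mult_1_right ee cs'(2))
  then show ?case by blast
qed

text \<open>A bound on the degree in z becomes a bound on the order in d under the exchange. It
  shows that the Berezinian has no coefficients beyond those chosen as generators.\<close>

definition zdeg_le :: "int \<Rightarrow> 'a::calg psd \<Rightarrow> bool" where
  "zdeg_le e f \<longleftrightarrow> (\<forall>i j. i > e \<longrightarrow> coef f i j = 0)"

definition ddeg_le :: "int \<Rightarrow> 'a::calg psd \<Rightarrow> bool" where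
  "ddeg_le e f \<longleftrightarrow> (\<forall>i j. j > e \<longrightarrow> coef f i j = 0)"

lemma zdeg_le_mult: "zdeg_le e f \<Longrightarrow> zdeg_le e' g \<Longrightarrow> zdeg_le (e + e') (f * g)"
  and ddeg_le_mult: "ddeg_le e f \<Longrightarrow> ddeg_le e' g \<Longrightarrow> ddeg_le (e + e') (f * g)"
proof -
  obtain r s where f: "bounded_by r s (coef f)" by (rule coef_bounded)
  obtain r' s' where g: "bounded_by r' s' (coef g)" by (rule coef_bounded)
  show "zdeg_le (e + e') (f * g)" if "zdeg_le e f" "zdeg_le e' g"
  proof -
    have "bounded_by e s (coef f)" "bounded_by e' s' (coef g)" using f g that by (auto simp: bounded_by_def zdeg_le_def)
    from bounded_by_conv[OF this] show ?thesis by (auto simp: zdeg_le_def coef_mult bounded_by_def)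
  qed
  show "ddeg_le (e + e') (f * g)" if "ddeg_le e f" "ddeg_le e' g"
  proof -
    have "bounded_by r e (coef f)" "bounded_by r' e' (coef g)" using f g that by (auto simp: bounded_by_def ddeg_le_def)
    from bounded_by_conv[OF this] show ?thesis by (auto simp: ddeg_le_def coef_mult bounded_by_def)
  qed
qed

lemma zdeg_factors: "zdeg_le (\<Sum>x\<leftarrow>cs. if snd x then - 1 else 1) (z_factors cs :: 'a::calg psd)"
proof (induction cs)
  case Nil
  show ?case by (simp add: z_factors_def zdeg_le_def coef_1)
next
  case (Cons x cs)
  have "zdeg_le (if snd x then - 1 else 1) (if snd x then uinv (psd_z - scal (fst x)) else psd_z - scal (fst x) :: 'a psd)"
    by (cases "snd x") (simp_all only: if_True if_False uinv_z_frac, auto simp: zdeg_le_def coef_frac coef_monom scal_psd_def)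
  from zdeg_le_mult[OF this Cons] show ?case by (simp add: z_factors_def case_prod_unfold)
qed

lemma ddeg_factors: "ddeg_le 0 (z_factors cs :: 'a::calg psd)"
proof (induction cs)
  case Nil
  show ?case by (simp add: z_factors_def ddeg_le_def coef_1)
next
  case (Cons x cs)
  have "ddeg_le 0 (if snd x then uinv (psd_z - scal (fst x)) else psd_z - scal (fst x) :: 'a psd)"
    by (cases "snd x") (simp_all only: if_True if_False uinv_z_frac, auto simp: ddeg_le_def coef_frac coef_monom scal_psd_def)
  from ddeg_le_mult[OF this Cons] show ?case by (simp add: z_factors_def case_prod_unfold)
qed

lemma coef_mult_z_series:
  assumes o': "\<And>i j. coef f i j \<noteq> 0 \<Longrightarrow> j = 0" and x: "\<And>k. coef x k v = 0"
  shows "coef (f * x) u v = 0"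
  unfolding coef_mult conv_def
proof (rule sum.neutral, clarify)
  fix i j t assume *: "coef f i j \<noteq> 0"
  have j: "j = 0" by (rule o'[OF *])
  show "scal (pdo_coeff j (u + int t - i) t) * (coef f i j * coef x (u + int t - i) (v + int t - j)) = 0"
    by (cases t) (simp_all add: j x pdo_coeff_def)
qed

text \<open>Each factor raises the order in d by at most one, and the top order is reached only by
  choosing d in every factor.\<close>

lemma order_of_product:
  fixes L :: "(bool \<times> 'a::calg psd) list"
  assumes "\<And>c y i j. (c, y) \<in> set L \<Longrightarrow> coef y i j \<noteq> 0 \<Longrightarrow> j = 0"
  defines "x \<equiv> prod_list (map (\<lambda>(c, y). (if c then psd_d else 0) - y) L)"
  shows "j < 0 \<or> j > int (length L) \<Longrightarrow> coef x u j = 0"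
    and "coef x u (int (length L)) = (if u = 0 \<and> list_all fst L then 1 else 0)"
proof -
  have "(\<forall>u j. j < 0 \<or> j > int (length L) \<longrightarrow> coef x u j = 0) \<and> (\<forall>u. coef x u (int (length L)) = (if u = 0 \<and> list_all fst L then 1 else 0))"
    using assms(1) unfolding x_def
  proof (induction L)
    case Nil
    show ?case by (simp add: coef_1)
  next
    case (Cons cy L)
    obtain c y where cy: "cy = (c, y)" by (cases cy)
    let ?x = "prod_list (map (\<lambda>(c, y). (if c then psd_d else 0) - y) L)"
    have prem: "j = 0" if "(c, f) \<in> set L" "coef f i j \<noteq> 0" for c f i j
      by (rule Cons.prems[of c f i j]) (use that in auto)
    have IH0: "(\<forall>u j. j < 0 \<or> j > int (length L) \<longrightarrow> coef ?x u j = 0)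
        \<and> (\<forall>u. coef ?x u (int (length L)) = (if u = 0 \<and> list_all fst L then 1 else 0))"
    proof (rule Cons.IH)
      fix c f i j assume "(c, f) \<in> set L" "coef f i j \<noteq> 0"
      then show "j = 0" by (rule prem)
    qed
    have IH: "\<And>u j. j < 0 \<or> j > int (length L) \<Longrightarrow> coef ?x u j = 0"
      "\<And>u. coef ?x u (int (length L)) = (if u = 0 \<and> list_all fst L then 1 else 0)"
      using IH0 by blast+
    have y: "coef (y * ?x) u j = 0" if "j < 0 \<or> j > int (length L)" for u j
      by (rule coef_mult_z_series) (use Cons.prems cy IH(1) that in auto)
    have d: "coef ((if c then psd_d else 0) * ?x) u j = (if c then coef ?x u (j - 1) + scal (of_int (u + 1)) * coef ?x (u + 1) j else 0)" for u j
      by (simp add: coef_d_mult)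
    have e: "coef (prod_list (map (\<lambda>(c, y). (if c then psd_d else 0) - y) (cy # L))) u j
       = (if c then coef ?x u (j - 1) + scal (of_int (u + 1)) * coef ?x (u + 1) j else 0) - coef (y * ?x) u j" for u j
      using d[of u j] by (simp add: cy left_diff_distrib)
    show ?case
    proof (intro conjI allI impI)
      fix u j assume j: "j < 0 \<or> j > int (length (cy # L))"
      have "coef ?x u (j - 1) = 0" by (rule IH(1)) (use j in auto)
      moreover have "coef ?x (u + 1) j = 0" by (rule IH(1)) (use j in auto)
      moreover have "coef (y * ?x) u j = 0" by (rule y) (use j in auto)
      ultimately show "coef (prod_list (map (\<lambda>(c, y). (if c then psd_d else 0) - y) (cy # L))) u j = 0" unfolding e by simp
    next
      fix u
      have l1: "int (length (cy # L)) - 1 = int (length L)" by simp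
      have z1: "coef ?x (u + 1) (int (length (cy # L))) = 0" by (rule IH(1)) simp
      have z2: "coef (y * ?x) u (int (length (cy # L))) = 0" by (rule y) simp
      show "coef (prod_list (map (\<lambda>(c, y). (if c then psd_d else 0) - y) (cy # L))) u (int (length (cy # L))) = (if u = 0 \<and> list_all fst (cy # L) then 1 else 0)"
        unfolding e l1 z1 z2 IH(2) by (auto simp: cy)
    qed
  qed
  then show "j < 0 \<or> j > int (length L) \<Longrightarrow> coef x u j = 0" "coef x u (int (length L)) = (if u = 0 \<and> list_all fst L then 1 else 0)"
    by blast+
qed

text \<open>Coefficients of negative order vanish and those of top order are integers, so the
  coefficients that are not generators of the first algebra lie in every subalgebra.\<close>

lemma col_det_order:
  fixes y :: "nat \<Rightarrow> nat \<Rightarrow> 'a::calg psd"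
  assumes y: "\<And>a b i j. coef (y a b) i j \<noteq> 0 \<Longrightarrow> j = 0"
    and j: "j < 0 \<or> j \<ge> int (length js)"
  shows "coef (col_det js (\<lambda>a b. (if a = b then psd_d else 0) - y a b)) u j \<in> alg_hull G"
proof -
  have "coef (of_int (sign \<sigma>) * prod_list (map (\<lambda>b. (if \<sigma> b = b then psd_d else 0) - y (\<sigma> b) b) js)) u j \<in> alg_hull G" for \<sigma> :: "nat \<Rightarrow> nat"
  proof -
    let ?L = "map (\<lambda>b. (\<sigma> b = b, y (\<sigma> b) b)) js"
    have m: "map (\<lambda>b. (if \<sigma> b = b then psd_d else 0) - y (\<sigma> b) b) js = map (\<lambda>(c, y). (if c then psd_d else 0) - y) ?L" by simp
    have L: "j = 0" if "(c, f) \<in> set ?L" "coef f i j \<noteq> 0" for c f i j using that y by auto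
    have len: "length ?L = length js" by simp
    note O = order_of_product[of ?L, OF L, unfolded len]
    have "coef (prod_list (map (\<lambda>(c, y). (if c then psd_d else 0) - y) ?L)) u j \<in> alg_hull G"
    proof (cases "j = int (length js)")
      case True
      have "coef (prod_list (map (\<lambda>(c, y). (if c then psd_d else 0) - y) ?L)) u j = (if u = 0 \<and> list_all fst ?L then 1 else 0)"
        unfolding True by (rule O(2))
      moreover have "(if b then 1 else 0) \<in> alg_hull G" for b by (cases b) (simp_all add: alg_hull_0 alg_hull.one)
      ultimately show ?thesis by (simp only:)
    next
      case False
      then have "j < 0 \<or> j > int (length js)" using j by auto
      then show ?thesis by (simp only: O(1) alg_hull_0)
    qed
    then show ?thesis unfolding m by (cases "evenperm \<sigma>") (simp_all add: sign_def alg_hull_uminus)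
  qed
  then show ?thesis unfolding col_det_alt coef_sum by (intro alg_hull_sum) blast
qed

lemma col_det_zdeg:
  assumes y: "\<And>a b. zdeg_le 0 (M a b)"
  shows "zdeg_le 0 (col_det js M)"
proof -
  have "zdeg_le 0 (prod_list (map (\<lambda>b. M (\<sigma> b) b) js))" for \<sigma>
  proof (induction js)
    case Nil
    show ?case by (simp add: zdeg_le_def coef_1)
  next
    case (Cons a js)
    show ?case using zdeg_le_mult[OF y Cons] by simp
  qed
  then show ?thesis
    unfolding col_det_alt zdeg_le_def coef_sum
    by (intro allI impI sum.neutral ballI) (auto simp: sign_def)
qed

section \<open>Truncated current algebras\<close>

lemma psum_1 [simp]: "psum f (Suc 0) = 0" by (simp add: psum_def)

abbreviation "sub_blk f i k \<equiv> {psum f i + 1..psum f (i + 1) - k}"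

text \<open>A contraction matches s + k' with r. Both indices stay inside the block exactly when s +
  k + k' does, which reproduces the truncation: for k + k' at least the block size the range of s is
  empty.\<close>

lemma shift_sum:
  fixes g :: "nat \<Rightarrow> 'a::comm_monoid_add"
  assumes "i \<ge> 1" "i' \<ge> 1" "k < f i" "k' < f i'"
  shows "(\<Sum>r\<in>sub_blk f i k. \<Sum>s\<in>sub_blk f i' k'. if s + k' = r then g s else 0)
    = (if i = i' then \<Sum>s\<in>sub_blk f i (k + k'). g s else 0)"
proof -
  have "(\<Sum>r\<in>sub_blk f i k. \<Sum>s\<in>sub_blk f i' k'. if s + k' = r then g s else 0)
    = (\<Sum>s\<in>sub_blk f i' k'. if s + k' \<in> sub_blk f i k then g s else 0)"
    by (subst sum.swap) (simp cong: if_cong)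
  also have "\<dots> = (\<Sum>s\<in>{s \<in> sub_blk f i' k'. s + k' \<in> sub_blk f i k}. g s)"
    by (rule sum.inter_filter[symmetric]) simp
  also have "{s \<in> sub_blk f i' k'. s + k' \<in> sub_blk f i k} = (if i = i' then sub_blk f i (k + k') else {})"
  proof (cases "i = i'")
    case True
    then show ?thesis by auto
  next
    case False
    have "\<not> (s \<in> sub_blk f i' k' \<and> s + k' \<in> sub_blk f i k)" for s
    proof
      assume s: "s \<in> sub_blk f i' k' \<and> s + k' \<in> sub_blk f i k"
      then have "s + k' \<in> blk f i'" "s + k' \<in> blk f i"
        using psum_Suc[OF assms(1), of f] psum_Suc[OF assms(2), of f] assms(3,4) by auto
      then show False using blk_disjoint False by metis
    qed
    then show ?thesis using False by auto
  qed
  finally show ?thesis by simp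
qed

lemma lin_bracket:
  "lin \<theta> (bracket (lie_dsum A (\<lambda>i. takiff (f i) (gl_super J \<pi>))) (tak i a b k) (tak i' c e k'))
    = (if i = i' \<and> k + k' < f i then (if b = c then \<theta> (tak i a e (k + k')) else 0)
        - (if a = e then scal (psign ((\<pi> a + \<pi> b) * (\<pi> c + \<pi> e))) * \<theta> (tak i c b (k + k')) else 0) else 0)"
  by (simp add: lie_dsum_def takiff_def gl_super_def lin_push lin_diff lin_single)

lemma lin_lookup: "lin (\<lambda>x. if x = t then 1 else 0) v = Poly_Mapping.lookup v t"
  unfolding lin_def by (simp add: scal_complex_def in_keys_iff mult_delta cong: if_cong)

lemma basis_takiff: "tak i a b k \<in> basis (lie_dsum A (\<lambda>i. takiff (f i) (gl_super J \<pi>))) \<longleftrightarrow> i \<in> A \<and> a \<in> J \<and> b \<in> J \<and> k < f i"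
  by (auto simp: lie_dsum_def takiff_def gl_super_def)

lemma presentation_takiff:
  defines "g A f J \<pi> \<equiv> lie_dsum A (\<lambda>i. takiff (f i) (gl_super J \<pi>))"
  shows "presentation (basis (g A f J \<pi>)) (bpar (g A f J \<pi>)) (env_rels (g A f J \<pi>))"
proof (rule env_presentation, rule subsetI)
  fix x y t assume xy: "x \<in> basis (g A f J \<pi>)" "y \<in> basis (g A f J \<pi>)" and t: "t \<in> Poly_Mapping.keys (bracket (g A f J \<pi>) x y)"
  obtain i a b k where x: "x = tak i a b k" by (metis prod.exhaust)
  obtain i' c e k' where y: "y = tak i' c e k'" by (metis prod.exhaust)
  \<comment> \<open>A coefficient of the bracket is \<open>lin\<close> of an indicator function, so
    \<open>lin_bracket\<close> also describes the support of the bracket.\<close>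
  from t have "lin (\<lambda>x. if x = t then 1 else 0 :: complex) (bracket (g A f J \<pi>) x y) \<noteq> 0"
    by (simp only: lin_lookup in_keys_iff not_False_eq_True simp_thms)
  then have "i = i' \<and> k + k' < f i \<and> (t = tak i a e (k + k') \<or> t = tak i c b (k + k'))"
    unfolding x y g_def lin_bracket by (auto split: if_splits)
  then show "t \<in> basis (g A f J \<pi>)" using xy unfolding x y g_def by (auto simp: basis_takiff)
qed

lemma has_parity_ev:
  assumes "\<And>b. b \<in> B \<Longrightarrow> has_parity (\<theta> b) (par b)" and f: "f \<in> part (free_superalg B par) e"
  shows "has_parity (ev \<theta> f) e"
proof -
  have l: "has_parity (prod_list (map \<theta> l)) (sum_list (map par l))" if "set l \<subseteq> B" for l
    using that
  proof (induction l)
    case (Cons b l)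
    then have "has_parity (\<theta> b * prod_list (map \<theta> l)) (par b + sum_list (map par l))"
      by (intro has_parity_mult assms(1)) auto
    then show ?case unfolding list.map prod_list.Cons sum_list.Cons .
  qed (simp add: has_parity_1)
  have s: "has_parity (sum h K) e" if "\<And>k. k \<in> K \<Longrightarrow> has_parity (h k) e" for h :: "'b word \<Rightarrow> spoly lend" and K
    using that by (induction K rule: infinite_finite_induct) (auto intro: has_parity_add has_parity_0)
  show ?thesis unfolding ev_def
  proof (rule s)
    fix u assume "u \<in> Poly_Mapping.keys f"
    then have u: "set (letters u) \<subseteq> B" "sum_list (map par (letters u)) = e" using f by (auto simp: free_superalg_def)
    show "has_parity (scal (Poly_Mapping.lookup f u) * prod_list (map \<theta> (letters u))) e"
      using l[OF u(1)] unfolding u(2) by (rule has_parity_scal)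
  qed
qed

lemma has_parity_sum: "(\<And>k. k \<in> K \<Longrightarrow> has_parity (h k) e) \<Longrightarrow> has_parity (sum h K) e"
  by (induction K rule: infinite_finite_induct) (auto intro: has_parity_add has_parity_0)

lemma ev_SD: "(\<And>b. \<theta> b \<in> SD) \<Longrightarrow> ev \<theta> f \<in> SD"
proof (induction f rule: free_induct)
  case (letter b x)
  then show ?case by (simp add: ev_simps D.closed)
qed (simp_all add: ev_simps D.closed)

lemma double_sum_diff: "(\<Sum>r\<in>R. A r) * (\<Sum>s\<in>R'. B s) - c * ((\<Sum>s\<in>R'. B s) * (\<Sum>r\<in>R. A r))
    = (\<Sum>r\<in>R. \<Sum>s\<in>R'. A r * B s - c * (B s * (A r :: 'a::ring_1)))"
proof -
  have BA: "(\<Sum>s\<in>R'. B s) * (\<Sum>r\<in>R. A r) = (\<Sum>r\<in>R. \<Sum>s\<in>R'. B s * A r)"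
    unfolding sum_product by (rule sum.swap)
  show ?thesis unfolding BA sum_product[of A R B R'] unfolding sum_subtractf sum_distrib_left ..
qed

lemma psign_bilinear: "psign ((a + b) * (c + e)) = psign (b * c) * (psign (e * a) * psign (c * a) * psign (e * b))"
  by (simp only: distrib_left distrib_right psign_add mult.commute mult.left_commute mult.assoc)

lemma square_product:
  fixes x y v :: complex
  assumes "x * x = 1" "y * y = 1" "v * v = 1"
  shows "(x * y * v) * (x * y * v) = 1"
proof -
  have "(x * y * v) * (x * y * v) = (x * x) * (y * y) * (v * v)" by (simp only: mult.commute mult.left_commute mult.assoc)
  then show ?thesis by (simp only: assms mult_1_right)
qed

section \<open>The two homomorphisms in canonical generators\<close>

locale duality_data =
  fixes d' p' q' m' n' :: nat and w z :: "nat \<Rightarrow> complex" and \<xi> \<gamma> :: "nat \<Rightarrow> nat"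
  assumes xi: "(\<Sum>a\<in>{1..d'}. \<xi> a) = par_d" and gp: "(\<Sum>i\<in>{1..p'}. \<gamma> i) = par_p"
    and gq: "(\<Sum>i\<in>{1..q'}. \<gamma> (p' + i)) = par_q" and gm: "(\<Sum>i\<in>{1..m'}. \<gamma> (p' + q' + i)) = par_m"
    and gn: "(\<Sum>i\<in>{1..n'}. \<gamma> (p' + q' + m' + i)) = par_n"
begin

abbreviation "l \<equiv> p' + q' + m' + n'"

abbreviation "Z \<equiv> jordan l \<gamma> z"

abbreviation "W \<equiv> jordan d' \<xi> w"

lemma psum_xi: "psum \<xi> (Suc d') = par_d"
  using psum_add[of \<xi> 0 d'] xi by simp

lemma psum_gamma: "psum \<gamma> (Suc p') = par_p" "psum \<gamma> (Suc (p' + q')) = pq" "psum \<gamma> (Suc (p' + q' + m')) = pq + par_m"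
  "psum \<gamma> (Suc l) = NN"
  using psum_add[of \<gamma> 0 p'] psum_add[of \<gamma> p' q'] psum_add[of \<gamma> "p' + q'" m'] psum_add[of \<gamma> "p' + q' + m'" n'] gp gq gm gn
  by simp_all

lemma blk_N: "i \<in> {1..l} \<Longrightarrow> r \<in> blk \<gamma> i \<Longrightarrow> r \<in> {1..NN}"
  using blk_bounds[of i l r \<gamma>] unfolding psum_gamma .

lemma blk_d: "a \<in> {1..d'} \<Longrightarrow> r \<in> blk \<xi> a \<Longrightarrow> r \<in> {1..par_d}"
  using blk_bounds[of a d' r \<xi>] unfolding psum_xi .

lemma blk_pq: "i \<in> {1..l} \<Longrightarrow> r \<in> blk \<gamma> i \<Longrightarrow> r \<le> pq \<longleftrightarrow> i \<le> p' + q'"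
  using psum_mono[of "i + 1" "Suc (p' + q')" \<gamma>] psum_mono[of "Suc (p' + q')" i \<gamma>] psum_gamma(2)
  by (cases "i \<le> p' + q'") auto

text \<open>The blocks of \<gamma> refine the division of the flavours into the four groups of sizes
  p, q, m and n.\<close>

lemma ix_blk: "r \<in> blk \<gamma> i \<Longrightarrow> u \<in> blk \<gamma> i \<Longrightarrow> ix r = ix u"
  using psum_mono[of "i + 1" "Suc p'" \<gamma>] psum_mono[of "Suc p'" i \<gamma>]
    psum_mono[of "i + 1" "Suc (p' + q')" \<gamma>] psum_mono[of "Suc (p' + q')" i \<gamma>]
    psum_mono[of "i + 1" "Suc (p' + q' + m')" \<gamma>] psum_mono[of "Suc (p' + q' + m')" i \<gamma>] psum_gamma(1-3)
  unfolding idx_par_def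
  by (cases "i \<le> p'"; cases "i \<le> p' + q'"; cases "i \<le> p' + q' + m'") simp_all

lemma sign_ix: "(if ix i = 1 \<and> ix j = 1 then - 1 else 1) * (y :: 'a::calg) = scal (psign (ix i * ix j)) * y"
  by (cases "ix i = 0"; cases "ix j = 0") (simp_all add: psign_simps scal_minus)

sublocale K: super_weyl Z NN par_d "\<lambda>i. ix i = 1" Xo Po W
proof
  show "j < i \<Longrightarrow> Z i j = 0" for i j by (rule resolvent.triangular[OF resolvent_jordan])
  show "b < a \<Longrightarrow> W a b = 0" for a b by (rule resolvent.triangular[OF resolvent_jordan])
  show "(ix i = 1) = (ix j = 1)" if ij: "Z i j \<noteq> 0" for i j
  proof -
    obtain b where b: "b \<in> {1..l}" "i \<in> blk \<gamma> b" "j \<in> blk \<gamma> b" "i \<le> j" by (rule jordan_same_block[OF ij])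
    have "ix i = ix j" by (rule ix_blk[OF b(2,3)])
    then show ?thesis by (simp only:)
  qed
next
  fix i j a b assume ij: "i \<in> {1..NN}" "j \<in> {1..NN}" "a \<in> {1..par_d}" "b \<in> {1..par_d}"
  show "Xo i a * Xo j b = (if ix i = 1 \<and> ix j = 1 then - 1 else 1) * (Xo j b * Xo i a)"
    unfolding sign_ix by (rule Xo_Po_relations(1)[OF ij])
  show "Po i a * Po j b = (if ix i = 1 \<and> ix j = 1 then - 1 else 1) * (Po j b * Po i a)"
    unfolding sign_ix by (rule Xo_Po_relations(2)[OF ij])
  show "Po i a * Xo j b = (if ix i = 1 \<and> ix j = 1 then - 1 else 1) * (Xo j b * Po i a) + (if i = j \<and> a = b then 1 else 0)"
    unfolding sign_ix Xo_Po_relations(3)[OF ij] by simp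
qed

sublocale R: resolvent W by (rule resolvent_jordan)

text \<open>One formula for both cases of \<open>phi_gen\<close>: for the y flavours the product of
  (-1)^|r| with the sign in \<open>Po\<close> is - 1. Off the basis the value is 0, so that
  evaluation factors through the retraction onto the generators.\<close>

definition ph :: "tak \<Rightarrow> spoly lend" where
  "ph = (\<lambda>(i, ((a, b), k)). if i \<in> {1..l} \<and> a \<in> {1..par_d} \<and> b \<in> {1..par_d} \<and> k < \<gamma> i
     then \<Sum>r\<in>sub_blk \<gamma> i k. scal (psign (ix r)) * (Po r b * Xo (r + k) a) else 0)"

definition vph :: "tak \<Rightarrow> spoly lend" where
  "vph = (\<lambda>(a, ((i, j), k)). if a \<in> {1..d'} \<and> i \<in> {1..NN} \<and> j \<in> {1..NN} \<and> k < \<xi> a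
     then \<Sum>\<alpha>\<in>sub_blk \<xi> a k. Xo i (\<alpha> + k) * Po j \<alpha> else 0)"

lemma sub_blk_gamma:
  assumes "i \<in> {1..l}" "k < \<gamma> i" "r \<in> sub_blk \<gamma> i k"
  shows "r \<in> {1..NN}" "r + k \<in> {1..NN}" "ix (r + k) = ix r" "r \<le> pq \<longleftrightarrow> i \<le> p' + q'" "r + k \<le> pq \<longleftrightarrow> i \<le> p' + q'"
proof -
  have r: "r \<in> blk \<gamma> i" "r + k \<in> blk \<gamma> i" using blk_shift[of i l k \<gamma> r] assms by blast+
  show "r \<in> {1..NN}" "r + k \<in> {1..NN}" "ix (r + k) = ix r" "r \<le> pq \<longleftrightarrow> i \<le> p' + q'" "r + k \<le> pq \<longleftrightarrow> i \<le> p' + q'"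
    by (rule blk_N[OF assms(1) r(1)] blk_N[OF assms(1) r(2)] ix_blk[OF r(2,1)] blk_pq[OF assms(1) r(1)] blk_pq[OF assms(1) r(2)])+
qed

lemma sub_blk_xi:
  assumes "a \<in> {1..d'}" "k < \<xi> a" "\<alpha> \<in> sub_blk \<xi> a k"
  shows "\<alpha> \<in> {1..par_d}" "\<alpha> + k \<in> {1..par_d}"
  using blk_shift[of a d' k \<xi> \<alpha>] assms blk_d[OF assms(1)] by blast+

abbreviation "gl \<equiv> gl_takiff par_d l \<gamma>"

abbreviation "gls \<equiv> gls_takiff par_p par_q par_m par_n d' \<xi>"

lemma psign_cases: "psign e = 1 \<or> psign e = - 1" by (simp add: psign_def)

text \<open>The two factors of each summand have equal parity, so the graded commutator is an
  ordinary one with two contractions, and \<open>shift_sum\<close> collects them in degree k + k'.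
  The factor 1 stands for the trivial sign, in the shape of \<open>double_sum_diff\<close>.\<close>

lemma ph_bracket:
  assumes x: "tak i a b k \<in> basis gl" and y: "tak i' c e k' \<in> basis gl"
  shows "ph (tak i a b k) * ph (tak i' c e k') - 1 * (ph (tak i' c e k') * ph (tak i a b k)) = lin ph (bracket gl (tak i a b k) (tak i' c e k'))"
proof -
  have x': "i \<in> {1..l}" "a \<in> {1..par_d}" "b \<in> {1..par_d}" "k < \<gamma> i"
    and y': "i' \<in> {1..l}" "c \<in> {1..par_d}" "e \<in> {1..par_d}" "k' < \<gamma> i'"
    using x y unfolding gl_takiff_def basis_takiff by blast+
  have el: "(scal (psign (ix r)) * (Po r b * Xo (r + k) a)) * (scal (psign (ix s)) * (Po s e * Xo (s + k') c))
      - 1 * ((scal (psign (ix s)) * (Po s e * Xo (s + k') c)) * (scal (psign (ix r)) * (Po r b * Xo (r + k) a)))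
    = (if s + k' = r then if b = c then scal (psign (ix s)) * (Po s e * Xo (s + (k + k')) a) else 0 else 0)
      - (if r + k = s then if a = e then scal (psign (ix r)) * (Po r b * Xo (r + (k + k')) c) else 0 else 0)"
    if rs: "r \<in> sub_blk \<gamma> i k" "s \<in> sub_blk \<gamma> i' k'" for r s
  proof -
    note r = sub_blk_gamma[OF x'(1,4) rs(1)] and s = sub_blk_gamma[OF y'(1,4) rs(2)]
    let ?t1 = "if r + k = s \<and> a = e then - psign (ix (r + k)) else 0" and ?t2 = "if s + k' = r \<and> c = b then - psign (ix (s + k')) else 0"
    let ?s1 = "psign (ix (r + k) * ix s)" and ?s2 = "psign (ix (s + k') * ix r)" and ?s3 = "psign (ix s * ix r)" and ?s4 = "psign (ix (s + k') * ix (r + k))"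
    have ss: "?s1 * (?s2 * ?s3 * ?s4) = 1" "(?s2 * ?s3 * ?s4) * (?s2 * ?s3 * ?s4) = 1"
      unfolding r(3) s(3) by (simp_all add: psign_def)
    have "Po r b * Xo (r + k) a * (Po s e * Xo (s + k') c) - scal (?s1 * (?s2 * ?s3 * ?s4)) * (Po s e * Xo (s + k') c * (Po r b * Xo (r + k) a))
      = scal ?t1 * (Po r b * Xo (s + k') c) - scal (?s1 * (?s2 * ?s3 * ?s4) * ?t2) * (Po s e * Xo (r + k) a)"
      by (rule super_commutator[OF Xo_Po[OF r(2) s(1) x'(2) y'(3)] Xo_Po[OF s(2) r(1) y'(2) x'(3)]
            Xo_Po_relations(2)[OF s(1) r(1) y'(3) x'(3)] Xo_Po_relations(1)[OF s(2) r(2) y'(2) x'(2)] ss(2)])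
    then have "Po r b * Xo (r + k) a * (Po s e * Xo (s + k') c) - Po s e * Xo (s + k') c * (Po r b * Xo (r + k) a)
      = scal ?t1 * (Po r b * Xo (s + k') c) - scal ?t2 * (Po s e * Xo (r + k) a)"
      unfolding ss(1) by (simp only: scal_one mult_1_left)
    then have "scal (psign (ix r) * psign (ix s)) * (Po r b * Xo (r + k) a * (Po s e * Xo (s + k') c) - Po s e * Xo (s + k') c * (Po r b * Xo (r + k) a))
      = scal (psign (ix r) * psign (ix s) * ?t1) * (Po r b * Xo (s + k') c) - scal (psign (ix r) * psign (ix s) * ?t2) * (Po s e * Xo (r + k) a)"
      by (simp only: right_diff_distrib scal_scal)
    moreover have "scal (psign (ix r) * psign (ix s) * ?t1) * (Po r b * Xo (s + k') c)
      = - (if r + k = s then if a = e then scal (psign (ix r)) * (Po r b * Xo (r + (k + k')) c) else 0 else 0)"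
      using r(3) psign_cases[of "ix r"] by (auto simp: scal_minus add.assoc)
    moreover have "scal (psign (ix r) * psign (ix s) * ?t2) * (Po s e * Xo (r + k) a)
      = - (if s + k' = r then if b = c then scal (psign (ix s)) * (Po s e * Xo (s + (k + k')) a) else 0 else 0)"
      using s(3) psign_cases[of "ix s"] by (auto simp: scal_minus add.assoc add.commute[of k])
    ultimately show ?thesis
      by (simp only: scal_pull mult_1_left mult.commute[of "psign (ix s)"] right_diff_distrib[symmetric]) simp
  qed
  have "ph (tak i a b k) * ph (tak i' c e k') - 1 * (ph (tak i' c e k') * ph (tak i a b k))
    = (\<Sum>r\<in>sub_blk \<gamma> i k. \<Sum>s\<in>sub_blk \<gamma> i' k'.
        (if s + k' = r then if b = c then scal (psign (ix s)) * (Po s e * Xo (s + (k + k')) a) else 0 else 0)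
      - (if r + k = s then if a = e then scal (psign (ix r)) * (Po r b * Xo (r + (k + k')) c) else 0 else 0))"
    unfolding ph_def prod.case using x' y' by (simp only: simp_thms if_True double_sum_diff) (intro sum.cong refl el)
  also have "\<dots> = (if i = i' then \<Sum>s\<in>sub_blk \<gamma> i (k + k'). if b = c then scal (psign (ix s)) * (Po s e * Xo (s + (k + k')) a) else 0 else 0)
     - (if i' = i then \<Sum>r\<in>sub_blk \<gamma> i' (k' + k). if a = e then scal (psign (ix r)) * (Po r b * Xo (r + (k + k')) c) else 0 else 0)"
  proof -
    have "(\<Sum>r\<in>sub_blk \<gamma> i k. \<Sum>s\<in>sub_blk \<gamma> i' k'. if r + k = s then g r else 0) = (\<Sum>s\<in>sub_blk \<gamma> i' k'. \<Sum>r\<in>sub_blk \<gamma> i k. if r + k = s then g r else 0)"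
      for g :: "nat \<Rightarrow> spoly lend" by (rule sum.swap)
    note sw = this
    have 1: "i \<ge> 1" "i' \<ge> 1" using x' y' by auto
    show ?thesis unfolding sum_subtractf sw shift_sum[OF 1 x'(4) y'(4)] shift_sum[OF 1(2,1) y'(4) x'(4)] ..
  qed
  also have "\<dots> = lin ph (bracket gl (tak i a b k) (tak i' c e k'))"
    unfolding gl_takiff_def lin_bracket using x' y' psum_Suc[of i \<gamma>] by (auto simp: ph_def psign_simps add.commute)
  finally show ?thesis .
qed

text \<open>The same computation with colours in place of flavours. The sign of the bracket factors
  into the signs of the four exchanges by \<open>psign_bilinear\<close>.\<close>

lemma vph_bracket:
  assumes x: "tak a i j k \<in> basis gls" and y: "tak a' i' j' k' \<in> basis gls"
  shows "vph (tak a i j k) * vph (tak a' i' j' k') - scal (psign ((ix i + ix j) * (ix i' + ix j'))) * (vph (tak a' i' j' k') * vph (tak a i j k))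
    = lin vph (bracket gls (tak a i j k) (tak a' i' j' k'))"
proof -
  define c where "c = psign ((ix i + ix j) * (ix i' + ix j'))"
  have x': "a \<in> {1..d'}" "i \<in> {1..NN}" "j \<in> {1..NN}" "k < \<xi> a"
    and y': "a' \<in> {1..d'}" "i' \<in> {1..NN}" "j' \<in> {1..NN}" "k' < \<xi> a'"
    using x y unfolding gls_takiff_def basis_takiff by blast+
  have el: "(Xo i (r + k) * Po j r) * (Xo i' (s + k') * Po j' s) - scal c * ((Xo i' (s + k') * Po j' s) * (Xo i (r + k) * Po j r))
    = (if s + k' = r then if j = i' then Xo i (s + (k + k')) * Po j' s else 0 else 0)
      - (if r + k = s then if i = j' then scal c * (Xo i' (r + (k + k')) * Po j r) else 0 else 0)"
    if rs: "r \<in> sub_blk \<xi> a k" "s \<in> sub_blk \<xi> a' k'" for r s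
  proof -
    note r = sub_blk_xi[OF x'(1,4) rs(1)] and s = sub_blk_xi[OF y'(1,4) rs(2)]
    let ?s1 = "psign (ix j * ix i')" and ?s2 = "psign (ix j' * ix i)" and ?s3 = "psign (ix i' * ix i)" and ?s4 = "psign (ix j' * ix j)"
    have ss: "?s1 * (?s2 * ?s3 * ?s4) = c" "(?s2 * ?s3 * ?s4) * (?s2 * ?s3 * ?s4) = 1"
      unfolding c_def by (rule psign_bilinear[symmetric], rule square_product) (rule psign_sq)+
    have "Xo i (r + k) * Po j r * (Xo i' (s + k') * Po j' s) - scal (?s1 * (?s2 * ?s3 * ?s4)) * (Xo i' (s + k') * Po j' s * (Xo i (r + k) * Po j r))
      = scal (if j = i' \<and> r = s + k' then 1 else 0) * (Xo i (r + k) * Po j' s)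
        - scal (?s1 * (?s2 * ?s3 * ?s4) * (if j' = i \<and> s = r + k then 1 else 0)) * (Xo i' (s + k') * Po j r)"
      by (rule super_commutator[OF Xo_Po_relations(3)[OF x'(3) y'(2) r(1) s(2)] Xo_Po_relations(3)[OF y'(3) x'(2) s(1) r(2)]
            Xo_Po_relations(1)[OF y'(2) x'(2) s(2) r(2)] Xo_Po_relations(2)[OF y'(3) x'(3) s(1) r(1)] ss(2)])
    then show ?thesis unfolding ss(1) by (auto simp: add.assoc add.commute[of k])
  qed
  have "vph (tak a i j k) * vph (tak a' i' j' k') - scal c * (vph (tak a' i' j' k') * vph (tak a i j k))
    = (\<Sum>r\<in>sub_blk \<xi> a k. \<Sum>s\<in>sub_blk \<xi> a' k'.
        (if s + k' = r then if j = i' then Xo i (s + (k + k')) * Po j' s else 0 else 0)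
      - (if r + k = s then if i = j' then scal c * (Xo i' (r + (k + k')) * Po j r) else 0 else 0))"
    unfolding vph_def prod.case using x' y' by (simp only: simp_thms if_True double_sum_diff) (intro sum.cong refl el)
  also have "\<dots> = (if a = a' then \<Sum>s\<in>sub_blk \<xi> a (k + k'). if j = i' then Xo i (s + (k + k')) * Po j' s else 0 else 0)
     - (if a' = a then \<Sum>r\<in>sub_blk \<xi> a' (k' + k). if i = j' then scal c * (Xo i' (r + (k + k')) * Po j r) else 0 else 0)"
  proof -
    have "(\<Sum>r\<in>sub_blk \<xi> a k. \<Sum>s\<in>sub_blk \<xi> a' k'. if r + k = s then g r else 0) = (\<Sum>s\<in>sub_blk \<xi> a' k'. \<Sum>r\<in>sub_blk \<xi> a k. if r + k = s then g r else 0)"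
      for g :: "nat \<Rightarrow> spoly lend" by (rule sum.swap)
    note sw = this
    have 1: "a \<ge> 1" "a' \<ge> 1" using x' y' by auto
    show ?thesis unfolding sum_subtractf sw shift_sum[OF 1 x'(4) y'(4)] shift_sum[OF 1(2,1) y'(4) x'(4)] ..
  qed
  also have "\<dots> = lin vph (bracket gls (tak a i j k) (tak a' i' j' k'))"
    unfolding gls_takiff_def lin_bracket c_def[symmetric] using x' y' psum_Suc[of a \<xi>] by (auto simp: vph_def sum_distrib_left add.commute)
  finally show ?thesis unfolding c_def .
qed

end

context duality_data
begin

lemma mul_op_va: "r \<in> {1..NN} \<Longrightarrow> a \<in> {1..par_d} \<Longrightarrow> mul_op V vp (va r a) = lend_rep (Mo (va r a))"
  and der_op_va: "r \<in> {1..NN} \<Longrightarrow> a \<in> {1..par_d} \<Longrightarrow> der_op V vp (va r a) = lend_rep (De (va r a))"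
  and Mo_va: "r \<in> {1..NN} \<Longrightarrow> a \<in> {1..par_d} \<Longrightarrow> Mo (va r a) \<in> SD"
  and De_va: "r \<in> {1..NN} \<Longrightarrow> a \<in> {1..par_d} \<Longrightarrow> De (va r a) \<in> SD"
  by (simp_all only: mul_op_rep der_op_rep SD_gens va_V)

lemma gl_basis: "tak i a b k \<in> basis gl \<longleftrightarrow> i \<in> {1..l} \<and> a \<in> {1..par_d} \<and> b \<in> {1..par_d} \<and> k < \<gamma> i"
  unfolding gl_takiff_def by (rule basis_takiff)

lemma gls_basis: "tak a i j k \<in> basis gls \<longleftrightarrow> a \<in> {1..d'} \<and> i \<in> {1..NN} \<and> j \<in> {1..NN} \<and> k < \<xi> a"
  unfolding gls_takiff_def by (rule basis_takiff)

lemma ph_val: "tak i a b k \<in> basis gl \<Longrightarrow> ph (tak i a b k) = (\<Sum>r\<in>sub_blk \<gamma> i k. scal (psign (ix r)) * (Po r b * Xo (r + k) a))"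
  unfolding gl_basis ph_def prod.case by (rule if_P)

lemma vph_val: "tak a i j k \<in> basis gls \<Longrightarrow> vph (tak a i j k) = (\<Sum>\<alpha>\<in>sub_blk \<xi> a k. Xo i (\<alpha> + k) * Po j \<alpha>)"
  unfolding gls_basis vph_def prod.case by (rule if_P)

lemma ph_outside: "t \<notin> basis gl \<Longrightarrow> ph t = 0"
proof -
  obtain i a b k where t: "t = tak i a b k" by (metis prod.exhaust)
  show "t \<notin> basis gl \<Longrightarrow> ph t = 0" unfolding t gl_basis ph_def prod.case by (rule if_not_P)
qed

lemma vph_outside: "t \<notin> basis gls \<Longrightarrow> vph t = 0"
proof -
  obtain i a b k where t: "t = tak i a b k" by (metis prod.exhaust)
  show "t \<notin> basis gls \<Longrightarrow> vph t = 0" unfolding t gls_basis vph_def prod.case by (rule if_not_P)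
qed

lemma bit_double: "e + e = (0 :: bit)" by (cases "e = 0") simp_all

lemma ph_SD: "t \<in> basis gl \<Longrightarrow> ph t \<in> SD \<and> has_parity (ph t) (bpar gl t)"
proof -
  assume t': "t \<in> basis gl"
  obtain i a b k where t: "t = tak i a b k" by (metis prod.exhaust)
  note x = t'[unfolded t gl_basis]
  have *: "scal (psign (ix r)) * (Po r b * Xo (r + k) a) \<in> SD \<and> has_parity (scal (psign (ix r)) * (Po r b * Xo (r + k) a)) 0"
    if "r \<in> sub_blk \<gamma> i k" for r
  proof -
    note r = sub_blk_gamma[OF _ _ that]
    have P: "Po r b \<in> SD \<and> has_parity (Po r b) (ix r)" by (rule Po_SD) (use r x in blast)+
    have X: "Xo (r + k) a \<in> SD \<and> has_parity (Xo (r + k) a) (ix (r + k))" by (rule Xo_SD) (use r x in blast)+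
    have "ix (r + k) = ix r" using r x by blast
    with P X show ?thesis using has_parity_scal[OF has_parity_mult[of "Po r b" "ix r" "Xo (r + k) a" "ix r"], of "psign (ix r)"]
      by (auto simp: bit_double intro: D.closed)
  qed
  have "bpar gl t = 0" by (simp add: t gl_takiff_def lie_dsum_def takiff_def gl_super_def)
  then show ?thesis unfolding t ph_val[OF t'[unfolded t]] using D.S_sum[of "sub_blk \<gamma> i k"] has_parity_sum[of "sub_blk \<gamma> i k"] * by auto
qed

lemma vph_SD: "t \<in> basis gls \<Longrightarrow> vph t \<in> SD \<and> has_parity (vph t) (bpar gls t)"
proof -
  assume t': "t \<in> basis gls"
  obtain a i j k where t: "t = tak a i j k" by (metis prod.exhaust)
  note x = t'[unfolded t gls_basis]
  have *: "Xo i (\<alpha> + k) * Po j \<alpha> \<in> SD \<and> has_parity (Xo i (\<alpha> + k) * Po j \<alpha>) (ix i + ix j)"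
    if "\<alpha> \<in> sub_blk \<xi> a k" for \<alpha>
  proof -
    note r = sub_blk_xi[OF _ _ that]
    have P: "Po j \<alpha> \<in> SD \<and> has_parity (Po j \<alpha>) (ix j)" by (rule Po_SD) (use r x in blast)+
    have X: "Xo i (\<alpha> + k) \<in> SD \<and> has_parity (Xo i (\<alpha> + k)) (ix i)" by (rule Xo_SD) (use r x in blast)+
    from P X show ?thesis using has_parity_mult[of "Xo i (\<alpha> + k)" "ix i" "Po j \<alpha>" "ix j"] D.closed(3) by blast
  qed
  have "bpar gls t = ix i + ix j" by (simp add: t gls_takiff_def lie_dsum_def takiff_def gl_super_def)
  then show ?thesis unfolding t vph_val[OF t'[unfolded t]] using D.S_sum[of "sub_blk \<xi> a k"] has_parity_sum[of "sub_blk \<xi> a k"] * by auto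
qed

lemma phi_gen_rep:
  assumes t: "tak i a b k \<in> basis gl"
  shows "phi_gen par_p par_q par_m par_n par_d (p' + q') \<gamma> (tak i a b k) = lend_rep (ph (tak i a b k))"
proof -
  note x = t[unfolded gl_basis]
  have x1: "i \<in> {1..l}" and x2: "a \<in> {1..par_d}" and x3: "b \<in> {1..par_d}" and x4: "k < \<gamma> i" using x by blast+
  show ?thesis
  proof (cases "i \<le> p' + q'")
    case True
    have "(\<Oplus>\<^bsub>DD\<^esub>r\<in>sub_blk \<gamma> i k. mul_op V vp (Yv b r) \<otimes>\<^bsub>DD\<^esub> der_op V vp (Yv a (r + k)))
      = lend_rep (\<Sum>r\<in>sub_blk \<gamma> i k. Mo (va r b) * De (va (r + k) a))"
    proof (rule D.finsum_h)
      fix r assume r: "r \<in> sub_blk \<gamma> i k"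
      note r' = sub_blk_gamma[OF x1 x4 r]
      have v: "Yv b r = va r b" "Yv a (r + k) = va (r + k) a" using r'(4,5) True by (auto simp: va_def)
      show "mul_op V vp (Yv b r) \<otimes>\<^bsub>DD\<^esub> der_op V vp (Yv a (r + k)) = lend_rep (Mo (va r b) * De (va (r + k) a))"
        unfolding v mul_op_va[OF r'(1) x3] der_op_va[OF r'(2) x2] by (rule D.h_mult[symmetric, OF Mo_va[OF r'(1) x3] De_va[OF r'(2) x2]])
      show "Mo (va r b) * De (va (r + k) a) \<in> SD" by (rule D.closed(3)[OF Mo_va[OF r'(1) x3] De_va[OF r'(2) x2]])
    qed
    then have "phi_gen par_p par_q par_m par_n par_d (p' + q') \<gamma> (tak i a b k) = \<ominus>\<^bsub>DD\<^esub> lend_rep (\<Sum>r\<in>sub_blk \<gamma> i k. Mo (va r b) * De (va (r + k) a))"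
      using True by (simp add: phi_gen_def Let_def)
    also have "\<dots> = lend_rep (- (\<Sum>r\<in>sub_blk \<gamma> i k. Mo (va r b) * De (va (r + k) a)))"
    proof (rule D.h_uminus[symmetric], rule D.S_sum)
      fix r assume r: "r \<in> sub_blk \<gamma> i k"
      note r' = sub_blk_gamma[OF x1 x4 r]
      show "Mo (va r b) * De (va (r + k) a) \<in> SD" by (rule D.closed(3)[OF Mo_va[OF r'(1) x3] De_va[OF r'(2) x2]])
    qed
    also have "- (\<Sum>r\<in>sub_blk \<gamma> i k. Mo (va r b) * De (va (r + k) a)) = ph (tak i a b k)"
      unfolding ph_val[OF t] sum_negf[symmetric]
    proof (rule sum.cong[OF refl])
      fix r assume r: "r \<in> sub_blk \<gamma> i k"
      note r' = sub_blk_gamma[OF x1 x4 r]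
      have le: "r \<le> pq" "r + k \<le> pq" using r'(4,5) True by auto
      have s: "psign (ix r) * psign (ix r + 1) = - 1" unfolding psign_add by (simp add: psign_def)
      show "- (Mo (va r b) * De (va (r + k) a)) = scal (psign (ix r)) * (Po r b * Xo (r + k) a)"
        unfolding Po_def Xo_def if_P[OF le(1)] if_P[OF le(2)] mult.assoc scal_scal s by (simp add: scal_minus)
    qed
    finally show ?thesis .
  next
    case False
    \<comment> \<open>This bound makes the truncated subtractions in the range of the sum
      exact.\<close>
    have pi: "pq \<le> psum \<gamma> i" using psum_mono[of "Suc (p' + q')" i \<gamma>] psum_gamma(2) False by simp
    let ?J = "{psum \<gamma> i + 1 - par_p - par_q..psum \<gamma> (i + 1) - k - par_p - par_q}"
    let ?g = "\<lambda>r. scal (psign (ix r)) * (De (va r b) * Mo (va (r + k) a))"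
    have J: "pq + r \<in> sub_blk \<gamma> i k" if "r \<in> ?J" for r using that pi psum_Suc[of i \<gamma>] x1 x4 by auto
    have S: "?g r \<in> SD" if "r \<in> sub_blk \<gamma> i k" for r
      using sub_blk_gamma[OF x1 x4 that] x2 x3 by (intro D.closed(4) D.closed(3) Mo_va De_va)
    have "(\<Oplus>\<^bsub>DD\<^esub>r\<in>?J. psign (idx_par par_p par_q par_m (par_p + par_q + r)) \<odot>\<^bsub>DD\<^esub> (der_op V vp (Xv b r) \<otimes>\<^bsub>DD\<^esub> mul_op V vp (Xv a (r + k))))
      = lend_rep (\<Sum>r\<in>?J. ?g (pq + r))"
    proof (rule D.finsum_h)
      fix r assume r: "r \<in> ?J"
      note r' = sub_blk_gamma[OF x1 x4 J[OF r]]
      have "1 \<le> r" using r pi by auto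
      then have v: "Xv b r = va (pq + r) b" "Xv a (r + k) = va (pq + r + k) a" by (auto simp: va_def)
      show "psign (idx_par par_p par_q par_m (par_p + par_q + r)) \<odot>\<^bsub>DD\<^esub> (der_op V vp (Xv b r) \<otimes>\<^bsub>DD\<^esub> mul_op V vp (Xv a (r + k))) = lend_rep (?g (pq + r))"
        unfolding v mul_op_va[OF r'(2) x2] der_op_va[OF r'(1) x3]
        by (simp only: D.h_mult[symmetric] D.h_scal[symmetric] D.closed Mo_va De_va r'(1,2) x2 x3)
      show "?g (pq + r) \<in> SD" by (rule S[OF J[OF r]])
    qed
    moreover have "(\<Sum>r\<in>?J. ?g (pq + r)) = (\<Sum>r\<in>sub_blk \<gamma> i k. ?g r)"
      by (rule sum.reindex_bij_witness[where i = "\<lambda>r. r - pq" and j = "\<lambda>r. pq + r"]) (use pi in auto)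
    moreover have "(\<Sum>r\<in>sub_blk \<gamma> i k. ?g r) = ph (tak i a b k)"
      unfolding ph_val[OF t]
    proof (rule sum.cong[OF refl])
      fix r assume r: "r \<in> sub_blk \<gamma> i k"
      note r' = sub_blk_gamma[OF x1 x4 r]
      have "\<not> r \<le> pq" "\<not> r + k \<le> pq" using r'(4,5) False by auto
      then show "?g r = scal (psign (ix r)) * (Po r b * Xo (r + k) a)" by (simp add: Po_def Xo_def)
    qed
    ultimately show ?thesis using False by (simp add: phi_gen_def Let_def)
  qed
qed

lemma varphi_gen_rep:
  assumes t: "tak a i j k \<in> basis gls"
  shows "varphi_gen par_p par_q par_m par_n par_d \<xi> (tak a i j k) = lend_rep (vph (tak a i j k))"
proof -
  note x = t[unfolded gls_basis]
  have x1: "a \<in> {1..d'}" and x2: "i \<in> {1..NN}" and x3: "j \<in> {1..NN}" and x4: "k < \<xi> a" using x by blast+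
  show ?thesis unfolding varphi_gen_def Let_def prod.case vph_val[OF t]
  proof (rule D.finsum_h)
    fix \<alpha> assume al: "\<alpha> \<in> sub_blk \<xi> a k"
    note al' = sub_blk_xi[OF x1 x4 al]
    show "Xo i (\<alpha> + k) * Po j \<alpha> \<in> SD" using Xo_SD[OF x2 al'(2)] Po_SD[OF x3 al'(1)] D.closed(3) by blast
    note mem = Mo_va[OF x2 al'(2)] De_va[OF x2 al'(2)] Mo_va[OF x3 al'(1)] De_va[OF x3 al'(1)]
    note ops = mul_op_va[OF x2 al'(2)] der_op_va[OF x2 al'(2)] mul_op_va[OF x3 al'(1)] der_op_va[OF x3 al'(1)]
    have vi: "i \<le> pq \<Longrightarrow> Yv (\<alpha> + k) i = va i (\<alpha> + k)" "\<not> i \<le> pq \<Longrightarrow> Xv (\<alpha> + k) (i - par_p - par_q) = va i (\<alpha> + k)"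
      and vj: "j \<le> pq \<Longrightarrow> Yv \<alpha> j = va j \<alpha>" "\<not> j \<le> pq \<Longrightarrow> Xv \<alpha> (j - par_p - par_q) = va j \<alpha>"
      by (simp_all add: va_def)
    show "(if i \<le> par_p + par_q then
        (if j \<le> par_p + par_q
         then psign (idx_par par_p par_q par_m j + 1) \<odot>\<^bsub>DD\<^esub> (der_op V vp (Yv (\<alpha> + k) i) \<otimes>\<^bsub>DD\<^esub> mul_op V vp (Yv \<alpha> j))
         else der_op V vp (Yv (\<alpha> + k) i) \<otimes>\<^bsub>DD\<^esub> der_op V vp (Xv \<alpha> (j - par_p - par_q)))
      else
        (if j \<le> par_p + par_q
         then psign (idx_par par_p par_q par_m j + 1) \<odot>\<^bsub>DD\<^esub>
                (mul_op V vp (Xv (\<alpha> + k) (i - par_p - par_q)) \<otimes>\<^bsub>DD\<^esub> mul_op V vp (Yv \<alpha> j))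
         else mul_op V vp (Xv (\<alpha> + k) (i - par_p - par_q)) \<otimes>\<^bsub>DD\<^esub> der_op V vp (Xv \<alpha> (j - par_p - par_q))))
      = lend_rep (Xo i (\<alpha> + k) * Po j \<alpha>)"
      by (cases "i \<le> pq"; cases "j \<le> pq")
        (simp_all only: if_True if_False vi vj ops Xo_def Po_def scal_left_commute[of "De _"] scal_left_commute[of "Mo _"]
          D.h_scal D.h_mult D.closed mem simp_thms)
  qed
qed

lemma pres_gl: "presentation (basis gl) (bpar gl) (env_rels gl)"
  unfolding gl_takiff_def by (rule presentation_takiff)

lemma pres_gls: "presentation (basis gls) (bpar gls) (env_rels gls)"
  unfolding gls_takiff_def by (rule presentation_takiff)

abbreviation "pg \<equiv> presentation.pr (basis gl) (bpar gl) (env_rels gl)"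

abbreviation "ps \<equiv> presentation.pr (basis gls) (bpar gls) (env_rels gls)"

text \<open>From here on the homomorphism is evaluation of free polynomials at \<open>ph\<close>;
  \<open>varphi_pr\<close> does the same with \<open>vph\<close>.\<close>

lemma phi_pr: "phi par_p par_q par_m par_n par_d (p' + q') l \<gamma> (pg x) = lend_rep (ev ph x)"
  unfolding phi_def
proof (rule D.induced_hom_eval[OF pres_gl])
  show "ph t \<in> SD" if "t \<in> basis gl" for t using ph_SD[OF that] by blast
  show "ph t = 0" if "t \<notin> basis gl" for t by (rule ph_outside[OF that])
  show "phi_gen par_p par_q par_m par_n par_d (p' + q') \<gamma> t = lend_rep (ph t)" if "t \<in> basis gl" for t
  proof -
    obtain i a b k where t: "t = tak i a b k" by (metis prod.exhaust)
    show ?thesis using that unfolding t by (rule phi_gen_rep)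
  qed
  show "ph t * ph t' - scal (psign (bpar gl t * bpar gl t')) * (ph t' * ph t) = lin ph (bracket gl t t')"
    if tt: "t \<in> basis gl" "t' \<in> basis gl" for t t'
  proof -
    obtain i a b k where t: "t = tak i a b k" by (metis prod.exhaust)
    obtain i' a' b' k' where t': "t' = tak i' a' b' k'" by (metis prod.exhaust)
    have "bpar gl t = 0" by (simp add: t gl_takiff_def lie_dsum_def takiff_def gl_super_def)
    then have "psign (bpar gl t * bpar gl t') = 1" by (simp add: psign_def)
    then show ?thesis using ph_bracket[OF tt[unfolded t t']] by (simp only: t t' scal_one)
  qed
  show "lend_rep (ev ph f) \<in> part DD e" if "f \<in> part (free_superalg (basis gl) (bpar gl)) e" for e f
  proof (rule has_parity_part)
    show "has_parity (ev ph f) e" by (rule has_parity_ev[OF _ that]) (use ph_SD in blast)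
    show "ev ph f \<in> SD" by (rule ev_SD) (metis ph_SD ph_outside D.S_0)
  qed
qed

lemma varphi_pr: "varphi par_p par_q par_m par_n par_d d' \<xi> (ps x) = lend_rep (ev vph x)"
  unfolding varphi_def
proof (rule D.induced_hom_eval[OF pres_gls])
  show "vph t \<in> SD" if "t \<in> basis gls" for t using vph_SD[OF that] by blast
  show "vph t = 0" if "t \<notin> basis gls" for t by (rule vph_outside[OF that])
  show "varphi_gen par_p par_q par_m par_n par_d \<xi> t = lend_rep (vph t)" if "t \<in> basis gls" for t
  proof -
    obtain i a b k where t: "t = tak i a b k" by (metis prod.exhaust)
    show ?thesis using that unfolding t by (rule varphi_gen_rep)
  qed
  show "vph t * vph t' - scal (psign (bpar gls t * bpar gls t')) * (vph t' * vph t) = lin vph (bracket gls t t')"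
    if tt: "t \<in> basis gls" "t' \<in> basis gls" for t t'
  proof -
    obtain i a b k where t: "t = tak i a b k" by (metis prod.exhaust)
    obtain i' a' b' k' where t': "t' = tak i' a' b' k'" by (metis prod.exhaust)
    have "bpar gls t = ix a + ix b" "bpar gls t' = ix a' + ix b'"
      by (simp_all add: t t' gls_takiff_def lie_dsum_def takiff_def gl_super_def)
    then show ?thesis using vph_bracket[OF tt[unfolded t t']] by (simp only: t t')
  qed
  show "lend_rep (ev vph f) \<in> part DD e" if "f \<in> part (free_superalg (basis gls) (bpar gls)) e" for e f
  proof (rule has_parity_part)
    show "has_parity (ev vph f) e" by (rule has_parity_ev[OF _ that]) (use vph_SD in blast)
    show "ev vph f \<in> SD" by (rule ev_SD) (metis vph_SD vph_outside D.S_0)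
  qed
qed

end

section \<open>The images of the Gaudin algebras\<close>

lemma sum_parity_signs: "(\<Sum>i\<in>{1..NN}. if ix i = 1 then - 1 else 1 :: int) = int par_p + int par_m - int par_q - int par_n"
proof -
  let ?f = "\<lambda>i. if ix i = 1 then - 1 else 1 :: int"
  have "sum ?f {1..NN} = sum ?f {1..par_p} + sum ?f {par_p + 1..par_p + par_q} + sum ?f {pq + 1..pq + par_m} + sum ?f {pq + par_m + 1..pq + par_m + par_n}"
  proof -
    have "sum ?f {1..NN} = sum ?f {1..pq + par_m} + sum ?f {pq + par_m + 1..pq + par_m + par_n}" by (rule sum.ub_add_nat) simp
    also have "sum ?f {1..pq + par_m} = sum ?f {1..pq} + sum ?f {pq + 1..pq + par_m}" by (rule sum.ub_add_nat) simp
    also have "sum ?f {1..pq} = sum ?f {1..par_p} + sum ?f {par_p + 1..par_p + par_q}" by (rule sum.ub_add_nat) simp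
    finally show ?thesis .
  qed
  moreover have "sum ?f {1..par_p} = (\<Sum>i\<in>{1..par_p}. 1)" "sum ?f {par_p + 1..par_p + par_q} = (\<Sum>i\<in>{par_p + 1..par_p + par_q}. - 1)"
    "sum ?f {pq + 1..pq + par_m} = (\<Sum>i\<in>{pq + 1..pq + par_m}. 1)"
    "sum ?f {pq + par_m + 1..pq + par_m + par_n} = (\<Sum>i\<in>{pq + par_m + 1..pq + par_m + par_n}. - 1)"
    by (rule sum.cong; auto simp: idx_par_def)+
  ultimately show ?thesis by simp
qed

lemma psd_O_frac: "psd_frac x c k \<in> psd_O"
  by (rule psd_OI) (auto simp: coef_frac split: if_splits)

context duality_data
begin

lemma cover_gl: "full_cover (univ_env gl) pg"
proof -
  interpret pres: presentation "basis gl" "bpar gl" "env_rels gl" by (rule pres_gl)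
  show ?thesis unfolding univ_env_def full_cover_def by (rule pres.P.cover_axioms)
qed

lemma cover_gls: "full_cover (univ_env gls) ps"
proof -
  interpret pres: presentation "basis gls" "bpar gls" "env_rels gls" by (rule pres_gls)
  show ?thesis unfolding univ_env_def full_cover_def by (rule pres.P.cover_axioms)
qed

text \<open>The two Gaudin matrices lifted to free algebras. From there one homomorphism leads to
  the enveloping superalgebra, where the generators are defined, and another to the Weyl
  superalgebra, where the images are compared.\<close>

definition MF :: "nat \<Rightarrow> nat \<Rightarrow> tak free psd" where
  "MF a b = (if a = b then psd_d else 0) - scal (W a b)
     - (\<Sum>i\<in>{1..l}. \<Sum>k\<in>{..<\<gamma> i}. psd_frac (letter (tak i a b k)) (z i) k)"

definition BF :: "nat \<Rightarrow> nat \<Rightarrow> tak free psd" where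
  "BF i j = (if i = j then psd_d else 0) - scal (Z i j)
     - scal (psign (ix i)) * (\<Sum>a\<in>{1..d'}. \<Sum>k\<in>{..<\<xi> a}. psd_frac (letter (tak a i j k)) (w a) k)"

lemma gl_matrix_rep:
  assumes a: "a \<in> {1..par_d}" and b: "b \<in> {1..par_d}"
  shows "gl_matrix par_d d' l w \<xi> z \<gamma> (a, b) = (\<lambda>i j. pg (coef (MF a b) i j))"
proof -
  interpret pres: presentation "basis gl" "bpar gl" "env_rels gl" by (rule pres_gl)
  interpret U: full_cover "univ_env gl" pg by (rule cover_gl)
  interpret PU: full_cover "pdo (univ_env gl)" "\<lambda>f i j. pg (coef f i j)" by (rule U.pdo_cover)
  let ?h = "\<lambda>f i j. pg (coef f i j)"
  let ?A = "if a = b then psd_d else 0 :: tak free psd" and ?B = "scal (W a b) :: tak free psd"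
  let ?C = "\<Sum>i\<in>{1..l}. \<Sum>k\<in>{..<\<gamma> i}. psd_frac (letter (tak i a b k)) (z i) k"
  have fr: "pdo_frac (univ_env gl) (env_gen gl (tak i a b k)) (z i) k = ?h (psd_frac (letter (tak i a b k)) (z i) k)"
    if "i \<in> {1..l}" "k \<in> {..<\<gamma> i}" for i k
  proof -
    have "tak i a b k \<in> basis gl" using that a b by (simp add: gl_basis)
    then have "env_gen gl (tak i a b k) = pg (letter (tak i a b k))" by (simp only: env_gen_def pres.pr_letter)
    then show ?thesis by (simp only: U.pdo_frac_h)
  qed
  have s: "(\<Oplus>\<^bsub>pdo (univ_env gl)\<^esub>i\<in>{1..l}. \<Oplus>\<^bsub>pdo (univ_env gl)\<^esub>k\<in>{..<\<gamma> i}. pdo_frac (univ_env gl) (env_gen gl (tak i a b k)) (z i) k) = ?h ?C"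
  proof (rule PU.finsum_h)
    fix i assume i: "i \<in> {1..l}"
    show "(\<Oplus>\<^bsub>pdo (univ_env gl)\<^esub>k\<in>{..<\<gamma> i}. pdo_frac (univ_env gl) (env_gen gl (tak i a b k)) (z i) k) = ?h (\<Sum>k\<in>{..<\<gamma> i}. psd_frac (letter (tak i a b k)) (z i) k)"
      by (rule PU.finsum_h) (rule fr[OF i], assumption, rule UNIV_I)
  qed (rule UNIV_I)
  have d: "(if a = b then pdo_dz (univ_env gl) else \<zero>\<^bsub>pdo (univ_env gl)\<^esub>) = ?h ?A"
    by (cases "a = b") (simp_all only: if_True if_False simp_thms U.pdo_dz_h PU.h_0)
  have w: "W a b \<odot>\<^bsub>pdo (univ_env gl)\<^esub> \<one>\<^bsub>pdo (univ_env gl)\<^esub> = ?h ?B"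
    using PU.h_scal[of 1 "W a b", OF UNIV_I] unfolding PU.h_1 mult_1_right by (rule sym)
  have 1: "?h (?A - ?B - ?C) = ?h (?A - ?B) \<ominus>\<^bsub>pdo (univ_env gl)\<^esub> ?h ?C" by (rule PU.h_minus) (rule UNIV_I)+
  have 2: "?h (?A - ?B) = ?h ?A \<ominus>\<^bsub>pdo (univ_env gl)\<^esub> ?h ?B" by (rule PU.h_minus) (rule UNIV_I)+
  show ?thesis unfolding gl_matrix_def Let_def prod.case MF_def 1 2 d w s ..
qed

lemma gls_matrix_rep:
  assumes a: "i \<in> {1..NN}" and b: "j \<in> {1..NN}"
  shows "gls_matrix par_p par_q par_m par_n d' l w \<xi> z \<gamma> (i, j) = (\<lambda>u v. ps (coef (BF i j) u v))"
proof -
  interpret pres: presentation "basis gls" "bpar gls" "env_rels gls" by (rule pres_gls)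
  interpret U: full_cover "univ_env gls" ps by (rule cover_gls)
  interpret PU: full_cover "pdo (univ_env gls)" "\<lambda>f u v. ps (coef f u v)" by (rule U.pdo_cover)
  let ?h = "\<lambda>f u v. ps (coef f u v)"
  let ?A = "if i = j then psd_d else 0 :: tak free psd" and ?B = "scal (Z i j) :: tak free psd"
  let ?C = "\<Sum>a\<in>{1..d'}. \<Sum>k\<in>{..<\<xi> a}. psd_frac (letter (tak a i j k)) (w a) k"
  have fr: "pdo_frac (univ_env gls) (env_gen gls (tak c i j k)) (w c) k = ?h (psd_frac (letter (tak c i j k)) (w c) k)"
    if "c \<in> {1..d'}" "k \<in> {..<\<xi> c}" for c k
  proof -
    have "tak c i j k \<in> basis gls" using that a b by (simp add: gls_basis)
    then have "env_gen gls (tak c i j k) = ps (letter (tak c i j k))" by (simp only: env_gen_def pres.pr_letter)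
    then show ?thesis by (simp only: U.pdo_frac_h)
  qed
  have s: "(\<Oplus>\<^bsub>pdo (univ_env gls)\<^esub>a\<in>{1..d'}. \<Oplus>\<^bsub>pdo (univ_env gls)\<^esub>k\<in>{..<\<xi> a}. pdo_frac (univ_env gls) (env_gen gls (tak a i j k)) (w a) k) = ?h ?C"
  proof (rule PU.finsum_h)
    fix c assume c: "c \<in> {1..d'}"
    show "(\<Oplus>\<^bsub>pdo (univ_env gls)\<^esub>k\<in>{..<\<xi> c}. pdo_frac (univ_env gls) (env_gen gls (tak c i j k)) (w c) k) = ?h (\<Sum>k\<in>{..<\<xi> c}. psd_frac (letter (tak c i j k)) (w c) k)"
      by (rule PU.finsum_h) (rule fr[OF c], assumption, rule UNIV_I)
  qed (rule UNIV_I)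
  have d: "(if i = j then pdo_dz (univ_env gls) else \<zero>\<^bsub>pdo (univ_env gls)\<^esub>) = ?h ?A"
    by (cases "i = j") (simp_all only: if_True if_False simp_thms U.pdo_dz_h PU.h_0)
  have w: "Z i j \<odot>\<^bsub>pdo (univ_env gls)\<^esub> \<one>\<^bsub>pdo (univ_env gls)\<^esub> = ?h ?B"
    using PU.h_scal[of 1 "Z i j", OF UNIV_I] unfolding PU.h_1 mult_1_right by (rule sym)
  have 0: "?h (scal (psign (ix i)) * ?C) = psign (ix i) \<odot>\<^bsub>pdo (univ_env gls)\<^esub> ?h ?C" by (rule PU.h_scal) (rule UNIV_I)
  have 1: "?h (?A - ?B - scal (psign (ix i)) * ?C) = ?h (?A - ?B) \<ominus>\<^bsub>pdo (univ_env gls)\<^esub> ?h (scal (psign (ix i)) * ?C)" by (rule PU.h_minus) (rule UNIV_I)+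
  have 2: "?h (?A - ?B) = ?h ?A \<ominus>\<^bsub>pdo (univ_env gls)\<^esub> ?h ?B" by (rule PU.h_minus) (rule UNIV_I)+
  show ?thesis unfolding gls_matrix_def Let_def prod.case BF_def 1 2 0 d w s ..
qed

text \<open>By \<open>res_jordan\<close> the resolvent at distance k inside block i is (z -
  z_i)^(-k-1), the fraction that accompanies degree k of the i-th summand.\<close>

lemma frac_sum_gamma:
  assumes a: "a \<in> {1..par_d}" and b: "b \<in> {1..par_d}"
  shows "K.bil NN (K.res psd_z) b a = (\<Sum>i\<in>{1..l}. \<Sum>k\<in>{..<\<gamma> i}. psd_frac (ph (tak i a b k)) (z i) k)"
proof -
  define F where "F r u = K.res psd_z r u * (psd_const (Po r b) * (if ix u = 1 then - psd_const (Xo u a) else psd_const (Xo u a)))" for r u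
  define G where "G i k r = psd_frac 1 (z i) k * psd_const (scal (psign (ix r)) * (Po r b * Xo (r + k) a))" for i k r
  have "K.bil NN (K.res psd_z) b a = (\<Sum>q\<in>{1..psum \<gamma> (Suc l)} \<times> {1..psum \<gamma> (Suc l)}. F (fst q) (snd q))"
    unfolding K.bil_def F_def psum_gamma(4) ..
  also have "\<dots> = (\<Sum>i\<in>{1..l}. \<Sum>k\<in>{..<\<gamma> i}. \<Sum>r\<in>sub_blk \<gamma> i k. G i k r)"
  proof (rule block_sum)
    fix i r k assume i: "i \<in> {1..l}" and r: "r \<in> blk \<gamma> i" "r + k \<in> blk \<gamma> i"
    have res: "K.res psd_z r (r + k) = (psd_frac 1 (z i) k :: spoly lend psd)"
      using res_jordan[OF i r(2), of z r] r(1) by (simp only: le_add1 simp_thms if_True diff_add_inverse)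
    have ix: "ix (r + k) = ix r" by (rule ix_blk[OF r(2,1)])
    show "F r (r + k) = G i k r"
      unfolding F_def G_def res ix by (cases "ix r = 0") (simp_all add: psign_simps scal_minus psd_const_mult psd_const_uminus)
  next
    fix r u assume u: "u \<in> {1..psum \<gamma> (Suc l)}" and n: "\<And>i. i \<in> {1..l} \<Longrightarrow> r \<in> blk \<gamma> i \<Longrightarrow> u \<in> blk \<gamma> i \<Longrightarrow> r \<le> u \<Longrightarrow> False"
    obtain j where j: "j \<in> {1..l}" "u \<in> blk \<gamma> j" using blk_ex[OF u] by blast
    have "\<not> (r \<in> blk \<gamma> j \<and> r \<le> u)" using n[OF j(1) _ j(2)] by blast
    then have "K.res psd_z r u = (0 :: spoly lend psd)" using res_jordan[OF j, of z r] by (simp only: if_False)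
    then show "F r u = 0" by (simp add: F_def)
  qed
  also have "\<dots> = (\<Sum>i\<in>{1..l}. \<Sum>k\<in>{..<\<gamma> i}. psd_frac (ph (tak i a b k)) (z i) k)"
  proof (rule sum.cong[OF refl], rule sum.cong[OF refl])
    fix i k assume "i \<in> {1..l}" "k \<in> {..<\<gamma> i}"
    then have t: "tak i a b k \<in> basis gl" using a b by (simp add: gl_basis)
    show "(\<Sum>r\<in>sub_blk \<gamma> i k. G i k r) = psd_frac (ph (tak i a b k)) (z i) k"
      unfolding G_def ph_val[OF t] frac_const[of "sum _ _"] psd_const_sum sum_distrib_left ..
  qed
  finally show ?thesis .
qed

text \<open>The same mechanism for the colours: the distance inside a block of \<xi> is the degree
  of the current.\<close>

lemma frac_sum_xi:
  assumes i: "i \<in> {1..NN}" and j: "j \<in> {1..NN}"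
  shows "(\<Sum>b\<in>{1..par_d}. \<Sum>a\<in>{1..par_d}. (if ix i = 1 then - psd_const (Xo i b) else psd_const (Xo i b)) * R.res psd_z a b * psd_const (Po j a))
    = scal (psign (ix i)) * (\<Sum>a\<in>{1..d'}. \<Sum>k\<in>{..<\<xi> a}. psd_frac (vph (tak a i j k)) (w a) k)"
proof -
  define F where "F a b = (if ix i = 1 then - psd_const (Xo i b) else psd_const (Xo i b)) * R.res psd_z a b * psd_const (Po j a)" for a b
  define G where "G a k r = scal (psign (ix i)) * (psd_frac 1 (w a) k * psd_const (Xo i (r + k) * Po j r))" for a k r
  have "(\<Sum>b\<in>{1..par_d}. \<Sum>a\<in>{1..par_d}. F a b) = (\<Sum>a\<in>{1..par_d}. \<Sum>b\<in>{1..par_d}. F a b)" by (rule sum.swap)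
  also have "\<dots> = (\<Sum>q\<in>{1..psum \<xi> (Suc d')} \<times> {1..psum \<xi> (Suc d')}. F (fst q) (snd q))"
    unfolding sum.cartesian_product case_prod_unfold psum_xi ..
  also have "\<dots> = (\<Sum>a\<in>{1..d'}. \<Sum>k\<in>{..<\<xi> a}. \<Sum>r\<in>sub_blk \<xi> a k. G a k r)"
  proof (rule block_sum)
    fix a r k assume a: "a \<in> {1..d'}" and r: "r \<in> blk \<xi> a" "r + k \<in> blk \<xi> a"
    have res: "R.res psd_z r (r + k) = (psd_frac 1 (w a) k :: spoly lend psd)"
      using res_jordan[OF a r(2), of w r] r(1) by (simp only: le_add1 simp_thms if_True diff_add_inverse)
    show "F r (r + k) = G a k r"
      unfolding F_def G_def res
      by (cases "ix i = 0") (simp_all add: psign_simps scal_minus psd_const_mult frac_commute[symmetric] mult.assoc[symmetric])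
  next
    fix r u assume u: "u \<in> {1..psum \<xi> (Suc d')}" and n: "\<And>i. i \<in> {1..d'} \<Longrightarrow> r \<in> blk \<xi> i \<Longrightarrow> u \<in> blk \<xi> i \<Longrightarrow> r \<le> u \<Longrightarrow> False"
    obtain c where c: "c \<in> {1..d'}" "u \<in> blk \<xi> c" using blk_ex[OF u] by blast
    have "\<not> (r \<in> blk \<xi> c \<and> r \<le> u)" using n[OF c(1) _ c(2)] by blast
    then have "R.res psd_z r u = (0 :: spoly lend psd)" using res_jordan[OF c, of w r] by (simp only: if_False)
    then show "F r u = 0" by (simp add: F_def)
  qed
  also have "\<dots> = (\<Sum>a\<in>{1..d'}. \<Sum>k\<in>{..<\<xi> a}. scal (psign (ix i)) * psd_frac (vph (tak a i j k)) (w a) k)"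
  proof (rule sum.cong[OF refl], rule sum.cong[OF refl])
    fix a k assume "a \<in> {1..d'}" "k \<in> {..<\<xi> a}"
    then have t: "tak a i j k \<in> basis gls" using i j by (simp add: gls_basis)
    show "(\<Sum>r\<in>sub_blk \<xi> a k. G a k r) = scal (psign (ix i)) * psd_frac (vph (tak a i j k)) (w a) k"
      unfolding G_def vph_val[OF t] frac_const[of "sum _ _"] psd_const_sum sum_distrib_left ..
  qed
  also have "\<dots> = scal (psign (ix i)) * (\<Sum>a\<in>{1..d'}. \<Sum>k\<in>{..<\<xi> a}. psd_frac (vph (tak a i j k)) (w a) k)"
    by (simp only: sum_distrib_left)
  finally show ?thesis unfolding F_def .
qed

text \<open>Transposed, because \<open>W_inverse\<close> asks for the inverse of z minus the
  transpose of W.\<close>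

abbreviation "H \<equiv> \<lambda>b a. R.res (psd_z :: spoly lend psd) a b"

lemma W_inverse_H: "K.W_inverse H"
  unfolding K.W_inverse_def
proof (intro ballI)
  fix b c assume bc: "b \<in> {1..par_d}" "c \<in> {1..par_d}"
  have "(\<Sum>a\<in>{1..par_d}. H b a * ((if a = c then psd_z else 0) - scal (W c a)))
    = (\<Sum>a\<in>{1..par_d}. ((if c = a then psd_z else 0) - scal (W c a)) * R.res psd_z a b)"
  proof (rule sum.cong[OF refl])
    fix a
    have z: "R.res psd_z a b * psd_z = psd_z * (R.res psd_z a b :: spoly lend psd)"
      by (rule R.res_commute[OF unit_z_scal(1)]) simp
    show "H b a * ((if a = c then psd_z else 0) - scal (W c a)) = ((if c = a then psd_z else 0) - scal (W c a)) * R.res psd_z a b"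
      using z by (auto simp: left_diff_distrib right_diff_distrib scal_central[of "W c a" "R.res psd_z a b"] scal_central[of "W a a" "R.res psd_z a b"])
  qed
  also have "\<dots> = (if c = b then 1 else 0)" by (rule R.res_left[OF unit_z_scal(1) bc(2,1)])
  finally show "(\<Sum>a\<in>{1..par_d}. H b a * ((if a = c then psd_z else 0) - scal (W c a))) = (if b = c then 1 else 0)" by auto
qed

lemmas ph_map = hom_calgD[OF hom_psd_map[OF hom_ev[of ph]]] psd_map_monom[OF hom_ev[of ph]] psd_map_frac[OF hom_ev[of ph]]

lemmas vph_map = hom_calgD[OF hom_psd_map[OF hom_ev[of vph]]] psd_map_monom[OF hom_ev[of vph]] psd_map_frac[OF hom_ev[of vph]]

definition Y :: "nat \<Rightarrow> nat \<Rightarrow> spoly lend psd" where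
  "Y a b = scal (W a b) + (\<Sum>i\<in>{1..l}. \<Sum>k\<in>{..<\<gamma> i}. psd_frac (ph (tak i a b k)) (z i) k)"

lemma MF_map: "psd_map (ev ph) (MF a b) = (if a = b then psd_d else 0) - Y a b"
  unfolding MF_def Y_def by (cases "a = b") (simp_all add: ph_map ev_simps diff_diff_eq)

lemma L1_Y: "a \<in> {1..par_d} \<Longrightarrow> b \<in> {1..par_d} \<Longrightarrow> K.L1 a b = (if a = b then psd_d else 0) - Y a b"
  unfolding K.L1_def Y_def by (simp only: frac_sum_gamma diff_diff_eq)

lemma BF_map: "i \<in> {1..NN} \<Longrightarrow> j \<in> {1..NN} \<Longrightarrow> psd_map (ev vph) (BF i j) = K.M H i j"
  unfolding BF_def K.M_def by (simp only: frac_sum_xi) (cases "i = j"; simp add: vph_map ev_simps)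

abbreviation "js \<equiv> [1..<Suc par_d]"

definition cA :: "spoly lend psd" where "cA = col_det js (\<lambda>a b. (if a = b then psd_d else 0) - Y a b)"

lemma cA_L1: "cA = col_det js K.L1"
  unfolding cA_def by (rule col_det_cong) (auto simp: L1_Y simp del: upt_Suc)

definition GA :: "spoly lend set" where "GA = {coef cA k (int i - 1) | k i. i \<in> {1..par_d}}"

lemma phi_image: "phi par_p par_q par_m par_n par_d (p' + q') l \<gamma> ` gaudin_gl par_d d' l w \<xi> z \<gamma> = lend_rep ` alg_hull GA"
proof -
  interpret U: full_cover "univ_env gl" pg by (rule cover_gl)
  interpret PU: full_cover "pdo (univ_env gl)" "\<lambda>f i j. pg (coef f i j)" by (rule U.pdo_cover)
  let ?C = "col_det js MF"
  let ?G = "{coef ?C k (int i - 1) | k i. i \<in> {1..par_d}}"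
  have C: "cdet (pdo (univ_env gl)) par_d (gl_matrix par_d d' l w \<xi> z \<gamma>) = (\<lambda>i j. pg (coef ?C i j))"
    by (rule PU.cdet_h) (rule gl_matrix_rep)
  have "{pg (coef ?C k (int i - 1)) | k i. i \<in> {1..par_d}} = pg ` ?G" by blast
  then have "gaudin_gl par_d d' l w \<xi> z \<gamma> = pg ` alg_hull ?G"
    unfolding gaudin_gl_def Let_def C by (simp only: U.gen_alg_h)
  then have "phi par_p par_q par_m par_n par_d (p' + q') l \<gamma> ` gaudin_gl par_d d' l w \<xi> z \<gamma> = lend_rep ` (ev ph ` alg_hull ?G)"
    by (simp only: image_image phi_pr)
  also have "\<dots> = lend_rep ` alg_hull (ev ph ` ?G)" by (simp only: hom_alg_hull[OF hom_ev])
  also have "ev ph ` ?G = GA"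
  proof -
    have "psd_map (ev ph) ?C = cA"
      unfolding hom_col_det[OF hom_psd_map[OF hom_ev]] MF_map cA_def ..
    then have e: "ev ph (coef ?C k j) = coef cA k j" for k j using coef_psd_map[OF hom_ev, of ph ?C k j] by (simp only:)
    have "ev ph ` ?G = {ev ph (coef ?C k (int i - 1)) | k i. i \<in> {1..par_d}}" by blast
    then show ?thesis unfolding e GA_def .
  qed
  finally show ?thesis .
qed

lemma psd_over_cA: "psd_over GA cA"
  unfolding psd_over_def
proof (intro allI)
  fix u j
  show "coef cA u j \<in> alg_hull GA"
  proof (cases "0 \<le> j \<and> j < int par_d")
    case True
    then have "coef cA u j \<in> GA" unfolding GA_def by (intro CollectI exI[of _ u] exI[of _ "Suc (nat j)"]) auto
    then show ?thesis by (rule alg_hull.incl)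
  next
    case False
    show ?thesis unfolding cA_def
    proof (rule col_det_order)
      show "coef (Y a b) i v \<noteq> 0 \<Longrightarrow> v = 0" for a b i v
        by (rule ccontr) (simp add: Y_def coef_frac scal_psd_def coef_monom)
      show "j < 0 \<or> int (length js) \<le> j" using False by auto
    qed
  qed
qed

lemma zdeg_cA: "zdeg_le 0 cA"
  unfolding cA_def
proof (rule col_det_zdeg)
  fix a b
  show "zdeg_le 0 ((if a = b then psd_d else 0) - Y a b)"
    unfolding zdeg_le_def by (auto simp: Y_def coef_frac scal_psd_def coef_monom)
qed

text \<open>The inverses of the upper left blocks are formed over the free algebra, where Neumann
  series are at hand. Their images in the enveloping superalgebra compute the Berezinian, and their
  images in the Weyl superalgebra supply the rows R.\<close>

lemma berezinian_exists:
  obtains R where "K.M_last_rows H R"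
    "varphi par_p par_q par_m par_n par_d d' \<xi> ` gaudin_gls par_p par_q par_m par_n d' l w \<xi> z \<gamma>
      = lend_rep ` alg_hull {coef (K.ber R NN) k i | k i. i \<le> int par_p + int par_m - int par_q - int par_n}"
proof -
  interpret U: full_cover "univ_env gls" ps by (rule cover_gls)
  interpret PU: full_cover "pdo (univ_env gls)" "\<lambda>f i j. ps (coef f i j)" by (rule U.pdo_cover)
  define B where "B i j = scal (Z i j) + scal (psign (ix i)) * (\<Sum>a\<in>{1..d'}. \<Sum>k\<in>{..<\<xi> a}. psd_frac (letter (tak a i j k)) (w a) k)" for i j
  have BF: "(if i = j then psd_d else 0) - B i j = BF i j" for i j by (simp add: B_def BF_def diff_diff_eq)
  have O: "B i j \<in> psd_O" for i j unfolding B_def by (intro psd_O_closed psd_O_frac)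
  have "\<exists>N. (\<forall>i\<in>{1..k}. \<forall>j\<in>{1..k}. (\<Sum>u\<in>{1..k}. BF i u * N u j) = (if i = j then 1 else 0))
     \<and> (\<forall>i\<in>{1..k}. \<forall>j\<in>{1..k}. (\<Sum>u\<in>{1..k}. N i u * BF u j) = (if i = j then 1 else 0)) \<and> (\<forall>i\<in>{1..k}. unit (N i i))" for k :: nat
  proof (rule psd_d_matrix_invertible[of "{1..k}" B, unfolded BF, OF finite_atLeastAtMost O])
    fix N assume N: "\<And>i j. i \<in> {1..k} \<Longrightarrow> j \<in> {1..k} \<Longrightarrow> (\<Sum>u\<in>{1..k}. BF i u * N u j) = (if i = j then 1 else 0)"
      "\<And>i j. i \<in> {1..k} \<Longrightarrow> j \<in> {1..k} \<Longrightarrow> (\<Sum>u\<in>{1..k}. N i u * BF u j) = (if i = j then 1 else 0)"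
      "\<And>i. i \<in> {1..k} \<Longrightarrow> unit (N i i)"
    have 1: "\<forall>i\<in>{1..k}. \<forall>j\<in>{1..k}. (\<Sum>u\<in>{1..k}. BF i u * N u j) = (if i = j then 1 else 0)" by (intro ballI, rule N(1))
    have 2: "\<forall>i\<in>{1..k}. \<forall>j\<in>{1..k}. (\<Sum>u\<in>{1..k}. N i u * BF u j) = (if i = j then 1 else 0)" by (intro ballI, rule N(2))
    have 3: "\<forall>i\<in>{1..k}. unit (N i i)" by (intro ballI, rule N(3))
    show "\<exists>N. (\<forall>i\<in>{1..k}. \<forall>j\<in>{1..k}. (\<Sum>u\<in>{1..k}. BF i u * N u j) = (if i = j then 1 else 0))
     \<and> (\<forall>i\<in>{1..k}. \<forall>j\<in>{1..k}. (\<Sum>u\<in>{1..k}. N i u * BF u j) = (if i = j then 1 else 0)) \<and> (\<forall>i\<in>{1..k}. unit (N i i))"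
      using 1 2 3 by (intro exI[of _ N] conjI)
  qed
  from choice[OF allI[OF this]] obtain N where N0: "\<forall>k. (\<forall>i\<in>{1..k}. \<forall>j\<in>{1..k}. (\<Sum>u\<in>{1..k}. BF i u * N k u j) = (if i = j then 1 else 0))
     \<and> (\<forall>i\<in>{1..k}. \<forall>j\<in>{1..k}. (\<Sum>u\<in>{1..k}. N k i u * BF u j) = (if i = j then 1 else 0)) \<and> (\<forall>i\<in>{1..k}. unit (N k i i))"
    by (rule exE)
  have N: "\<And>k i j. i \<in> {1..k} \<Longrightarrow> j \<in> {1..k} \<Longrightarrow> (\<Sum>u\<in>{1..k}. BF i u * N k u j) = (if i = j then 1 else 0)"
    "\<And>k i j. i \<in> {1..k} \<Longrightarrow> j \<in> {1..k} \<Longrightarrow> (\<Sum>u\<in>{1..k}. N k i u * BF u j) = (if i = j then 1 else 0)"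
    "\<And>k i. i \<in> {1..k} \<Longrightarrow> unit (N k i i)"
    using N0 by blast+
  have u: "unit (N k k k)" if "k \<in> {1..NN}" for k by (rule N(3)) (use that in simp)
  let ?b = "prod_list (map (\<lambda>k. if ix k = 0 then uinv (N k k k) else N k k k) [1..<Suc NN])"
  have ber: "berezinian (pdo (univ_env gls)) NN ix (gls_matrix par_p par_q par_m par_n d' l w \<xi> z \<gamma>) = (\<lambda>i j. ps (coef ?b i j))"
  proof (rule PU.berezinian_h[where M = BF and N = N])
    show "gls_matrix par_p par_q par_m par_n d' l w \<xi> z \<gamma> (i, j) = (\<lambda>u v. ps (coef (BF i j) u v))"
      if "i \<in> {1..NN}" "j \<in> {1..NN}" for i j by (rule gls_matrix_rep[OF that])
    show "(\<Sum>u\<in>{1..k}. BF i u * N k u j) = (if i = j then 1 else 0)" if "k \<le> NN" "i \<in> {1..k}" "j \<in> {1..k}" for k i j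
      by (rule N(1)[OF that(2,3)])
    show "(\<Sum>u\<in>{1..k}. N k i u * BF u j) = (if i = j then 1 else 0)" if "k \<le> NN" "i \<in> {1..k}" "j \<in> {1..k}" for k i j
      by (rule N(2)[OF that(2,3)])
    show "unit (N k k k)" if "k \<in> {1..NN}" for k by (rule u[OF that])
  qed
  define R where "R k j = psd_map (ev vph) (N k k j)" for k j
  have hom: "hom_calg (psd_map (ev vph))" by (rule hom_psd_map[OF hom_ev])
  have rows: "K.M_last_rows H R"
    unfolding K.M_last_rows_def
  proof (intro ballI conjI)
    fix k assume k: "k \<in> {1..NN}"
    show "unit (R k k)" unfolding R_def by (rule hom_unit(1)[OF hom u[OF k]])
    fix j assume j: "j \<in> {1..k}"
    have "(\<Sum>i\<in>{1..k}. R k i * K.M H i j) = (\<Sum>i\<in>{1..k}. psd_map (ev vph) (N k k i * BF i j))"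
    proof (rule sum.cong[OF refl])
      fix i assume i: "i \<in> {1..k}"
      have ij: "i \<in> {1..NN}" "j \<in> {1..NN}" using i j k by auto
      show "R k i * K.M H i j = psd_map (ev vph) (N k k i * BF i j)"
        unfolding R_def hom_calgD(2)[OF hom] BF_map[OF ij] ..
    qed
    also have "\<dots> = psd_map (ev vph) (\<Sum>i\<in>{1..k}. N k k i * BF i j)" by (simp only: hom_calgD(8)[OF hom])
    also have "(\<Sum>i\<in>{1..k}. N k k i * BF i j) = (if k = j then 1 else 0)" by (rule N(2)) (use k j in auto)
    finally show "(\<Sum>i\<in>{1..k}. R k i * K.M H i j) = (if k = j then 1 else 0)"
      by (simp add: hom_calgD(3,5)[OF hom] split: if_splits)
  qed
  have b: "psd_map (ev vph) ?b = K.ber R NN"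
  proof -
    have "map (psd_map (ev vph)) (map (\<lambda>k. if ix k = 0 then uinv (N k k k) else N k k k) [1..<Suc NN])
      = map (\<lambda>k. if ix k = 1 then R k k else uinv (R k k)) [1..<Suc NN]"
      unfolding map_map
    proof (rule map_cong[OF refl])
      fix k assume "k \<in> set [1..<Suc NN]"
      then have k: "k \<in> {1..NN}" by auto
      show "(psd_map (ev vph) \<circ> (\<lambda>k. if ix k = 0 then uinv (N k k k) else N k k k)) k = (if ix k = 1 then R k k else uinv (R k k))"
        by (cases "ix k = 0") (simp_all add: R_def hom_unit(2)[OF hom u[OF k]])
    qed
    then show ?thesis unfolding K.ber_def hom_calgD(9)[OF hom] by (simp only:)
  qed
  let ?e = "int par_p + int par_m - int par_q - int par_n"
  let ?G = "{coef ?b k i | k i. i \<le> ?e}"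
  have "{ps (coef ?b k i) | k i. i \<le> ?e} = ps ` ?G" by blast
  then have "gaudin_gls par_p par_q par_m par_n d' l w \<xi> z \<gamma> = ps ` alg_hull ?G"
    unfolding gaudin_gls_def Let_def ber by (simp only: U.gen_alg_h)
  then have "varphi par_p par_q par_m par_n par_d d' \<xi> ` gaudin_gls par_p par_q par_m par_n d' l w \<xi> z \<gamma> = lend_rep ` (ev vph ` alg_hull ?G)"
    by (simp only: image_image varphi_pr)
  also have "\<dots> = lend_rep ` alg_hull (ev vph ` ?G)" by (simp only: hom_alg_hull[OF hom_ev])
  also have "ev vph ` ?G = {coef (K.ber R NN) k i | k i. i \<le> ?e}"
  proof -
    have e: "ev vph (coef ?b k j) = coef (K.ber R NN) k j" for k j using coef_psd_map[OF hom_ev, of vph ?b k j] b by (simp only:)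
    have "ev vph ` ?G = {ev vph (coef ?b k i) | k i. i \<le> ?e}" by blast
    then show ?thesis unfolding e .
  qed
  finally show ?thesis by (rule that[OF rows])
qed

text \<open>The identity expresses \<open>cA\<close> through b and b through \<open>cA\<close>,
  using only the exchange and invertible factors with scalar coefficients; so each generating set
  lies in the algebra generated by the other.\<close>

lemma gaudin_duality:
  "phi par_p par_q par_m par_n par_d (p' + q') l \<gamma> ` gaudin_gl par_d d' l w \<xi> z \<gamma>
    = varphi par_p par_q par_m par_n par_d d' \<xi> ` gaudin_gls par_p par_q par_m par_n d' l w \<xi> z \<gamma>"
proof -
  let ?e = "int par_p + int par_m - int par_q - int par_n"
  obtain R where R: "K.M_last_rows H R"
    "varphi par_p par_q par_m par_n par_d d' \<xi> ` gaudin_gls par_p par_q par_m par_n d' l w \<xi> z \<gamma>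
      = lend_rep ` alg_hull {coef (K.ber R NN) k i | k i. i \<le> ?e}" by (rule berezinian_exists)
  define b where "b = K.ber R NN"
  define GB where "GB = {coef b k i | k i. i \<le> ?e}"
  define fs where "fs = map (\<lambda>i. (Z i i, ix i = 1)) [1..<Suc NN]"
  define gs where "gs = map (\<lambda>a. (W a a, False)) js"
  define f g :: "spoly lend psd" where "f = z_factors fs" and "g = z_factors gs"
  have f: "K.fpr psd_z NN = f" unfolding K.fpr_def f_def z_factors_def fs_def by (simp add: comp_def del: upt_Suc)
  have g: "prod_list (map (\<lambda>a. psd_z - scal (W a a)) js) = g" unfolding g_def z_factors_def gs_def by (simp add: comp_def del: upt_Suc)
  have dual: "psd_swap (cA * f) = g * b"
    using K.duality_identity[OF W_inverse_H R(1)] unfolding f g cA_L1 b_def .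
  obtain fs' where fs': "f * z_factors fs' = 1" using z_factors_inverse[of fs] unfolding f_def by blast
  obtain gs' where gs': "z_factors gs' * g = 1" using z_factors_inverse[of gs] unfolding g_def by blast
  have b: "b = z_factors gs' * psd_swap (cA * f)" unfolding dual mult.assoc[symmetric] gs' by simp
  have a: "cA = psd_swap (g * b) * z_factors fs'" unfolding dual[symmetric] swap_swap mult.assoc fs' by simp
  have "(\<Sum>x\<leftarrow>fs. if snd x then - 1 else 1 :: int) = (\<Sum>i\<in>{1..NN}. if ix i = 1 then - 1 else 1)"
    unfolding fs_def map_map comp_def snd_conv interv_sum_list_conv_sum_set_nat by (rule sum.cong) auto
  then have "zdeg_le ?e f" using zdeg_factors[of fs, where 'a = "spoly lend"] sum_parity_signs by (simp only: f_def)
  \<comment> \<open>\<open>cA\<close> has degree at most 0 in z and f has degree p + m - q - n.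
    After the exchange this bounds the order in d, which division by g does not change.\<close>
  then have "zdeg_le (0 + ?e) (cA * f)" by (rule zdeg_le_mult[OF zdeg_cA])
  then have "ddeg_le ?e (psd_swap (cA * f))" by (simp add: zdeg_le_def ddeg_le_def)
  then have deg: "ddeg_le (0 + ?e) b" unfolding b by (rule ddeg_le_mult[OF ddeg_factors])
  have ob: "psd_over GB b"
    unfolding psd_over_def
  proof (intro allI)
    fix i j
    show "coef b i j \<in> alg_hull GB"
    proof (cases "j \<le> ?e")
      case True
      then have "coef b i j \<in> GB" unfolding GB_def by blast
      then show ?thesis by (rule alg_hull.incl)
    next
      case False
      then have "coef b i j = 0" using deg by (simp add: ddeg_le_def)
      then show ?thesis by (simp add: alg_hull_0)
    qed
  qed
  have oa: "psd_over GB cA"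
    unfolding a by (intro psd_over_mult psd_over_factors) (simp only: psd_over_swap g_def, intro psd_over_mult psd_over_factors ob)
  have ob': "psd_over GA b"
    unfolding b by (intro psd_over_mult psd_over_factors) (simp only: psd_over_swap f_def, intro psd_over_mult psd_over_factors psd_over_cA)
  have "GA \<subseteq> alg_hull GB" using oa unfolding GA_def psd_over_def by blast
  moreover have "GB \<subseteq> alg_hull GA" using ob' unfolding GB_def psd_over_def by blast
  ultimately have "alg_hull GA = alg_hull GB" by (meson alg_hull_subset subset_antisym)
  then show ?thesis unfolding phi_image R(2) GB_def b_def by simp
qed

end

theorem theorem1p1:
  fixes d p q m n d' p' q' m' n' l :: nat
    and w z :: "nat \<Rightarrow> complex"
    and \<xi> \<gamma> :: "nat \<Rightarrow> nat"
  assumes "d \<ge> 1" and "\<not> (p = 0 \<and> q = 0 \<and> m = 0 \<and> n = 0)"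
    and "1 \<le> d'" and "d' \<le> d"
    and "p' \<le> p" and "q' \<le> q" and "m' \<le> m" and "n' \<le> n"
    and "l = p' + q' + m' + n'"
    and "\<forall>a\<in>{1..d'}. \<xi> a > 0" and "(\<Sum>a\<in>{1..d'}. \<xi> a) = d"
    and "\<forall>i\<in>{1..l}. \<gamma> i > 0"
    and "(\<Sum>i\<in>{1..p'}. \<gamma> i) = p"
    and "(\<Sum>i\<in>{1..q'}. \<gamma> (p' + i)) = q"
    and "(\<Sum>i\<in>{1..m'}. \<gamma> (p' + q' + i)) = m"
    and "(\<Sum>i\<in>{1..n'}. \<gamma> (p' + q' + m' + i)) = n"
  shows "phi p q m n d (p' + q') l \<gamma> ` gaudin_gl d d' l w \<xi> z \<gamma>
       = varphi p q m n d d' \<xi> ` gaudin_gls p q m n d' l w \<xi> z \<gamma>"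
proof -
  have "duality_at par_p par_q par_m par_n par_d"
    unfolding duality_at_def
  proof (intro allI impI)
    fix d' p' q' m' n' :: nat and w z :: "nat \<Rightarrow> complex" and \<xi> \<gamma> :: "nat \<Rightarrow> nat"
    assume *: "(\<Sum>a\<in>{1..d'}. \<xi> a) = par_d" "(\<Sum>i\<in>{1..p'}. \<gamma> i) = par_p" "(\<Sum>i\<in>{1..q'}. \<gamma> (p' + i)) = par_q"
      "(\<Sum>i\<in>{1..m'}. \<gamma> (p' + q' + i)) = par_m" "(\<Sum>i\<in>{1..n'}. \<gamma> (p' + q' + m' + i)) = par_n"
    interpret duality_data d' p' q' m' n' w z \<xi> \<gamma> by unfold_locales (rule *)+
    show "phi par_p par_q par_m par_n par_d (p' + q') (p' + q' + m' + n') \<gamma> ` gaudin_gl par_d d' (p' + q' + m' + n') w \<xi> z \<gamma>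
       = varphi par_p par_q par_m par_n par_d d' \<xi> ` gaudin_gls par_p par_q par_m par_n d' (p' + q' + m' + n') w \<xi> z \<gamma>"
      by (rule gaudin_duality)
  qed
  \<comment> \<open>The fixed parameters would violate the duality if any parameters did.\<close>
  then have "duality_at p q m n d" by (rule duality_at_counterexample)
  then show ?thesis using assms(10-16) unfolding duality_at_def assms(9) by blast
qed

end
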